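(* Let $n\ge 7$ be an integer and let $t\ge 3$ be the integer with $2^t-1\le n<2^{t+1}-1$. Then the height of $\widetilde w_2\in H^2(\widetilde G_{n,3};\mathbb Z_2)$ is \[\operatorname{ht}(\widetilde w_2)=\begin{cases} 2^t-4,& 2^t-1\le n\le 2^t+2^{t-1}\\ 2^{t+1}-3\cdot 2^s-1,& 2^{t+1}-2^{s+1}+1\le n\le 2^{t+1}-2^s \text{ for an integer } s \text{ with } 1\le s\le t-2. \end{cases}\]
   Context: $\widetilde G_{n,3}$ is the Grassmann manifold of oriented $3$-dimensional linear subspaces of $\mathbb R^n$, and $\widetilde w_i\in H^i(\widetilde G_{n,3};\mathbb Z_2)$, $i=2,3$, are the Stiefel--Whitney classes of the canonical $3$-dimensional vector bundle over $\widetilde G_{n,3}$. The height $\operatorname{ht}(x)$ of a cohomology class $x$ is the supremum of all integers $m$ with $x^m\neq 0$. *)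

theory Defs
  imports "HOL-Analysis.Analysis" "HOL-Homology.Homology" "HOL-Algebra.QuotRing" "HOL-Library.Z2"
    "HOL-Library.Extended_Nat"
begin

section \<open>The singular cohomology ring with coefficients in the field with two elements\<close>

text \<open>
  A total cochain on \<open>X\<close> is a finitely supported family \<open>c\<close>, whose component \<open>c p\<close> is a function
  on the singular \<open>p\<close>-simplices of \<open>X\<close>, made total by the value 0. This is the direct sum of the
  groups \<open>Hom(C\<^sub>p(X), \<int>\<^sub>2)\<close>. The signs in the coboundary disappear in characteristic 2.
\<close>

type_synonym 'a cochain = "nat \<Rightarrow> ((nat \<Rightarrow> real) \<Rightarrow> 'a) \<Rightarrow> bit"

definition cochains :: "'a topology \<Rightarrow> 'a cochain set" where
  "cochains X = {c. (\<forall>p f. c p f \<noteq> 0 \<longrightarrow> singular_simplex p X f) \<and> finite {p. \<exists>f. c p f \<noteq> 0}}"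

definition coboundary :: "'a topology \<Rightarrow> 'a cochain \<Rightarrow> 'a cochain" where
  "coboundary X c p f =
     (if 1 \<le> p \<and> singular_simplex p X f then \<Sum>k\<le>p. c (p - 1) (singular_face p k f) else 0)"

definition front_face :: "nat \<Rightarrow> ((nat \<Rightarrow> real) \<Rightarrow> 'a) \<Rightarrow> (nat \<Rightarrow> real) \<Rightarrow> 'a" where
  "front_face p f = restrict f (standard_simplex p)"

text \<open>
  The back \<open>q\<close>-face of a \<open>(p + q)\<close>-simplex, spanned by its vertices \<open>p, \<dots>, p + q\<close>.
\<close>

definition back_face :: "nat \<Rightarrow> nat \<Rightarrow> ((nat \<Rightarrow> real) \<Rightarrow> 'a) \<Rightarrow> (nat \<Rightarrow> real) \<Rightarrow> 'a" where
  "back_face p q f = restrict (f \<circ> (\<lambda>x i. if i < p then 0 else x (i - p))) (standard_simplex q)"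

definition cup :: "'a topology \<Rightarrow> 'a cochain \<Rightarrow> 'a cochain \<Rightarrow> 'a cochain" where
  "cup X c d n f =
     (if singular_simplex n X f
      then \<Sum>p\<le>n. c p (front_face p f) * d (n - p) (back_face p (n - p) f) else 0)"

definition cocycle_ring :: "'a topology \<Rightarrow> 'a cochain ring" where
  "cocycle_ring X =
     \<lparr>carrier = {c \<in> cochains X. coboundary X c = (\<lambda>p f. 0)},
      mult = cup X,
      one = (\<lambda>p f. if p = 0 \<and> singular_simplex 0 X f then 1 else 0),
      zero = (\<lambda>p f. 0),
      add = (\<lambda>c d p f. c p f + d p f)\<rparr>"

definition coboundaries :: "'a topology \<Rightarrow> 'a cochain set" where
  "coboundaries X = coboundary X ` cochains X"

definition cohomology_ring :: "'a topology \<Rightarrow> 'a cochain set ring" where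
  "cohomology_ring X = cocycle_ring X Quot coboundaries X"

text \<open>The homogeneous part of degree \<open>p\<close>, as a subset of the total ring.\<close>

definition cohomology :: "nat \<Rightarrow> 'a topology \<Rightarrow> 'a cochain set set" where
  "cohomology p X =
     {coboundaries X +>\<^bsub>cocycle_ring X\<^esub> c | c.
        c \<in> carrier (cocycle_ring X) \<and> (\<forall>q f. q \<noteq> p \<longrightarrow> c q f = 0)}"

definition cochain_pullback :: "'a topology \<Rightarrow> ('a \<Rightarrow> 'b) \<Rightarrow> 'b cochain \<Rightarrow> 'a cochain" where
  "cochain_pullback X g c p f = (if singular_simplex p X f then c p (simplex_map p g f) else 0)"

definition cohomology_pullback ::
    "'a topology \<Rightarrow> ('a \<Rightarrow> 'b) \<Rightarrow> 'b cochain set \<Rightarrow> 'a cochain set" where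
  "cohomology_pullback X g u =
     (\<Union>c\<in>u. coboundaries X +>\<^bsub>cocycle_ring X\<^esub> cochain_pullback X g c)"

definition height :: "('a, 'b) ring_scheme \<Rightarrow> 'a \<Rightarrow> enat" where
  "height R x = Sup {enat m | m. x [^]\<^bsub>R\<^esub> m \<noteq> \<zero>\<^bsub>R\<^esub>}"


section \<open>Quotient topologies, projective space, and oriented Grassmannians\<close>

definition quotient_topology :: "'a topology \<Rightarrow> ('a \<Rightarrow> 'b) \<Rightarrow> 'b topology" where
  "quotient_topology X q =
     topology (\<lambda>U. U \<subseteq> q ` topspace X \<and> openin X {x \<in> topspace X. q x \<in> U})"

lemma openin_quotient_topology:
  "openin (quotient_topology X q) U \<longleftrightarrow>
     U \<subseteq> q ` topspace X \<and> openin X {x \<in> topspace X. q x \<in> U}"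
proof -
  have "istopology (\<lambda>U. U \<subseteq> q ` topspace X \<and> openin X {x \<in> topspace X. q x \<in> U})"
    unfolding istopology_def
  proof (intro conjI allI impI)
    fix S T
    assume S: "S \<subseteq> q ` topspace X \<and> openin X {x \<in> topspace X. q x \<in> S}"
      and T: "T \<subseteq> q ` topspace X \<and> openin X {x \<in> topspace X. q x \<in> T}"
    have "{x \<in> topspace X. q x \<in> S \<inter> T} =
        {x \<in> topspace X. q x \<in> S} \<inter> {x \<in> topspace X. q x \<in> T}" by auto
    moreover have "openin X ({x \<in> topspace X. q x \<in> S} \<inter> {x \<in> topspace X. q x \<in> T})"
      using S T by (intro openin_Int) auto
    ultimately show "openin X {x \<in> topspace X. q x \<in> S \<inter> T}" by (simp only:)
    from S show "S \<inter> T \<subseteq> q ` topspace X" by auto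
  next
    fix K
    assume K: "\<forall>S\<in>K. S \<subseteq> q ` topspace X \<and> openin X {x \<in> topspace X. q x \<in> S}"
    then show "\<Union> K \<subseteq> q ` topspace X" by blast
    have "{x \<in> topspace X. q x \<in> \<Union> K} = (\<Union>S\<in>K. {x \<in> topspace X. q x \<in> S})" by auto
    moreover have "openin X (\<Union>S\<in>K. {x \<in> topspace X. q x \<in> S})"
      using K by (intro openin_Union) auto
    ultimately show "openin X {x \<in> topspace X. q x \<in> \<Union> K}" by (simp only:)
  qed
  then show ?thesis unfolding quotient_topology_def by simp
qed

lemma topspace_quotient_topology: "topspace (quotient_topology X q) = q ` topspace X"
proof -
  have "{x \<in> topspace X. q x \<in> q ` topspace X} = topspace X" by auto
  then have "openin (quotient_topology X q) (q ` topspace X)"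
    by (simp add: openin_quotient_topology)
  then show ?thesis
    unfolding topspace_def[of "quotient_topology X q"]
    by (auto simp: openin_quotient_topology)
qed

lemma quotient_map_quotient_topology: "quotient_map X (quotient_topology X q) q"
  by (auto simp: quotient_map_def openin_quotient_topology topspace_quotient_topology)

definition projective_space :: "(real^'n) set topology" where
  "projective_space = quotient_topology (top_of_set (- {0})) (\<lambda>v. span {v})"

text \<open>
  The rows of a \<open>k \<times> n\<close> matrix are the vectors of a \<open>k\<close>-frame. Two frames are ordered bases of
  the same subspace with the same orientation iff they differ by a matrix of positive determinant.
  An orientation class of frames determines the subspace spanned by its members, so that these
  classes are the oriented \<open>k\<close>-dimensional subspaces.
\<close>

definition frames :: "(real^'n^'k) set" where
  "frames = {M. inj (\<lambda>i. row i M) \<and> independent (rows M)}"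

definition oriented_subspace :: "real^'n^'k \<Rightarrow> (real^'n^'k) set" where
  "oriented_subspace M = {A ** M | A :: real^'k^'k. det A > 0}"

definition oriented_Grassmannian :: "(real^'n^'k) set topology" where
  "oriented_Grassmannian = quotient_topology (top_of_set frames) oriented_subspace"

text \<open>
  The fibre of the canonical bundle over a point: the subspace itself. All frames in the class
  have the same span.
\<close>

definition canonical_fibre :: "(real^'n^'k) set \<Rightarrow> (real^'n) set" where
  "canonical_fibre V = (\<Union>M\<in>V. span (rows M))"


section \<open>Stiefel--Whitney classes\<close>

text \<open>
  A rank \<open>k\<close> subbundle of the trivial bundle with base \<open>B\<close> and fibre \<open>\<real>\<^sup>n\<close> (\<open>n \<ge> 2\<close>) is
  given by its fibres \<open>F b\<close>. The Stiefel--Whitney classes are defined through the projective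
  bundle, as in Hatcher and Husemoller: the inclusions of the fibres into \<open>\<real>\<^sup>n\<close>
  induce a map from the projective bundle \<open>P(F)\<close> to projective space; if \<open>h\<close> is the pullback of the
  generator of the first cohomology group of projective space, then the powers \<open>1, h, \<dots>, h\<^sup>k\<^sup>-\<^sup>1\<close>
  form a basis of \<open>H\<^sup>*(P(F))\<close> over \<open>H\<^sup>*(B)\<close>, and the classes are the coefficients in
  \<open>h\<^sup>k + w\<^sub>1 h\<^sup>k\<^sup>-\<^sup>1 + \<dots> + w\<^sub>k = 0\<close>, with \<open>w\<^sub>0 = 1\<close> and \<open>w\<^sub>i = 0\<close> for \<open>i > k\<close>.
\<close>

definition projective_bundle ::
    "'b topology \<Rightarrow> ('b \<Rightarrow> (real^'n) set) \<Rightarrow> ('b \<times> (real^'n) set) topology" where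
  "projective_bundle B F = subtopology (prod_topology B projective_space) {(b, L). L \<subseteq> F b}"

definition projective_generator :: "(real^'n) set cochain set" where
  "projective_generator =
     (THE a. a \<in> cohomology 1 projective_space \<and> a \<noteq> \<zero>\<^bsub>cohomology_ring projective_space\<^esub>)"

definition tautological_class ::
    "'b topology \<Rightarrow> ('b \<Rightarrow> (real^'n) set) \<Rightarrow> ('b \<times> (real^'n) set) cochain set" where
  "tautological_class B F = cohomology_pullback (projective_bundle B F) snd projective_generator"

definition stiefel_whitney ::
    "'b topology \<Rightarrow> ('b \<Rightarrow> (real^'n) set) \<Rightarrow> nat \<Rightarrow> nat \<Rightarrow> 'b cochain set" where
  "stiefel_whitney B F k =
     (THE w. w 0 = \<one>\<^bsub>cohomology_ring B\<^esub> \<and>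
        (\<forall>i. w i \<in> cohomology i B) \<and>
        (\<forall>i>k. w i = \<zero>\<^bsub>cohomology_ring B\<^esub>) \<and>
        (let P = projective_bundle B F; H = cohomology_ring P; h = tautological_class B F in
           (\<Oplus>\<^bsub>H\<^esub>i\<in>{..k}. cohomology_pullback P fst (w i) \<otimes>\<^bsub>H\<^esub> (h [^]\<^bsub>H\<^esub> (k - i)))
             = \<zero>\<^bsub>H\<^esub>))"

definition canonical_stiefel_whitney :: "nat \<Rightarrow> (real^'n^'k) set cochain set" where
  "canonical_stiefel_whitney =
     stiefel_whitney oriented_Grassmannian canonical_fibre (CARD('k))"

end

(*
  Classes are treated as singular cochains modulo coboundaries. Lifting simplices along a double cover gives
  its transfer and the Gysin sequence, and with Mayer-Vietoris the Leray-Hirsch theorem for projective bundles.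
  Let F be the manifold of flags (L1, L2) of orthogonal lines in R^n. Its cohomology is generated by the classes
  x, y of the two lines. The bundle of such flags inside the canonical bundle over the oriented Grassmannian
  double covers the manifold of flags (L1, L2, L3), with class x + y + z, where z is the class of L3. By
  Leray-Hirsch, pulling back from the Grassmannian is injective; w2 becomes x^2 + x y + y^2, and a polynomial in
  x, y vanishes upstairs exactly if it lies in the ideal generated by x^n, by the complete symmetric polynomial of
  degree n - 1 in x, y and by the one of degree n - 2 in x, y, x + y. The heights come from the congruence
  (x^2 + x y + y^2)^(2^k - 1) = (x y)^(2^k - 1) modulo x^(2^k), y^(2^k) and Poincare duality in F.
*)
theory Submission
 imports Defs "HOL-Library.Function_Algebras" "HOL-Computational_Algebra.Polynomial"
begin

text \<open>Only classes of degree one are ever moved past other factors, so commutativity is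
  established for them alone, by an explicit homotopy. Leray-Hirsch is proved over an arbitrary
  base, because it is used for towers of projective bundles over the Grassmannian as well as over a
  point.

  The generator of degree n - 2 arises thus. By the Gysin sequence, a class from F dies upstairs iff
  on the manifold of triples it is a multiple of x + y + z. That manifold is a projective bundle
  over F; comparing coefficients of powers of z turns the condition into divisibility, in F itself,
  by the Whitney polynomial of the complement of the two lines, taken at z = x + y.

  For nonvanishing of p, duality asks for a polynomial u that kills this generator while p u is the
  top class; such u are written down. For vanishing, p is expressed through relations that hold
  upstairs. All identities rest on the Frobenius map: x y (x + y) times the complete symmetric
  polynomial of degree m in x, y, x + y is x^(m+3) + y^(m+3) + (x + y)^(m+3), which simplifies when
  a power of two can be split off the exponent.\<close>

abbreviation "RP \<equiv> projective_space"
abbreviation "PB \<equiv> projective_bundle"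
abbreviation "HR \<equiv> cohomology_ring"
abbreviation "ZR \<equiv> cocycle_ring"
abbreviation "Gr \<equiv> oriented_Grassmannian"
abbreviation "CF \<equiv> canonical_fibre"
abbreviation "smap \<equiv> simplex_map"
abbreviation "\<Delta> \<equiv> standard_simplex"

text \<open>With these rules active, sums and products of bits would turn into bit operations, out
  of reach of the ring and sum lemmas.\<close>

declare add_bit_eq_xor [simp del] mult_bit_eq_and [simp del] minus_bit_def [simp del]
 uminus_bit_def [simp del] power_bit_unfold [simp del]

lemmas cm_comp = continuous_map_compose[unfolded comp_def]

section \<open>Mod 2 cochains as total functions\<close>

lemma bit_add_self [simp]: "(b::bit) + b = 0" by (cases b) simp_all

lemma cochain_add_self [simp]: "(c::'a cochain) + c = 0" by (intro ext) simp

lemma cochain_add_self2 [simp]: "(c::'a cochain) + (c + d) = d" by (simp add: add.assoc[symmetric])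

lemma cochain_sum_apply: "(\<Sum>i\<in>A. (c i :: 'a cochain)) p f = (\<Sum>i\<in>A. c i p f)"
 by (induction A rule: infinite_finite_induct) auto

text \<open>\<open>delta\<close>, \<open>smile\<close>, \<open>unit\<close> and \<open>pull\<close>
  make no case distinction on being a simplex of a given space. They do not depend on the space, and
  laws such as \<open>leibniz\<close> and \<open>smile_assoc\<close> become plain equations of
  functions.\<close>

definition delta :: "'a cochain \<Rightarrow> 'a cochain" where
 "delta c p f = (if p = 0 then 0 else \<Sum>k\<le>p. c (p - 1) (singular_face p k f))"

definition smile :: "'a cochain \<Rightarrow> 'a cochain \<Rightarrow> 'a cochain" (infixl "\<smile>" 70) where
 "(c \<smile> d) n f = (\<Sum>p\<le>n. c p (front_face p f) * d (n - p) (back_face p (n - p) f))"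

definition unit :: "'a cochain" where "unit p f = (if p = 0 then 1 else 0)"

definition pull :: "('a \<Rightarrow> 'b) \<Rightarrow> 'b cochain \<Rightarrow> 'a cochain" where
 "pull g c p f = c p (smap p g f)"

type_synonym 'a sset = "nat \<Rightarrow> ((nat \<Rightarrow> real) \<Rightarrow> 'a) \<Rightarrow> bool"

definition Sing :: "'a topology \<Rightarrow> 'a sset" where
 "Sing X p f \<longleftrightarrow> singular_simplex p X f"

text \<open>A set of simplices closed under faces. The simplices of a space, those small for a
  cover, and unions and intersections of such sets are all treated alike; the front and back faces
  are what the cup product evaluates.\<close>

definition sset :: "'a sset \<Rightarrow> bool" where
 "sset K \<longleftrightarrow> (\<forall>p f. K p f \<longrightarrow> (\<exists>X. singular_simplex p X f)) \<and>
   (\<forall>p f k. K (Suc p) f \<longrightarrow> k \<le> Suc p \<longrightarrow> K p (singular_face (Suc p) k f)) \<and>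
   (\<forall>p q f. K (p + q) f \<longrightarrow> K p (front_face p f) \<and> K q (back_face p q f))"

definition eqK :: "'a sset \<Rightarrow> 'a cochain \<Rightarrow> 'a cochain \<Rightarrow> bool" where
 "eqK K c d \<longleftrightarrow> (\<forall>p f. K p f \<longrightarrow> c p f = d p f)"

definition Z :: "'a sset \<Rightarrow> 'a cochain \<Rightarrow> bool" where
 "Z K c \<longleftrightarrow> eqK K (delta c) 0"

text \<open>The primitive \<open>e\<close> is an arbitrary function, without bounds on its degrees
  or support. \<open>coboundaries_iff\<close> shows that for classes of bounded degree this gives
  the same relation as the given ring.\<close>

definition coh :: "'a sset \<Rightarrow> 'a cochain \<Rightarrow> 'a cochain \<Rightarrow> bool" where
 "coh K c d \<longleftrightarrow> (\<exists>e. eqK K c (d + delta e))"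

abbreviation "eqS X \<equiv> eqK (Sing X)"
abbreviation "ZS X \<equiv> Z (Sing X)"
abbreviation "cohS X \<equiv> coh (Sing X)"

lemma delta_add: "delta (c + d) = delta c + delta d" by (intro ext) (simp add: delta_def sum.distrib)

lemma delta_0 [simp]: "delta 0 = 0" by (intro ext) (simp add: delta_def)

lemma delta_sum: "delta (\<Sum>i\<in>A. c i) = (\<Sum>i\<in>A. delta (c i))"
 using sum_comp_morphism[of delta c A] by (simp add: delta_add comp_def)

lemma smile_add_left: "(a + b) \<smile> c = a \<smile> c + b \<smile> c"
 by (intro ext) (simp add: smile_def algebra_simps sum.distrib)

lemma smile_add_right: "a \<smile> (b + c) = a \<smile> b + a \<smile> c"
 by (intro ext) (simp add: smile_def algebra_simps sum.distrib)

lemma smile_0_left [simp]: "0 \<smile> c = 0" by (intro ext) (simp add: smile_def)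

lemma smile_0_right [simp]: "c \<smile> 0 = 0" by (intro ext) (simp add: smile_def)

lemma smile_sum_left: "(\<Sum>i\<in>A. c i) \<smile> d = (\<Sum>i\<in>A. c i \<smile> d)"
 using sum_comp_morphism[of "\<lambda>c. c \<smile> d" c A] by (simp add: smile_add_left comp_def)

lemma smile_sum_right: "d \<smile> (\<Sum>i\<in>A. c i) = (\<Sum>i\<in>A. d \<smile> c i)"
 using sum_comp_morphism[of "\<lambda>c. d \<smile> c" c A] by (simp add: smile_add_right comp_def)

lemma pull_add: "pull g (c + d) = pull g c + pull g d" by (intro ext) (simp add: pull_def)

lemma pull_0 [simp]: "pull g 0 = 0" by (intro ext) (simp add: pull_def)

lemma pull_sum: "pull g (\<Sum>i\<in>A. c i) = (\<Sum>i\<in>A. pull g (c i))"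
 using sum_comp_morphism[of "pull g" c A] by (simp add: pull_add comp_def)

lemma pull_unit [simp]: "pull g unit = unit" by (intro ext) (simp add: pull_def unit_def)

lemma simplex_map_comp: "smap p (h \<circ> g) c = smap p h (smap p g c)"
 by (simp add: simplex_map_compose)

lemma pull_pull: "pull g (pull h c) = pull (h \<circ> g) c"
 by (intro ext) (simp add: pull_def simplex_map_comp)

subsection \<open>Faces\<close>

lemma vertex_shift_in_simplex:
 assumes "x \<in> \<Delta> q"
 shows "(\<lambda>i. if i < p then 0 else x (i - p)) \<in> \<Delta> (p + q)" proof -
 have "(\<Sum>i\<le>p+q. if i < p then 0 else x (i - p)) = (\<Sum>i\<in>{p..p+q}. x (i - p))"
  by (rule sum.mono_neutral_cong_right) auto
 also have "\<dots> = (\<Sum>i\<le>q. x i)"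
  by (rule sum.reindex_bij_witness[of _ "\<lambda>i. i + p" "\<lambda>i. i - p"]) auto
 finally show ?thesis using assms by (auto simp: standard_simplex_def)
qed

lemma standard_simplex_le: "x \<in> \<Delta> p \<Longrightarrow> p \<le> q \<Longrightarrow> x \<in> \<Delta> q"
 using standard_simplex_mono by blast

lemma simplical_face_mem: "k \<le> Suc p \<Longrightarrow> x \<in> \<Delta> p \<Longrightarrow> simplical_face k x \<in> \<Delta> (Suc p)"
 using simplical_face_in_standard_simplex[of "Suc p" k x] by simp

lemma simplex_restrict:
 assumes "singular_simplex p X f"
 shows "restrict f (\<Delta> p) = f"
 using assms by (simp add: singular_simplex_def extensional_restrict)

lemma simplex_reparam:
 assumes f: "singular_simplex p X f"
  and g: "\<And>i. continuous_map (powertop_real UNIV) euclideanreal (\<lambda>x. g x i)"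
  and m: "\<And>x. x \<in> \<Delta> q \<Longrightarrow> g x \<in> \<Delta> p"
 shows "singular_simplex q X (restrict (f \<circ> g) (\<Delta> q))" proof -
 let ?PT = "(powertop_real UNIV)"
 have 1: "continuous_map (subtopology ?PT (\<Delta> q)) (subtopology ?PT (\<Delta> p)) g"
  using g m by (auto simp: continuous_map_in_subtopology continuous_map_componentwise
    intro: continuous_map_from_subtopology)
 have 2: "continuous_map (subtopology ?PT (\<Delta> p)) X f" using f singular_simplex_def by blast
 show ?thesis by (simp add: singular_simplex_def continuous_map_compose [OF 1 2])
qed

lemma simplex_front:
 assumes "singular_simplex (p + q) X f"
 shows "singular_simplex p X (front_face p f)" proof -
 have "continuous_map (powertop_real UNIV) euclideanreal (\<lambda>x. x i)" for i :: nat
  by (rule continuous_map_product_projection) simp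
 thus ?thesis using simplex_reparam[OF assms, of "\<lambda>x. x" p]
  by (simp add: front_face_def comp_def standard_simplex_le)
qed

lemma simplex_back:
 assumes "singular_simplex (p + q) X f"
 shows "singular_simplex q X (back_face p q f)" unfolding back_face_def
proof (rule simplex_reparam[OF assms])
 show "continuous_map (powertop_real UNIV) euclideanreal (\<lambda>x. if i < p then 0 else x (i - p))" for i
  by (auto intro: continuous_map_product_projection)
qed (rule vertex_shift_in_simplex)

lemma sset_S [simp]: "sset (Sing X)" unfolding sset_def Sing_def
 using singular_simplex_singular_face[of "Suc _" X]
 by (auto intro: simplex_front simplex_back)

lemma sset_face: "sset K \<Longrightarrow> K p f \<Longrightarrow> p \<noteq> 0 \<Longrightarrow> k \<le> p \<Longrightarrow> K (p - 1) (singular_face p k f)"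
 unfolding sset_def by (metis One_nat_def Suc_pred neq0_conv)

lemma sset_front: "sset K \<Longrightarrow> K n f \<Longrightarrow> p \<le> n \<Longrightarrow> K p (front_face p f)"
 unfolding sset_def by (metis le_add_diff_inverse)

lemma sset_back: "sset K \<Longrightarrow> K n f \<Longrightarrow> p \<le> n \<Longrightarrow> K (n - p) (back_face p (n - p) f)"
 unfolding sset_def by (metis le_add_diff_inverse)

lemma sset_restrict: "sset K \<Longrightarrow> K p f \<Longrightarrow> restrict f (\<Delta> p) = f"
 unfolding sset_def using simplex_restrict by blast

lemma sset_Ex: "(\<And>i. i \<in> I \<Longrightarrow> sset (K i)) \<Longrightarrow> sset (\<lambda>p f. \<exists>i\<in>I. K i p f)"
 unfolding sset_def by blast

lemma front_face_front_face: "p \<le> q \<Longrightarrow> front_face p (front_face q f) = front_face p f"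
 unfolding front_face_def by (auto simp: fun_eq_iff intro: standard_simplex_le)

lemma back_face_back_face: "back_face p q (back_face p' (p + q) f) = back_face (p' + p) q f" proof
 fix x :: "nat \<Rightarrow> real"
 have "(\<lambda>i. if i < p' then 0 else if i - p' < p then 0 else x (i - p' - p))
   = (\<lambda>i. if i < p' + p then 0 else x (i - (p' + p)))" by (auto simp: fun_eq_iff)
 thus "back_face p q (back_face p' (p + q) f) x = back_face (p' + p) q f x"
  using vertex_shift_in_simplex[of x q p] by (auto simp: back_face_def)
qed

lemma front_face_back_face: "front_face q (back_face p (q + r) f) = back_face p q (front_face (p + q) f)"
proof
 fix x :: "nat \<Rightarrow> real"
 show "front_face q (back_face p (q + r) f) x = back_face p q (front_face (p + q) f) x"
  using vertex_shift_in_simplex[of x q p]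
  by (auto simp: back_face_def front_face_def intro: standard_simplex_le)
qed

lemma front_face_simplex_map: "p \<le> n \<Longrightarrow> front_face p (smap n g f) = smap p g (front_face p f)"
 unfolding front_face_def simplex_map_def by (auto simp: fun_eq_iff intro: standard_simplex_le)

lemma back_face_simplex_map: "back_face p q (smap (p + q) g f) = smap q g (back_face p q f)"
 unfolding back_face_def simplex_map_def by (auto simp: fun_eq_iff vertex_shift_in_simplex)

lemma singular_face_map: "k \<le> Suc p \<Longrightarrow> singular_face (Suc p) k (smap (Suc p) g f) = smap p g (singular_face (Suc p) k f)"
 unfolding singular_face_def simplex_map_def by (auto simp: fun_eq_iff simplical_face_mem)

lemma front_face_singular_face_gt:
 assumes "p < k" "p \<le> n"
 shows "front_face p (singular_face (Suc n) k f) = front_face p f" proof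
 fix x :: "nat \<Rightarrow> real"
 have "simplical_face k x = x" if "x \<in> \<Delta> p"
  using that assms by (auto simp: fun_eq_iff simplical_face_def standard_simplex_def)
 thus "front_face p (singular_face (Suc n) k f) x = front_face p f x"
  using assms by (auto simp: front_face_def singular_face_def intro: standard_simplex_le)
qed

lemma front_face_singular_face_le:
 assumes "k \<le> Suc p" "p \<le> n"
 shows "front_face p (singular_face (Suc n) k f) = singular_face (Suc p) k (front_face (Suc p) f)" proof
 fix x :: "nat \<Rightarrow> real"
 show "front_face p (singular_face (Suc n) k f) x = singular_face (Suc p) k (front_face (Suc p) f) x"
  using assms simplical_face_mem[of k p x]
  by (auto simp: front_face_def singular_face_def intro: standard_simplex_le)
qed

lemma back_face_singular_face_le:
 assumes "k \<le> p"
 shows "back_face p q (singular_face (Suc (p + q)) k f) = back_face (Suc p) q f" proof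
 fix x :: "nat \<Rightarrow> real"
 have "simplical_face k (\<lambda>i. if i < p then 0 else x (i - p)) = (\<lambda>i. if i < Suc p then 0 else x (i - Suc p))"
  using assms by (auto simp: fun_eq_iff simplical_face_def)
 thus "back_face p q (singular_face (Suc (p + q)) k f) x = back_face (Suc p) q f x"
  using vertex_shift_in_simplex[of x q p] by (auto simp: back_face_def singular_face_def)
qed

lemma back_face_singular_face_ge:
 assumes "k \<le> Suc q"
 shows "back_face p q (singular_face (Suc (p + q)) (p + k) f) = singular_face (Suc q) k (back_face p (Suc q) f)"
proof
 fix x :: "nat \<Rightarrow> real"
 have "simplical_face (p + k) (\<lambda>i. if i < p then 0 else x (i - p)) = (\<lambda>i. if i < p then 0 else simplical_face k x (i - p))"
  using assms by (auto simp: fun_eq_iff simplical_face_def)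
 thus "back_face p q (singular_face (Suc (p + q)) (p + k) f) x = singular_face (Suc q) k (back_face p (Suc q) f) x"
  using vertex_shift_in_simplex[of x q p] simplical_face_mem[of k q x] assms
  by (auto simp: back_face_def singular_face_def)
qed

lemma front_face_full: "sset K \<Longrightarrow> K p f \<Longrightarrow> front_face p f = f"
 by (simp add: front_face_def sset_restrict)

lemma back_face_full: "sset K \<Longrightarrow> K p f \<Longrightarrow> back_face 0 p f = f"
 using sset_restrict[of K p f] by (simp add: back_face_def comp_def)

subsection \<open>The cochain complex and the cup product\<close>

lemma eqKI: "(\<And>p f. K p f \<Longrightarrow> c p f = d p f) \<Longrightarrow> eqK K c d" by (simp add: eqK_def)
lemma eqK_refl [simp]: "eqK K c c" by (simp add: eqK_def)
lemma eqK_sym: "eqK K c d \<Longrightarrow> eqK K d c" by (simp add: eqK_def)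
lemma eqK_trans [trans]: "eqK K c d \<Longrightarrow> eqK K d e \<Longrightarrow> eqK K c e" by (simp add: eqK_def)
lemma eqK_add: "eqK K a b \<Longrightarrow> eqK K c d \<Longrightarrow> eqK K (a + c) (b + d)" by (simp add: eqK_def)
lemma eqK_sum: "(\<And>i. i \<in> A \<Longrightarrow> eqK K (c i) (d i)) \<Longrightarrow> eqK K (\<Sum>i\<in>A. c i) (\<Sum>i\<in>A. d i)"
 by (simp add: eqK_def cochain_sum_apply)
lemma eqK_mono: "eqK L c d \<Longrightarrow> (\<And>p f. K p f \<Longrightarrow> L p f) \<Longrightarrow> eqK K c d" by (simp add: eqK_def)
lemma eqK_swap: "eqK K (a + b) c \<Longrightarrow> eqK K a (c + b)" proof -
 have "x + y = z \<Longrightarrow> x = z + y" for x y z :: bit by (cases y) auto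
 thus "eqK K (a + b) c \<Longrightarrow> eqK K a (c + b)" unfolding eqK_def plus_fun_apply by blast
qed
lemma eqK_diff: "eqK K (a + b) 0 \<longleftrightarrow> eqK K a b" proof -
 have "x + y = 0 \<longleftrightarrow> x = y" for x y :: bit by (cases x; cases y) auto
 thus ?thesis by (simp add: eqK_def)
qed

lemma eqK_delta: "sset K \<Longrightarrow> eqK K c d \<Longrightarrow> eqK K (delta c) (delta d)"
 unfolding eqK_def delta_def using sset_face[of K] by (auto intro!: sum.cong)

lemma eqK_smile:
 assumes "sset K" "eqK K a b" "eqK K c d"
 shows "eqK K (a \<smile> c) (b \<smile> d)" proof (rule eqKI)
 fix p f assume K: "K p f"
 show "(a \<smile> c) p f = (b \<smile> d) p f" unfolding smile_def proof (rule sum.cong[OF refl])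
  fix k assume "k \<in> {..p}"
  hence "K k (front_face k f)" "K (p - k) (back_face k (p - k) f)"
   using sset_front[OF assms(1) K] sset_back[OF assms(1) K] by auto
  thus "a k (front_face k f) * c (p - k) (back_face k (p - k) f)
    = b k (front_face k f) * d (p - k) (back_face k (p - k) f)" using assms by (simp add: eqK_def)
 qed
qed

text \<open>The pairing of a mod 2 cochain with an integral singular chain. It carries chain level
  facts on boundaries, subdivision and homotopies over to cochains.\<close>

definition evalc :: "'a cochain \<Rightarrow> nat \<Rightarrow> 'a chain \<Rightarrow> bit" where
 "evalc c p x = (\<Sum>f\<in>Poly_Mapping.keys x. of_int (Poly_Mapping.lookup x f) * c p f)"

lemma evalc_superset:
 assumes "finite A" "Poly_Mapping.keys x \<subseteq> A"
 shows "evalc c p x = (\<Sum>f\<in>A. of_int (Poly_Mapping.lookup x f) * c p f)" unfolding evalc_def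
 by (rule sum.mono_neutral_left) (use assms in \<open>auto simp: in_keys_iff\<close>)

lemma evalc_add: "evalc c p (x + y) = evalc c p x + evalc c p y" proof -
 let ?A = "Poly_Mapping.keys x \<union> Poly_Mapping.keys y"
 have "evalc c p z = (\<Sum>f\<in>?A. of_int (Poly_Mapping.lookup z f) * c p f)" if "Poly_Mapping.keys z \<subseteq> ?A" for z
  using that by (intro evalc_superset) auto
 thus ?thesis using keys_add[of x y] by (simp add: lookup_add distrib_right sum.distrib)
qed

lemma evalc_0 [simp]: "evalc c p 0 = 0" by (simp add: evalc_def)

lemma evalc_minus: "evalc c p (- x) = evalc c p x"
 using evalc_add[of c p x "- x"] by (cases "evalc c p x"; cases "evalc c p (- x)") auto

lemma evalc_diff: "evalc c p (x - y) = evalc c p x + evalc c p y"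
 using evalc_add[of c p x "- y"] by (simp add: evalc_minus)

lemma evalc_of [simp]: "evalc c p (frag_of f) = c p f" by (simp add: evalc_def)

lemma evalc_sum: "evalc c p (\<Sum>i\<in>A. x i) = (\<Sum>i\<in>A. evalc c p (x i))"
 by (induction A rule: infinite_finite_induct) (auto simp: evalc_add)

lemma evalc_cmul_sign: "evalc c p (frag_cmul ((-1) ^ k) x) = evalc c p x"
 by (cases "even k") (auto simp: evalc_minus)

lemma evalc_boundary_of: "p \<noteq> 0 \<Longrightarrow> evalc c (p - 1) (chain_boundary p (frag_of f)) = delta c p f"
 by (simp add: chain_boundary_of evalc_sum evalc_cmul_sign delta_def)

lemma evalc_boundary: "p \<noteq> 0 \<Longrightarrow> evalc c (p - 1) (chain_boundary p x) = evalc (delta c) p x"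
 using subset_UNIV proof (induction x rule: frag_induction)
 case zero
 thus ?case by simp
next
 case (one f)
 thus ?case using evalc_boundary_of[of p c f] by simp
next
 case (diff a b)
 thus ?case by (simp add: chain_boundary_diff evalc_diff)
qed

text \<open>The pairing reduces this to the boundary of a boundary, known for singular chains; hence
  equality on \<open>K\<close> only.\<close>

lemma delta_delta: assumes "sset K" shows "eqK K (delta (delta c)) 0" proof (rule eqKI)
 fix p f assume K: "K p f"
 then obtain X where X: "singular_simplex p X f" using assms unfolding sset_def by blast
 show "delta (delta c) p f = 0 p f" proof (cases "p \<ge> 2")
  case True
  have "delta (delta c) p f = evalc (delta c) (p - 1) (chain_boundary p (frag_of f))"
   using True by (intro evalc_boundary_of[symmetric]) auto
  also have "\<dots> = evalc c (p - 1 - 1) (chain_boundary (p - 1) (chain_boundary p (frag_of f)))"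
   using True by (intro evalc_boundary[symmetric]) auto
  also have "\<dots> = 0"
   using chain_boundary_boundary[of p X "frag_of f"] X by (simp add: singular_chain_of)
  finally show ?thesis by simp
 next
  case False
  hence "p = 0 \<or> p = 1" by auto
  thus ?thesis by (auto simp: delta_def)
 qed
qed

lemma last_face_front: "singular_face (Suc p) (Suc p) (front_face (Suc p) f) = front_face p f"
 using front_face_singular_face_le[of "Suc p" p p f] front_face_singular_face_gt[of p "Suc p" p f] by simp

lemma first_face_back: "singular_face (Suc q) 0 (back_face p (Suc q) f) = back_face (Suc p) q f"
 using back_face_singular_face_ge[of 0 q p f] back_face_singular_face_le[of p p q f] by simp

text \<open>In the term with front part of dimension \<open>p\<close>, faces up to \<open>p\<close>
  act on the front factor and the later ones on the back factor. The right-hand side has two terms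
  more, from the last face of the front and the first face of the back; both equal
  \<open>?M p\<close> and cancel mod 2.\<close>

lemma leibniz_eq: "delta (c \<smile> d) m f = (delta c \<smile> d + c \<smile> delta d) m f" proof (cases m)
 case 0
 thus ?thesis by (simp add: delta_def smile_def)
next
 case m: (Suc n)
 let ?F = "\<lambda>p k. c p (singular_face (Suc p) k (front_face (Suc p) f)) * d (n - p) (back_face (Suc p) (n - p) f)"
 let ?G = "\<lambda>p k. c p (front_face p f) * d (n - p) (singular_face (Suc (n - p)) k (back_face p (Suc (n - p)) f))"
 let ?M = "\<lambda>p. c p (front_face p f) * d (n - p) (back_face (Suc p) (n - p) f)"
 have L: "delta (c \<smile> d) m f = (\<Sum>p\<le>n. \<Sum>k\<le>Suc n. c p (front_face p (singular_face (Suc n) k f)) * d (n - p) (back_face p (n - p) (singular_face (Suc n) k f)))"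
  unfolding m delta_def smile_def by (simp del: sum.atMost_Suc) (rule sum.swap)
 have inner: "(\<Sum>k\<le>Suc n. c p (front_face p (singular_face (Suc n) k f)) * d (n - p) (back_face p (n - p) (singular_face (Suc n) k f)))
   = (\<Sum>k\<le>p. ?F p k) + (\<Sum>k\<in>{1..Suc (n - p)}. ?G p k)" if "p \<le> n" for p proof -
  let ?H = "\<lambda>k. c p (front_face p (singular_face (Suc n) k f)) * d (n - p) (back_face p (n - p) (singular_face (Suc n) k f))"
  have "(\<Sum>k\<le>Suc n. ?H k) = (\<Sum>k\<in>{..p} \<union> {Suc p..Suc n}. ?H k)"
   using that by (intro sum.cong) auto
  also have "\<dots> = (\<Sum>k\<le>p. ?H k) + (\<Sum>k\<in>{Suc p..Suc n}. ?H k)"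
   by (intro sum.union_disjoint) auto
  also have "(\<Sum>k\<le>p. ?H k) = (\<Sum>k\<le>p. ?F p k)"
   using that back_face_singular_face_le[of _ p "n - p" f]
   by (intro sum.cong) (auto simp: front_face_singular_face_le)
  also have "(\<Sum>k\<in>{Suc p..Suc n}. ?H k) = (\<Sum>k\<in>{1..Suc (n - p)}. ?H (p + k))"
   by (rule sum.reindex_bij_witness[of _ "\<lambda>i. p + i" "\<lambda>i. i - p"]) (use that in auto)
  also have "\<dots> = (\<Sum>k\<in>{1..Suc (n - p)}. ?G p k)"
   using that back_face_singular_face_ge[of _ "n - p" p f]
   by (intro sum.cong) (auto simp: front_face_singular_face_gt)
  finally show ?thesis .
 qed
 have R1: "(delta c \<smile> d) m f = (\<Sum>p\<le>n. (\<Sum>k\<le>p. ?F p k) + ?M p)" proof -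
  have "(delta c \<smile> d) m f = (\<Sum>p\<le>n. delta c (Suc p) (front_face (Suc p) f) * d (n - p) (back_face (Suc p) (n - p) f))"
   unfolding smile_def m by (subst sum.atMost_Suc_shift) (simp add: delta_def)
  also have "\<dots> = (\<Sum>p\<le>n. \<Sum>k\<le>Suc p. ?F p k)"
   by (simp add: delta_def sum_distrib_right del: sum.atMost_Suc)
  also have "\<dots> = (\<Sum>p\<le>n. (\<Sum>k\<le>p. ?F p k) + ?M p)" by (simp add: last_face_front)
  finally show ?thesis .
 qed
 have R2: "(c \<smile> delta d) m f = (\<Sum>p\<le>n. ?M p + (\<Sum>k\<in>{1..Suc (n - p)}. ?G p k))" proof -
  have "(c \<smile> delta d) m f = (\<Sum>p\<le>n. c p (front_face p f) * delta d (Suc n - p) (back_face p (Suc n - p) f))"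
   unfolding smile_def m by (simp add: delta_def)
  also have "\<dots> = (\<Sum>p\<le>n. \<Sum>k\<le>Suc (n - p). ?G p k)"
   by (intro sum.cong refl) (simp add: delta_def sum_distrib_left Suc_diff_le del: sum.atMost_Suc)
  also have "\<dots> = (\<Sum>p\<le>n. ?G p 0 + (\<Sum>k\<in>{1..Suc (n - p)}. ?G p k))"
   by (intro sum.cong refl) (simp add: atMost_atLeast0 sum.atLeast_Suc_atMost del: sum.cl_ivl_Suc)
  finally show ?thesis by (simp add: first_face_back)
 qed
 have "delta (c \<smile> d) m f = (\<Sum>p\<le>n. ((\<Sum>k\<le>p. ?F p k) + ?M p) + (?M p + (\<Sum>k\<in>{1..Suc (n - p)}. ?G p k)))"
  unfolding L proof (rule sum.cong[OF refl])
  fix p assume "p \<in> {..n}"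
  hence "p \<le> n" by simp
  have e: "x + y = (x + mm) + (mm + y)" for x y mm :: bit by (cases mm) (auto simp: add.assoc)
  show "(\<Sum>k\<le>Suc n. c p (front_face p (singular_face (Suc n) k f)) * d (n - p) (back_face p (n - p) (singular_face (Suc n) k f)))
   = ((\<Sum>k\<le>p. ?F p k) + ?M p) + (?M p + (\<Sum>k\<in>{1..Suc (n - p)}. ?G p k))"
   unfolding inner[OF \<open>p \<le> n\<close>] by (rule e)
 qed
 thus ?thesis unfolding plus_fun_apply R1 R2 sum.distrib .
qed

lemma leibniz: "delta (c \<smile> d) = delta c \<smile> d + c \<smile> delta d"
 by (intro ext) (rule leibniz_eq)

lemma smile_assoc: "(a \<smile> b) \<smile> c = a \<smile> (b \<smile> c)" proof (intro ext)
 fix n f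
 let ?t = "\<lambda>p r. a p (front_face p f) * b r (front_face r (back_face p (n - p) f)) * c (n - p - r) (back_face (p + r) (n - p - r) f)"
 have "((a \<smile> b) \<smile> c) n f = (\<Sum>q\<le>n. \<Sum>p\<le>q. ?t p (q - p))"
  unfolding smile_def sum_distrib_right proof (intro sum.cong refl)
  fix p q assume "q \<in> {..n}" "p \<in> {..q}"
  hence "p \<le> q" "q \<le> n" by auto
  thus "a p (front_face p (front_face q f)) * b (q - p) (back_face p (q - p) (front_face q f)) *
    c (n - q) (back_face q (n - q) f) = ?t p (q - p)"
   using front_face_back_face[of "q - p" p "n - q" f] by (simp add: front_face_front_face)
 qed
 also have "\<dots> = (\<Sum>(q, p)\<in>Sigma {..n} (\<lambda>q. {..q}). ?t p (q - p))"
  by (rule sum.Sigma) auto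
 also have "\<dots> = (\<Sum>(p, r)\<in>Sigma {..n} (\<lambda>p. {..n - p}). ?t p r)"
  by (rule sum.reindex_bij_witness[of _ "\<lambda>(p, r). (p + r, p)" "\<lambda>(q, p). (p, q - p)"]) auto
 also have "\<dots> = (\<Sum>p\<le>n. \<Sum>r\<le>n - p. ?t p r)" by (rule sum.Sigma[symmetric]) auto
 also have "\<dots> = (a \<smile> (b \<smile> c)) n f" unfolding smile_def sum_distrib_left
 proof (intro sum.cong refl)
  fix p r assume "p \<in> {..n}" "r \<in> {..n - p}"
  thus "?t p r = a p (front_face p f) * (b r (front_face r (back_face p (n - p) f)) *
    c (n - p - r) (back_face r (n - p - r) (back_face p (n - p) f)))"
   using back_face_back_face[of r "n - p - r" p f] by (simp add: mult.assoc)
 qed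
 finally show "((a \<smile> b) \<smile> c) n f = (a \<smile> (b \<smile> c)) n f" .
qed

lemma unit_smile: assumes "sset K" shows "eqK K (unit \<smile> c) c" proof (rule eqKI)
 fix p f assume K: "K p f"
 have "(unit \<smile> c) p f = (\<Sum>q\<le>p. if q = 0 then c p f else 0)"
  unfolding smile_def unit_def by (intro sum.cong refl) (use back_face_full[OF assms K] in auto)
 thus "(unit \<smile> c) p f = c p f" by simp
qed

lemma smile_unit: assumes "sset K" shows "eqK K (c \<smile> unit) c" proof (rule eqKI)
 fix p f assume K: "K p f"
 have "(c \<smile> unit) p f = (\<Sum>q\<le>p. if q = p then c p f else 0)"
  unfolding smile_def unit_def by (intro sum.cong refl) (use front_face_full[OF assms K] in auto)
 thus "(c \<smile> unit) p f = c p f" by simp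
qed

lemma delta_unit [simp]: "delta unit p f = (if p = 1 then 0 else 0)"
 by (cases p) (auto simp: delta_def unit_def)

lemma Z_unit [simp]: "Z K unit" by (simp add: Z_def eqK_def)

lemma Z_0 [simp]: "Z K 0" by (simp add: Z_def)

lemma pull_smile: "pull g (a \<smile> b) = pull g a \<smile> pull g b"
proof (intro ext, unfold pull_def smile_def, intro sum.cong refl)
 fix n p :: nat and f assume "p \<in> {..n}"
 thus "a p (front_face p (smap n g f)) * b (n - p) (back_face p (n - p) (smap n g f)) =
  a p (smap p g (front_face p f)) * b (n - p) (smap (n - p) g (back_face p (n - p) f))"
  using back_face_simplex_map[of p "n - p" g f] by (simp add: front_face_simplex_map)
qed

lemma pull_delta: "pull g (delta c) = delta (pull g c)" proof (intro ext)
 fix p f show "pull g (delta c) p f = delta (pull g c) p f"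
  by (cases p) (auto simp: pull_def delta_def singular_face_map simp del: sum.atMost_Suc intro!: sum.cong)
qed

lemma Z_add: "Z K a \<Longrightarrow> Z K b \<Longrightarrow> Z K (a + b)"
 unfolding Z_def delta_add using eqK_add[of K "delta a" 0 "delta b" 0] by simp

lemma Z_sum: "(\<And>i. i \<in> A \<Longrightarrow> Z K (c i)) \<Longrightarrow> Z K (\<Sum>i\<in>A. c i)"
 unfolding Z_def delta_sum using eqK_sum[of A K "\<lambda>i. delta (c i)" "\<lambda>i. 0"] by simp

lemma Z_delta: "sset K \<Longrightarrow> Z K (delta c)" unfolding Z_def by (rule delta_delta)

lemma Z_smile: "sset K \<Longrightarrow> Z K a \<Longrightarrow> Z K b \<Longrightarrow> Z K (a \<smile> b)"
 unfolding Z_def leibniz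
 using eqK_add[OF eqK_smile[of K "delta a" 0 b b] eqK_smile[of K a a "delta b" 0]] by simp

lemma Z_eqK: "sset K \<Longrightarrow> eqK K a b \<Longrightarrow> Z K a \<Longrightarrow> Z K b"
 unfolding Z_def using eqK_delta eqK_trans eqK_sym by metis

lemma Z_mono: "Z L c \<Longrightarrow> (\<And>p f. K p f \<Longrightarrow> L p f) \<Longrightarrow> Z K c"
 unfolding Z_def by (rule eqK_mono)

definition maps :: "('a \<Rightarrow> 'b) \<Rightarrow> 'a sset \<Rightarrow> 'b sset \<Rightarrow> bool" where
 "maps g K L \<longleftrightarrow> (\<forall>p f. K p f \<longrightarrow> L p (smap p g f))"

lemma maps_Sing: "continuous_map X Y g \<Longrightarrow> maps g (Sing X) (Sing Y)"
 by (simp add: maps_def Sing_def singular_simplex_simplex_map)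

lemma eqK_pull: "maps g K L \<Longrightarrow> eqK L c d \<Longrightarrow> eqK K (pull g c) (pull g d)"
 by (simp add: maps_def eqK_def pull_def)

lemma Z_pull: "maps g K L \<Longrightarrow> Z L c \<Longrightarrow> Z K (pull g c)"
 unfolding Z_def pull_delta[symmetric] using eqK_pull[of g K L "delta c" 0] by simp

lemma coh_refl [simp]: "coh K c c" unfolding coh_def by (rule exI[of _ 0]) simp

lemma eqK_coh: "eqK K c d \<Longrightarrow> coh K c d" unfolding coh_def by (rule exI[of _ 0]) simp

lemma coh_sym: "coh K c d \<Longrightarrow> coh K d c" proof -
 assume "coh K c d"
 then obtain e where "eqK K c (d + delta e)" by (auto simp: coh_def)
 hence "eqK K d (c + delta e)" unfolding eqK_def by (auto simp: add.assoc)
 thus ?thesis by (auto simp: coh_def)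
qed

lemma coh_trans [trans]: "coh K a b \<Longrightarrow> coh K b c \<Longrightarrow> coh K a c" proof -
 assume "coh K a b" "coh K b c"
 then obtain d e where "eqK K a (b + delta d)" "eqK K b (c + delta e)" by (auto simp: coh_def)
 hence "eqK K a (c + delta (e + d))" unfolding eqK_def by (auto simp: add.assoc delta_add)
 thus ?thesis by (auto simp: coh_def)
qed

lemma coh_add: "coh K a b \<Longrightarrow> coh K c d \<Longrightarrow> coh K (a + c) (b + d)" proof -
 assume "coh K a b" "coh K c d"
 then obtain x y where "eqK K a (b + delta x)" "eqK K c (d + delta y)" by (auto simp: coh_def)
 hence "eqK K (a + c) (b + d + delta (x + y))" unfolding eqK_def by (auto simp: ac_simps delta_add)
 thus ?thesis by (auto simp: coh_def)
qed

lemma coh_sum: "(\<And>i. i \<in> A \<Longrightarrow> coh K (c i) (d i)) \<Longrightarrow> coh K (\<Sum>i\<in>A. c i) (\<Sum>i\<in>A. d i)"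
proof (induction A rule: infinite_finite_induct)
 case (insert x F)
 hence "coh K (c x + sum c F) (d x + sum d F)" by (intro coh_add) auto
 thus ?case by (simp only: sum.insert[OF insert(1,2)])
qed simp_all

lemma coh_delta: "coh K (delta e) 0" unfolding coh_def by (rule exI[of _ e]) simp

lemma coh_mono: "coh L c d \<Longrightarrow> (\<And>p f. K p f \<Longrightarrow> L p f) \<Longrightarrow> coh K c d"
 unfolding coh_def using eqK_mono by metis

lemma coh_add_0: "coh K (a + b) 0 \<longleftrightarrow> coh K a b" proof
 assume "coh K (a + b) 0"
 thus "coh K a b" using coh_add[of K "a + b" 0 b b] by (simp add: add.assoc)
next
 assume "coh K a b"
 thus "coh K (a + b) 0" using coh_add[of K a b b b] by simp
qed

lemma coh_pull: "maps g K L \<Longrightarrow> coh L c d \<Longrightarrow> coh K (pull g c) (pull g d)" proof -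
 assume g: "maps g K L" and "coh L c d"
 then obtain e where "eqK L c (d + delta e)" by (auto simp: coh_def)
 from eqK_pull[OF g this] show ?thesis unfolding coh_def pull_add pull_delta by blast
qed

lemma coh_Z: "sset K \<Longrightarrow> coh K a b \<Longrightarrow> Z K a \<Longrightarrow> Z K b" proof -
 assume K: "sset K" and "coh K a b" and a: "Z K a"
 then obtain e where "eqK K a (b + delta e)" by (auto simp: coh_def)
 hence "eqK K (a + delta e) b" unfolding eqK_def by (auto simp: add.assoc)
 thus ?thesis using Z_eqK[OF K] Z_add[OF a Z_delta[OF K]] by blast
qed

lemma coh_smile_left:
 assumes K: "sset K" and c: "Z K c" and ab: "coh K a b"
 shows "coh K (a \<smile> c) (b \<smile> c)" proof -
 obtain e where e: "eqK K a (b + delta e)" using ab by (auto simp: coh_def)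
 have "eqK K (a \<smile> c) (b \<smile> c + delta e \<smile> c)"
  using eqK_smile[OF K e eqK_refl[of K c]] by (simp add: smile_add_left)
 also have "eqK K \<dots> (b \<smile> c + delta (e \<smile> c))"
  using eqK_smile[OF K eqK_refl[of K e], of "delta c" 0] c by (auto simp: leibniz eqK_def Z_def)
 finally show ?thesis by (auto simp: coh_def)
qed

lemma coh_smile_right:
 assumes K: "sset K" and c: "Z K c" and ab: "coh K a b"
 shows "coh K (c \<smile> a) (c \<smile> b)" proof -
 obtain e where e: "eqK K a (b + delta e)" using ab by (auto simp: coh_def)
 have "eqK K (c \<smile> a) (c \<smile> b + c \<smile> delta e)"
  using eqK_smile[OF K eqK_refl[of K c] e] by (simp add: smile_add_right)
 also have "eqK K \<dots> (c \<smile> b + delta (c \<smile> e))" using eqK_smile[OF K, of "delta c" 0 e e] c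
  by (auto simp: leibniz eqK_def Z_def)
 finally show ?thesis by (auto simp: coh_def)
qed

lemma coh_smile:
 assumes "sset K" "Z K a" "Z K c" "coh K a b" "coh K c d"
 shows "coh K (a \<smile> c) (b \<smile> d)"
 using assms coh_smile_left coh_smile_right coh_Z coh_trans by metis

section \<open>Commuting with a class of degree one\<close>

definition concentrated :: "nat \<Rightarrow> 'a cochain \<Rightarrow> bool" where
 "concentrated n c \<longleftrightarrow> (\<forall>p f. p \<noteq> n \<longrightarrow> c p f = 0)"

definition edge :: "nat \<Rightarrow> ((nat \<Rightarrow> real) \<Rightarrow> 'a) \<Rightarrow> (nat \<Rightarrow> real) \<Rightarrow> 'a" where
 "edge i f = back_face i 1 (front_face (Suc i) f)"

text \<open>The sum of \<open>h\<close> over the edges from each vertex to the next. For a cocycle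
  of degree one it is the value on the edge from the first to the last vertex.\<close>

definition path_sum :: "'a cochain \<Rightarrow> nat \<Rightarrow> ((nat \<Rightarrow> real) \<Rightarrow> 'a) \<Rightarrow> bit" where
 "path_sum h n f = (\<Sum>i<n. h 1 (edge i f))"

lemma edge_face:
 assumes "i < n"
 shows "Suc i < k \<Longrightarrow> edge i (singular_face (Suc n) k f) = edge i f"
  and "k \<le> i \<Longrightarrow> edge i (singular_face (Suc n) k f) = edge (Suc i) f"
  and "edge i (singular_face (Suc n) (Suc i) f) = singular_face 2 1 (back_face i 2 (front_face (Suc (Suc i)) f))"
proof -
 show "Suc i < k \<Longrightarrow> edge i (singular_face (Suc n) k f) = edge i f"
  using assms by (simp add: edge_def front_face_singular_face_gt)
 show "k \<le> i \<Longrightarrow> edge i (singular_face (Suc n) k f) = edge (Suc i) f"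
  using assms back_face_singular_face_le[of k i 1] by (simp add: edge_def front_face_singular_face_le)
 show "edge i (singular_face (Suc n) (Suc i) f) = singular_face 2 1 (back_face i 2 (front_face (Suc (Suc i)) f))"
  using assms back_face_singular_face_ge[of 1 1 i]
  by (simp add: edge_def front_face_singular_face_le numeral_2_eq_2)
qed

lemma path_sum_first_face: "path_sum h (Suc n) f = h 1 (edge 0 f) + path_sum h n (singular_face (Suc n) 0 f)"
 unfolding path_sum_def sum.lessThan_Suc_shift by (simp add: edge_face(2))

lemma path_sum_last_face: "path_sum h (Suc n) f = path_sum h n (singular_face (Suc n) (Suc n) f) + h 1 (edge n f)"
 unfolding path_sum_def by (simp add: edge_face(1))

text \<open>Omitting an inner vertex replaces two consecutive edges by the third side of a triangle,
  and \<open>h\<close> is closed on that triangle.\<close>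

lemma path_sum_inner_face:
 assumes K: "sset K" and h: "Z K h" and f: "K (Suc n) f" and k: "0 < k" "k \<le> n"
 shows "path_sum h n (singular_face (Suc n) k f) = path_sum h (Suc n) f" proof -
 obtain i where i: "k = Suc i" using k by (cases k) auto
 let ?t = "back_face i 2 (front_face (Suc (Suc i)) f)"
 have "K (Suc (Suc i)) (front_face (Suc (Suc i)) f)" using sset_front[OF K f] k i by simp
 hence "K 2 ?t" using sset_back[OF K, of "Suc (Suc i)" _ i] by (simp add: numeral_2_eq_2)
 hence "delta h 2 ?t = 0" using h by (auto simp: Z_def eqK_def)
 moreover have "singular_face 2 0 ?t = edge (Suc i) f"
  using first_face_back[of 1 i] by (simp add: edge_def numeral_2_eq_2)
 moreover have "singular_face 2 2 ?t = edge i f"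
  using back_face_singular_face_ge[of 2 1 i "front_face (Suc (Suc i)) f"]
  by (simp add: edge_def numeral_2_eq_2 last_face_front)
 ultimately have t: "h 1 (singular_face 2 1 ?t) = h 1 (edge i f) + h 1 (edge (Suc i) f)"
  by (cases "h 1 (edge i f)"; cases "h 1 (edge (Suc i) f)"; cases "h 1 (singular_face 2 1 ?t)")
    (auto simp: delta_def numeral_2_eq_2)
 let ?g = "\<lambda>j. h 1 (edge j f)"
 have "path_sum h n (singular_face (Suc n) k f)
   = (\<Sum>j<n. if j < i then ?g j else if j = i then ?g i + ?g (Suc i) else ?g (Suc j))"
  unfolding path_sum_def by (intro sum.cong refl) (use t i in \<open>auto simp: edge_face\<close>)
 also have "\<dots> = (\<Sum>j<Suc n. ?g j)" proof -
  have "(\<Sum>j<m. if j < i then ?g j else if j = i then ?g i + ?g (Suc i) else ?g (Suc j))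
    = (if m \<le> i then (\<Sum>j<m. ?g j) else (\<Sum>j<Suc m. ?g j))" for m proof (induction m)
   case (Suc m)
   then consider "m < i" | "m = i" | "i < m" by linarith
   thus ?case using Suc by cases (auto simp: algebra_simps)
  qed simp
  thus ?thesis using k i by simp
 qed
 finally show ?thesis by (simp add: path_sum_def)
qed

lemma smile_concentrated_right:
 assumes "concentrated 1 h"
 shows "(a \<smile> h) (Suc n) f = a n (front_face n f) * h 1 (back_face n 1 f)" proof -
 have "(a \<smile> h) (Suc n) f = (\<Sum>p\<le>Suc n. if p = n then a n (front_face n f) * h 1 (back_face n 1 f) else 0)"
  unfolding smile_def proof (intro sum.cong refl)
  fix p assume "p \<in> {..Suc n}"
  hence "Suc n - p = 1 \<longleftrightarrow> p = n" by auto
  thus "a p (front_face p f) * h (Suc n - p) (back_face p (Suc n - p) f) =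
   (if p = n then a n (front_face n f) * h 1 (back_face n 1 f) else 0)"
   using assms by (auto simp: concentrated_def)
 qed
 thus ?thesis by (simp del: sum.atMost_Suc)
qed

lemma smile_concentrated_left:
 assumes "concentrated 1 h"
 shows "(h \<smile> a) (Suc n) f = h 1 (front_face 1 f) * a n (back_face 1 n f)" proof -
 have "(h \<smile> a) (Suc n) f = (\<Sum>p\<le>Suc n. if p = 1 then h 1 (front_face 1 f) * a n (back_face 1 n f) else 0)"
  unfolding smile_def by (intro sum.cong refl) (use assms in \<open>auto simp: concentrated_def\<close>)
 thus ?thesis by (simp del: sum.atMost_Suc)
qed

text \<open>The product of \<open>a\<close> with the cup-one primitive \<open>path_sum h\<close> bounds the commutator.\<close>

lemma deg1_central:
 assumes K: "sset K" and h: "concentrated 1 h" "Z K h" and a: "Z K a"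
 shows "coh K (a \<smile> h) (h \<smile> a)" proof -
 define T where "T = (\<lambda>p f. a p f * path_sum h p f)"
 have "eqK K (a \<smile> h) (h \<smile> a + delta T)" proof (rule eqKI)
  fix m f assume f: "K m f"
  show "(a \<smile> h) m f = (h \<smile> a + delta T) m f" proof (cases m)
   case 0
   thus ?thesis using h by (simp add: smile_def delta_def concentrated_def)
  next
   case m: (Suc n)
   let ?a = "\<lambda>k. a n (singular_face (Suc n) k f)"
   have K1: "K (Suc n) f" using f m by simp
   have da: "(\<Sum>k\<le>Suc n. ?a k) = 0" proof -
    have "delta a (Suc n) f = 0" using a K1 by (simp add: Z_def eqK_def del: sum.atMost_Suc)
    thus ?thesis by (simp add: delta_def del: sum.atMost_Suc)
   qed
   have e0: "back_face 1 n f = singular_face (Suc n) 0 f"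
    using first_face_back[of n 0 f] back_face_full[OF K K1] by simp
   have en: "front_face n f = singular_face (Suc n) (Suc n) f"
    using last_face_front[of n f] front_face_full[OF K K1] by simp
   have ed: "edge 0 f = front_face 1 f" "edge n f = back_face n 1 f"
    using back_face_full[OF K sset_front[OF K K1, of 1]] front_face_full[OF K K1] by (simp_all add: edge_def)
   let ?S = "path_sum h (Suc n) f"
   \<comment> \<open>Only the two outer faces lose an edge of the path. Apart from these two
     corrections, the alternating sum is \<open>delta a\<close> times \<open>?S\<close>, hence
     zero.\<close>
   have t: "T n (singular_face (Suc n) k f) = ?a k * ?S + (if k = 0 then ?a 0 * h 1 (edge 0 f) else 0)
     + (if k = Suc n then ?a (Suc n) * h 1 (edge n f) else 0)" if k: "k \<le> Suc n" for k proof -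
    consider "k = 0" | "k = Suc n" | "0 < k" "k \<le> n" using k by linarith
    thus ?thesis proof cases
     case 1
     thus ?thesis unfolding T_def path_sum_first_face[of h n f]
      by (cases "h 1 (edge 0 f)") (auto simp: algebra_simps)
    next
     case 2
     thus ?thesis unfolding T_def path_sum_last_face[of h n f]
      by (cases "h 1 (edge n f)") (auto simp: algebra_simps)
    next
     case 3
     thus ?thesis using path_sum_inner_face[OF K h(2) K1 3] by (simp add: T_def)
    qed
   qed
   have "delta T m f = (\<Sum>k\<le>Suc n. T n (singular_face (Suc n) k f))"
    by (simp add: delta_def m del: sum.atMost_Suc)
   also have "\<dots> = (\<Sum>k\<le>Suc n. ?a k * ?S + (if k = 0 then ?a 0 * h 1 (edge 0 f) else 0)
     + (if k = Suc n then ?a (Suc n) * h 1 (edge n f) else 0))" by (intro sum.cong refl) (use t in auto)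
   also have "\<dots> = (\<Sum>k\<le>Suc n. ?a k) * ?S + ?a 0 * h 1 (edge 0 f) + ?a (Suc n) * h 1 (edge n f)"
    by (simp add: sum.distrib sum_distrib_right del: sum.atMost_Suc)
   finally have "delta T m f = ?a 0 * h 1 (edge 0 f) + ?a (Suc n) * h 1 (edge n f)" using da by simp
   thus ?thesis
    unfolding m plus_fun_apply smile_concentrated_right[OF h(1)] smile_concentrated_left[OF h(1)]
    by (simp add: e0[simplified] en ed mult.commute add.assoc[symmetric])
  qed
 qed
 thus ?thesis by (auto simp: coh_def)
qed

subsection \<open>Relative cochains\<close>

lemma evalc_frag_extend: "evalc c q (frag_extend D x) = evalc (\<lambda>_ f. evalc c q (D f)) p x"
 using subset_UNIV proof (induction x rule: frag_induction)
 case (diff a b)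
 thus ?case by (simp add: frag_extend_diff evalc_diff)
qed simp_all

text \<open>Relative chains are free, so acyclicity modulo \<open>K\<close> yields a contracting
  homotopy \<open>D\<close>, chosen simplex by simplex in increasing degree and zero on
  \<open>K\<close>. Evaluating the cocycle on \<open>D\<close> gives a primitive that vanishes on
  \<open>K\<close>.\<close>

lemma acyclic_imp_contractible:
 fixes X :: "'a topology"
 assumes K: "sset K" and KX: "\<And>p f. K p f \<Longrightarrow> singular_simplex p X f"
  and acyc: "\<And>p x. singular_chain p X x \<Longrightarrow> Poly_Mapping.keys (chain_boundary p x) \<subseteq> Collect (K (p - 1)) \<Longrightarrow>
    \<exists>y. singular_chain (Suc p) X y \<and> Poly_Mapping.keys (x - chain_boundary (Suc p) y) \<subseteq> Collect (K p)"
  and c: "ZS X c" and c0: "eqK K c 0"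
 shows "\<exists>e. eqK K e 0 \<and> eqS X c (delta e)" proof -
 define inK where "inK = (\<lambda>p (x :: 'a chain). Poly_Mapping.keys x \<subseteq> Collect (K p))"
 have inK_diff: "inK p a \<Longrightarrow> inK p b \<Longrightarrow> inK p (a - b)" for p a b
  unfolding inK_def using keys_diff[of a b] by blast
 have inK_bd: "inK (p - 1) (chain_boundary p (frag_of f))" if "K p f" for p f proof (cases "p = 0")
  case False
  have "Poly_Mapping.keys (chain_boundary p (frag_of f)) \<subseteq> (\<Union>k\<in>{..p}. {singular_face p k f})"
   unfolding chain_boundary_of using False
   by (auto intro!: order_trans[OF keys_sum] UN_mono order_trans[OF keys_cmul])
  thus ?thesis using sset_face[OF K that False] unfolding inK_def by auto
 qed (simp add: inK_def chain_boundary_def)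
 \<comment> \<open>With \<open>G p w\<close> for \<open>D\<close> applied to the boundary of
   \<open>w\<close>, the homotopy identity says that \<open>w - G p w\<close> and the boundary of
   \<open>D\<close> at \<open>w\<close> differ by a chain in \<open>K\<close>. The recursion chooses
   \<open>D\<close> to satisfy it.\<close>
 define step where "step = (\<lambda>p (f :: (nat \<Rightarrow> real) \<Rightarrow> 'a) z. if K p f then 0 else
   SOME y. singular_chain (Suc p) X y \<and> inK p (frag_of f - z - chain_boundary (Suc p) y))"
 define D where "D = rec_nat (\<lambda>f. step 0 f 0)
   (\<lambda>p Dp f. step (Suc p) f (frag_extend Dp (chain_boundary (Suc p) (frag_of f))))"
 define G where "G = (\<lambda>p w. if p = 0 then 0 else frag_extend (D (p - 1)) (chain_boundary p w))"
 have D_step: "D p f = step p f (G p (frag_of f))" for p f by (cases p) (simp_all add: D_def G_def)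
 have D_K: "D p f = 0" if "K p f" for p f using that by (simp add: D_step step_def)
 have extend_K: "frag_extend (D p) w = 0" if "inK p w" for p w
  using that D_K unfolding inK_def frag_extend_def by (intro sum.neutral) auto
 have G_diff: "G p (a - b) = G p a - G p b" for p a b
  by (simp add: G_def chain_boundary_diff frag_extend_diff)
 have main: "\<forall>f. singular_simplex p X f \<longrightarrow> singular_chain (Suc p) X (D p f) \<and>
   inK p (frag_of f - G p (frag_of f) - chain_boundary (Suc p) (D p f))" for p
 proof (induction p rule: less_induct)
  case (less p)
  show ?case proof (intro allI impI)
   fix f assume f: "singular_simplex p X f"
   let ?z = "G p (frag_of f)"
   show "singular_chain (Suc p) X (D p f) \<and> inK p (frag_of f - ?z - chain_boundary (Suc p) (D p f))"
   proof (cases "K p f")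
    case True
    hence "?z = 0" using extend_K[OF inK_bd[OF True]] by (simp add: G_def)
    thus ?thesis using True by (simp add: D_K inK_def)
   next
    case False
    have "singular_chain p X ?z \<and> inK (p - 1) (chain_boundary p (frag_of f - ?z))" proof (cases p)
     case 0
     thus ?thesis by (simp add: G_def inK_def chain_boundary_def)
    next
     case (Suc q)
     have IH: "singular_chain (Suc q) X (D q g)"
       "inK q (frag_of g - G q (frag_of g) - chain_boundary (Suc q) (D q g))"
      if "singular_simplex q X g" for g using less[of q] that Suc by auto
     let ?w = "chain_boundary (Suc q) (frag_of f)"
     have w: "singular_chain q X ?w"
      using f Suc by (intro singular_chain_boundary_alt) (simp add: singular_chain_of)
     have lin: "inK q (u - G q u - chain_boundary (Suc q) (frag_extend (D q) u))"
      if "singular_chain q X u" for u using that unfolding singular_chain_def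
     proof (induction u rule: frag_induction)
      case zero
      thus ?case by (simp add: inK_def G_def)
     next
      case (one g)
      thus ?case using IH(2)[of g] by simp
     next
      case (diff a b)
      have "a - b - G q (a - b) - chain_boundary (Suc q) (frag_extend (D q) (a - b)) =
        (a - G q a - chain_boundary (Suc q) (frag_extend (D q) a)) -
        (b - G q b - chain_boundary (Suc q) (frag_extend (D q) b))"
       by (simp add: G_diff frag_extend_diff chain_boundary_diff)
      thus ?case using inK_diff[OF diff] by (simp only:)
     qed
     \<comment> \<open>\<open>G\<close> takes the boundary once more, so the identity one degree
       lower says that \<open>?w\<close> minus the boundary of its image under \<open>D\<close> lies
       in \<open>K\<close>. This is the hypothesis of acyclicity for the next choice.\<close>
     have "G q ?w = 0" using chain_boundary_boundary[of "Suc q" X "frag_of f"] f Suc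
      by (simp add: G_def singular_chain_of)
     hence "inK q (?w - chain_boundary (Suc q) (frag_extend (D q) ?w))" using lin[OF w] by simp
     moreover have "singular_chain (Suc q) X (frag_extend (D q) ?w)"
      using w IH(1) by (intro singular_chain_extend) (auto simp: singular_chain_def)
     ultimately show ?thesis using Suc by (simp add: G_def chain_boundary_diff)
    qed
    hence "singular_chain p X (frag_of f - ?z)"
      "Poly_Mapping.keys (chain_boundary p (frag_of f - ?z)) \<subseteq> Collect (K (p - 1))"
     using f by (auto simp: singular_chain_of inK_def intro: singular_chain_diff)
    from acyc[OF this] have "\<exists>y. singular_chain (Suc p) X y \<and> inK p (frag_of f - ?z - chain_boundary (Suc p) y)"
     by (simp add: inK_def)
    from someI_ex[OF this] show ?thesis using False by (simp add: D_step step_def)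
   qed
  qed
 qed
 define e where "e = (\<lambda>p f. evalc c (Suc p) (D p f))"
 have eval_K: "evalc c p x = 0" if "inK p x" for p x
  using that c0 unfolding evalc_def inK_def eqK_def by (intro sum.neutral) auto
 have "eqK K e 0" by (auto simp: eqK_def e_def D_K)
 moreover have "eqS X c (delta e)" unfolding eqK_def Sing_def proof (intro allI impI)
  fix p f assume f: "singular_simplex p X f"
  have "evalc (delta c) (Suc p) (D p f) = 0"
   using main[of p] f c unfolding evalc_def Z_def eqK_def Sing_def singular_chain_def
   by (intro sum.neutral) auto
  hence "evalc c p (chain_boundary (Suc p) (D p f)) = 0"
   using evalc_boundary[of "Suc p" c "D p f"] by simp
  moreover have "evalc c p (frag_of f - G p (frag_of f) - chain_boundary (Suc p) (D p f)) = 0"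
   using eval_K main[of p] f by blast
  ultimately have "c p f + evalc c p (G p (frag_of f)) = 0" by (simp only: evalc_diff evalc_of add_0_right)
  hence 1: "c p f = evalc c p (G p (frag_of f))"
   by (cases "c p f"; cases "evalc c p (G p (frag_of f))") auto
  show "c p f = delta e p f" proof (cases p)
   case (Suc q)
   have "evalc c p (G p (frag_of f)) = evalc e q (chain_boundary p (frag_of f))"
    using evalc_frag_extend[of c p "D q" _ q] Suc by (simp add: G_def e_def evalc_def)
   thus ?thesis using 1 evalc_boundary_of[of p e f] Suc by simp
  qed (use 1 in \<open>simp add: G_def delta_def\<close>)
 qed
 ultimately show ?thesis by blast
qed

section \<open>Small simplices\<close>

definition small :: "'a topology \<Rightarrow> 'a set set \<Rightarrow> 'a sset" where
 "small X \<C> p f \<longleftrightarrow> (\<exists>U\<in>\<C>. Sing (subtopology X U) p f)"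

lemma sset_small [simp]: "sset (small X \<C>)" unfolding small_def[abs_def] by (rule sset_Ex) simp

lemma small_Sing: "small X \<C> p f \<Longrightarrow> Sing X p f"
 by (auto simp: small_def Sing_def singular_simplex_subtopology)

text \<open>Enough subdivisions make a chain small. The homotopy \<open>h\<close> from subdivision
  to the identity keeps small chains small, because \<open>hc\<close> applies to every space and in
  particular to each member of the cover.\<close>

lemma small_acyclic:
 assumes \<C>: "\<And>U. U \<in> \<C> \<Longrightarrow> openin X U" and X: "topspace X \<subseteq> \<Union>\<C>"
  and c: "ZS X c" and c0: "eqK (small X \<C>) c 0"
 shows "\<exists>e. eqK (small X \<C>) e 0 \<and> eqS X c (delta e)"
proof (rule acyclic_imp_contractible[OF _ _ _ c c0])
 fix p and x :: "'a chain"
 assume x: "singular_chain p X x" and bd: "Poly_Mapping.keys (chain_boundary p x) \<subseteq> Collect (small X \<C> (p - 1))"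
 obtain n where n: "\<And>m f. \<lbrakk>n \<le> m; f \<in> Poly_Mapping.keys ((singular_subdivision p ^^ m) x)\<rbrakk>
           \<Longrightarrow> \<exists>V \<in> \<C>. f \<in> (\<Delta> p) \<rightarrow> V"
  using sufficient_iterated_singular_subdivision_exists[OF \<C> X x] by blast
 obtain h where h0: "\<And>p. h p 0 = (0 :: 'a chain)"
  and hd: "\<And>p c1 c2. h p (c1-c2) = h p c1 - h p c2"
  and hc: "\<And>p X c. singular_chain p X c \<Longrightarrow> singular_chain (Suc p) X (h p c)"
  and hb: "\<And>p X c. singular_chain p X c
         \<Longrightarrow> chain_boundary (Suc p) (h p c) + h (p - Suc 0) (chain_boundary p c)
          = (singular_subdivision p ^^ n) c - c"
  by (rule chain_homotopic_iterated_singular_subdivision[of n]) blast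
 have sd: "Poly_Mapping.keys ((singular_subdivision p ^^ n) x) \<subseteq> Collect (small X \<C> p)" proof
  fix f assume f: "f \<in> Poly_Mapping.keys ((singular_subdivision p ^^ n) x)"
  have "singular_chain p X ((singular_subdivision p ^^ m) x)" for m
   by (induction m) (auto simp: x singular_chain_singular_subdivision)
  hence "singular_simplex p X f" using f unfolding singular_chain_def by blast
  thus "f \<in> Collect (small X \<C> p)" using n[OF order_refl f]
   by (auto simp: small_def Sing_def singular_simplex_subtopology)
 qed
 have hsmall: "Poly_Mapping.keys (h q w) \<subseteq> Collect (small X \<C> (Suc q))"
  if "Poly_Mapping.keys w \<subseteq> Collect (small X \<C> q)" for q w using that
 proof (induction w rule: frag_induction)
  case (one f)
  then obtain U where U: "U \<in> \<C>" "singular_chain q (subtopology X U) (frag_of f)"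
   by (auto simp: small_def Sing_def singular_chain_of)
  thus ?case using hc[OF U(2)] by (auto simp: singular_chain_def small_def Sing_def)
 next
  case (diff a b)
  thus ?case using keys_diff[of "h q a" "h q b"] by (auto simp: hd)
 qed (simp add: h0)
 have hs: "Poly_Mapping.keys (h (p - Suc 0) (chain_boundary p x)) \<subseteq> Collect (small X \<C> p)"
 proof (cases p)
  case 0
  thus ?thesis by (simp add: h0 chain_boundary_def)
 qed (use hsmall[OF bd] in simp)
 have "x - chain_boundary (Suc p) (- h p x) = (singular_subdivision p ^^ n) x - h (p - Suc 0) (chain_boundary p x)"
  using hb[OF x] by (simp add: chain_boundary_minus algebra_simps)
 hence "Poly_Mapping.keys (x - chain_boundary (Suc p) (- h p x)) \<subseteq> Collect (small X \<C> p)"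
  using keys_diff[of "(singular_subdivision p ^^ n) x" "h (p - Suc 0) (chain_boundary p x)"] sd hs by auto
 thus "\<exists>y. singular_chain (Suc p) X y \<and> Poly_Mapping.keys (x - chain_boundary (Suc p) y) \<subseteq> Collect (small X \<C> p)"
  using hc[OF x] by (metis singular_chain_minus)
qed (use small_Sing in \<open>auto simp: Sing_def\<close>)

lemma small_coh:
 assumes \<C>: "\<And>U. U \<in> \<C> \<Longrightarrow> openin X U" "topspace X \<subseteq> \<Union>\<C>"
  and c: "ZS X c" "ZS X d" and cd: "coh (small X \<C>) c d"
 shows "cohS X c d" proof -
 obtain e where e: "eqK (small X \<C>) c (d + delta e)" using cd by (auto simp: coh_def)
 have "ZS X (c + (d + delta e))" using c by (intro Z_add Z_delta) auto
 moreover have "eqK (small X \<C>) (c + (d + delta e)) 0" using e eqK_diff by blast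
 ultimately obtain e' where "eqS X (c + (d + delta e)) (delta e')"
  using small_acyclic[OF \<C>] by blast
 hence "cohS X (c + (d + delta e)) 0" by (auto simp: coh_def)
 hence "cohS X c (d + delta e)" by (simp add: coh_add_0)
 also have "cohS X (d + delta e) (d + 0)" by (intro coh_add coh_refl coh_delta)
 finally show ?thesis by simp
qed

subsection \<open>Homotopy invariance\<close>

text \<open>The cylinder is acyclic relative to its bottom, because the projection \<open>r\<close>
  to the bottom is homotopic to the identity through maps of pairs. So a cocycle on the cylinder and
  its pullback along \<open>r\<close> are cohomologous; restricting to the top compares
  \<open>g\<close> with \<open>f\<close>.\<close>

lemma homotopic_coh:
 fixes f g :: "'a \<Rightarrow> 'b"
 assumes fg: "homotopic_with (\<lambda>_. True) X Y f g" and c: "ZS Y c"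
 shows "cohS X (pull f c) (pull g c)" proof -
 let ?I = "top_of_set {0..1::real}"
 let ?XI = "prod_topology ?I X"
 obtain h where conth: "continuous_map ?XI Y h"
  and h0: "\<And>x. h(0, x) = f x" and h1: "\<And>x. h(1, x) = g x"
  using fg by (fastforce simp: homotopic_with_def)
 define S where "S = {0::real} \<times> topspace X"
 define r where "r = (\<lambda>z::real \<times> 'a. (0::real, snd z))"
 have cr: "continuous_map ?XI ?XI r"
  unfolding r_def by (intro continuous_map_pairedI continuous_map_snd) auto
 have hom: "homotopic_with (\<lambda>h. h \<in> S \<rightarrow> S) ?XI ?XI id r" unfolding homotopic_with_def
 proof (intro exI[of _ "\<lambda>z. ((1 - fst z) * fst (snd z), snd (snd z))"] conjI ballI allI)
  have 1: "continuous_map (prod_topology ?I ?XI) euclideanreal (\<lambda>z. (1 - fst z) * fst (snd z))"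
  proof -
   have a: "continuous_map (prod_topology ?I ?XI) euclideanreal fst"
    by (rule continuous_map_into_fulltopology[OF continuous_map_fst])
   have b: "continuous_map (prod_topology ?I ?XI) euclideanreal (\<lambda>z. fst (snd z))"
    using continuous_map_into_fulltopology[OF continuous_map_compose[OF continuous_map_snd continuous_map_fst]]
    by (simp add: comp_def)
   show ?thesis by (intro continuous_map_real_mult continuous_map_diff a b) auto
  qed
  have 2: "continuous_map (prod_topology ?I ?XI) ?I (\<lambda>z. (1 - fst z) * fst (snd z))"
   using 1 by (auto simp: continuous_map_in_subtopology mult_le_one)
  have 3: "continuous_map (prod_topology ?I ?XI) X (\<lambda>z. snd (snd z))"
   by (rule cm_comp[OF continuous_map_snd continuous_map_snd])
  show "continuous_map (prod_topology ?I ?XI) ?XI (\<lambda>z. ((1 - fst z) * fst (snd z), snd (snd z)))"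
   by (rule continuous_map_pairedI[OF 2 3])
 qed (auto simp: r_def S_def)
 define K where "K = Sing (subtopology ?XI S)"
 have rK: "eqK K (pull r d) d" for d :: "(real \<times> 'a) cochain" unfolding eqK_def pull_def
 proof (intro allI impI)
  fix p u assume "K p u"
  hence "singular_simplex p (subtopology ?XI S) u" by (simp add: K_def Sing_def)
  thus "d p (smap p r u) = d p u" by (subst simplex_map_id_gen) (auto simp: r_def S_def)
 qed
 let ?c = "pull h c"
 have zc: "ZS ?XI ?c" by (rule Z_pull[OF maps_Sing[OF conth] c])
 hence z: "ZS ?XI (?c + pull r ?c)" by (intro Z_add Z_pull[OF maps_Sing[OF cr]])
 have k0: "eqK K (?c + pull r ?c) 0" using rK[of ?c] eqK_sym by (auto simp: eqK_diff)
 have "\<exists>e. eqK K e 0 \<and> eqS ?XI (?c + pull r ?c) (delta e)"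
 proof (rule acyclic_imp_contractible[OF _ _ _ z k0])
  fix p and x :: "(real \<times> 'a) chain"
  assume x: "singular_chain p ?XI x" "Poly_Mapping.keys (chain_boundary p x) \<subseteq> Collect (K (p - 1))"
  hence rc: "singular_relcycle p ?XI S x"
   by (auto simp: singular_relcycle singular_chain_def K_def Sing_def)
  have "homologous_rel p ?XI S (chain_map p id x) (chain_map p r x)"
   by (rule homotopic_imp_homologous_rel_chain_maps[OF hom rc])
  hence "singular_relboundary p ?XI S (x - chain_map p r x)"
   using chain_map_ident[OF x(1)] by (simp add: homologous_rel_def)
  then obtain d e where de: "singular_chain (Suc p) ?XI d" "singular_chain p (subtopology ?XI S) e"
    "chain_boundary (Suc p) d + e = x - chain_map p r x" by (auto simp: singular_relboundary)
  have "continuous_map ?XI (subtopology ?XI S) r"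
   using cr by (auto simp: continuous_map_in_subtopology r_def S_def)
  hence "singular_chain p (subtopology ?XI S) (chain_map p r x)"
   using singular_chain_chain_map[OF x(1)] by blast
  hence "singular_chain p (subtopology ?XI S) (e + chain_map p r x)"
   using de(2) by (intro singular_chain_add)
  moreover have "x - chain_boundary (Suc p) d = e + chain_map p r x"
   using de(3) by (simp add: algebra_simps)
  ultimately show "\<exists>y. singular_chain (Suc p) ?XI y \<and> Poly_Mapping.keys (x - chain_boundary (Suc p) y) \<subseteq> Collect (K p)"
   using de(1) by (intro exI[of _ d]) (auto simp: singular_chain_def K_def Sing_def)
 qed (auto simp: K_def Sing_def singular_simplex_subtopology)
 then obtain e where e: "eqS ?XI (?c + pull r ?c) (delta e)" by blast
 have ci: "continuous_map X ?XI (\<lambda>x. (1, x))" by (intro continuous_map_pairedI) auto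
 have "cohS X (pull (\<lambda>x. (1, x)) (?c + pull r ?c)) 0" proof -
  have "cohS ?XI (?c + pull r ?c) 0" using e unfolding coh_def by (intro exI[of _ e]) simp
  from coh_pull[OF maps_Sing[OF ci] this] show ?thesis by simp
 qed
 moreover have "pull (\<lambda>x. (1, x)) (?c + pull r ?c) = pull g c + pull f c"
  by (simp add: pull_add pull_pull comp_def h0 h1 r_def)
 ultimately show ?thesis by (metis coh_add_0 coh_sym)
qed

subsection \<open>Orthogonal projections\<close>

text \<open>Projections encode the topology of families of subspaces: such a family counts as
  continuous when the projection of every fixed vector varies continuously.\<close>

definition proj :: "'a::euclidean_space set \<Rightarrow> 'a \<Rightarrow> 'a" where
 "proj S x = (THE y. y \<in> S \<and> (\<forall>w\<in>S. orthogonal (x - y) w))"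

lemma proj_unique:
 assumes S: "subspace S" and y: "y \<in> S" "\<And>w. w \<in> S \<Longrightarrow> orthogonal (x - y) w"
 shows "proj S x = y" unfolding proj_def proof (rule the_equality)
 fix z assume z: "z \<in> S \<and> (\<forall>w\<in>S. orthogonal (x - z) w)"
 have d: "y - z \<in> S" using S y z by (auto intro: subspace_diff)
 have "(x - z) \<bullet> (y - z) = 0" "(x - y) \<bullet> (y - z) = 0"
  using z y(2)[OF d] d by (auto simp: orthogonal_def)
 hence "(y - z) \<bullet> (y - z) = 0" by (simp add: inner_diff_left)
 thus "z = y" by simp
qed (use y in auto)

lemma proj:
 fixes S :: "'a::euclidean_space set"
 assumes S: "subspace S"
 shows proj_mem: "proj S x \<in> S" and proj_orthogonal: "w \<in> S \<Longrightarrow> orthogonal (x - proj S x) w"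
proof -
 obtain y z where yz: "y \<in> span S" "\<And>w. w \<in> span S \<Longrightarrow> orthogonal z w" "x = y + z"
  using orthogonal_subspace_decomp_exists by blast
 hence "proj S x = y" using S by (intro proj_unique) (auto simp: span_eq_iff[THEN iffD2])
 thus "proj S x \<in> S" "w \<in> S \<Longrightarrow> orthogonal (x - proj S x) w"
  using yz S by (auto simp: span_eq_iff[THEN iffD2])
qed

lemma proj_ident: "subspace S \<Longrightarrow> x \<in> S \<Longrightarrow> proj S x = x"
 by (rule proj_unique) (auto simp: orthogonal_def)

lemma proj_add: "subspace S \<Longrightarrow> proj S (x + y) = proj S x + proj S y" proof (rule proj_unique)
 fix w assume S: "subspace S" "w \<in> S"
 show "orthogonal (x + y - (proj S x + proj S y)) w"
  using proj_orthogonal[OF S, of x] proj_orthogonal[OF S, of y]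
  by (simp add: orthogonal_def inner_diff_left inner_add_left)
qed (auto intro: subspace_add proj_mem)

lemma proj_scale: "subspace S \<Longrightarrow> proj S (c *\<^sub>R x) = c *\<^sub>R proj S x"
proof (rule proj_unique)
 fix w assume S: "subspace S" "w \<in> S"
 show "orthogonal (c *\<^sub>R x - c *\<^sub>R proj S x) w" using proj_orthogonal[OF S, of x]
  by (simp add: orthogonal_def inner_diff_left flip: scaleR_diff_right)
qed (auto intro: subspace_scale proj_mem)

lemma linear_proj: "subspace S \<Longrightarrow> linear (proj S)" by (intro linearI proj_add proj_scale)

lemma proj_inner: "subspace S \<Longrightarrow> w \<in> S \<Longrightarrow> proj S x \<bullet> w = x \<bullet> w"
 using proj_orthogonal[of S w x] by (simp add: orthogonal_def inner_diff_left)

lemma proj_inner_sym: "subspace S \<Longrightarrow> proj S x \<bullet> y = x \<bullet> proj S y"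
 by (metis inner_commute proj_inner proj_mem)

lemma proj_line: "proj (span {v}) x = ((x \<bullet> v) / (v \<bullet> v)) *\<^sub>R v" proof (cases "v = 0")
 case False
 show ?thesis proof (rule proj_unique)
  show "((x \<bullet> v) / (v \<bullet> v)) *\<^sub>R v \<in> span {v}" by (intro span_scale span_base) auto
  fix w assume "w \<in> span {v}"
  then obtain k where "w = k *\<^sub>R v" by (auto simp: span_singleton)
  thus "orthogonal (x - ((x \<bullet> v) / (v \<bullet> v)) *\<^sub>R v) w"
   using False by (simp add: orthogonal_def inner_diff_left)
 qed simp
qed (auto intro!: proj_unique simp: orthogonal_def)

lemma linear_expand:
 fixes f :: "'a::euclidean_space \<Rightarrow> 'b::real_vector"
 assumes "linear f"
 shows "f x = (\<Sum>b\<in>Basis. (x \<bullet> b) *\<^sub>R f b)" proof -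
 have "f x = f (\<Sum>b\<in>Basis. (x \<bullet> b) *\<^sub>R b)" by (simp add: euclidean_representation)
 thus ?thesis by (simp add: linear_sum[OF assms] linear_scale[OF assms] comp_def)
qed

lemma cont_linear_family:
 fixes \<beta> :: "'a \<Rightarrow> 'b::euclidean_space \<Rightarrow> 'c::real_normed_vector"
 assumes lin: "\<And>x. x \<in> topspace X \<Longrightarrow> linear (\<beta> x)"
  and \<beta>: "\<And>u. u \<in> Basis \<Longrightarrow> continuous_map X euclidean (\<lambda>x. \<beta> x u)"
  and v: "continuous_map X euclidean v"
 shows "continuous_map X euclidean (\<lambda>x. \<beta> x (v x))" proof -
 have "continuous_map X euclidean (\<lambda>x. \<Sum>b\<in>Basis. (v x \<bullet> b) *\<^sub>R \<beta> x b)"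
 proof (intro continuous_map_sum)
  fix b :: 'b assume b: "b \<in> Basis"
  have "continuous_map X euclidean (\<lambda>x. v x \<bullet> b)"
   using continuous_map_compose[OF v, of euclidean "\<lambda>z. z \<bullet> b"]
   by (simp add: comp_def continuous_on_inner continuous_on_id continuous_on_const)
  hence "continuous_map X (prod_topology euclidean euclidean) (\<lambda>x. (v x \<bullet> b, \<beta> x b))"
   using \<beta>[OF b] by (intro continuous_map_pairedI)
  hence p: "continuous_map X (euclidean :: (real \<times> 'c) topology) (\<lambda>x. (v x \<bullet> b, \<beta> x b))"
   by simp
  have "continuous_on UNIV (\<lambda>z :: real \<times> 'c. fst z *\<^sub>R snd z)"
   by (intro continuous_intros)
  hence "continuous_map euclidean euclidean (\<lambda>z :: real \<times> 'c. fst z *\<^sub>R snd z)" by simp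
  from continuous_map_compose[OF p this]
  show "continuous_map X euclidean (\<lambda>x. (v x \<bullet> b) *\<^sub>R \<beta> x b)" by (simp add: comp_def)
 qed auto
 thus ?thesis by (rule continuous_map_eq) (metis linear_expand lin)
qed

subsection \<open>Projective space\<close>

lemma topspace_RP: "topspace RP = {span {v} | v :: real^'n. v \<noteq> 0}"
 unfolding projective_space_def topspace_quotient_topology by auto

lemma RP_I: "v \<noteq> 0 \<Longrightarrow> span {v} \<in> topspace RP"
 unfolding topspace_RP by blast

lemma RP_E: assumes "L \<in> topspace RP" obtains v where "v \<noteq> 0" "L = span {v}"
 using assms unfolding topspace_RP by blast

lemma RP_subspace [simp]: "L \<in> topspace RP \<Longrightarrow> subspace L"
 by (auto elim!: RP_E)

lemma RP_eq_span: "L \<in> topspace RP \<Longrightarrow> w \<in> L \<Longrightarrow> w \<noteq> 0 \<Longrightarrow> L = span {w}"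
proof -
 assume "L \<in> topspace RP" "w \<in> L" "w \<noteq> 0"
 then obtain v k where v: "v \<noteq> 0" "L = span {v}" "w = k *\<^sub>R v" by (auto elim!: RP_E simp: span_singleton)
 with \<open>w \<noteq> 0\<close> have "v = inverse k *\<^sub>R w" by simp
 hence "span {v} \<subseteq> span {w}" "span {w} \<subseteq> span {v}"
  using v(3) by (metis empty_subsetI insert_subset span_minimal span_scale span_superset subspace_span singletonI span_base)+
 thus ?thesis using v by blast
qed

lemma cont_span: "continuous_map (top_of_set (- {0})) RP (\<lambda>v :: real^'n. span {v})"
 unfolding projective_space_def by (rule quotient_imp_continuous_map[OF quotient_map_quotient_topology])

lemma cont_span_comp:
 assumes "continuous_map X euclidean v" "\<And>x. x \<in> topspace X \<Longrightarrow> v x \<noteq> 0"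
 shows "continuous_map X RP (\<lambda>x. span {v x :: real^'n})" proof -
 have "continuous_map X (top_of_set (- {0})) v" using assms by (auto simp: continuous_map_in_subtopology)
 from continuous_map_compose[OF this cont_span] show ?thesis by (simp add: comp_def)
qed

lemma cont_proj_line: "continuous_map RP euclidean (\<lambda>L. proj L (u :: real^'n))"
proof -
 have "continuous_map (top_of_set (- {0})) euclidean ((\<lambda>L. proj L u) \<circ> (\<lambda>v :: real^'n. span {v}))"
  by (auto simp: comp_def proj_line intro!: continuous_intros)
 thus ?thesis unfolding projective_space_def
  using continuous_compose_quotient_map[OF quotient_map_quotient_topology] by blast
qed

lemma cont_locally:
 assumes "\<And>x. x \<in> topspace X \<Longrightarrow> \<exists>U. openin X U \<and> x \<in> U \<and> continuous_map (subtopology X U) Y f"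
 shows "continuous_map X Y f" unfolding continuous_map_def proof (intro conjI allI impI)
 show "f \<in> topspace X \<rightarrow> topspace Y" proof
  fix x assume x: "x \<in> topspace X"
  then obtain U where "x \<in> U" "continuous_map (subtopology X U) Y f" using assms by blast
  thus "f x \<in> topspace Y" using x by (auto simp: continuous_map_def Pi_iff)
 qed
 fix W assume W: "openin Y W"
 show "openin X {x \<in> topspace X. f x \<in> W}" proof (subst openin_subopen, intro ballI)
  fix x assume x: "x \<in> {x \<in> topspace X. f x \<in> W}"
  then obtain U where U: "openin X U" "x \<in> U" "continuous_map (subtopology X U) Y f" using assms by blast
  have "openin (subtopology X U) {y \<in> topspace (subtopology X U). f y \<in> W}"
   using U(3) W by (rule openin_continuous_map_preimage)
  hence "openin X {y \<in> topspace (subtopology X U). f y \<in> W}"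
   using U(1) openin_trans_full by blast
  thus "\<exists>T. openin X T \<and> x \<in> T \<and> T \<subseteq> {x \<in> topspace X. f x \<in> W}"
   using x U(2) by (intro exI[of _ "{y \<in> topspace (subtopology X U). f y \<in> W}"]) auto
 qed
qed

lemma open_nonzero:
 assumes "continuous_map X euclidean (v :: 'a \<Rightarrow> 'b::real_normed_vector)"
 shows "openin X {x \<in> topspace X. v x \<noteq> 0}" proof -
 have "open (- {0 :: 'b})" by (rule open_Compl) simp
 thus ?thesis using openin_continuous_map_preimage[OF assms, of "- {0}"] by simp
qed

text \<open>Near \<open>x\<close>, the line \<open>L y\<close> is spanned by the projection to it of
  a fixed vector \<open>v\<close> that spans \<open>L x\<close>.\<close>

lemma cont_RP_I:
 assumes L: "\<And>x. x \<in> topspace X \<Longrightarrow> L x \<in> topspace RP"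
  and c: "\<And>u. continuous_map X euclidean (\<lambda>x. proj (L x) u)"
 shows "continuous_map X (RP :: (real^'n) set topology) L" proof (rule cont_locally)
 fix x assume x: "x \<in> topspace X"
 obtain v where v: "v \<noteq> 0" "L x = span {v}" using L[OF x] by (rule RP_E)
 let ?U = "{y \<in> topspace X. proj (L y) v \<noteq> 0}"
 have "continuous_map (subtopology X ?U) RP (\<lambda>y. span {proj (L y) v})"
  by (intro cont_span_comp continuous_map_from_subtopology c) auto
 moreover have "span {proj (L y) v} = L y" if "y \<in> ?U" for y proof -
  have y: "L y \<in> topspace RP" "proj (L y) v \<noteq> 0" using that L by auto
  from RP_eq_span[OF y(1) proj_mem[OF RP_subspace[OF y(1)]] y(2)] show ?thesis by (rule sym)
 qed
 ultimately have "continuous_map (subtopology X ?U) RP L" by (rule continuous_map_eq) simp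
 moreover have "proj (L x) v = v" using v by (simp add: proj_ident span_base)
 ultimately show "\<exists>U. openin X U \<and> x \<in> U \<and> continuous_map (subtopology X U) RP L"
  using open_nonzero[OF c, of v] x v by (intro exI[of _ ?U]) auto
qed

subsection \<open>Lifting simplices of projective space\<close>

text \<open>Lifts take values in nonzero rather than unit vectors: then linear maps that are
  injective on the lines carry lifts to lifts, without normalisation.\<close>

definition is_lift :: "nat \<Rightarrow> ((nat \<Rightarrow> real) \<Rightarrow> (real^'n) set) \<Rightarrow> ((nat \<Rightarrow> real) \<Rightarrow> real^'n) \<Rightarrow> bool" where
 "is_lift p f l \<longleftrightarrow> continuous_on (\<Delta> p) l \<and> (\<forall>x\<in>\<Delta> p. l x \<noteq> 0 \<and> f x = span {l x})"

lemma simplex_topology: "subtopology (powertop_real UNIV) (\<Delta> p) = top_of_set (\<Delta> p)"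
 by (simp add: euclidean_product_topology)

lemma compact_standard_simplex: "compact (\<Delta> p)"
 using compactin_standard_simplex[of p] by (simp add: euclidean_product_topology)

lemma connected_simplex: "connected (\<Delta> p)"
 using connectedin_standard_simplex[of p] by (simp add: euclidean_product_topology)

lemma simplex_cont: "singular_simplex p X f \<Longrightarrow> continuous_map (top_of_set (\<Delta> p)) X f"
 by (simp add: singular_simplex_def simplex_topology)

lemma norm_proj_diff:
 fixes L M :: "'a::euclidean_space set"
 assumes "subspace L" "subspace M" "u \<in> L" "u \<noteq> 0"
  and d: "\<And>b. b \<in> Basis \<Longrightarrow> norm (proj L b - proj M b) < 1 / DIM('a)"
 shows "proj M u \<noteq> 0" proof
 assume 0: "proj M u = 0"
 have "u = proj L u - proj M u" using assms 0 by (simp add: proj_ident)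
 also have "\<dots> = (\<Sum>b\<in>Basis. (u \<bullet> b) *\<^sub>R (proj L b - proj M b))"
  using linear_expand[OF linear_proj[OF assms(1)], of u] linear_expand[OF linear_proj[OF assms(2)], of u]
  by (simp add: sum_subtractf scaleR_diff_right)
 finally have "norm u \<le> (\<Sum>b\<in>Basis. norm ((u \<bullet> b) *\<^sub>R (proj L b - proj M b)))"
  by (metis norm_sum)
 also have "\<dots> < (\<Sum>b\<in>(Basis::'a set). norm u * (1 / DIM('a)))" proof (rule sum_strict_mono)
  fix b :: 'a assume b: "b \<in> Basis"
  have "norm ((u \<bullet> b) *\<^sub>R (proj L b - proj M b)) \<le> norm u * norm (proj L b - proj M b)"
   using Basis_le_norm[OF b, of u] by (simp add: mult_right_mono)
  also have "\<dots> < norm u * (1 / DIM('a))" using d[OF b] assms(4) by (intro mult_strict_left_mono) auto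
  finally show "norm ((u \<bullet> b) *\<^sub>R (proj L b - proj M b)) < norm u * (1 / DIM('a))" .
 qed auto
 also have "\<dots> = norm u" by simp
 finally show False by simp
qed

text \<open>The lift is carried along the segments from the vertex \<open>0\<close> by orthogonal projection from
 each line to the next one, in steps so small that consecutive lines are never orthogonal.\<close>

lemma lift_exists:
 fixes f :: "(nat \<Rightarrow> real) \<Rightarrow> (real^'n) set"
 assumes f: "singular_simplex p RP f"
 obtains l where "is_lift p f l" proof -
 let ?D = "\<Delta> p"
 define v0 :: "nat \<Rightarrow> real" where "v0 = (\<lambda>j. if j = 0 then 1 else 0)"
 define y where "y = (\<lambda>(t::real, x :: nat \<Rightarrow> real). (\<lambda>i. (1 - t) * v0 i + t * x i))"
 have cf: "continuous_map (top_of_set ?D) RP f" using f by (rule simplex_cont)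
 hence fRP: "f x \<in> topspace RP" if "x \<in> ?D" for x
  using that by (auto simp: continuous_map_def Pi_iff)
 have yD: "y z \<in> ?D" if "z \<in> {0..1} \<times> ?D" for z
  using that convex_standard_simplex[of v0 p "snd z" "fst z"] by (auto simp: y_def v0_def)
 have cy: "continuous_on ({0..1} \<times> ?D) y" unfolding y_def case_prod_beta
 proof (rule continuous_on_coordinatewise_then_product)
  fix i
  have "continuous_on UNIV (\<lambda>x :: nat \<Rightarrow> real. x i)" by (rule continuous_on_product_coordinates)
  hence "continuous_on ({0..1} \<times> ?D) (\<lambda>z. snd z i)"
   by (rule continuous_on_compose2) (auto intro: continuous_intros)
  thus "continuous_on ({0..1} \<times> ?D) (\<lambda>z. (1 - fst z) * v0 i + fst z * snd z i)"
   by (intro continuous_intros)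
 qed
 have cproj: "continuous_on ?D (\<lambda>x. proj (f x) u)" for u
  using cm_comp[OF cf cont_proj_line[of u]] by simp
 define F where "F = (\<lambda>u z. proj (f (y z)) u)"
 have cF: "continuous_on ({0..1} \<times> ?D) (F u)" for u
  unfolding F_def by (rule continuous_on_compose2[OF cproj cy]) (use yD in auto)
 have "uniformly_continuous_on ({0..1} \<times> ?D) (F u)" for u
  by (intro compact_uniformly_continuous cF compact_Times compact_standard_simplex) auto
 hence "\<exists>d>0. \<forall>z\<in>{0..1} \<times> ?D. \<forall>z'\<in>{0..1} \<times> ?D. dist z' z < d \<longrightarrow> dist (F u z') (F u z) < 1 / DIM(real^'n)" for u
  unfolding uniformly_continuous_on_def by (metis zero_less_divide_1_iff of_nat_0_less_iff DIM_positive)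
 then obtain d where d: "\<And>u. d u > 0" "\<And>u z z'. z \<in> {0..1} \<times> ?D \<Longrightarrow> z' \<in> {0..1} \<times> ?D \<Longrightarrow> dist z' z < d u \<Longrightarrow>
   dist (F u z') (F u z) < 1 / DIM(real^'n)" by metis
 define d0 where "d0 = Min (d ` (Basis :: (real^'n) set))"
 have "d0 > 0" using d(1) by (simp add: d0_def)
 then obtain N where N: "N > 0" "1 / real N < d0" using nat_approx_posE[of d0] by (metis zero_less_Suc)
 have step: "proj (f (y (real (Suc i) / N, x))) u \<noteq> 0"
  if i: "i < N" and x: "x \<in> ?D" and u: "u \<in> f (y (real i / N, x))" "u \<noteq> 0" for i x u proof -
  let ?a = "(real i / N, x)" and ?b = "(real (Suc i) / N, x)"
  have ab: "?a \<in> {0..1} \<times> ?D" "?b \<in> {0..1} \<times> ?D" using i x by (auto simp: divide_simps)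
  have "dist ?a ?b = \<bar>real i / N - real (Suc i) / N\<bar>" by (simp add: dist_Pair_Pair dist_real_def)
  also have "real i / N - real (Suc i) / N = - (1 / N)" by (simp add: diff_divide_distrib[symmetric])
  finally have "dist ?a ?b < d0" using N by simp
  moreover have "d0 \<le> d b" if "b \<in> Basis" for b using that by (simp add: d0_def)
  ultimately have "dist (F b ?a) (F b ?b) < 1 / DIM(real^'n)" if "b \<in> Basis" for b
   using d(2)[OF ab(2) ab(1), of b] order_less_le_trans[of _ d0 "d b"] that by blast
  thus ?thesis using fRP[OF yD[OF ab(1)]] fRP[OF yD[OF ab(2)]] u
   by (intro norm_proj_diff[of "f (y ?a)"]) (auto simp: F_def dist_norm)
 qed
 \<comment> \<open>At stage \<open>i\<close> the section follows the lines at time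
   \<open>i / N\<close> of the contraction of the simplex to \<open>v0\<close>; at time 0 the line
   is constant.\<close>
 have "\<exists>l. continuous_on ?D l \<and> (\<forall>x\<in>?D. l x \<noteq> 0 \<and> l x \<in> f (y (real i / N, x)))" if "i \<le> N" for i
  using that proof (induction i)
  case 0
  have "v0 \<in> ?D" by (simp add: v0_def)
  from RP_E[OF fRP[OF this]] obtain u where u: "u \<noteq> 0" "f v0 = span {u}" .
  have "y (0, x) = v0" for x by (simp add: y_def)
  thus ?case using u by (intro exI[of _ "\<lambda>_. u"]) (auto intro: span_base)
 next
  case (Suc i)
  then obtain l where l: "continuous_on ?D l" "\<forall>x\<in>?D. l x \<noteq> 0 \<and> l x \<in> f (y (real i / N, x))" by auto
  have i: "real (Suc i) / N \<in> {0..1}" using Suc.prems N by auto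
  have sub: "subspace (f (y (real (Suc i) / N, x)))" if "x \<in> ?D" for x using fRP yD i that by simp
  have "continuous_map (top_of_set ?D) euclidean (\<lambda>x. proj (f (y (real (Suc i) / N, x))) (l x))"
  proof (rule cont_linear_family[of _ "\<lambda>x. proj (f (y (real (Suc i) / N, x)))"])
   fix u
    have "continuous_on ?D (\<lambda>x. (real (Suc i) / N, x))"
     by (intro continuous_on_Pair continuous_on_const continuous_on_id)
    hence "continuous_on ?D (\<lambda>x. F u (real (Suc i) / N, x))"
     by (rule continuous_on_compose2[OF cF]) (use i in auto)
    thus "continuous_map (top_of_set ?D) euclidean (\<lambda>x. proj (f (y (real (Suc i) / real N, x))) u)"
     by (simp add: F_def)
  qed (use sub l in \<open>auto intro: linear_proj\<close>)
  thus ?case using l(2) step[of i] Suc.prems sub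
   by (intro exI[of _ "\<lambda>x. proj (f (y (real (Suc i) / N, x))) (l x)"]) (auto intro: proj_mem)
 qed
 from this[of N] obtain l where l: "continuous_on ?D l" "\<forall>x\<in>?D. l x \<noteq> 0 \<and> l x \<in> f (y (1, x))"
  using N by auto
 have "y (1, x) = x" for x by (simp add: y_def)
 hence "l x \<noteq> 0 \<and> f x = span {l x}" if "x \<in> ?D" for x
  using l(2) that RP_eq_span[OF fRP[OF that], of "l x"] by auto
 hence "is_lift p f l" using l(1) by (simp add: is_lift_def)
 thus thesis by (rule that)
qed

section \<open>Relative signs and the generating cocycle of projective space\<close>

definition sgn2 :: "real^'n \<Rightarrow> real^'n \<Rightarrow> bit" where
 "sgn2 u v = (if u \<bullet> v < 0 then 1 else 0)"

lemma sgn2_trans: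
 assumes "u \<noteq> 0" "v \<noteq> 0" "w \<noteq> 0" "v \<in> span {u}" "w \<in> span {u}"
 shows "sgn2 u v + sgn2 v w = sgn2 u w" proof -
 obtain a b where ab: "v = a *\<^sub>R u" "w = b *\<^sub>R u" using assms by (auto simp: span_singleton)
 have ab0: "a \<noteq> 0" "b \<noteq> 0" using assms ab by auto
 have s: "0 < u \<bullet> u" using assms by simp
 have "u \<bullet> (a *\<^sub>R u) < 0 \<longleftrightarrow> a < 0" "u \<bullet> (b *\<^sub>R u) < 0 \<longleftrightarrow> b < 0"
  using mult_less_cancel_right_pos[OF s, of a 0] mult_less_cancel_right_pos[OF s, of b 0] by simp_all
 moreover have "(a *\<^sub>R u) \<bullet> (b *\<^sub>R u) = (a * b) * (u \<bullet> u)" by simp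
 hence "(a *\<^sub>R u) \<bullet> (b *\<^sub>R u) < 0 \<longleftrightarrow> a * b < 0"
  using mult_less_cancel_right_pos[OF s, of "a * b" 0] by (simp only: mult_zero_left)
 ultimately show ?thesis using ab0 unfolding sgn2_def ab by (auto simp: mult_less_0_iff not_less)
qed

lemma sgn2_self [simp]: "sgn2 u u = 0" by (simp add: sgn2_def not_less)

lemma sgn2_linear: "linear \<beta> \<Longrightarrow> \<beta> u \<noteq> 0 \<Longrightarrow> u \<noteq> 0 \<Longrightarrow> v \<in> span {u} \<Longrightarrow> sgn2 (\<beta> u) (\<beta> v) = sgn2 u v"
proof -
 assume \<beta>: "linear \<beta>" "\<beta> u \<noteq> 0" "u \<noteq> 0" "v \<in> span {u}"
 then obtain a where a: "v = a *\<^sub>R u" by (auto simp: span_singleton)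
 have "\<beta> u \<bullet> \<beta> u > 0" "u \<bullet> u > 0" using \<beta> by auto
 hence "\<beta> u \<bullet> (a *\<^sub>R \<beta> u) < 0 \<longleftrightarrow> a < 0" "u \<bullet> (a *\<^sub>R u) < 0 \<longleftrightarrow> a < 0"
  by (auto simp only: inner_scaleR_right mult_less_0_iff)
 thus ?thesis unfolding sgn2_def a linear_scale[OF \<beta>(1)] by (simp only:)
qed

lemma sgn2_const_on_connected:
 assumes c: "connected D" "continuous_on D l" "continuous_on D m"
  and 0: "\<And>x. x \<in> D \<Longrightarrow> l x \<bullet> m x \<noteq> 0" and xy: "x \<in> D" "y \<in> D"
 shows "sgn2 (l x) (m x) = sgn2 (l y) (m y)" proof -
 have "connected ((\<lambda>x. l x \<bullet> m x) ` D)"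
  by (intro connected_continuous_image c continuous_intros)
 hence "is_interval ((\<lambda>x. l x \<bullet> m x) ` D)" by (simp add: is_interval_connected_1)
 hence i: "0 \<in> (\<lambda>x. l x \<bullet> m x) ` D" if "l a \<bullet> m a \<le> 0" "0 \<le> l b \<bullet> m b" "a \<in> D" "b \<in> D" for a b
  using that unfolding is_interval_1 by blast
 have "0 \<notin> (\<lambda>x. l x \<bullet> m x) ` D" using 0 by force
 hence "\<not> (l x \<bullet> m x \<le> 0 \<and> 0 \<le> l y \<bullet> m y)" "\<not> (l y \<bullet> m y \<le> 0 \<and> 0 \<le> l x \<bullet> m x)"
  using i[of x y] i[of y x] xy by blast+
 thus ?thesis unfolding sgn2_def by auto
qed

lemma lift_unique:
 assumes "is_lift p f l" "is_lift p f m" "x \<in> \<Delta> p" "y \<in> \<Delta> p"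
 shows "sgn2 (l x) (m x) = sgn2 (l y) (m y)"
proof (rule sgn2_const_on_connected[OF connected_simplex])
 fix z assume "z \<in> \<Delta> p"
 hence "l z \<noteq> 0" "m z \<noteq> 0" "span {l z} = span {m z}" using assms by (auto simp: is_lift_def)
 moreover have "m z \<in> span {m z}" by (simp add: span_base)
 ultimately obtain a where "m z = a *\<^sub>R l z" by (auto simp: span_singleton)
 thus "l z \<bullet> m z \<noteq> 0" using \<open>l z \<noteq> 0\<close> \<open>m z \<noteq> 0\<close> by auto
qed (use assms in \<open>auto simp: is_lift_def\<close>)

definition vtx :: "nat \<Rightarrow> nat \<Rightarrow> real" where "vtx i = (\<lambda>j. if j = i then 1 else 0)"

lemma vtx_mem [simp]: "vtx i \<in> \<Delta> p \<longleftrightarrow> i \<le> p" by (simp add: vtx_def)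

lemma vtx_face: "simplical_face k (vtx i) = vtx (if i < k then i else Suc i)"
 by (auto simp: simplical_face_def vtx_def fun_eq_iff)

lemma singular_face_vtx: "i \<le> p \<Longrightarrow> singular_face (Suc p) k f (vtx i) = f (vtx (if i < k then i else Suc i))"
 by (simp add: singular_face_def vtx_face del: if_image_distrib)

definition sect :: "(real^'n) set \<Rightarrow> real^'n" where
 "sect L = (SOME v. v \<noteq> 0 \<and> v \<in> L)"

lemma sect: assumes "L \<in> topspace RP" shows "sect L \<noteq> 0" "sect L \<in> L" "L = span {sect L}"
proof -
 from RP_E[OF assms] obtain u where "u \<noteq> 0" "L = span {u}" .
 hence "\<exists>v. v \<noteq> 0 \<and> v \<in> L" by (meson singletonI span_base)
 from someI_ex[OF this] show a: "sect L \<noteq> 0" "sect L \<in> L" by (simp_all add: sect_def)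
 show "L = span {sect L}" by (rule RP_eq_span[OF assms a(2,1)])
qed

text \<open>\<open>sect\<close> picks a vector in each line with no continuity at all. The value on
  a path is 1 when a lift along it agrees in sign with the picked vector at one end and disagrees at
  the other. A different choice would change \<open>eta\<close> by a coboundary.\<close>

definition eta :: "(real^'n) set cochain" where "eta p f = (if p = 1 then
   (let l = (SOME l. is_lift 1 f l) in sgn2 (l (vtx 0)) (sect (f (vtx 0))) + sgn2 (l (vtx 1)) (sect (f (vtx 1)))) else 0)"

lemma conc_eta: "concentrated 1 eta" by (simp add: concentrated_def eta_def)

lemma is_lift_RP: "is_lift p f l \<Longrightarrow> x \<in> \<Delta> p \<Longrightarrow> f x \<in> topspace RP"
 by (metis RP_I is_lift_def)

lemma is_lift_mem: "is_lift p f l \<Longrightarrow> x \<in> \<Delta> p \<Longrightarrow> l x \<noteq> 0 \<and> l x \<in> f x"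
 by (metis is_lift_def singletonI span_base)

lemma bit_cancel: "(x::bit) + y = z \<Longrightarrow> x + y' = z' \<Longrightarrow> y + y' = z + z'"
 by (cases x) auto

text \<open>Two lifts of one path differ by a sign that is constant along it, so the sign enters
  twice and cancels.\<close>

lemma eta_eq:
 assumes l: "is_lift 1 f l"
 shows "eta 1 f = sgn2 (l (vtx 0)) (sect (f (vtx 0))) + sgn2 (l (vtx 1)) (sect (f (vtx 1)))" proof -
 define m where "m = (SOME l. is_lift 1 f l)"
 have m: "is_lift 1 f m" using someI[of "is_lift 1 f", OF l] by (simp only: m_def)
 have t: "sgn2 (l (vtx i)) (m (vtx i)) + sgn2 (m (vtx i)) (sect (f (vtx i))) = sgn2 (l (vtx i)) (sect (f (vtx i)))"
  if i: "i \<le> 1" for i proof -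
  have v: "vtx i \<in> \<Delta> 1" using i by simp
  have "l (vtx i) \<noteq> 0" "f (vtx i) = span {l (vtx i)}" using l v by (auto simp: is_lift_def)
  with sect(1,2)[OF is_lift_RP[OF l v]] is_lift_mem[OF m v] show ?thesis by (intro sgn2_trans) simp_all
 qed
 have eq: "sgn2 (l (vtx 1)) (m (vtx 1)) = sgn2 (l (vtx 0)) (m (vtx 0))"
  by (rule lift_unique[OF l m]) simp_all
 have "eta 1 f = sgn2 (m (vtx 0)) (sect (f (vtx 0))) + sgn2 (m (vtx 1)) (sect (f (vtx 1)))"
  unfolding eta_def m_def Let_def by (rule if_P) (rule refl)
 also have "\<dots> = sgn2 (l (vtx 0)) (sect (f (vtx 0))) + sgn2 (l (vtx 1)) (sect (f (vtx 1)))"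
  by (rule bit_cancel[OF t[OF le0] t[OF order_refl, unfolded eq]])
 finally show ?thesis .
qed

lemma cont_simplical_face: "continuous_on S (simplical_face k :: _ \<Rightarrow> nat \<Rightarrow> real)"
proof (rule continuous_on_coordinatewise_then_product)
 fix i
 have "continuous_on S (\<lambda>x :: nat \<Rightarrow> real. x j)" for j
  by (rule continuous_on_subset[OF continuous_on_product_coordinates]) simp
 thus "continuous_on S (\<lambda>x :: nat \<Rightarrow> real. simplical_face k x i)"
  by (cases "i < k"; cases "i = k") (auto simp: simplical_face_def)
qed

lemma is_lift_face:
 assumes l: "is_lift (Suc p) f l" and k: "k \<le> Suc p"
 shows "is_lift p (singular_face (Suc p) k f) (l \<circ> simplical_face k)" unfolding is_lift_def
proof (intro conjI ballI)
 have c: "continuous_on (\<Delta> (Suc p)) l" using l by (simp only: is_lift_def)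
 show "continuous_on (\<Delta> p) (l \<circ> simplical_face k)"
  by (rule continuous_on_compose[OF cont_simplical_face continuous_on_subset[OF c]])
   (use simplical_face_mem[OF k] in blast)
next
 fix x assume x: "x \<in> \<Delta> p"
 have "l (simplical_face k x) \<noteq> 0" "f (simplical_face k x) = span {l (simplical_face k x)}"
  using l simplical_face_mem[OF k x] unfolding is_lift_def by blast+
 thus "(l \<circ> simplical_face k) x \<noteq> 0" "singular_face (Suc p) k f x = span {(l \<circ> simplical_face k) x}"
  using x by (simp_all only: singular_face_def restrict_apply comp_apply diff_Suc_Suc diff_zero if_True not_False_eq_True)
qed

text \<open>One lift over the whole triangle restricts to lifts of its three sides, and each vertex
  contributes to two of them.\<close>

lemma Z_eta: "ZS RP eta" unfolding Z_def eqK_def Sing_def proof (intro allI impI)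
 fix p f assume f: "singular_simplex p (RP :: (real^'n) set topology) f"
 show "delta eta p f = 0 p f" proof (cases "p = 2")
  case True
  obtain l where l: "is_lift (Suc 1) f l" using lift_exists[OF f] True by (metis Suc_1)
  let ?s = "\<lambda>i. sgn2 (l (vtx i)) (sect (f (vtx i)))"
  have "eta 1 (singular_face 2 k f) = ?s (if 0 < k then 0 else 1) + ?s (if 1 < k then 1 else 2)" if "k \<le> 2" for k
   using eta_eq[OF is_lift_face[OF l]] that singular_face_vtx[of _ 1 k f]
   by (simp add: vtx_face numeral_2_eq_2)
  hence "delta eta 2 f = (\<Sum>k\<le>2::nat. ?s (if 0 < k then 0 else 1) + ?s (if 1 < k then 1 else 2))"
   by (simp add: delta_def)
  also have "\<dots> = 0" by (cases "?s 0"; cases "?s 1"; cases "?s 2") (auto simp: numeral_2_eq_2)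
  finally show ?thesis using True by simp
 qed (auto simp: delta_def eta_def intro!: sum.neutral)
qed

abbreviation vfun :: "('a \<Rightarrow> bit) \<Rightarrow> 'a cochain" where
 "vfun t \<equiv> \<lambda>p f. if p = 0 then t (f (vtx 0)) else 0"

lemma delta_vertex_function: "delta (vfun t) p f = (if p = 1 then t (f (vtx 1)) + t (f (vtx 0)) else 0)"
 using singular_face_vtx[of 0 0 _ f] by (cases p) (auto simp: delta_def)

lemma is_lift_map: "is_lift p (smap p g f) l \<longleftrightarrow> is_lift p (\<lambda>x. g (f x)) l"
 by (auto simp: is_lift_def simplex_map_def)

text \<open>Linear maps \<open>\<beta> x\<close>, injective on the lines, carry lifts for
  \<open>L\<close> to lifts for \<open>L'\<close>. The choices at the vertices account for the
  coboundary, which is kept explicit because the induction over trivial bundles needs equality of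
  cochains.\<close>

lemma eta_natural_eq:
 fixes L L' :: "'a \<Rightarrow> (real^'n) set"
 assumes L: "continuous_map X RP L" and L': "continuous_map X RP L'"
  and lin: "\<And>x. x \<in> topspace X \<Longrightarrow> linear (\<beta> x)"
  and \<beta>: "\<And>u. continuous_map X euclidean (\<lambda>x. \<beta> x u :: real^'n)"
  and im: "\<And>x u. x \<in> topspace X \<Longrightarrow> u \<in> L x \<Longrightarrow> u \<noteq> 0 \<Longrightarrow> \<beta> x u \<in> L' x \<and> \<beta> x u \<noteq> 0"
 shows "eqS X (pull L eta) (pull L' eta + delta (vfun (\<lambda>x. sgn2 (\<beta> x (sect (L x))) (sect (L' x)))))"
proof -
 define t where "t = (\<lambda>x. sgn2 (\<beta> x (sect (L x))) (sect (L' x)))"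
 define e where "e = vfun t"
 have "eqS X (pull L eta) (pull L' eta + delta e)" unfolding eqK_def Sing_def proof (intro allI impI)
  fix p f assume f: "singular_simplex p X f"
  show "pull L eta p f = (pull L' eta + delta e) p f" proof (cases "p = 1")
   case True
   note f = f[unfolded True]
   have fX: "f x \<in> topspace X" if "x \<in> \<Delta> 1" for x
    using simplex_cont[OF f] that by (auto simp: continuous_map_def Pi_iff)
   have RP: "L (f x) \<in> topspace RP" "L' (f x) \<in> topspace RP" if "x \<in> \<Delta> 1" for x
    using fX[OF that] L L' by (auto simp: continuous_map_def Pi_iff)
   obtain l where l: "is_lift 1 (smap 1 L f) l"
    using lift_exists singular_simplex_simplex_map[OF f L] by blast
   hence lL: "l x \<noteq> 0" "l x \<in> L (f x)" if "x \<in> \<Delta> 1" for x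
    using is_lift_mem that unfolding is_lift_map by blast+
   have "continuous_map (top_of_set (\<Delta> 1)) euclidean (\<lambda>x. \<beta> (f x) (l x))"
   proof (rule cont_linear_family[of _ "\<lambda>x. \<beta> (f x)"])
    show "continuous_map (top_of_set (\<Delta> 1)) euclidean (\<lambda>x. \<beta> (f x) u)" for u
     by (rule cm_comp[OF simplex_cont[OF f] \<beta>])
   qed (use l fX lin in \<open>auto simp: is_lift_def\<close>)
   moreover have "\<beta> (f x) (l x) \<noteq> 0 \<and> L' (f x) = span {\<beta> (f x) (l x)}" if "x \<in> \<Delta> 1" for x
    using im[OF fX[OF that] lL(2)[OF that] lL(1)[OF that]]
     RP_eq_span[OF RP(2)[OF that], of "\<beta> (f x) (l x)"] by auto
   ultimately have m: "is_lift 1 (smap 1 L' f) (\<lambda>x. \<beta> (f x) (l x))"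
    unfolding is_lift_map by (simp add: is_lift_def)
   have s: "sgn2 (\<beta> (f x) (l x)) (sect (L' (f x))) = sgn2 (l x) (sect (L (f x))) + t (f x)"
    if x: "x \<in> \<Delta> 1" for x proof -
    have b: "\<beta> (f x) (l x) \<noteq> 0" "\<beta> (f x) (l x) \<in> L' (f x)" using im fX[OF x] lL[OF x] by auto
    have c: "\<beta> (f x) (sect (L (f x))) \<noteq> 0" "\<beta> (f x) (sect (L (f x))) \<in> L' (f x)"
     using im fX[OF x] sect[OF RP(1)[OF x]] by auto
    have "sgn2 (\<beta> (f x) (l x)) (\<beta> (f x) (sect (L (f x)))) = sgn2 (l x) (sect (L (f x)))"
     using lin[OF fX[OF x]] b lL[OF x] sect[OF RP(1)[OF x]] RP_eq_span[OF RP(1)[OF x] lL(2)[OF x] lL(1)[OF x]]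
     by (intro sgn2_linear) auto
    moreover have "sgn2 (\<beta> (f x) (l x)) (\<beta> (f x) (sect (L (f x)))) + t (f x) = sgn2 (\<beta> (f x) (l x)) (sect (L' (f x)))"
     unfolding t_def using b c sect[OF RP(2)[OF x]] RP_eq_span[OF RP(2)[OF x] b(2,1)]
     by (intro sgn2_trans) auto
    ultimately show ?thesis by simp
   qed
   have "pull L eta 1 f = sgn2 (l (vtx 0)) (sect (L (f (vtx 0)))) + sgn2 (l (vtx 1)) (sect (L (f (vtx 1))))"
    unfolding pull_def eta_eq[OF l] by (simp add: simplex_map_def)
   moreover have "pull L' eta 1 f = (sgn2 (l (vtx 0)) (sect (L (f (vtx 0)))) + t (f (vtx 0)))
     + (sgn2 (l (vtx 1)) (sect (L (f (vtx 1)))) + t (f (vtx 1)))"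
    unfolding pull_def eta_eq[OF m] using s[of "vtx 0"] s[of "vtx 1"] by (simp add: simplex_map_def)
   moreover have "delta e 1 f = t (f (vtx 1)) + t (f (vtx 0))"
    unfolding e_def delta_vertex_function by simp
   ultimately show ?thesis unfolding True plus_fun_apply
    by (cases "t (f (vtx 0))"; cases "t (f (vtx 1))") (auto simp: add.assoc)
  next
   case False
   thus ?thesis unfolding plus_fun_apply e_def delta_vertex_function by (simp add: pull_def eta_def)
  qed
 qed
 thus ?thesis by (simp only: e_def t_def)
qed

lemma eta_natural:
 fixes L L' :: "'a \<Rightarrow> (real^'n) set"
 assumes L: "continuous_map X RP L" and L': "continuous_map X RP L'"
  and lin: "\<And>x. x \<in> topspace X \<Longrightarrow> linear (\<beta> x)"
  and \<beta>: "\<And>u. continuous_map X euclidean (\<lambda>x. \<beta> x u :: real^'n)"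
  and im: "\<And>x u. x \<in> topspace X \<Longrightarrow> u \<in> L x \<Longrightarrow> u \<noteq> 0 \<Longrightarrow> \<beta> x u \<in> L' x \<and> \<beta> x u \<noteq> 0"
 shows "cohS X (pull L eta) (pull L' eta)"
 unfolding coh_def by (intro exI) (rule eta_natural_eq[OF assms])

lemma pull_const_eta:
 assumes "L \<in> topspace RP"
 shows "eqS X (pull (\<lambda>_. L) eta) 0" unfolding eqK_def Sing_def proof (intro allI impI)
 fix p f
 show "pull (\<lambda>_. L) eta p f = 0 p f" proof (cases "p = 1")
  case True
  have "is_lift 1 (smap 1 (\<lambda>_. L) f) (\<lambda>_. sect L)"
   unfolding is_lift_map using sect[OF assms] by (auto simp: is_lift_def)
  thus ?thesis unfolding True pull_def eta_eq[OF \<open>is_lift 1 (smap 1 (\<lambda>_. L) f) (\<lambda>_. sect L)\<close>]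
   by (simp add: simplex_map_def)
 qed (simp add: pull_def eta_def)
qed

subsection \<open>Double covers and the transfer\<close>

lemma simplexD: "singular_simplex p X f \<Longrightarrow> x \<in> \<Delta> p \<Longrightarrow> f x \<in> topspace X"
 by (auto simp: singular_simplex_def continuous_map_def Pi_iff)

lemma simplex_ext:
 assumes "singular_simplex p X f" "singular_simplex p Y g" "\<And>x. x \<in> \<Delta> p \<Longrightarrow> f x = g x"
 shows "f = g" using assms by (auto simp: singular_simplex_def extensional_def fun_eq_iff) metis

text \<open>The covering enters only through lifts of simplices. \<open>\<theta>\<close> labels the
  two points of each fibre, with no continuity, and \<open>w\<close> records whether the label
  changes along an edge; it represents the characteristic class of the cover.\<close>

locale double_cover =
 fixes E :: "'a topology" and X :: "'b topology" and pr :: "'a \<Rightarrow> 'b" and \<tau> :: "'a \<Rightarrow> 'a"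
  and \<theta> :: "'a \<Rightarrow> bit" and w :: "'b cochain"
 assumes cont_pr: "continuous_map E X pr" and cont_\<tau>: "continuous_map E E \<tau>"
  and pr_\<tau>: "x \<in> topspace E \<Longrightarrow> pr (\<tau> x) = pr x"
  and \<tau>_\<tau>: "x \<in> topspace E \<Longrightarrow> \<tau> (\<tau> x) = x"
  and \<theta>_\<tau>: "x \<in> topspace E \<Longrightarrow> \<theta> (\<tau> x) = \<theta> x + 1"
  and lift: "singular_simplex p X f \<Longrightarrow> \<exists>g. singular_simplex p E g \<and> smap p pr g = f"
  and unique: "singular_simplex p E g \<Longrightarrow> singular_simplex p E g' \<Longrightarrow> smap p pr g = smap p pr g' \<Longrightarrow>
   g' = g \<or> g' = smap p \<tau> g"
  and conc: "concentrated 1 w"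
  and w_edge: "singular_simplex 1 E g \<Longrightarrow> w 1 (smap 1 pr g) = \<theta> (g (vtx 1)) + \<theta> (g (vtx 0))"
begin

definition Theta :: "'a cochain" where "Theta p g = (if p = 0 then \<theta> (g (vtx 0)) else 0)"

definition lf :: "nat \<Rightarrow> ((nat \<Rightarrow> real) \<Rightarrow> 'b) \<Rightarrow> (nat \<Rightarrow> real) \<Rightarrow> 'a" where
 "lf p f = (SOME g. singular_simplex p E g \<and> smap p pr g = f \<and> \<theta> (g (vtx 0)) = 0)"

definition tr :: "'a cochain \<Rightarrow> 'b cochain" where
 "tr c p f = c p (lf p f) + c p (smap p \<tau> (lf p f))"

lemma tau_simplex: "singular_simplex p E g \<Longrightarrow> singular_simplex p E (smap p \<tau> g)"
 by (rule singular_simplex_simplex_map[OF _ cont_\<tau>])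

lemma pr_tau_simplex: "singular_simplex p E g \<Longrightarrow> smap p pr (smap p \<tau> g) = smap p pr g"
 unfolding simplex_map_def by (auto simp: fun_eq_iff pr_\<tau> dest: simplexD)

lemma tau_tau_simplex: "singular_simplex p E g \<Longrightarrow> smap p \<tau> (smap p \<tau> g) = g"
proof -
 assume g: "singular_simplex p E g"
 show ?thesis by (rule simplex_ext[OF tau_simplex[OF tau_simplex[OF g]] g])
   (simp add: simplex_map_def \<tau>_\<tau>[OF simplexD[OF g]])
qed

lemma theta_tau_simplex: "singular_simplex p E g \<Longrightarrow> \<theta> (smap p \<tau> g (vtx 0)) = \<theta> (g (vtx 0)) + 1"
 using \<theta>_\<tau>[OF simplexD[of p E g "vtx 0"]] by (simp add: simplex_map_def)

lemma lf:
 assumes "singular_simplex p X f"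
 shows lf_simplex: "singular_simplex p E (lf p f)" and pr_lf: "smap p pr (lf p f) = f"
  and theta_lf: "\<theta> (lf p f (vtx 0)) = 0" proof -
 obtain g where g: "singular_simplex p E g" "smap p pr g = f" using lift[OF assms] by blast
 have "\<exists>g. singular_simplex p E g \<and> smap p pr g = f \<and> \<theta> (g (vtx 0)) = 0"
 proof (cases "\<theta> (g (vtx 0)) = 0")
  case False
  thus ?thesis using g tau_simplex[OF g(1)] pr_tau_simplex[OF g(1)] theta_tau_simplex[OF g(1)]
   by (intro exI[of _ "smap p \<tau> g"]) auto
 qed (use g in blast)
 from someI_ex[OF this] show "singular_simplex p E (lf p f)" "smap p pr (lf p f) = f" "\<theta> (lf p f (vtx 0)) = 0"
  by (simp_all add: lf_def)
qed

lemma tr_eq: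
 assumes g: "singular_simplex p E g"
 shows "tr c p (smap p pr g) = c p g + c p (smap p \<tau> g)" proof -
 have f: "singular_simplex p X (smap p pr g)" using g by (rule singular_simplex_simplex_map[OF _ cont_pr])
 from unique[OF lf_simplex[OF f] g] pr_lf[OF f]
 have "g = lf p (smap p pr g) \<or> g = smap p \<tau> (lf p (smap p pr g))" by simp
 thus ?thesis proof
  assume a: "g = lf p (smap p pr g)"
  show ?thesis unfolding tr_def a[symmetric] ..
 next
  assume a: "g = smap p \<tau> (lf p (smap p pr g))"
  hence "smap p \<tau> g = lf p (smap p pr g)"
   using tau_tau_simplex[OF lf_simplex[OF f]] by simp
  thus ?thesis unfolding tr_def using a by (simp add: add.commute)
 qed
qed

lemma Sing_E: "Sing X p f \<Longrightarrow> (\<And>g. singular_simplex p E g \<Longrightarrow> f = smap p pr g \<Longrightarrow> \<theta> (g (vtx 0)) = 0 \<Longrightarrow> P) \<Longrightarrow> P"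
 unfolding Sing_def using lf by metis

lemma tr_pull: "eqS X (tr (pull pr a)) 0" proof (rule eqKI)
 fix p f assume "Sing X p f"
 thus "tr (pull pr a) p f = 0 p f" by (rule Sing_E) (simp add: tr_eq pull_def pr_tau_simplex)
qed

lemma tr_add: "tr (a + b) = tr a + tr b" by (intro ext) (simp add: tr_def algebra_simps)

lemma tr_eqK: "eqS E a b \<Longrightarrow> eqS X (tr a) (tr b)"
 using lf_simplex tau_simplex by (simp add: eqK_def tr_def Sing_def)

lemma tr_smile: "eqS X (tr (pull pr a \<smile> c)) (a \<smile> tr c)" proof (rule eqKI)
 fix n f assume "Sing X n f"
 then obtain g where g: "singular_simplex n E g" "f = smap n pr g" by (rule Sing_E)
 have "tr (pull pr a \<smile> c) n f = (\<Sum>p\<le>n. pull pr a p (front_face p g) * c (n - p) (back_face p (n - p) g)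
   + pull pr a p (front_face p (smap n \<tau> g)) * c (n - p) (back_face p (n - p) (smap n \<tau> g)))"
  unfolding g(2) tr_eq[OF g(1)] by (simp add: smile_def sum.distrib)
 also have "\<dots> = (\<Sum>p\<le>n. a p (front_face p f) * tr c (n - p) (back_face p (n - p) f))"
 proof (rule sum.cong[OF refl])
  fix p assume "p \<in> {..n}"
  hence p: "p \<le> n" and n: "n = p + (n - p)" by auto
  have b: "back_face p (n - p) (smap n h g) = smap (n - p) h (back_face p (n - p) g)" for h :: "'a \<Rightarrow> 'c"
   using back_face_simplex_map[of p "n - p" h g] n by simp
  have bg: "singular_simplex (n - p) E (back_face p (n - p) g)"
   using simplex_back[of p "n - p" E g] g n by simp
  have fg: "singular_simplex p E (front_face p g)"
   using simplex_front[of p "n - p" E g] g n by simp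
  have "pull pr a p (front_face p g) = a p (front_face p f)"
   by (simp add: pull_def g(2) front_face_simplex_map[OF p])
  moreover have "pull pr a p (front_face p (smap n \<tau> g)) = a p (front_face p f)"
   by (simp add: pull_def g(2) front_face_simplex_map[OF p] pr_tau_simplex[OF fg])
  moreover have "tr c (n - p) (back_face p (n - p) f) = c (n - p) (back_face p (n - p) g)
    + c (n - p) (back_face p (n - p) (smap n \<tau> g))" proof -
   have "back_face p (n - p) f = smap (n - p) pr (back_face p (n - p) g)"
    unfolding g(2) using back_face_simplex_map[of p "n - p" pr g] n by simp
   moreover have "back_face p (n - p) (smap n \<tau> g) = smap (n - p) \<tau> (back_face p (n - p) g)"
    using back_face_simplex_map[of p "n - p" \<tau> g] n by simp
   ultimately show ?thesis using tr_eq[OF bg] by simp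
  qed
  ultimately show "pull pr a p (front_face p g) * c (n - p) (back_face p (n - p) g)
   + pull pr a p (front_face p (smap n \<tau> g)) * c (n - p) (back_face p (n - p) (smap n \<tau> g))
   = a p (front_face p f) * tr c (n - p) (back_face p (n - p) f)" by (simp add: distrib_left)
 qed
 finally show "tr (pull pr a \<smile> c) n f = (a \<smile> tr c) n f" by (simp add: smile_def)
qed

lemma tr_delta: "eqS X (tr (delta c)) (delta (tr c))" proof (rule eqKI)
 fix n f assume "Sing X n f"
 then obtain g where g: "singular_simplex n E g" "f = smap n pr g" by (rule Sing_E)
 show "tr (delta c) n f = delta (tr c) n f" proof (cases n)
  case 0
  thus ?thesis by (simp add: tr_def delta_def)
 next
  case (Suc m)
  have "tr c m (singular_face (Suc m) k f) = c m (singular_face (Suc m) k g) + c m (singular_face (Suc m) k (smap (Suc m) \<tau> g))"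
   if k: "k \<le> Suc m" for k proof -
   have "singular_simplex m E (singular_face (Suc m) k g)"
    using singular_simplex_singular_face[of "Suc m" E g k] g Suc k by simp
   from tr_eq[OF this] show ?thesis using g(2) Suc by (simp add: singular_face_map[OF k])
  qed
  thus ?thesis unfolding g(2) tr_eq[OF g(1)]
   using g(2) Suc by (simp add: delta_def sum.distrib del: sum.atMost_Suc)
 qed
qed

lemma Z_tr: "ZS E c \<Longrightarrow> ZS X (tr c)" proof -
 assume "ZS E c"
 hence "eqS X (tr (delta c)) (tr 0)" unfolding Z_def by (rule tr_eqK)
 moreover have "tr 0 = 0" by (intro ext) (simp add: tr_def)
 ultimately show ?thesis unfolding Z_def using tr_delta eqK_sym eqK_trans by metis
qed

lemma tr_coh: "cohS E a b \<Longrightarrow> cohS X (tr a) (tr b)" proof -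
 assume "cohS E a b"
 then obtain e where "eqS E a (b + delta e)" by (auto simp: coh_def)
 hence "eqS X (tr a) (tr b + tr (delta e))" using tr_eqK by (metis tr_add)
 also have "eqS X \<dots> (tr b + delta (tr e))" by (intro eqK_add eqK_refl tr_delta)
 finally show ?thesis by (auto simp: coh_def)
qed

lemma Theta_smile: "sset K \<Longrightarrow> K p g \<Longrightarrow> (Theta \<smile> c) p g = \<theta> (g (vtx 0)) * c p g"
proof -
 assume K: "sset K" "K p g"
 have "(Theta \<smile> c) p g = (\<Sum>q\<le>p. if q = 0 then \<theta> (g (vtx 0)) * c p g else 0)"
  unfolding smile_def Theta_def
  by (intro sum.cong refl) (use back_face_full[OF K] in \<open>auto simp: front_face_def\<close>)
 thus ?thesis by simp
qed

lemma delta_Theta: "eqS E (delta Theta) (pull pr w)" proof (rule eqKI)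
 fix p g assume "Sing E p g"
 thus "delta Theta p g = pull pr w p g" using delta_vertex_function[of \<theta> p g] w_edge[of g] conc
  by (cases "p = 1") (auto simp: Theta_def[abs_def] pull_def Sing_def concentrated_def)
qed

text \<open>Each cochain upstairs has the form \<open>pull pr a + Theta \<smile> pull pr b\<close>.
  Here \<open>a\<close> is its value on the lift that starts in the sheet labelled 0, and
  \<open>b\<close> is its transfer, the difference to the other lift. \<open>decompose_zero\<close>
  gives uniqueness.\<close>

lemma decompose: "eqS E c (pull pr (\<lambda>p f. c p (lf p f)) + Theta \<smile> pull pr (tr c))" proof (rule eqKI)
 fix p g assume "Sing E p g"
 hence g: "singular_simplex p E g" by (simp add: Sing_def)
 let ?f = "smap p pr g"
 have f: "singular_simplex p X ?f" using g by (rule singular_simplex_simplex_map[OF _ cont_pr])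
 from unique[OF lf_simplex[OF f] g] pr_lf[OF f]
 consider "g = lf p ?f" | "g = smap p \<tau> (lf p ?f)" by auto
 hence "c p g = c p (lf p ?f) + \<theta> (g (vtx 0)) * tr c p ?f" proof cases
  case 1
  thus ?thesis using theta_lf[OF f] by simp
 next
  case 2
  hence "\<theta> (g (vtx 0)) = 1" using theta_tau_simplex[OF lf_simplex[OF f]] theta_lf[OF f] by simp
  thus ?thesis using 2 by (simp add: tr_def add.assoc[symmetric])
 qed
 thus "c p g = (pull pr (\<lambda>p f. c p (lf p f)) + Theta \<smile> pull pr (tr c)) p g"
  using Theta_smile[OF sset_S \<open>Sing E p g\<close>] by (simp add: pull_def)
qed

lemma decompose_zero:
 assumes "eqS E (pull pr a + Theta \<smile> pull pr b) 0"
 shows "eqS X a 0" "eqS X b 0" proof -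
 have "a p f = 0 \<and> b p f = 0" if f: "Sing X p f" for p f proof -
  obtain g where g: "singular_simplex p E g" "f = smap p pr g" "\<theta> (g (vtx 0)) = 0"
   using f by (rule Sing_E)
  have S: "Sing E p h" if "singular_simplex p E h" for h using that by (simp add: Sing_def)
  have "(pull pr a + Theta \<smile> pull pr b) p g = 0" "(pull pr a + Theta \<smile> pull pr b) p (smap p \<tau> g) = 0"
   using assms S[OF g(1)] S[OF tau_simplex[OF g(1)]] unfolding eqK_def by auto
  thus ?thesis using g theta_tau_simplex[OF g(1)] pr_tau_simplex[OF g(1)]
   by (simp add: Theta_smile[OF sset_S S[OF g(1)]] Theta_smile[OF sset_S S[OF tau_simplex[OF g(1)]]] pull_def)
 qed
 thus "eqS X a 0" "eqS X b 0" by (simp_all add: eqK_def)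
qed

text \<open>In the coordinates \<open>(a, b)\<close> the coboundary is
  \<open>(delta a + w \<smile> b, delta b)\<close>, so the complex upstairs is the mapping cone of
  the product with \<open>w\<close>. The pieces of the Gysin sequence below are read off from
  this.\<close>

lemma delta_decomposed:
 "eqS E (delta (pull pr a + Theta \<smile> pull pr b)) (pull pr (delta a + w \<smile> b) + Theta \<smile> pull pr (delta b))"
proof -
 have "eqS E (delta Theta \<smile> pull pr b) (pull pr w \<smile> pull pr b)"
  by (intro eqK_smile delta_Theta) auto
 hence "eqS E (delta (pull pr a) + (delta Theta \<smile> pull pr b + Theta \<smile> delta (pull pr b)))
   (delta (pull pr a) + (pull pr w \<smile> pull pr b + Theta \<smile> delta (pull pr b)))"
  by (intro eqK_add) auto
 thus ?thesis by (simp add: delta_add leibniz pull_add pull_smile pull_delta add.assoc)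
qed

lemma gysin_kernel:
 assumes "cohS E (pull pr x) 0"
 obtains d where "ZS X d" "cohS X x (w \<smile> d)" proof -
 obtain e where e: "eqS E (pull pr x) (delta e)" using assms by (auto simp: coh_def)
 define a where "a = (\<lambda>p f. e p (lf p f))"
 define b where "b = tr e"
 have "eqS E (delta e) (delta (pull pr a + Theta \<smile> pull pr b))"
  unfolding a_def b_def by (intro eqK_delta decompose) auto
 hence "eqS E (pull pr x) (pull pr (delta a + w \<smile> b) + Theta \<smile> pull pr (delta b))"
  using e delta_decomposed eqK_trans by metis
 hence "eqS E (pull pr x + (pull pr (delta a + w \<smile> b) + Theta \<smile> pull pr (delta b))) 0"
  by (simp only: eqK_diff)
 hence z: "eqS E (pull pr (x + (delta a + w \<smile> b)) + Theta \<smile> pull pr (delta b)) 0"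
  by (simp add: pull_add add.assoc)
 have "eqS X x (delta a + w \<smile> b)" using decompose_zero(1)[OF z] by (simp only: eqK_diff)
 hence "cohS X x (w \<smile> b)" unfolding coh_def by (intro exI[of _ a]) (simp add: add.commute)
 moreover have "ZS X b" using decompose_zero(2)[OF z] by (simp add: Z_def)
 ultimately show thesis using that by blast
qed

text \<open>\<open>Theta\<close> is 1 on exactly one of the two lifts of a simplex.\<close>

lemma tr_Theta: "eqS X (tr (Theta \<smile> pull pr d)) d" proof (rule eqKI)
 fix p f assume "Sing X p f"
 then obtain g where g: "singular_simplex p E g" "f = smap p pr g" "\<theta> (g (vtx 0)) = 0"
  by (rule Sing_E)
 have S: "Sing E p h" if "singular_simplex p E h" for h using that by (simp add: Sing_def)
 show "tr (Theta \<smile> pull pr d) p f = d p f" unfolding g(2) tr_eq[OF g(1)]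
  using g theta_tau_simplex[OF g(1)] pr_tau_simplex[OF g(1)]
  by (simp add: Theta_smile[OF sset_S S[OF g(1)]] Theta_smile[OF sset_S S[OF tau_simplex[OF g(1)]]] pull_def)
qed

lemma tr_annihilated: assumes "ZS E c" shows "cohS X (w \<smile> tr c) 0" proof -
 define a where "a = (\<lambda>p f. c p (lf p f))"
 have "eqS E (delta c) (delta (pull pr a + Theta \<smile> pull pr (tr c)))"
  unfolding a_def by (intro eqK_delta decompose sset_S)
 hence "eqS E (pull pr (delta a + w \<smile> tr c) + Theta \<smile> pull pr (delta (tr c))) 0"
  using delta_decomposed assms eqK_sym eqK_trans unfolding Z_def by metis
 hence "eqS X (w \<smile> tr c) (delta a)" using decompose_zero(1) eqK_diff eqK_sym by blast
 thus ?thesis unfolding coh_def by (intro exI[of _ a]) simp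
qed

lemma tr_kernel:
 assumes c: "ZS E c" and 0: "cohS X (tr c) 0"
 obtains a where "ZS X a" "cohS E c (pull pr a)" proof -
 obtain g where g: "eqS X (tr c) (delta g)" using 0 by (auto simp: coh_def)
 \<comment> \<open>Adding the coboundary of \<open>Theta \<smile> pull pr g\<close> removes the part
   of \<open>c\<close> with \<open>Theta\<close>, at the price of \<open>w \<smile> g\<close> in the
   other part.\<close>
 define a where "a = (\<lambda>p f. c p (lf p f)) + w \<smile> g"
 have m: "maps pr (Sing E) (Sing X)" by (rule maps_Sing[OF cont_pr])
 let ?u = "pull pr (\<lambda>p f. c p (lf p f))" and ?v = "Theta \<smile> pull pr (delta g)"
 have "eqS E c (?u + ?v)"
  by (rule eqK_trans[OF decompose]) (intro eqK_add eqK_smile eqK_refl eqK_pull[OF m g] sset_S)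
 moreover have "eqS E (delta (Theta \<smile> pull pr g)) (pull pr (w \<smile> g) + ?v)"
  using delta_decomposed[of 0 g] by simp
 ultimately have "eqS E (c + delta (Theta \<smile> pull pr g)) ((?u + ?v) + (pull pr (w \<smile> g) + ?v))"
  by (rule eqK_add)
 also have "(?u + ?v) + (pull pr (w \<smile> g) + ?v) = pull pr a"
  by (simp add: a_def pull_add ac_simps)
 finally have e: "eqS E (c + delta (Theta \<smile> pull pr g)) (pull pr a)" .
 have "ZS E (pull pr a)" by (rule Z_eqK[OF sset_S e]) (intro Z_add c Z_delta sset_S)
 hence "eqS E (pull pr (delta a) + Theta \<smile> pull pr 0) 0" by (simp add: Z_def pull_delta)
 hence "ZS X a" unfolding Z_def by (rule decompose_zero(1))
 moreover have "cohS E (pull pr a) c" using eqK_sym[OF e] by (auto simp: coh_def)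
 ultimately show thesis using that coh_sym by blast
qed

lemma tr_Theta_unit: "eqS X (tr Theta) unit"
 using eqK_trans[OF tr_eqK[OF eqK_sym[OF smile_unit[OF sset_S]]] tr_Theta[of unit, unfolded pull_unit]] .

end

subsection \<open>Sphere bundles of trivial bundles\<close>

definition usphere :: "(real^'n) set \<Rightarrow> (real^'n) topology" where
 "usphere V = top_of_set (sphere 0 1 \<inter> V)"

lemma topspace_bundle:
 "topspace (PB B F) = {(b, L). b \<in> topspace B \<and> L \<in> topspace RP \<and> L \<subseteq> F b}"
 by (auto simp: projective_bundle_def)

lemma cont_bundle_iff: "continuous_map X (PB B F) g \<longleftrightarrow>
   continuous_map X B (fst \<circ> g) \<and> continuous_map X RP (snd \<circ> g) \<and>
   (\<forall>x\<in>topspace X. snd (g x) \<subseteq> F (fst (g x)))"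
 unfolding projective_bundle_def continuous_map_in_subtopology continuous_map_pairwise
 by (auto simp: Pi_iff case_prod_beta)

lemma cont_bundle_fst: "continuous_map (PB B F) B fst"
 unfolding projective_bundle_def by (intro continuous_map_from_subtopology continuous_map_fst)

lemma cont_bundle_snd: "continuous_map (PB B F) RP snd"
 unfolding projective_bundle_def by (intro continuous_map_from_subtopology continuous_map_snd)

lemma simplex_restrictI:
 "continuous_map (top_of_set (\<Delta> p)) X f \<Longrightarrow> singular_simplex p X (restrict f (\<Delta> p))"
 by (simp add: singular_simplex_def simplex_topology)

lemma span_minus_singleton: "span {- v} = span {v :: 'a::real_vector}" proof (rule subset_antisym)
 show "span {- v} \<subseteq> span {v}" by (rule span_minimal) (auto intro: span_neg span_base)
 show "span {v} \<subseteq> span {- v}" using span_neg[OF span_base[of "- v" "{- v}"]] by (intro span_minimal) auto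
qed

text \<open>The unit sphere bundle covers the projective bundle. Labelling a unit vector by
  comparison with the chosen vector of its line makes the cocycle of the cover equal to the
  tautological cocycle, not merely cohomologous to it.\<close>

lemma sphere_double_cover:
 fixes V :: "(real^'n) set"
 assumes V: "subspace V"
 shows "double_cover (prod_topology U (usphere V)) (PB U (\<lambda>_. V))
   (\<lambda>(u, v). (u, span {v})) (\<lambda>(u, v). (u, - v)) (\<lambda>(u, v). sgn2 v (sect (span {v}))) (pull snd eta)"
  (is "double_cover ?E ?X ?pr ?\<tau> ?\<theta> ?w") proof
 have cs: "continuous_map ?E euclidean snd"
  using continuous_map_into_fulltopology continuous_map_snd unfolding usphere_def by metis
 have tE: "topspace ?E = topspace U \<times> (sphere 0 1 \<inter> V)" by (simp add: usphere_def)
 have nz: "snd x \<noteq> 0" if "x \<in> topspace ?E" for x using that unfolding tE by auto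
 show cont_pr: "continuous_map ?E ?X ?pr" proof -
  have "continuous_map ?E RP (\<lambda>x. span {snd x})"
   by (rule cont_span_comp[OF cs nz])
  thus ?thesis unfolding cont_bundle_iff
   using tE V by (auto simp: comp_def case_prod_beta continuous_map_fst span_minimal)
 qed
 show "continuous_map ?E ?E ?\<tau>" proof -
  have "continuous_map ?E euclidean (\<lambda>x. - snd x)" using cs by (rule continuous_map_minus)
  hence "continuous_map ?E (usphere V) (\<lambda>x. - snd x)"
   unfolding usphere_def continuous_map_in_subtopology using V by (auto simp: subspace_neg usphere_def)
  thus ?thesis unfolding case_prod_beta by (intro continuous_map_pairedI continuous_map_fst)
 qed
 show "?pr (?\<tau> x) = ?pr x" if "x \<in> topspace ?E" for x proof -
  show ?thesis by (simp add: case_prod_beta span_minus_singleton)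
 qed
 show "?\<tau> (?\<tau> x) = x" for x by (simp add: case_prod_beta)
 show "?\<theta> (?\<tau> x) = ?\<theta> x + 1" if "x \<in> topspace ?E" for x proof -
  note n = span_minus_singleton[of "snd x"]
  have "sect (span {snd x}) \<noteq> 0" "sect (span {snd x}) \<in> span {snd x}"
   using sect[OF RP_I[OF nz[OF that]]] by auto
  then obtain a where "sect (span {snd x}) = a *\<^sub>R snd x" "a \<noteq> 0" by (auto simp: span_singleton)
  hence "snd x \<bullet> sect (span {snd x}) \<noteq> 0" using nz[OF that] by simp
  thus ?thesis using n by (auto simp: case_prod_beta sgn2_def)
 qed
 show "concentrated 1 ?w" by (simp add: concentrated_def pull_def eta_def)
 have sndl: "is_lift p (\<lambda>x. span {snd (g x)}) (\<lambda>x. snd (g x))" if g: "singular_simplex p ?E g" for p g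
 proof -
  have "continuous_map (top_of_set (\<Delta> p)) euclidean (\<lambda>x. snd (g x))"
   by (rule cm_comp[OF simplex_cont[OF g] cs])
  thus ?thesis using nz[OF simplexD[OF g]] by (auto simp: is_lift_def)
 qed
 have sm: "smap p snd (smap p ?pr g) = smap p (\<lambda>v. span {snd v}) g" for p g
  by (auto simp: simplex_map_def fun_eq_iff case_prod_beta)
 show "?w 1 (smap 1 ?pr g) = ?\<theta> (g (vtx 1)) + ?\<theta> (g (vtx 0))" if g: "singular_simplex 1 ?E g" for g
 proof -
  have "is_lift 1 (smap 1 (\<lambda>v. span {snd v}) g) (\<lambda>x. snd (g x))"
   unfolding is_lift_map by (rule sndl[OF g])
  from eta_eq[OF this] show ?thesis
   unfolding pull_def sm by (simp add: simplex_map_def case_prod_beta add.commute)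
 qed
 show "\<exists>g. singular_simplex p ?E g \<and> smap p ?pr g = f" if f: "singular_simplex p ?X f" for p f
 proof -
  have f2: "singular_simplex p RP (smap p snd f)"
   by (rule singular_simplex_simplex_map[OF f cont_bundle_snd])
  obtain l where l: "is_lift p (smap p snd f) l" by (rule lift_exists[OF f2])
  have l': "continuous_on (\<Delta> p) l" "l x \<noteq> 0" "snd (f x) = span {l x}" if "x \<in> \<Delta> p" for x
   using l that unfolding is_lift_map by (auto simp: is_lift_def)
  define m where "m = (\<lambda>x. l x /\<^sub>R norm (l x))"
  have cl: "continuous_on (\<Delta> p) l" using l by (simp add: is_lift_def)
  have "continuous_on (\<Delta> p) m"
   unfolding m_def by (intro continuous_intros cl) (use l' in auto)
  moreover have mV: "m x \<in> sphere 0 1 \<inter> V" "span {m x} = snd (f x)" if x: "x \<in> \<Delta> p" for x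
  proof -
   have fx: "f x \<in> topspace ?X" using simplexD[OF f x] .
   have "l x \<in> snd (f x)" unfolding l'(3)[OF x] by (simp add: span_base)
   hence m: "m x \<in> snd (f x)" "m x \<noteq> 0" "norm (m x) = 1"
    using l'(2)[OF x] unfolding l'(3)[OF x] m_def by (auto intro: span_scale)
   show "m x \<in> sphere 0 1 \<inter> V" "span {m x} = snd (f x)"
    using m fx RP_eq_span[of "snd (f x)" "m x"] by (auto simp: topspace_bundle)
  qed
  ultimately have "continuous_map (top_of_set (\<Delta> p)) (usphere V) m"
   unfolding usphere_def continuous_map_in_subtopology by auto
  moreover have "continuous_map (top_of_set (\<Delta> p)) U (\<lambda>x. fst (f x))"
   by (rule cm_comp[OF simplex_cont[OF f] cont_bundle_fst])
  ultimately have "continuous_map (top_of_set (\<Delta> p)) ?E (\<lambda>x. (fst (f x), m x))"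
   by (intro continuous_map_pairedI)
  hence g: "singular_simplex p ?E (restrict (\<lambda>x. (fst (f x), m x)) (\<Delta> p))"
   by (rule simplex_restrictI)
  have "smap p ?pr (restrict (\<lambda>x. (fst (f x), m x)) (\<Delta> p)) = f"
   by (rule simplex_ext[OF singular_simplex_simplex_map[OF g cont_pr] f]) (simp add: simplex_map_def mV)
  thus ?thesis using g by blast
 qed
 show "g' = g \<or> g' = smap p ?\<tau> g"
  if g: "singular_simplex p ?E g" and g': "singular_simplex p ?E g'" and e: "smap p ?pr g = smap p ?pr g'" for p g g'
 proof -
  have e': "fst (g x) = fst (g' x)" "span {snd (g x)} = span {snd (g' x)}" if "x \<in> \<Delta> p" for x
   using fun_cong[OF e, of x] that by (auto simp: simplex_map_def case_prod_beta)
  have l': "is_lift p (\<lambda>x. span {snd (g x)}) (\<lambda>x. snd (g' x))"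
   using sndl[OF g'] by (simp add: is_lift_def e'(2))
  have s: "sgn2 (snd (g x)) (snd (g' x)) = sgn2 (snd (g (vtx 0))) (snd (g' (vtx 0)))" if "x \<in> \<Delta> p" for x
   by (rule lift_unique[OF sndl[OF g] l' that]) simp
  \<comment> \<open>Unit vectors in the same line agree up to sign, and by \<open>s\<close> this
    sign is the same all over the simplex.\<close>
  have pm: "snd (g' x) = (if sgn2 (snd (g x)) (snd (g' x)) = 0 then snd (g x) else - snd (g x))" if x: "x \<in> \<Delta> p" for x
  proof -
   have n: "norm (snd (g x)) = 1" "norm (snd (g' x)) = 1"
    using simplexD[OF g x] simplexD[OF g' x] unfolding tE by auto
   have "snd (g' x) \<in> span {snd (g x)}" unfolding e'(2)[OF x] by (simp add: span_base)
   then obtain a where a: "snd (g' x) = a *\<^sub>R snd (g x)" by (auto simp: span_singleton)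
   hence "a = 1 \<or> a = -1" using n by auto
   moreover have "snd (g x) \<bullet> snd (g x) = 1" using n by (simp add: dot_square_norm)
   ultimately show ?thesis using a by (auto simp: sgn2_def)
  qed
  let ?s = "sgn2 (snd (g (vtx 0))) (snd (g' (vtx 0)))"
  have pm': "snd (g' x) = (if ?s = 0 then snd (g x) else - snd (g x))" if x: "x \<in> \<Delta> p" for x
   using pm[OF x] unfolding s[OF x] .
  show ?thesis proof (cases "?s = 0")
   case True
   have "g' = g" by (rule simplex_ext[OF g' g]) (simp add: prod_eq_iff e'(1) pm' True)
   thus ?thesis ..
  next
   case False
   have ct: "continuous_map ?E ?E ?\<tau>" by fact
   have "g' = smap p ?\<tau> g"
    by (rule simplex_ext[OF g' singular_simplex_simplex_map[OF g ct]])
     (simp only: prod_eq_iff simplex_map_def restrict_apply comp_apply case_prod_beta fst_conv snd_conv e'(1) pm' False if_True if_False simp_thms)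
   thus ?thesis ..
  qed
 qed
qed

subsection \<open>Pullbacks and homogeneous parts\<close>

lemma pull_cong_Sing:
 assumes "\<And>x. x \<in> topspace X \<Longrightarrow> g x = h x"
 shows "eqS X (pull g c) (pull h c)" unfolding eqK_def pull_def Sing_def proof (intro allI impI)
 fix p f assume "singular_simplex p X f"
 from simplex_map_eq[OF this assms] show "c p (smap p g f) = c p (smap p h f)" by (rule arg_cong)
qed

lemma pull_ident:
 assumes "\<And>x. x \<in> topspace X \<Longrightarrow> g x = x"
 shows "eqS X (pull g c) c" unfolding eqK_def pull_def Sing_def proof (intro allI impI)
 fix p f assume "singular_simplex p X f"
 from simplex_map_id_gen[OF this assms] show "c p (smap p g f) = c p f" by (rule arg_cong)
qed

definition homog :: "nat \<Rightarrow> 'a cochain \<Rightarrow> 'a cochain" where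
 "homog n c p f = (if p = n then c p f else 0)"

lemma conc_homog [simp]: "concentrated n (homog n c)" by (simp add: concentrated_def homog_def)

lemma delta_homog: "delta (homog n c) = homog (Suc n) (delta c)" proof (intro ext)
 fix p f show "delta (homog n c) p f = homog (Suc n) (delta c) p f"
  by (cases p) (auto simp: delta_def homog_def)
qed

lemma homog_0 [simp]: "homog n 0 = 0" by (intro ext) (simp add: homog_def)

lemma eqK_homog: "eqK K a b \<Longrightarrow> eqK K (homog n a) (homog n b)" by (simp add: eqK_def homog_def)

lemma Z_homog: "Z K c \<Longrightarrow> Z K (homog n c)"
 unfolding Z_def delta_homog using eqK_homog[of K "delta c" 0] by fastforce

lemma homog_concentrated: "concentrated n c \<Longrightarrow> homog n c = c"
 by (intro ext) (simp add: concentrated_def homog_def)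

lemma bit_add_self2 [simp]: "(b::bit) + (b + c) = c" by (cases b) (auto simp: add.assoc[symmetric])

lemmas bit_ac = add.assoc add.commute add.left_commute bit_add_self bit_add_self2

lemma bit_swap: "(x::bit) + y = z \<Longrightarrow> x = z + y" by (cases y) auto

lemma eqKD: "eqK K a b \<Longrightarrow> K p f \<Longrightarrow> a p f = b p f" by (simp add: eqK_def)

subsection \<open>Powers of a class and free modules over the base\<close>

primrec cpow :: "'a cochain \<Rightarrow> nat \<Rightarrow> 'a cochain" where "cpow h 0 = unit"
| "cpow h (Suc i) = cpow h i \<smile> h"

lemma Z_cpow: "sset K \<Longrightarrow> Z K h \<Longrightarrow> Z K (cpow h i)"
 by (induction i) (auto intro: Z_smile)

lemma pull_cpow: "pull g (cpow h i) = cpow (pull g h) i" by (induction i) (simp_all add: pull_smile)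

lemma coh_cpow: "sset K \<Longrightarrow> Z K h \<Longrightarrow> coh K h h' \<Longrightarrow> coh K (cpow h i) (cpow h' i)"
 by (induction i) (auto intro: coh_smile Z_cpow)

lemma cpow_add: assumes K: "sset K" shows "eqK K (cpow h (i + j)) (cpow h i \<smile> cpow h j)"
proof (induction j)
 case 0
 show ?case using eqK_sym[OF smile_unit[OF K]] by simp
next
 case (Suc j)
 show ?case using eqK_smile[OF K Suc eqK_refl[of K h]] by (simp add: smile_assoc)
qed

lemma conc_smile:
 assumes "concentrated m a" "concentrated n b" shows "concentrated (m + n) (a \<smile> b)"
 unfolding concentrated_def smile_def proof (intro allI impI sum.neutral ballI)
 fix p f q assume "p \<noteq> m + n" "q \<in> {..p}"
 hence "q \<noteq> m \<or> p - q \<noteq> n" by auto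
 thus "a q (front_face q f) * b (p - q) (back_face q (p - q) f) = 0" proof
  assume "q \<noteq> m"
  hence "a q (front_face q f) = 0" using assms(1) unfolding concentrated_def by blast
  thus ?thesis by simp
 next
  assume "p - q \<noteq> n"
  hence "b (p - q) (back_face q (p - q) f) = 0" using assms(2) unfolding concentrated_def by blast
  thus ?thesis by simp
 qed
qed

lemma conc_unit: "concentrated 0 unit" by (simp add: concentrated_def unit_def)

lemma conc_cpow: "concentrated 1 h \<Longrightarrow> concentrated i (cpow h i)"
 using conc_smile[of _ "cpow h _" 1 h] by (induction i) (auto simp: conc_unit)

lemma conc_pull: "concentrated n c \<Longrightarrow> concentrated n (pull g c)"
 by (simp add: concentrated_def pull_def)

lemma coh_homog: "coh K a b \<Longrightarrow> coh K (homog n a) (homog n b)" proof -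
 assume "coh K a b"
 then obtain e where e: "eqK K a (b + delta e)" by (auto simp: coh_def)
 have "\<exists>e'. homog n (delta e) = delta e'" proof (cases n)
  case 0
  hence "homog n (delta e) = delta 0" by (intro ext) (simp add: homog_def delta_def)
  thus ?thesis by blast
 next
  case (Suc m)
  thus ?thesis using delta_homog[of m e] by (intro exI[of _ "homog m e"]) simp
 qed
 then obtain e' where "homog n (delta e) = delta e'" by blast
 moreover have "homog n (b + delta e) = homog n b + homog n (delta e)" by (intro ext) (simp add: homog_def)
 ultimately show ?thesis unfolding coh_def using eqK_homog[OF e, of n] by (intro exI[of _ e']) simp
qed

definition lh :: "('p \<Rightarrow> 'b) \<Rightarrow> 'p cochain \<Rightarrow> nat \<Rightarrow> (nat \<Rightarrow> 'b cochain) \<Rightarrow> 'p cochain" where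
 "lh q h k a = (\<Sum>i<k. pull q (a i) \<smile> cpow h i)"

text \<open>The conclusion of the Leray-Hirsch theorem: cohomology of \<open>K\<close> is free over
  that of \<open>M\<close>, with the powers of \<open>h\<close> below \<open>k\<close> as
  basis.\<close>

definition LH :: "'b sset \<Rightarrow> 'p sset \<Rightarrow> ('p \<Rightarrow> 'b) \<Rightarrow> 'p cochain \<Rightarrow> nat \<Rightarrow> bool" where
 "LH M K q h k \<longleftrightarrow>
   (\<forall>a. (\<forall>i<k. Z M (a i)) \<longrightarrow> coh K (lh q h k a) 0 \<longrightarrow> (\<forall>i<k. coh M (a i) 0)) \<and>
   (\<forall>c. Z K c \<longrightarrow> (\<exists>a. (\<forall>i<k. Z M (a i)) \<and> coh K c (lh q h k a)))"

text \<open>\<open>LH\<close> restated as acyclicity of a mapping cone: in this form it passes to unions by gluing primitives.\<close>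

definition LHcone :: "'b sset \<Rightarrow> 'p sset \<Rightarrow> ('p \<Rightarrow> 'b) \<Rightarrow> 'p cochain \<Rightarrow> nat \<Rightarrow> bool" where
 "LHcone M K q h k \<longleftrightarrow>
   (\<forall>a c. (\<forall>i<k. Z M (a i)) \<longrightarrow> eqK K (delta c) (lh q h k a) \<longrightarrow>
    (\<exists>b e. (\<forall>i<k. eqK M (a i) (delta (b i))) \<and> eqK K c (lh q h k b + delta e)))"

lemma lh_add: "lh q h k (\<lambda>i. a i + b i) = lh q h k a + lh q h k b"
 by (simp only: lh_def pull_add smile_add_left sum.distrib)

lemma eqK_lh:
 assumes "sset K" "maps q K M" "\<And>i. i < k \<Longrightarrow> eqK M (a i) (b i)"
 shows "eqK K (lh q h k a) (lh q h k b)"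
 unfolding lh_def using assms by (intro eqK_sum eqK_smile eqK_pull) auto

lemma Z_lh:
 assumes "sset K" "maps q K M" "Z K h" "\<And>i. i < k \<Longrightarrow> Z M (a i)"
 shows "Z K (lh q h k a)" unfolding lh_def using assms by (intro Z_sum Z_smile Z_cpow Z_pull) auto

lemma coh_lh:
 assumes "sset K" "maps q K M" "Z K h" "\<And>i. i < k \<Longrightarrow> coh M (a i) (b i)"
 shows "coh K (lh q h k a) (lh q h k b)"
 unfolding lh_def using assms by (intro coh_sum coh_smile_left Z_cpow coh_pull) auto

lemma delta_lh:
 assumes K: "sset K" and h: "Z K h"
 shows "eqK K (delta (lh q h k b)) (lh q h k (\<lambda>i. delta (b i)))" unfolding lh_def delta_sum
proof (rule eqK_sum)
 fix i
 have "eqK K (pull q (b i) \<smile> delta (cpow h i)) 0"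
  using eqK_smile[OF K eqK_refl Z_cpow[OF K h, unfolded Z_def]] by fastforce
 from eqK_add[OF eqK_refl this] show "eqK K (delta (pull q (b i) \<smile> cpow h i)) (pull q (delta (b i)) \<smile> cpow h i)"
  by (simp add: leibniz pull_delta)
qed

lemma LH_iff_cone:
 assumes M: "sset M" and K: "sset K" and q: "maps q K M" and h: "Z K h"
 shows "LH M K q h k \<longleftrightarrow> LHcone M K q h k" proof
 assume L: "LH M K q h k"
 show "LHcone M K q h k" unfolding LHcone_def proof (intro allI impI)
  fix a c assume a: "\<forall>i<k. Z M (a i)" and c: "eqK K (delta c) (lh q h k a)"
  have "coh K (lh q h k a) 0" using eqK_sym[OF c] unfolding coh_def by (intro exI[of _ c]) simp
  hence "\<forall>i<k. coh M (a i) 0" using L a unfolding LH_def by blast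
  hence "\<forall>i. \<exists>b. i < k \<longrightarrow> eqK M (a i) (delta b)" by (auto simp: coh_def)
  then obtain b where b: "\<And>i. i < k \<Longrightarrow> eqK M (a i) (delta (b i))" by metis
  have "eqK K (delta (lh q h k b)) (lh q h k a)"
   by (rule eqK_trans[OF delta_lh[OF K h] eqK_lh[OF K q]]) (use b eqK_sym in auto)
  hence "eqK K (delta (c + lh q h k b)) (lh q h k a + lh q h k a)"
   unfolding delta_add by (rule eqK_add[OF c])
  hence "Z K (c + lh q h k b)" by (simp add: Z_def)
  then obtain b' where b': "\<forall>i<k. Z M (b' i)" "coh K (c + lh q h k b) (lh q h k b')"
   using L unfolding LH_def by blast
  then obtain e where e: "eqK K (c + lh q h k b) (lh q h k b' + delta e)" by (auto simp: coh_def)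
  have "eqK K c (lh q h k b' + delta e + lh q h k b)" by (rule eqK_swap[OF e])
  hence "eqK K c (lh q h k (\<lambda>i. b' i + b i) + delta e)" by (simp add: lh_add ac_simps)
  moreover have "eqK M (a i) (delta (b' i + b i))" if "i < k" for i
   using eqK_add[OF b'(1)[rule_format, OF that, unfolded Z_def] eqK_sym[OF b[OF that]]] eqK_sym
   by (simp add: delta_add)
  ultimately show "\<exists>b e. (\<forall>i<k. eqK M (a i) (delta (b i))) \<and> eqK K c (lh q h k b + delta e)"
   by (intro exI[of _ "\<lambda>i. b' i + b i"] exI[of _ e]) simp
 qed
next
 assume C: "LHcone M K q h k"
 show "LH M K q h k" unfolding LH_def proof (intro conjI allI impI)
  fix a i assume a: "\<forall>i<k. Z M (a i)" and "coh K (lh q h k a) 0" and i: "i < k"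
  then obtain c where "eqK K (delta c) (lh q h k a)" unfolding coh_def using eqK_sym by fastforce
  then obtain b where "\<forall>i<k. eqK M (a i) (delta (b i))" using C a unfolding LHcone_def by blast
  thus "coh M (a i) 0" unfolding coh_def using i by (intro exI[of _ "b i"]) simp
 next
  fix c assume c: "Z K c"
  have "eqK K (delta c) (lh q h k (\<lambda>_. 0))" using c by (simp add: Z_def lh_def)
  then obtain b e where b: "\<forall>i<k. eqK M 0 (delta (b i))" "eqK K c (lh q h k b + delta e)"
   using C[unfolded LHcone_def, rule_format, of "\<lambda>_. 0" c] by auto
  thus "\<exists>a. (\<forall>i<k. Z M (a i)) \<and> coh K c (lh q h k a)"
   unfolding coh_def Z_def by (intro exI[of _ b]) (auto simp: eqK_def)
 qed
qed

text \<open>The Mayer-Vietoris argument, by hand: the primitives on the two parts differ on the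
  intersection by a cocycle of the cone, which the third hypothesis bounds. Cochains being total
  functions, this correction is at once defined on all of the first part.\<close>

lemma LHcone_union_small:
 assumes s: "sset M1" "sset M2" "sset K1" "sset K2"
  and q: "maps q K1 M1" "maps q K2 M2" "maps q (\<lambda>p f. K1 p f \<and> K2 p f) (\<lambda>p f. M1 p f \<and> M2 p f)"
  and s12: "sset (\<lambda>p f. K1 p f \<and> K2 p f)"
  and h: "Z K1 h" "Z K2 h"
  and C: "LHcone M1 K1 q h k" "LHcone M2 K2 q h k" "LHcone (\<lambda>p f. M1 p f \<and> M2 p f) (\<lambda>p f. K1 p f \<and> K2 p f) q h k"
 shows "LHcone (\<lambda>p f. M1 p f \<or> M2 p f) (\<lambda>p f. K1 p f \<or> K2 p f) q h k"
 unfolding LHcone_def proof (intro allI impI)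
 let ?M = "\<lambda>p f. M1 p f \<and> M2 p f" and ?K = "\<lambda>p f. K1 p f \<and> K2 p f"
 fix a c assume a: "\<forall>i<k. Z (\<lambda>p f. M1 p f \<or> M2 p f) (a i)"
  and c: "eqK (\<lambda>p f. K1 p f \<or> K2 p f) (delta c) (lh q h k a)"
 have "\<forall>i<k. Z M1 (a i)" "eqK K1 (delta c) (lh q h k a)" using a c by (auto simp: Z_def eqK_def)
 then obtain b1 e1 where 1: "\<forall>i<k. eqK M1 (a i) (delta (b1 i))" "eqK K1 c (lh q h k b1 + delta e1)"
  using C(1) unfolding LHcone_def by blast
 have "\<forall>i<k. Z M2 (a i)" "eqK K2 (delta c) (lh q h k a)" using a c by (auto simp: Z_def eqK_def)
 then obtain b2 e2 where 2: "\<forall>i<k. eqK M2 (a i) (delta (b2 i))" "eqK K2 c (lh q h k b2 + delta e2)"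
  using C(2) unfolding LHcone_def by blast
 have "eqK ?M (delta (b1 i + b2 i)) 0" if "i < k" for i proof (rule eqKI)
  fix p f assume f: "M1 p f \<and> M2 p f"
  have "a i p f = delta (b1 i) p f" "a i p f = delta (b2 i) p f"
   using eqKD[OF 1(1)[rule_format, OF that]] eqKD[OF 2(1)[rule_format, OF that]] f by blast+
  thus "delta (b1 i + b2 i) p f = 0 p f" by (simp add: delta_add)
 qed
 moreover have "eqK ?K (delta (e1 + e2)) (lh q h k (\<lambda>i. b1 i + b2 i))" proof (rule eqKI)
  fix p f assume "K1 p f \<and> K2 p f"
  hence "lh q h k b1 p f + delta e1 p f = lh q h k b2 p f + delta e2 p f"
   using eqKD[OF 1(2), of p f] eqKD[OF 2(2), of p f] by (simp only: plus_fun_apply)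
  thus "delta (e1 + e2) p f = lh q h k (\<lambda>i. b1 i + b2 i) p f"
   using bit_swap[of "lh q h k b1 p f" "delta e1 p f"] by (simp add: delta_add lh_add bit_ac)
 qed
 ultimately obtain g e3 where 3: "\<forall>i<k. eqK ?M (b1 i + b2 i) (delta (g i))" "eqK ?K (e1 + e2) (lh q h k g + delta e3)"
  using C(3)[unfolded LHcone_def Z_def, rule_format, of "\<lambda>i. b1 i + b2 i" "e1 + e2"] by blast
 define B where "B = (\<lambda>i p f. if M1 p f then (b1 i + delta (g i)) p f else b2 i p f)"
 define E where "E = (\<lambda>p f. if K1 p f then (e1 + (lh q h k g + delta e3)) p f else e2 p f)"
 have B1: "eqK M1 (B i) (b1 i + delta (g i))" for i by (simp add: eqK_def B_def)
 have B2: "eqK M2 (B i) (b2 i)" if "i < k" for i proof (rule eqKI)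
  fix p f assume "M2 p f"
  thus "B i p f = b2 i p f" using 3(1) that eqKD[of ?M "b1 i + b2 i" "delta (g i)" p f, symmetric]
   by (simp add: B_def bit_ac)
 qed
 have E1: "eqK K1 E (e1 + (lh q h k g + delta e3))" by (simp add: eqK_def E_def)
 have E2: "eqK K2 E e2" proof (rule eqKI)
  fix p f assume "K2 p f"
  thus "E p f = e2 p f" using eqKD[OF 3(2), of p f, symmetric] by (simp add: E_def bit_ac)
 qed
 have "eqK (\<lambda>p f. M1 p f \<or> M2 p f) (a i) (delta (B i))" if "i < k" for i proof -
  have "eqK M1 (delta (B i)) (delta (b1 i) + delta (delta (g i)))"
   using eqK_delta[OF s(1) B1] by (simp add: delta_add)
  hence "eqK M1 (delta (B i)) (delta (b1 i))"
   using delta_delta[OF s(1), of "g i"] by (simp add: eqK_def)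
  moreover have "eqK M2 (delta (B i)) (delta (b2 i))" by (rule eqK_delta[OF s(2) B2[OF that]])
  ultimately show ?thesis using 1(1) 2(1) that by (auto simp: eqK_def)
 qed
 moreover have "eqK (\<lambda>p f. K1 p f \<or> K2 p f) c (lh q h k B + delta E)" proof -
  have "eqK K1 c (lh q h k B + delta E)" proof (rule eqKI)
   fix p f assume f: "K1 p f"
   have "lh q h k B p f = lh q h k b1 p f + lh q h k (\<lambda>i. delta (g i)) p f"
    using eqKD[OF eqK_lh[OF s(3) q(1) B1] f] by (simp add: lh_add)
   moreover have "delta E p f = delta e1 p f + lh q h k (\<lambda>i. delta (g i)) p f"
    using eqKD[OF eqK_delta[OF s(3) E1] f] eqKD[OF delta_lh[OF s(3) h(1)] f] eqKD[OF delta_delta[OF s(3)] f]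
    by (simp add: delta_add)
   ultimately show "c p f = (lh q h k B + delta E) p f" using eqKD[OF 1(2) f] by (simp add: bit_ac)
  qed
  moreover have "eqK K2 c (lh q h k B + delta E)"
   by (rule eqK_trans[OF 2(2) eqK_add[OF eqK_sym[OF eqK_lh[OF s(4) q(2) B2]] eqK_sym[OF eqK_delta[OF s(4) E2]]]])
  ultimately show ?thesis by (auto simp: eqK_def)
 qed
 ultimately show "\<exists>b e. (\<forall>i<k. eqK (\<lambda>p f. M1 p f \<or> M2 p f) (a i) (delta (b i))) \<and>
   eqK (\<lambda>p f. K1 p f \<or> K2 p f) c (lh q h k b + delta e)" by blast
qed

text \<open>Primitives on small simplices solve the problem up to cocycles that vanish on small
  simplices. Such cocycles are coboundaries by \<open>small_acyclic\<close>, first on the base and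
  then on the total space.\<close>

lemma LHcone_small:
 assumes q: "maps q (Sing P) (Sing B)" and qs: "maps q (small P \<D>) (small B \<C>)" and h: "ZS P h"
  and CB: "\<And>U. U \<in> \<C> \<Longrightarrow> openin B U" "topspace B \<subseteq> \<Union>\<C>"
  and CP: "\<And>U. U \<in> \<D> \<Longrightarrow> openin P U" "topspace P \<subseteq> \<Union>\<D>"
  and C: "LHcone (small B \<C>) (small P \<D>) q h k"
 shows "LHcone (Sing B) (Sing P) q h k" unfolding LHcone_def proof (intro allI impI)
 fix a c assume a: "\<forall>i<k. ZS B (a i)" and c: "eqS P (delta c) (lh q h k a)"
 have za: "\<forall>i<k. Z (small B \<C>) (a i)" proof (intro allI impI)
  fix i assume "i < k"
  hence "ZS B (a i)" using a by simp
  thus "Z (small B \<C>) (a i)" by (rule Z_mono) (rule small_Sing)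
 qed
 have "eqK (small P \<D>) (delta c) (lh q h k a)" using c by (rule eqK_mono) (rule small_Sing)
 with za obtain b e where b: "\<forall>i<k. eqK (small B \<C>) (a i) (delta (b i))" "eqK (small P \<D>) c (lh q h k b + delta e)"
  using C unfolding LHcone_def by blast
 have "\<exists>g. eqK (small B \<C>) g 0 \<and> eqS B (a i + delta (b i)) (delta g)" if "i < k" for i
 proof (rule small_acyclic[OF CB])
  show "ZS B (a i + delta (b i))" using a that by (intro Z_add Z_delta sset_S) simp
  show "eqK (small B \<C>) (a i + delta (b i)) 0" using b that by (simp add: eqK_diff)
 qed
 hence "\<forall>i. \<exists>g. i < k \<longrightarrow> eqK (small B \<C>) g 0 \<and> eqS B (a i + delta (b i)) (delta g)" by blast
 then obtain g where g: "\<And>i. i < k \<Longrightarrow> eqK (small B \<C>) (g i) 0" "\<And>i. i < k \<Longrightarrow> eqS B (a i + delta (b i)) (delta (g i))"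
  by metis
 have ab: "eqS B (a i) (delta (b i + g i))" if "i < k" for i
  using eqK_swap[OF g(2)[OF that]] by (simp add: delta_add add.commute)
 let ?y = "c + (lh q h k (\<lambda>i. b i + g i) + delta e)"
 have "ZS P ?y" unfolding Z_def eqK_def proof (intro allI impI)
  fix p f assume f: "Sing P p f"
  have "delta (lh q h k (\<lambda>i. b i + g i)) p f = lh q h k a p f"
   using eqKD[OF delta_lh[OF sset_S h] f] eqKD[OF eqK_lh[OF sset_S q ab] f] by simp
  thus "delta ?y p f = 0 p f"
   using eqKD[OF c f] eqKD[OF delta_delta[OF sset_S] f, of e] by (simp add: delta_add)
 qed
 moreover have "eqK (small P \<D>) ?y 0" proof (rule eqKI)
  fix p f assume f: "small P \<D> p f"
  have "eqK (small P \<D>) (lh q h k g) (lh q h k (\<lambda>_. 0))"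
   by (rule eqK_lh[OF sset_small qs]) (use g(1) in simp)
  hence "lh q h k g p f = 0" using f by (simp add: eqK_def lh_def)
  thus "?y p f = 0 p f" using eqKD[OF b(2) f] by (simp add: lh_add bit_ac)
 qed
 ultimately obtain e' where e': "eqS P ?y (delta e')" using small_acyclic[OF CP] by blast
 have "eqS P c (lh q h k (\<lambda>i. b i + g i) + delta (e + e'))"
  using eqK_swap[OF e'] by (simp add: delta_add ac_simps)
 thus "\<exists>b e. (\<forall>i<k. eqS B (a i) (delta (b i))) \<and> eqS P c (lh q h k b + delta e)"
  using ab by (intro exI[of _ "\<lambda>i. b i + g i"] exI[of _ "e + e'"]) simp
qed

subsection \<open>Products vanishing on a cover\<close>

lemma lambda_zero: "(\<lambda>p f. 0 :: bit) = 0" by (intro ext) simp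

lemma coh_eq_delta: "coh K c 0 \<Longrightarrow> (\<And>s. eqK K c (delta s) \<Longrightarrow> P) \<Longrightarrow> P"
 by (auto simp: coh_def)

lemma small_two: "small X {U, V} p f \<longleftrightarrow> Sing (subtopology X U) p f \<or> Sing (subtopology X V) p f"
 by (auto simp: small_def)

lemma Sing_sub: "Sing (subtopology X U) p f \<Longrightarrow> Sing X p f"
 by (simp add: Sing_def singular_simplex_subtopology)

text \<open>The argument of Lusternik and Schnirelmann: with one representative vanishing on
  \<open>U\<close> and the other on \<open>V\<close>, the product vanishes on every simplex that
  lies in \<open>U\<close> or in \<open>V\<close>.\<close>

lemma cover_smile:
 assumes U: "openin X U" and V: "openin X V" and c: "ZS X c" and d: "ZS X d"
  and cU: "cohS (subtopology X U) c 0" and dV: "cohS (subtopology X V) d 0"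
 shows "cohS (subtopology X (U \<union> V)) (c \<smile> d) 0" proof -
 let ?Y = "subtopology X (U \<union> V)"
 obtain s where s: "eqS (subtopology X U) c (delta s)" by (rule coh_eq_delta[OF cU])
 obtain t where t: "eqS (subtopology X V) d (delta t)" by (rule coh_eq_delta[OF dV])
 define c' where "c' = c + delta s"
 define d' where "d' = d + delta t"
 have Zc: "ZS ?Y c" by (rule Z_mono[OF c Sing_sub])
 have Zd: "ZS ?Y d" by (rule Z_mono[OF d Sing_sub])
 have Z': "ZS ?Y c'" "ZS ?Y d'" unfolding c'_def d'_def by (intro Z_add Zc Zd Z_delta sset_S)+
 have "cohS ?Y (c + delta s) (c + 0)" "cohS ?Y (d + delta t) (d + 0)"
  by (intro coh_add coh_refl coh_delta)+
 hence cc: "cohS ?Y c' c" "cohS ?Y d' d" by (simp_all add: c'_def d'_def)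
 have sub: "subtopology ?Y U = subtopology X U" "subtopology ?Y V = subtopology X V"
  by (simp_all add: subtopology_subtopology Int_absorb1)
 have 1: "eqS (subtopology X U) (c' \<smile> d') 0"
  using eqK_smile[OF sset_S eqK_diff[THEN iffD2, OF s, folded c'_def] eqK_refl] by simp
 have 2: "eqS (subtopology X V) (c' \<smile> d') 0"
  using eqK_smile[OF sset_S eqK_refl eqK_diff[THEN iffD2, OF t, folded d'_def]] by simp
 have "eqK (small ?Y {U, V}) (c' \<smile> d') 0"
  unfolding eqK_def small_two sub using eqKD[OF 1] eqKD[OF 2] by blast
 hence sm: "coh (small ?Y {U, V}) (c' \<smile> d') 0" by (rule eqK_coh)
 have op: "openin ?Y U" "openin ?Y V" using U V by (auto simp: openin_subset_topspace_eq openin_open_subtopology openin_Un)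
 have "cohS ?Y (c' \<smile> d') 0"
  by (rule small_coh[OF _ _ Z_smile[OF sset_S Z'] Z_0 sm]) (use op in auto)
 moreover have "cohS ?Y (c' \<smile> d') (c \<smile> d)" by (rule coh_smile[OF sset_S Z' cc])
 ultimately show ?thesis using coh_trans[OF coh_sym] by blast
qed

lemma cover_cpow:
 assumes "finite J" and U: "\<And>i. i \<in> J \<Longrightarrow> openin X (U i)" and h: "ZS X h"
  and hU: "\<And>i. i \<in> J \<Longrightarrow> cohS (subtopology X (U i)) h 0"
 shows "cohS (subtopology X (\<Union>i\<in>J. U i)) (cpow h (card J)) 0" using assms(1) U hU
proof (induction J rule: finite_induct)
 case empty
 have "\<not> Sing (subtopology X {}) p f" for p f by (simp add: Sing_def singular_simplex_empty)
 thus ?case by (intro eqK_coh) (simp add: eqK_def)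
next
 case (insert i J)
 have "cohS (subtopology X ((\<Union>i\<in>J. U i) \<union> U i)) (cpow h (card J) \<smile> h) 0"
 proof (rule cover_smile[OF _ _ Z_cpow[OF sset_S h] h])
  show "cohS (subtopology X (\<Union>i\<in>J. U i)) (cpow h (card J)) 0"
   by (rule insert.IH; rule insert.prems; rule insertI2; assumption)
  show "cohS (subtopology X (U i)) h 0" by (rule insert.prems) simp
  show "openin X (U i)" "openin X (\<Union>i\<in>J. U i)" using insert.prems(1) by auto
 qed
 thus "cohS (subtopology X (\<Union>i\<in>insert i J. U i)) (cpow h (card (insert i J))) 0"
  using insert.hyps by (simp add: Un_commute)
qed

subsection \<open>The projective bundle of a trivial bundle\<close>

lemma cont_proj_snd: "continuous_map (PB B F) euclidean (\<lambda>z. proj (snd z) u)"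
proof -
 have "continuous_map (PB B F) euclidean ((\<lambda>L. proj L u) \<circ> snd)"
  by (rule continuous_map_compose[OF cont_bundle_snd cont_proj_line])
 thus ?thesis by (simp only: comp_def)
qed

abbreviation taut :: "('b \<times> (real^'n) set) cochain" where "taut \<equiv> pull snd eta"

lemma Z_taut: "ZS (PB B F) taut"
 by (rule Z_pull[OF maps_Sing[OF cont_bundle_snd] Z_eta])

lemma conc_taut: "concentrated 1 taut" by (rule conc_pull[OF conc_eta])

lemma taut_central:
 "ZS (PB B F) a \<Longrightarrow> cohS (PB B F) (a \<smile> taut) (taut \<smile> a)"
 by (rule deg1_central[OF sset_S conc_taut Z_taut])

text \<open>Where no line is orthogonal to \<open>e\<close>, projection to \<open>span {e}\<close>
  identifies all lines with one fixed line.\<close>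

lemma eta_zero_on_chart:
 fixes L :: "'a \<Rightarrow> (real^'n) set"
 assumes L: "continuous_map X RP L" and e: "e \<noteq> 0" and nz: "\<And>x. x \<in> topspace X \<Longrightarrow> proj (L x) e \<noteq> 0"
 shows "cohS X (pull L eta) 0" proof -
 have "cohS X (pull L eta) (pull (\<lambda>_. span {e}) eta)"
 proof (rule eta_natural[OF L, where \<beta> = "\<lambda>_ u. proj (span {e}) u"])
  show "continuous_map X RP (\<lambda>_. span {e})" by (simp add: RP_I e)
  fix x u assume x: "x \<in> topspace X" and u: "u \<in> L x" "u \<noteq> 0"
  have LR: "L x \<in> topspace RP" using L x by (auto simp: continuous_map_def Pi_iff)
  hence "L x = span {u}" by (rule RP_eq_span[OF _ u])
  hence "e \<bullet> u \<noteq> 0" using nz[OF x] by (auto simp: proj_line)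
  thus "proj (span {e}) u \<in> span {e} \<and> proj (span {e}) u \<noteq> 0"
   using e by (simp add: proj_mem proj_line inner_commute span_scale span_base)
 qed (auto intro: linear_proj)
 from coh_trans[OF this eqK_coh[OF pull_const_eta[OF RP_I[OF e]]]] show ?thesis .
qed

text \<open>A line in \<open>span I\<close> cannot be orthogonal to every \<open>e\<close> in
  \<open>I\<close>, so there are \<open>card I\<close> charts that cover the bundle, and the class
  vanishes on each of them.\<close>

lemma taut_nilpotent:
 fixes I :: "(real^'n) set"
 assumes I: "I \<subseteq> Basis"
 shows "cohS (PB B (\<lambda>_. span I)) (cpow taut (card I)) 0" proof -
 let ?X = "PB B (\<lambda>_. span I)"
 have fin: "finite I" using I finite_Basis by (rule finite_subset)
 let ?U = "\<lambda>e. {z \<in> topspace ?X. proj (snd z) e \<noteq> 0}"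
 have "cohS (subtopology ?X (\<Union>e\<in>I. ?U e)) (cpow taut (card I)) 0"
 proof (rule cover_cpow[OF fin _ Z_taut])
  fix e assume e: "e \<in> I"
  show "openin ?X (?U e)" by (rule open_nonzero[OF cont_proj_snd])
  show "cohS (subtopology ?X (?U e)) taut 0"
   by (rule eta_zero_on_chart[OF continuous_map_from_subtopology[OF cont_bundle_snd], of e])
    (use e I in auto)
 qed
 moreover have "topspace ?X \<subseteq> (\<Union>e\<in>I. ?U e)" proof
  fix z assume z: "z \<in> topspace ?X"
  hence zR: "snd z \<in> topspace RP" and zI: "snd z \<subseteq> span I" by (auto simp: topspace_bundle)
  show "z \<in> (\<Union>e\<in>I. ?U e)" proof (rule ccontr)
   assume "z \<notin> (\<Union>e\<in>I. ?U e)"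
   hence 0: "proj (snd z) e = 0" if "e \<in> I" for e using z that by auto
   have "span I \<subseteq> {x. proj (snd z) x = 0}" proof (rule span_minimal)
    show "subspace {x. proj (snd z) x = 0}"
     using linear_subspace_kernel[OF linear_proj[OF RP_subspace[OF zR]]] .
   qed (use 0 in auto)
   hence "proj (snd z) (sect (snd z)) = 0" using zI sect(2)[OF zR] by auto
   thus False using sect(1,2)[OF zR] RP_subspace[OF zR] by (simp add: proj_ident)
  qed
 qed
 hence "subtopology ?X (\<Union>e\<in>I. ?U e) = ?X" by (intro subtopology_superset) auto
 ultimately show ?thesis by simp
qed

lemma maps_bundle_fst: "maps fst (Sing (PB B F)) (Sing B)"
 by (rule maps_Sing[OF cont_bundle_fst])

text \<open>A point has one simplex in each degree, and all its faces coincide; counting the faces,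
  the coboundary is alternately zero and the identity.\<close>

lemma point_cohomology:
 assumes X: "topspace X = {x}" and m: "ZS X m"
 shows "cohS X m 0 \<or> cohS X m unit" proof -
 define g where "g = (\<lambda>p :: nat. restrict (\<lambda>_. x) (\<Delta> p))"
 have fg: "Sing X p f \<Longrightarrow> f = g p" for p f by (rule simplex_ext[of p X f X])
   (use X in \<open>auto simp: Sing_def g_def dest: simplexD intro!: simplex_restrictI\<close>)
 have gS: "Sing X p (g p)" for p unfolding Sing_def g_def by (rule simplex_restrictI) (simp add: X)
 have face: "singular_face (Suc p) k (g (Suc p)) = g p" if "k \<le> Suc p" for p k
  by (rule fg) (use sset_face[OF sset_S gS[of "Suc p"], of k] that in simp)
 have delta_g: "delta c (Suc p) (g (Suc p)) = (if even p then 0 else c p (g p))" for c p proof -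
  have "delta c (Suc p) (g (Suc p)) = (\<Sum>k\<le>Suc p. c p (g p))" proof -
   have "(\<Sum>k\<le>Suc p. c p (singular_face (Suc p) k (g (Suc p)))) = (\<Sum>k\<le>Suc p. c p (g p))"
    by (rule sum.cong) (simp_all add: face)
   thus ?thesis by (simp add: delta_def del: sum.atMost_Suc sum_constant)
  qed
  also have "\<dots> = of_nat (Suc (Suc p)) * c p (g p)" by (simp del: sum.atMost_Suc)
  also have "\<dots> = (if even p then 0 else c p (g p))" proof -
   have "of_nat j = (if even j then 0 else 1 :: bit)" for j by (induction j) auto
   thus ?thesis by simp
  qed
  finally show ?thesis .
 qed
 define e :: "'a cochain" where "e = (\<lambda>p f. if odd p then m (Suc p) (g (Suc p)) else 0)"
 define u where "u = (if m 0 (g 0) = 0 then 0 else unit :: 'a cochain)"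
 have "eqS X m (u + delta e)" proof (rule eqKI)
  fix p f assume f: "Sing X p f"
  show "m p f = (u + delta e) p f" proof (cases p)
   case 0
   thus ?thesis using fg[OF f] by (simp add: u_def unit_def delta_def)
  next
   case (Suc q)
   have "m p (g p) = 0" if "even q"
    using eqKD[OF m[unfolded Z_def] gS, of "Suc p"] delta_g[of m p] Suc that by simp
   thus ?thesis using fg[OF f] delta_g[of e q] Suc by (auto simp: u_def unit_def e_def)
  qed
 qed
 hence "cohS X m u" by (auto simp: coh_def)
 thus ?thesis by (cases "m 0 (g 0) = 0") (auto simp: u_def)
qed

lemma unit_not_coh_0: assumes "Sing X p f" shows "\<not> cohS X unit 0" proof
 assume "cohS X unit 0"
 then obtain s where s: "eqS X unit (delta s)" by (rule coh_eq_delta)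
 have "Sing X 0 (front_face 0 f)" by (rule sset_front[OF sset_S assms]) simp
 from eqKD[OF s this] show False by (simp add: unit_def delta_def)
qed

section \<open>Linear maps of lines and retractions of projective bundles\<close>

lemma line_image:
 assumes L: "L \<in> topspace RP" and lin: "linear T" and nz: "\<And>u. u \<in> L \<Longrightarrow> u \<noteq> 0 \<Longrightarrow> T u \<noteq> 0"
  and v: "v \<in> L" "v \<noteq> 0"
 shows "T ` L = span {T v}" "T ` L \<in> topspace RP" proof -
 show e: "T ` L = span {T v}" using RP_eq_span[OF L v] linear_span_image[OF lin, of "{v}"] by simp
 show "T ` L \<in> topspace RP" unfolding e by (rule RP_I[OF nz[OF v]])
qed

lemma cont_line_image:
 fixes T :: "'b \<Rightarrow> real^'n \<Rightarrow> real^'n"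
 assumes L: "continuous_map X RP L" and T: "\<And>u. continuous_map X euclidean (\<lambda>x. T x u)"
  and lin: "\<And>x. x \<in> topspace X \<Longrightarrow> linear (T x)"
  and nz: "\<And>x u. x \<in> topspace X \<Longrightarrow> u \<in> L x \<Longrightarrow> u \<noteq> 0 \<Longrightarrow> T x u \<noteq> 0"
 shows "continuous_map X RP (\<lambda>x. T x ` L x)" proof (rule cont_locally)
 have LR: "L x \<in> topspace RP" if "x \<in> topspace X" for x
  using L that by (auto dest: continuous_map_funspace)
 have pc: "continuous_map X euclidean (\<lambda>x. proj (L x) v)" for v
  by (rule cm_comp[OF L cont_proj_line[of v]])
 fix x assume x: "x \<in> topspace X"
 define v where "v = sect (L x)"
 have v: "v \<in> L x" "v \<noteq> 0" using sect[OF LR[OF x]] by (auto simp: v_def)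
 let ?U = "{y \<in> topspace X. proj (L y) v \<noteq> 0}"
 have P: "proj (L y) v \<in> L y" if "y \<in> topspace X" for y by (rule proj_mem[OF RP_subspace[OF LR[OF that]]])
 have "continuous_map (subtopology X ?U) RP (\<lambda>y. span {T y (proj (L y) v)})"
 proof (rule cont_span_comp)
  show "continuous_map (subtopology X ?U) euclidean (\<lambda>y. T y (proj (L y) v))"
   by (rule continuous_map_from_subtopology, rule cont_linear_family[OF lin T pc])
 qed (use nz P in auto)
 hence "continuous_map (subtopology X ?U) RP (\<lambda>x. T x ` L x)"
  by (rule continuous_map_eq) (use line_image(1)[OF LR lin nz P] in auto)
 moreover have "proj (L x) v = v" using v LR[OF x] by (simp add: proj_ident)
 ultimately show "\<exists>U. openin X U \<and> x \<in> U \<and> continuous_map (subtopology X U) RP (\<lambda>x. T x ` L x)"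
  using open_nonzero[OF pc] x v by (intro exI[of _ ?U]) auto
qed

text \<open>Relations are tested after pulling back along \<open>\<Phi>\<close>, and expansions are
  brought back along \<open>\<Psi>\<close>; for both it suffices that \<open>\<Psi>\<close> is a
  section of \<open>\<Phi>\<close>.\<close>

lemma LH_transfer:
 assumes \<Phi>: "continuous_map P Q \<Phi>" and \<Psi>: "continuous_map Q P \<Psi>"
  and \<Phi>\<Psi>: "\<And>z. z \<in> topspace Q \<Longrightarrow> \<Phi> (\<Psi> z) = z"
  and q: "continuous_map P B q" "continuous_map Q B r" "\<And>z. z \<in> topspace P \<Longrightarrow> r (\<Phi> z) = q z"
  and h: "ZS P h" "ZS Q h'" "cohS P (pull \<Phi> h') h"
  and L: "LH (Sing B) (Sing P) q h k"
 shows "LH (Sing B) (Sing Q) r h' k" proof -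
 have mP: "maps \<Phi> (Sing P) (Sing Q)" and mQ: "maps \<Psi> (Sing Q) (Sing P)" by (intro maps_Sing \<Phi> \<Psi>)+
 have lh: "cohS P (pull \<Phi> (lh r h' k a)) (lh q h k a)" if a: "\<forall>i<k. ZS B (a i)" for a
  unfolding lh_def pull_sum pull_smile pull_cpow pull_pull proof (intro coh_sum coh_smile sset_S)
  have mr: "maps r (Sing Q) (Sing B)" by (rule maps_Sing[OF q(2)])
  have Zh: "ZS P (pull \<Phi> h')" by (rule Z_pull[OF mP h(2)])
  fix i assume i: "i \<in> {..<k}"
  show "ZS P (cpow (pull \<Phi> h') i)" by (rule Z_cpow[OF sset_S Zh])
  show "cohS P (cpow (pull \<Phi> h') i) (cpow h i)" by (rule coh_cpow[OF sset_S Zh h(3)])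
  have "ZS P (pull \<Phi> (pull r (a i)))" using a i by (intro Z_pull[OF mP] Z_pull[OF mr]) auto
  thus "ZS P (pull (r \<circ> \<Phi>) (a i))" by (simp only: pull_pull)
  show "cohS P (pull (r \<circ> \<Phi>) (a i)) (pull q (a i))"
   by (rule eqK_coh, rule pull_cong_Sing) (simp add: q)
 qed
 have bk: "cohS Q (pull \<Psi> (pull \<Phi> c)) c" for c
  unfolding pull_pull by (rule eqK_coh, rule pull_ident) (simp add: \<Phi>\<Psi>)
 show ?thesis unfolding LH_def proof (intro conjI allI impI)
  fix a i assume a: "\<forall>i<k. ZS B (a i)" and 0: "cohS Q (lh r h' k a) 0" and i: "i < k"
  have "cohS P (lh q h k a) (pull \<Phi> 0)" by (rule coh_trans[OF coh_sym[OF lh[OF a]] coh_pull[OF mP 0]])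
  thus "cohS B (a i) 0" using L a i unfolding LH_def by simp
 next
  fix c assume "ZS Q c"
  hence "ZS P (pull \<Phi> c)" by (rule Z_pull[OF mP])
  then obtain a where a: "\<forall>i<k. ZS B (a i)" "cohS P (pull \<Phi> c) (lh q h k a)"
   using L unfolding LH_def by blast
  have "cohS P (pull \<Phi> c) (pull \<Phi> (lh r h' k a))" by (rule coh_trans[OF a(2) coh_sym[OF lh[OF a(1)]]])
  from coh_trans[OF coh_trans[OF coh_sym[OF bk] coh_pull[OF mQ this]] bk]
  have "cohS Q c (lh r h' k a)" .
  with a(1) show "\<exists>a. (\<forall>i<k. ZS B (a i)) \<and> cohS Q c (lh r h' k a)" by blast
 qed
qed

text \<open>Two local primitives glue as soon as their difference on the overlap extends, up to a
  coboundary, to a cocycle on \<open>A\<close>: that cocycle is added to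
  \<open>\<alpha>\<close>.\<close>

lemma mayer_vietoris_zero:
 assumes AB: "openin X A" "openin X B" "topspace X \<subseteq> A \<union> B" and c: "ZS X c"
  and \<alpha>: "eqS (subtopology X A) c (delta \<alpha>)" and \<beta>: "eqS (subtopology X B) c (delta \<beta>)"
  and a: "ZS (subtopology X A) a" and g: "cohS (subtopology X (A \<inter> B)) (\<alpha> + \<beta>) a"
 shows "cohS X c 0" proof -
 obtain g where g: "eqS (subtopology X (A \<inter> B)) (\<alpha> + \<beta>) (a + delta g)" using g by (auto simp: coh_def)
 let ?A = "Sing (subtopology X A)" and ?B = "Sing (subtopology X B)"
 define \<gamma> where "\<gamma> = (\<lambda>p f. if ?A p f then (\<alpha> + a) p f else (\<beta> + delta g) p f)"
 have "eqK ?A (delta \<gamma>) (delta (\<alpha> + a))" by (rule eqK_delta[OF sset_S]) (simp add: \<gamma>_def eqK_def)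
 hence 1: "eqK ?A c (delta \<gamma>)"
  using eqK_add[OF \<alpha> eqK_sym[OF a[unfolded Z_def]]] eqK_sym eqK_trans by (simp add: delta_add) blast
 have "eqK ?B (delta \<gamma>) (delta (\<beta> + delta g))" proof (rule eqK_delta[OF sset_S], unfold eqK_def, intro allI impI)
  fix p f assume f: "?B p f"
  show "\<gamma> p f = (\<beta> + delta g) p f" proof (cases "?A p f")
   case True
   hence "Sing (subtopology X (A \<inter> B)) p f" using f by (auto simp: Sing_def singular_simplex_subtopology)
   from eqKD[OF g this] have "\<alpha> p f + a p f = \<beta> p f + delta g p f"
    by (cases "\<alpha> p f"; cases "\<beta> p f"; cases "a p f"; cases "delta g p f") auto
   thus ?thesis by (simp add: \<gamma>_def)
  qed (simp add: \<gamma>_def)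
 qed
 hence 2: "eqK ?B c (delta \<gamma>)"
  using eqK_add[OF \<beta> eqK_sym[OF delta_delta[OF sset_S, unfolded Z_def]], of g] eqK_sym eqK_trans
  by (simp add: delta_add) blast
 have "eqK (small X {A, B}) c (delta \<gamma>)" using 1 2 by (auto simp: eqK_def small_two)
 hence "cohS X c (delta \<gamma>)"
  by (intro small_coh[OF _ _ c Z_delta[OF sset_S] eqK_coh]) (use AB in auto)
 thus ?thesis using coh_delta coh_trans by blast
qed

lemma line_kernel:
 assumes "L \<in> topspace RP" "linear Q" "u \<in> L" "Q u \<noteq> 0" "v \<in> L" "v \<noteq> 0"
 shows "Q v \<noteq> 0"
 using RP_eq_span[OF assms(1,5,6)] assms(3,4) by (auto simp: span_singleton linear_scale[OF assms(2)])

text \<open>The linear homotopy \<open>T t\<close> from the identity to the projector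
  \<open>Q\<close> satisfies \<open>Q (T t v) = Q v\<close>. So it never collapses a line on which
  \<open>Q\<close> is nonzero, and it stays inside \<open>W\<close>.\<close>

lemma line_retraction:
 fixes V :: "(real^'n) set" and U :: "'u topology" and Q :: "real^'n \<Rightarrow> real^'n"
 assumes V: "subspace V" and Q: "linear Q" "\<And>v. Q (Q v) = Q v" "Q ` V \<subseteq> V"
 defines "X \<equiv> PB U (\<lambda>_. V)" and "r \<equiv> \<lambda>z. (fst z, Q ` snd z)"
 defines "W \<equiv> {z \<in> topspace X. \<exists>u\<in>snd z. Q u \<noteq> 0}"
 shows "openin X W" "continuous_map (subtopology X W) (subtopology X W) r"
  "ZS (subtopology X W) c \<Longrightarrow> cohS (subtopology X W) c (pull r c)" proof -
 let ?Y = "subtopology X W" and ?I = "top_of_set {0..1::real}"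
 define T where "T = (\<lambda>(t :: real) v. (1 - t) *\<^sub>R v + t *\<^sub>R Q v)"
 have XD: "snd z \<in> topspace RP" "snd z \<subseteq> V" "fst z \<in> topspace U" if "z \<in> topspace X" for z
  using that by (auto simp: X_def topspace_bundle)
 show "openin X W" proof (subst openin_subopen, intro ballI)
  fix z assume z: "z \<in> W"
  then obtain u where u: "u \<in> snd z" "Q u \<noteq> 0" by (auto simp: W_def)
  have "continuous_map X euclidean (\<lambda>z. Q (proj (snd z) u))" unfolding X_def
   by (rule continuous_map_compose[OF cont_proj_snd, of euclidean Q, unfolded comp_def])
    (simp add: linear_continuous_on linear_conv_bounded_linear[symmetric] Q)
  from open_nonzero[OF this] have o: "openin X {z \<in> topspace X. Q (proj (snd z) u) \<noteq> 0}" .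
  have "proj (snd z) u = u" using z u by (intro proj_ident RP_subspace XD) (auto simp: W_def)
  moreover have "proj (snd y) u \<in> snd y" if "y \<in> topspace X" for y using that by (intro proj_mem RP_subspace XD)
  ultimately show "\<exists>T. openin X T \<and> z \<in> T \<and> T \<subseteq> W" using z u
   by (intro exI[of _ "{z \<in> topspace X. Q (proj (snd z) u) \<noteq> 0}"] conjI o) (unfold W_def, simp, blast)
 qed
 have lT: "linear (T t)" for t unfolding T_def
  by (intro linear_compose_add linear_compose_scale_right linear_ident) (simp add: Q)
 have QT: "Q (T t v) = Q v" for t v
  unfolding T_def linear_add[OF Q(1)] linear_scale[OF Q(1)] Q(2) by (simp add: scaleR_add_left[symmetric])
 have nz: "Q v \<noteq> 0" if "z \<in> W" "v \<in> snd z" "v \<noteq> 0" for z v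
  using that line_kernel[OF XD(1) Q(1), of z _ v] by (auto simp: W_def)
 have Tnz: "T t v \<noteq> 0" if "z \<in> W" "v \<in> snd z" "v \<noteq> 0" for z t v
  using nz[OF that] QT[of t v] linear_0[OF Q(1)] by auto
 let ?H = "\<lambda>z. (fst (snd z), T (fst z) ` snd (snd z))"
 have c2: "continuous_map (prod_topology ?I ?Y) RP (\<lambda>z. snd (snd z))"
  using continuous_map_compose[OF continuous_map_snd continuous_map_from_subtopology[OF cont_bundle_snd]]
  unfolding X_def by (simp add: comp_def)
 have "continuous_map (prod_topology ?I ?Y) RP (\<lambda>z. T (fst z) ` snd (snd z))"
 proof (rule cont_line_image[OF c2])
  fix u
  have "continuous_map ?I euclidean (\<lambda>t. T t u)" unfolding T_def by (auto intro!: continuous_intros)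
  from continuous_map_compose[OF continuous_map_fst this]
  show "continuous_map (prod_topology ?I ?Y) euclidean (\<lambda>z. T (fst z) u)" by (simp add: comp_def)
 qed (use lT Tnz in auto)
 moreover have "continuous_map (prod_topology ?I ?Y) U (\<lambda>z. fst (snd z))"
  using continuous_map_compose[OF continuous_map_snd continuous_map_from_subtopology[OF cont_bundle_fst]]
  unfolding X_def by (simp add: comp_def)
 moreover have TW: "(fst z, T t ` snd z) \<in> W" if z: "z \<in> W" for z t proof -
  have zX: "z \<in> topspace X" using z by (simp add: W_def)
  obtain v where v: "v \<in> snd z" "v \<noteq> 0" using sect[OF XD(1)[OF zX]] by blast
  have "T t ` snd z \<in> topspace RP" by (rule line_image(2)[OF XD(1)[OF zX] lT Tnz[OF z] v])
  moreover have "T t ` snd z \<subseteq> V" using XD(2)[OF zX] Q(3) V by (auto simp: T_def intro!: subspace_add subspace_scale)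
  ultimately have "(fst z, T t ` snd z) \<in> topspace X" using XD(3)[OF zX] by (simp add: X_def topspace_bundle)
  thus ?thesis using nz[OF z v] QT[of t v] v by (auto simp: W_def intro!: bexI[of _ v])
 qed
 ultimately have "continuous_map (prod_topology ?I ?Y) X ?H"
  unfolding X_def cont_bundle_iff by (auto simp: comp_def W_def X_def topspace_bundle)
 hence H: "continuous_map (prod_topology ?I ?Y) ?Y ?H" using TW by (auto simp: continuous_map_in_subtopology)
 have r1: "T 1 ` L = Q ` L" "T 0 ` L = L" for L by (simp_all add: T_def)
 have hom: "homotopic_with (\<lambda>_. True) ?Y ?Y (\<lambda>z. z) r" unfolding homotopic_with_def
  by (intro exI[of _ ?H]) (use H in \<open>simp add: r1 r_def\<close>)
 show "continuous_map ?Y ?Y r" using homotopic_with_imp_continuous_maps[OF hom] by simp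
 assume c: "ZS ?Y c"
 have "eqS ?Y (pull (\<lambda>z. z) c) c" by (rule pull_ident) simp
 from coh_trans[OF coh_sym[OF eqK_coh[OF this]] homotopic_coh[OF hom c]] show "cohS ?Y c (pull r c)" .
qed

lemma eqK_cpow: "sset K \<Longrightarrow> eqK K h h' \<Longrightarrow> eqK K (cpow h i) (cpow h' i)"
 by (induction i) (auto intro: eqK_smile)

lemma delta_smile: "sset K \<Longrightarrow> Z K a \<Longrightarrow> eqK K (delta (a \<smile> b)) (a \<smile> delta b)"
 using eqK_add[OF eqK_smile[of K "delta a" 0 b b] eqK_refl[of K "a \<smile> delta b"]] by (simp add: Z_def leibniz)

lemma pull_lh: "pull g (lh q h k a) = lh (q \<circ> g) (pull g h) k a"
 by (simp add: lh_def pull_sum pull_smile pull_cpow pull_pull)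

lemma coh_lh_class:
 assumes K: "sset K" "maps q K M" "Z K h" "coh K h h'" "\<And>i. i < k \<Longrightarrow> Z M (a i)"
 shows "coh K (lh q h k a) (lh q h' k a)"
 unfolding lh_def using assms by (intro coh_sum coh_smile_right coh_cpow Z_pull) auto

text \<open>The induction step from \<open>V\<close> to \<open>V' = V \<oplus> \<real>e\<close>. The projective bundle over \<open>V'\<close> is covered by \<open>A\<close>, which
 retracts onto that over \<open>V\<close>, and \<open>B\<close>, which retracts onto the base, and \<open>A \<inter> B\<close> is equivalent to the double
 cover \<open>E\<close> over \<open>V\<close>. The representative \<open>h\<close> of the tautological class is pulled back from \<open>V\<close> on \<open>A\<close>, is the
 coboundary of \<open>\<sigma>\<close> on \<open>B\<close>, and \<open>\<sigma>\<close> restricts to the sheet function on \<open>E\<close>; so the transfer of the difference of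
 the two primitives of its top power is the top power over \<open>V\<close>.\<close>

locale line_extension =
 fixes U :: "'u topology" and V V' :: "(real^'n) set" and e :: "real^'n" and q :: nat
 assumes V: "subspace V" "subspace V'" "V \<subseteq> V'" and e: "e \<in> V'" "norm e = 1"
  and perp: "\<And>v. v \<in> V \<Longrightarrow> v \<bullet> e = 0" and dec: "\<And>v. v \<in> V' \<Longrightarrow> v - (v \<bullet> e) *\<^sub>R e \<in> V"
  and LHX: "LH (Sing U) (Sing (PB U (\<lambda>_. V))) fst taut (Suc q)"
  and nil: "cohS (PB U (\<lambda>_. V)) (cpow taut (Suc q)) 0"
begin

abbreviation "X \<equiv> PB U (\<lambda>_. V)"
abbreviation "X' \<equiv> PB U (\<lambda>_. V')"
abbreviation "E \<equiv> prod_topology U (usphere V)"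
abbreviation "Q \<equiv> \<lambda>v. v - (v \<bullet> e) *\<^sub>R e"
abbreviation "r \<equiv> \<lambda>z :: 'u \<times> (real^'n) set. (fst z, Q ` snd z)"
abbreviation "P \<equiv> \<lambda>v. (v \<bullet> e) *\<^sub>R e"
definition "A = {z \<in> topspace X'. \<exists>u\<in>snd z. Q u \<noteq> 0}"
definition "B = {z \<in> topspace X'. \<exists>u\<in>snd z. P u \<noteq> 0}"
abbreviation "SA \<equiv> Sing (subtopology X' A)"
abbreviation "SB \<equiv> Sing (subtopology X' B)"
abbreviation "SC \<equiv> Sing (subtopology X' (A \<inter> B))"
abbreviation "pr \<equiv> (\<lambda>(u :: 'u, v :: real^'n). (u, span {v}))"
abbreviation "j \<equiv> \<lambda>z :: 'u \<times> (real^'n). (fst z, span {snd z + e})"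

sublocale double_cover E X pr "\<lambda>(u, v). (u, - v)" "\<lambda>(u, v). sgn2 v (sect (span {v}))" taut
 by (rule sphere_double_cover[OF V(1)])

lemma ee: "e \<bullet> e = 1" using e by (simp add: dot_square_norm)

lemma linear_Q: "linear Q"
 by (intro linearI) (auto simp: algebra_simps inner_add_left)

lemma linear_P: "linear P"
 by (intro linearI) (auto simp: algebra_simps inner_add_left)

lemma QP: "Q (Q v) = Q v" "P (P v) = P v" by (simp_all add: ee inner_diff_left)

lemma V'_QP: "Q ` V' \<subseteq> V'" "P ` V' \<subseteq> V'" using V dec subspace_scale[OF V(2) e(1)] by auto

lemmas retr = line_retraction[OF V(2) linear_Q QP(1) V'_QP(1), of U, folded A_def]
lemmas retr_B = line_retraction[OF V(2) linear_P QP(2) V'_QP(2), of U, folded B_def]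

lemma X'D: "z \<in> topspace X' \<Longrightarrow> fst z \<in> topspace U \<and> snd z \<in> topspace RP \<and> snd z \<subseteq> V'"
 by (auto simp: topspace_bundle)

lemma AD: "z \<in> A \<Longrightarrow> z \<in> topspace X'" and BD: "z \<in> B \<Longrightarrow> z \<in> topspace X'" by (auto simp: A_def B_def)

lemma cover: "topspace X' \<subseteq> A \<union> B" proof
 fix z assume z: "z \<in> topspace X'"
 obtain v where "v \<in> snd z" "v \<noteq> 0" using sect X'D[OF z] by blast
 thus "z \<in> A \<union> B" using z by (cases "v \<bullet> e = 0") (auto simp: A_def B_def ee intro!: bexI[of _ v])
qed

lemma Q_nz: "z \<in> A \<Longrightarrow> v \<in> snd z \<Longrightarrow> v \<noteq> 0 \<Longrightarrow> Q v \<noteq> 0"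
 using line_kernel[OF _ linear_Q, of "snd z" _ v] X'D[of z] unfolding A_def by blast

lemma P_nz: "z \<in> B \<Longrightarrow> v \<in> snd z \<Longrightarrow> v \<noteq> 0 \<Longrightarrow> P v \<noteq> 0"
 using line_kernel[OF _ linear_P, of "snd z" _ v] X'D[of z] unfolding B_def by blast

lemma snd_A: "continuous_map (subtopology X' W) RP snd"
 by (rule continuous_map_from_subtopology[OF cont_bundle_snd])

lemma fst_A: "continuous_map (subtopology X' W) U fst"
 by (rule continuous_map_from_subtopology[OF cont_bundle_fst])

lemma cont_r: "continuous_map (subtopology X' A) X r" proof -
 have "continuous_map (subtopology X' A) RP (\<lambda>z. Q ` snd z)"
  by (rule cont_line_image[OF snd_A]) (use linear_Q Q_nz in auto)
 moreover have "Q ` snd z \<subseteq> V" if "z \<in> topspace X'" for z using X'D[OF that] dec by auto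
 ultimately show ?thesis unfolding cont_bundle_iff using fst_A by (auto simp: comp_def)
qed

lemma X_sub: "Sing X p f \<Longrightarrow> SA p f" proof -
 have t: "z \<in> A" if z: "z \<in> topspace X" for z proof -
  have "snd z \<in> topspace RP" "snd z \<subseteq> V" "fst z \<in> topspace U"
   using z by (auto simp: topspace_bundle)
  moreover from this obtain v where "v \<in> snd z" "v \<noteq> 0" using sect by blast
  moreover from calculation have "Q v \<noteq> 0" using perp[of v] by auto
  ultimately show ?thesis using V(3) by (cases z) (auto simp: A_def topspace_bundle)
 qed
 have "continuous_map X X' id" using V(3) unfolding cont_bundle_iff
  by (auto simp: cont_bundle_fst cont_bundle_snd topspace_bundle)
 hence "continuous_map X (subtopology X' A) id" using t by (auto simp: continuous_map_in_subtopology)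
 from continuous_map_compose[OF _ this] show "Sing X p f \<Longrightarrow> SA p f"
  by (auto simp: Sing_def singular_simplex_def)
qed

lemma nz_j: "v \<in> V \<Longrightarrow> v + e \<noteq> 0" using perp[of v] ee by (auto simp: add_eq_0_iff2)

lemma span_AB: assumes "u \<in> topspace U" "x \<in> V'" "Q x \<noteq> 0" "x \<bullet> e \<noteq> 0"
 shows "(u, span {x}) \<in> A" "(u, span {x}) \<in> B" proof -
 have "x \<noteq> 0" using assms by auto
 hence "(u, span {x}) \<in> topspace X'" using assms V RP_I[of x]
  by (simp add: topspace_bundle span_minimal)
 moreover have "x \<in> span {x}" by (simp add: span_base)
 ultimately show "(u, span {x}) \<in> A" "(u, span {x}) \<in> B" using assms e
  unfolding A_def B_def by (auto intro!: bexI[of _ x])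
qed

lemma span_j: assumes "u \<in> topspace U" "v \<in> V" "v \<noteq> 0"
 shows "j (u, v) \<in> A" "j (u, v) \<in> B" "r (j (u, v)) = (u, span {v})" proof -
 have v: "Q (v + e) = v" "(v + e) \<bullet> e = 1" using perp[OF assms(2)] ee by (auto simp: inner_add_left)
 show "j (u, v) \<in> A" "j (u, v) \<in> B"
  using span_AB[of u "v + e"] assms v V e by (auto intro: subspace_add)
 have "Q ` span {v + e} = span {Q (v + e)}" using linear_span_image[OF linear_Q, of "{v + e}"] by (simp only: image_insert image_empty)
 thus "r (j (u, v)) = (u, span {v})" using v(1) by simp
qed

lemma topE: "z \<in> topspace E \<Longrightarrow> fst z \<in> topspace U \<and> snd z \<in> V \<and> snd z \<noteq> 0" by (auto simp: usphere_def)

lemma cont_j: "continuous_map E (subtopology X' (A \<inter> B)) j" proof -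
 have "continuous_map E euclidean snd"
  using continuous_map_into_fulltopology continuous_map_snd unfolding usphere_def by metis
 hence c: "continuous_map E euclidean (\<lambda>z. snd z + e)" by (intro continuous_map_add) auto
 have "continuous_map E RP (\<lambda>z. span {snd z + e})"
  by (rule cont_span_comp[OF c]) (use nz_j topE in blast)
 moreover have J: "j z \<in> A" "j z \<in> B" if "z \<in> topspace E" for z
  using span_j(1,2)[of "fst z" "snd z"] topE[OF that] by simp_all
 moreover have "span {snd z + e} \<subseteq> V'" if "z \<in> topspace E" for z using X'D[OF AD[OF J(1)[OF that]]] by simp
 ultimately show ?thesis unfolding continuous_map_in_subtopology cont_bundle_iff
  by (auto simp del: topspace_prod_topology simp: comp_def continuous_map_fst)
qed

lemma mj: "maps j (Sing E) SA" "maps j (Sing E) SB" "maps j (Sing E) SC"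
proof -
 show "maps j (Sing E) SC" by (rule maps_Sing[OF cont_j])
 thus "maps j (Sing E) SA" "maps j (Sing E) SB"
  by (auto simp: maps_def Sing_def singular_simplex_subtopology)
qed

lemma r_j: "eqS E (pull j (pull r c)) (pull pr c)" unfolding pull_pull
proof (rule pull_cong_Sing)
 fix z assume "z \<in> topspace E"
 thus "(r \<circ> j) z = pr z" using span_j(3)[of "fst z" "snd z"] topE[of z] by (simp add: case_prod_beta)
qed

text \<open>A homotopy inverse of \<open>j\<close>, which sends a unit vector \<open>v\<close> to
  the line of \<open>v + e\<close>. A line in the overlap has spanning vectors with positive
  \<open>e\<close>-component, one of them being the projection of \<open>e\<close> to it; its part
  in \<open>V\<close> is normalised.\<close>

definition \<rho> :: "'u \<times> (real^'n) set \<Rightarrow> 'u \<times> (real^'n)" where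
 "\<rho> z = (fst z, let v = proj (snd z) e in Q v /\<^sub>R norm (Q v))"

lemma SC_lift: assumes "z \<in> A \<inter> B"
 shows "proj (snd z) e \<in> snd z" "Q (proj (snd z) e) \<noteq> 0" "proj (snd z) e \<bullet> e > 0" "snd z = span {proj (snd z) e}"
proof -
 let ?v = "proj (snd z) e"
 have L: "snd z \<in> topspace RP" using assms X'D AD by blast
 note i = proj_inner[OF RP_subspace[OF L], of _ e]
 show v: "?v \<in> snd z" by (rule proj_mem[OF RP_subspace[OF L]])
 have nz: "?v \<noteq> 0" proof
  assume "?v = 0"
  hence "u \<bullet> e = 0" if "u \<in> snd z" for u using i[OF that] by (simp add: inner_commute)
  thus False using assms by (auto simp: B_def)
 qed
 have "?v \<bullet> e = ?v \<bullet> ?v" using i[OF v] by (simp add: inner_commute)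
 thus "?v \<bullet> e > 0" using nz by simp
 show "Q ?v \<noteq> 0" "snd z = span {?v}" using Q_nz[of z ?v] v nz assms RP_eq_span[OF L v] by blast+
qed

lemma cont_\<rho>: "continuous_map (subtopology X' (A \<inter> B)) E \<rho>" and r_\<rho>: "z \<in> A \<inter> B \<Longrightarrow> pr (\<rho> z) = r z"
 and \<rho>_coh: "Z SC c \<Longrightarrow> coh SC c (pull \<rho> (pull j c))" proof -
 let ?C = "subtopology X' (A \<inter> B)" and ?I = "top_of_set {0..1::real}" and ?v = "\<lambda>z :: 'u \<times> (real^'n) set. proj (snd z) e"
 let ?n = "\<lambda>z. norm (Q (?v z))"
 have cv: "continuous_map ?C euclidean ?v" by (intro continuous_map_from_subtopology cont_proj_snd)
 have n0: "?n z > 0" if "z \<in> A \<inter> B" for z using SC_lift(2)[OF that] by simp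
 have tC: "topspace ?C = A \<inter> B" using AD by auto
 have QV: "Q (?v z) \<in> V" if "z \<in> A \<inter> B" for z using that SC_lift(1)[OF that] X'D[OF AD] dec by blast
 have cont: "continuous_map ?C euclidean (g \<circ> ?v)" if "continuous_on {v. Q v \<noteq> 0} g" for g :: "real^'n \<Rightarrow> 'b::topological_space"
 proof -
  have "continuous_map ?C (top_of_set {v. Q v \<noteq> 0}) ?v"
   using cv SC_lift(2) unfolding continuous_map_in_subtopology tC by blast
  moreover have "continuous_map (top_of_set {v. Q v \<noteq> 0}) euclidean g" using that by simp
  ultimately show ?thesis by (rule continuous_map_compose)
 qed
 have "continuous_map ?C euclidean (\<lambda>z. Q (?v z) /\<^sub>R ?n z)"
  using cont[of "\<lambda>v. Q v /\<^sub>R norm (Q v)", unfolded comp_def] by (rule meta_mp) (auto intro!: continuous_intros)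
 moreover have "Q (?v z) /\<^sub>R ?n z \<in> sphere 0 1 \<inter> V" if "z \<in> A \<inter> B" for z
  using QV[OF that] n0[OF that] V by (auto intro!: subspace_scale)
 ultimately show "continuous_map ?C E \<rho>" unfolding \<rho>_def Let_def usphere_def
  by (intro continuous_map_pairedI fst_A) (auto simp: continuous_map_in_subtopology)
 show "pr (\<rho> z) = r z" if z: "z \<in> A \<inter> B" for z proof -
  have "Q ` snd z = span {Q (?v z)}"
   using SC_lift(4)[OF z] linear_span_image[OF linear_Q, of "{?v z}"] by simp
  moreover have "span {Q (?v z) /\<^sub>R ?n z} = span {Q (?v z)}"
   using n0[OF z] SC_lift(2)[OF z] RP_eq_span[OF RP_I[of "Q (?v z)"], of "Q (?v z) /\<^sub>R ?n z"]
   by (auto intro: span_scale span_base)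
  ultimately show ?thesis by (simp add: \<rho>_def Let_def)
 qed
 \<comment> \<open>The vector keeps its part in \<open>V\<close>, while its
   \<open>e\<close>-component moves from the given one to the norm of that part. It stays positive
   throughout, so the line never leaves the overlap.\<close>
 define w where "w = (\<lambda>t (z :: 'u \<times> (real^'n) set). Q (?v z) + ((1 - t) * (?v z \<bullet> e) + t * ?n z) *\<^sub>R e)"
 have Qw: "Q (w t z) = Q (?v z)" if "z \<in> A \<inter> B" for t z
  using perp[OF QV[OF that]] ee by (simp add: w_def algebra_simps inner_diff_left)
 have we: "w t z \<bullet> e > 0" if z: "z \<in> A \<inter> B" and t: "t \<in> {0..1}" for t z proof -
  have "w t z \<bullet> e = (1 - t) * (?v z \<bullet> e) + t * ?n z"
   using perp[OF QV[OF z]] ee by (simp add: w_def inner_add_left)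
  also have "\<dots> > 0" using t n0[OF z] SC_lift(3)[OF z] by (cases "t = 0") (auto intro!: add_nonneg_pos)
  finally show ?thesis .
 qed
 have w0: "w t z \<noteq> 0" if "z \<in> A \<inter> B" for t z using Qw[OF that, of t] SC_lift(2)[OF that] by auto
 let ?H = "\<lambda>z. (fst (snd z), span {w (fst z) (snd z)})"
 have cI: "continuous_map (prod_topology ?I ?C) euclidean (\<lambda>z. w (fst z) (snd z))" proof -
  let ?g = "\<lambda>z :: real \<times> (real^'n). Q (snd z) + ((1 - fst z) * (snd z \<bullet> e) + fst z * norm (Q (snd z))) *\<^sub>R e"
  have "continuous_map (prod_topology ?I ?C) (prod_topology ?I euclidean) (\<lambda>z. (fst z, ?v (snd z)))"
   using continuous_map_compose[OF continuous_map_snd cv]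
   by (intro continuous_map_pairedI continuous_map_fst) (simp add: comp_def)
  moreover have "continuous_on ({0..1} \<times> UNIV) ?g" by (intro continuous_intros)
  hence "continuous_map (prod_topology ?I euclidean) euclidean ?g"
   by (simp only: prod_topology_subtopology_eu[of _ UNIV, simplified] continuous_map_iff_continuous)
  ultimately show ?thesis using continuous_map_compose by (fastforce simp: comp_def w_def)
 qed
 have "continuous_map (prod_topology ?I ?C) RP (\<lambda>z. span {w (fst z) (snd z)})"
  by (rule cont_span_comp[OF cI]) (use w0 in auto)
 moreover have wC: "(fst z, span {w t z}) \<in> A \<inter> B" if z: "z \<in> A \<inter> B" "t \<in> {0..1}" for t z
 proof -
  have "w t z \<in> V'" unfolding w_def using QV[OF z(1)] V e by (auto intro!: subspace_add subspace_scale)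
  moreover have "Q (w t z) \<noteq> 0" "w t z \<bullet> e \<noteq> 0" using Qw[OF z(1), of t] SC_lift(2)[OF z(1)] we[OF z] by auto
  ultimately show ?thesis using span_AB[of "fst z" "w t z"] X'D[OF AD] z by blast
 qed
 moreover have "span {w t z} \<subseteq> V'" if "z \<in> A \<inter> B" "t \<in> {0..1}" for t z using X'D[OF AD] wC[OF that] by fastforce
 moreover have "continuous_map (prod_topology ?I ?C) U (\<lambda>z. fst (snd z))"
  by (rule cm_comp[OF continuous_map_snd fst_A])
 ultimately have H: "continuous_map (prod_topology ?I ?C) ?C ?H" unfolding continuous_map_in_subtopology
   cont_bundle_iff by (auto simp: comp_def)
 have w0e: "span {w 0 z} = snd z" if z: "z \<in> A \<inter> B" for z using SC_lift(4)[OF z] by (simp add: w_def)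
 have j\<rho>: "j (\<rho> z) = (fst z, span {w 1 z})" if z: "z \<in> A \<inter> B" for z
 proof -
  have "w 1 z = ?n z *\<^sub>R (Q (?v z) /\<^sub>R ?n z + e)" using n0[OF z] by (simp add: w_def algebra_simps)
  thus ?thesis using span_image_scale[of "{Q (?v z) /\<^sub>R ?n z + e}" "\<lambda>_. ?n z"] n0[OF z]
   by (simp add: \<rho>_def Let_def)
 qed
 have hom: "homotopic_with (\<lambda>_. True) ?C ?C (\<lambda>z. (fst z, span {w 0 z})) (\<lambda>z. (fst z, span {w 1 z}))"
  unfolding homotopic_with_def using H by (intro exI[of _ ?H]) auto
 assume c: "Z SC c"
 have "eqK SC (pull (\<lambda>z. (fst z, span {w 0 z})) c) c" by (rule pull_ident) (use w0e in \<open>auto simp: tC\<close>)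
 moreover have "eqK SC (pull (\<lambda>z. (fst z, span {w 1 z})) c) (pull \<rho> (pull j c))"
  unfolding pull_pull by (rule pull_cong_Sing) (use j\<rho> in \<open>auto simp: tC\<close>)
 ultimately show "coh SC c (pull \<rho> (pull j c))"
  using homotopic_coh[OF hom c] coh_sym coh_trans eqK_coh by blast
qed

text \<open>\<open>y\<close> is the sign by which \<open>Q\<close> changes the chosen vectors, and
  \<open>s\<close> compares the chosen vector with \<open>e\<close>. Both are explicit so that
  \<open>h\<close> and \<open>\<sigma>\<close> obey equations of cochains, and
  \<open>\<sigma>\<close> restricts to \<open>Theta\<close> itself.\<close>

definition "y z = sgn2 (Q (sect (snd z))) (sect (Q ` snd z))" for z :: "'u \<times> (real^'n) set"
definition "s z = sgn2 (sect (snd z)) e" for z :: "'u \<times> (real^'n) set"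
definition "h = taut + delta (vfun y)"
definition "\<sigma> = vfun (\<lambda>z. s z + y z)"

lemma mr: "maps r SA (Sing X)" by (rule maps_Sing[OF cont_r])

lemma mm\<rho>: "maps \<rho> SC (Sing E)" by (rule maps_Sing[OF cont_\<rho>])

lemma SA_sub: "SA p f \<Longrightarrow> Sing X' p f" and SB_sub: "SB p f \<Longrightarrow> Sing X' p f"
 and SC_sub: "SC p f \<Longrightarrow> SA p f" "SC p f \<Longrightarrow> SB p f"
 by (auto simp: Sing_def singular_simplex_subtopology)

lemma Z_h: "ZS X' h" unfolding h_def by (intro Z_add Z_taut Z_delta sset_S)

lemma h_A: "eqK SA h (pull r taut)" proof -
 have "eqK SA taut (pull (\<lambda>z. Q ` snd z) eta + delta (vfun y))" unfolding y_def[abs_def]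
 proof (rule eta_natural_eq[OF snd_A, where \<beta> = "\<lambda>_. Q"])
  show "continuous_map (subtopology X' A) RP (\<lambda>z. Q ` snd z)"
   using cont_r by (simp add: cont_bundle_iff comp_def)
  fix z u assume "z \<in> topspace (subtopology X' A)" "u \<in> snd z" "u \<noteq> 0"
  thus "Q u \<in> Q ` snd z \<and> Q u \<noteq> 0" using Q_nz[of z u] by (intro conjI imageI) auto
 qed (rule linear_Q, simp)
 hence "eqK SA (pull (\<lambda>z. Q ` snd z) eta) h" unfolding h_def by (rule eqK_swap[OF eqK_sym])
 thus ?thesis by (simp add: eqK_sym pull_pull comp_def)
qed

lemma h_B: "eqK SB h (delta \<sigma>)" proof -
 let ?t = "\<lambda>z. sgn2 (P (sect (snd z))) (sect (span {e}))"
 have RP: "span {e} \<in> topspace RP" using e by (intro RP_I) auto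
 have "eqK SB taut (pull (\<lambda>_. span {e}) eta + delta (vfun ?t))"
 proof (rule eta_natural_eq[OF snd_A, where \<beta> = "\<lambda>_. P"])
  fix z u assume "z \<in> topspace (subtopology X' B)" "u \<in> snd z" "u \<noteq> 0"
  thus "P u \<in> span {e} \<and> P u \<noteq> 0" using P_nz[of z u] by (intro conjI span_scale span_base) auto
 qed (use linear_P RP in simp_all)
 also have "eqK SB \<dots> (0 + delta (vfun s))" proof (intro eqK_add pull_const_eta RP, unfold eqK_def, intro allI impI)
  fix p f assume f: "SB p f"
  have t: "?t (f (vtx i)) = s (f (vtx i)) + sgn2 e (sect (span {e}))" if "i \<le> p" for i proof -
   let ?v = "sect (snd (f (vtx i)))"
   have fB: "f (vtx i) \<in> B" using simplexD[of p "subtopology X' B" f "vtx i"] f that by (simp add: Sing_def)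
   have v: "?v \<in> snd (f (vtx i))" "?v \<noteq> 0" using sect X'D[OF BD[OF fB]] by auto
   from P_nz[OF fB v] have nz: "?v \<bullet> e \<noteq> 0" "e \<noteq> 0" by auto
   have "e = inverse (?v \<bullet> e) *\<^sub>R P ?v" using nz by simp
   hence eP: "e \<in> span {P ?v}" by (metis span_base span_scale singletonI)
   have "span {P ?v} = span {e}" using span_image_scale[of "{e}" "\<lambda>_. ?v \<bullet> e"] nz by simp
   hence "sgn2 (P ?v) e + sgn2 e (sect (span {e})) = ?t (f (vtx i))"
    using nz eP sect[OF RP] by (intro sgn2_trans) auto
   moreover have "sgn2 (P ?v) e = s (f (vtx i))" using ee by (simp add: s_def sgn2_def)
   ultimately show ?thesis by simp
  qed
  show "delta (vfun ?t) p f = delta (vfun s) p f" unfolding delta_vertex_function[of ?t] delta_vertex_function[of s] using t[of 0] t[of 1]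
   by (cases "sgn2 e (sect (span {e}))") (auto simp: add.assoc)
 qed
 finally have "eqK SB h (0 + delta (vfun s) + delta (vfun y))" unfolding h_def by (intro eqK_add eqK_refl)
 moreover have "\<sigma> = vfun s + vfun y" by (intro ext) (simp add: \<sigma>_def)
 ultimately show ?thesis by (simp add: delta_add)
qed

lemma \<sigma>_j: "eqS E (pull j \<sigma>) Theta" proof (rule eqKI)
 fix p f assume f: "Sing E p f"
 have "s (j z) + y (j z) = sgn2 (snd z) (sect (span {snd z}))" if "z \<in> topspace E" for z proof -
  let ?v = "snd z"
  have v: "?v \<in> V" "?v \<noteq> 0" "fst z \<in> topspace U" using topE[OF that] by auto
  note n = nz_j[OF v(1)]
  obtain c where c: "sect (span {?v + e}) = c *\<^sub>R (?v + e)" "c \<noteq> 0"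
   using sect[OF RP_I[OF n]] by (auto simp: span_singleton)
  have Qc: "Q (c *\<^sub>R (?v + e)) = c *\<^sub>R ?v" using perp[OF v(1)] ee by (simp add: algebra_simps inner_add_left)
  have "s (j z) = sgn2 (c *\<^sub>R ?v) ?v" using perp[OF v(1)] ee inner_gt_zero_iff[of ?v] v(2) c(2)
   by (simp add: s_def sgn2_def c inner_add_left mult_less_0_iff not_less)
  moreover have "y (j z) = sgn2 (c *\<^sub>R ?v) (sect (span {?v}))"
   using span_j(3)[OF v(3,1,2)] Qc by (simp add: y_def c(1))
  moreover have "span {c *\<^sub>R ?v} = span {?v}" using span_image_scale[of "{?v}" "\<lambda>_. c"] c by simp
  hence "sgn2 (c *\<^sub>R ?v) ?v + sgn2 ?v (sect (span {?v})) = sgn2 (c *\<^sub>R ?v) (sect (span {?v}))"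
   using sect[OF RP_I[OF v(2)]] c v by (intro sgn2_trans) (auto simp: span_base)
  ultimately show ?thesis by (metis bit_add_self2)
 qed
 moreover have "f (vtx 0) \<in> topspace E" using f simplexD[of p E f "vtx 0"] by (auto simp: Sing_def)
 ultimately show "pull j \<sigma> p f = Theta p f"
  by (auto simp: pull_def \<sigma>_def Theta_def simplex_map_def case_prod_beta)
qed

lemma h_E: "eqS E (pull j h) (pull pr taut)"
 by (rule eqK_trans[OF eqK_pull[OF mj(1) h_A] r_j])

text \<open>Up to coboundary, a cocycle on \<open>A\<close> is pulled back along \<open>r\<close>,
  and \<open>r\<close> after \<open>j\<close> is the covering map; the transfer kills what comes
  from below.\<close>

lemma tr_j_A: assumes "Z SA c" shows "cohS X (tr (pull j c)) 0" proof -
 have "cohS E (pull j c) (pull pr c)"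
  by (rule coh_trans[OF coh_pull[OF mj(1) retr(3)[OF assms]] eqK_coh[OF r_j]])
 from coh_trans[OF tr_coh[OF this] eqK_coh[OF tr_pull]] show ?thesis .
qed

lemma retract_B: assumes "Z SB c" obtains m where "ZS U m" "coh SB c (pull fst m)" proof -
 let ?i = "\<lambda>u :: 'u. (u, span {e})"
 have e0: "e \<noteq> 0" using e by auto
 have "?i u \<in> B" if "u \<in> topspace U" for u using that e e0 ee V RP_I[OF e0]
  by (auto simp: B_def topspace_bundle span_minimal span_base intro!: bexI[of _ e])
 hence "continuous_map U (subtopology X' B) ?i" unfolding continuous_map_in_subtopology
   cont_bundle_iff using RP_I[OF e0] span_minimal[of "{e}" V'] e V by (auto simp: comp_def)
 hence "ZS U (pull ?i c)" by (rule Z_pull[OF maps_Sing assms])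
 moreover have "eqK SB (pull (\<lambda>z. (fst z, P ` snd z)) c) (pull (?i \<circ> fst) c)"
 proof (rule pull_cong_Sing)
  fix z assume "z \<in> topspace (subtopology X' B)"
  hence z: "z \<in> B" by simp
  obtain v where v: "v \<in> snd z" "v \<noteq> 0" using sect X'D[OF BD[OF z]] by blast
  have "P ` snd z = span {P v}" by (rule line_image(1)[OF _ linear_P P_nz[OF z] v]) (use X'D BD z in auto)
  also have "\<dots> = span {e}" using span_image_scale[of "{e}" "\<lambda>_. v \<bullet> e"] P_nz[OF z v] by simp
  finally show "(fst z, P ` snd z) = (?i \<circ> fst) z" by simp
 qed
 ultimately show thesis using that coh_trans[OF retr_B(3)[OF assms] eqK_coh] by (simp add: pull_pull)
qed

lemma fst_j: "pull j (pull fst m) = pull pr (pull fst m)" by (simp add: pull_pull comp_def case_prod_beta)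

lemma tr_j_B: assumes "Z SB c" shows "cohS X (tr (pull j c)) 0" proof -
 obtain m where "coh SB c (pull fst m)" using retract_B[OF assms] .
 from coh_trans[OF tr_coh[OF coh_pull[OF mj(2) this, unfolded fst_j]] eqK_coh[OF tr_pull]] show ?thesis .
qed

text \<open>If the difference of the primitives has zero transfer, it comes from \<open>X\<close> by
  the Gysin sequence. Through \<open>r\<close> it then extends over \<open>A\<close>, and the
  primitives can be glued.\<close>

lemma zero_criterion:
 assumes c: "ZS X' c" "eqK SA c (delta \<alpha>)" "eqK SB c (delta \<beta>)" "cohS X (tr (pull j (\<alpha> + \<beta>))) 0"
 shows "cohS X' c 0" proof -
 have ZC: "Z SC (\<alpha> + \<beta>)" unfolding Z_def delta_add eqK_diff
  using eqK_mono[OF c(2) SC_sub(1)] eqK_mono[OF c(3) SC_sub(2)] eqK_sym eqK_trans by blast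
 obtain a where a: "ZS X a" "cohS E (pull j (\<alpha> + \<beta>)) (pull pr a)"
  using tr_kernel[OF Z_pull[OF mj(3) ZC] c(4)] .
 have "eqK SC (pull \<rho> (pull pr a)) (pull r a)"
  unfolding pull_pull by (rule pull_cong_Sing) (use r_\<rho> AD in auto)
 with coh_trans[OF coh_trans[OF \<rho>_coh[OF ZC] coh_pull[OF mm\<rho> a(2)]]] have "coh SC (\<alpha> + \<beta>) (pull r a)"
  by (blast intro: eqK_coh)
 thus ?thesis by (rule mayer_vietoris_zero[OF retr(1) retr_B(1) cover c(1-3) Z_pull[OF mr a(1)]])
qed

lemma top_primitives:
 assumes m: "ZS U m"
 obtains \<alpha> \<beta> where "eqK SA (pull fst m \<smile> cpow h (Suc q)) (delta \<alpha>)" "eqK SB (pull fst m \<smile> cpow h (Suc q)) (delta \<beta>)"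
  "cohS X (tr (pull j (\<alpha> + \<beta>))) (pull fst m \<smile> cpow taut q)" proof -
 obtain \<nu> where \<nu>: "eqS X (cpow taut (Suc q)) (delta \<nu>)" by (rule coh_eq_delta[OF nil])
 let ?m = "pull fst m" and ?\<alpha> = "pull fst m \<smile> pull r \<nu>" and ?\<beta> = "pull fst m \<smile> (cpow h q \<smile> \<sigma>)"
 have mA: "Z SA ?m" and mB: "Z SB ?m" by (intro Z_pull[OF maps_Sing m] fst_A)+
 have "eqK SA (cpow h (Suc q)) (pull r (cpow taut (Suc q)))"
  using eqK_cpow[OF sset_S h_A] by (simp add: pull_cpow del: cpow.simps)
 from eqK_trans[OF this eqK_pull[OF mr \<nu>]] have "eqK SA (cpow h (Suc q)) (delta (pull r \<nu>))" by (simp add: pull_delta)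
 hence 1: "eqK SA (?m \<smile> cpow h (Suc q)) (delta ?\<alpha>)"
  using eqK_trans[OF eqK_smile[OF sset_S eqK_refl] eqK_sym[OF delta_smile[OF sset_S mA]]] by blast
 have Zh: "Z SB (cpow h q)" by (rule Z_cpow[OF sset_S Z_mono[OF Z_h SB_sub]])
 have "eqK SB (cpow h (Suc q)) (delta (cpow h q \<smile> \<sigma>))" unfolding cpow.simps
  using eqK_trans[OF eqK_smile[OF sset_S eqK_refl h_B] eqK_sym[OF delta_smile[OF sset_S Zh]]] .
 hence 2: "eqK SB (?m \<smile> cpow h (Suc q)) (delta ?\<beta>)"
  using eqK_trans[OF eqK_smile[OF sset_S eqK_refl] eqK_sym[OF delta_smile[OF sset_S mB]]] by blast
 have "eqS E (pull j ?\<alpha>) (pull pr (?m \<smile> \<nu>))" unfolding pull_smile fst_j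
  by (rule eqK_smile[OF sset_S eqK_refl r_j])
 from eqK_trans[OF tr_eqK[OF this] tr_pull] have t1: "eqS X (tr (pull j ?\<alpha>)) 0" .
 have "eqS E (pull j ?\<beta>) (pull pr (?m \<smile> cpow taut q) \<smile> Theta)" unfolding pull_smile fst_j smile_assoc pull_cpow
  by (intro eqK_smile eqK_refl eqK_cpow sset_S h_E \<sigma>_j)
 note t2 = eqK_trans[OF tr_eqK[OF this] tr_smile]
 have "eqS X ((?m \<smile> cpow taut q) \<smile> tr Theta) ((?m \<smile> cpow taut q) \<smile> unit)"
  by (rule eqK_smile[OF sset_S eqK_refl tr_Theta_unit])
 note t3 = eqK_trans[OF eqK_trans[OF t2 this] smile_unit[OF sset_S]]
 have "cohS X (tr (pull j (?\<alpha> + ?\<beta>))) (?m \<smile> cpow taut q)"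
  using eqK_coh[OF eqK_add[OF t1 t3]] by (simp add: pull_add tr_add)
 with 1 2 show thesis by (rule that)
qed

lemma freeness: "\<forall>i<Suc q. ZS U (a i) \<Longrightarrow> cohS X (lh fst taut (Suc q) a) 0 \<Longrightarrow> i < Suc q \<Longrightarrow>
  cohS U (a i) 0" using LHX unfolding LH_def by blast

lemma spanning: assumes "ZS X c"
 obtains a where "\<forall>i<Suc q. ZS U (a i)" "cohS X c (lh fst taut (Suc q) a)"
 using LHX assms unfolding LH_def by blast

text \<open>A primitive over the whole of \<open>X'\<close> differs from the standard ones by
  cocycles on \<open>A\<close> and on \<open>B\<close>, whose transfers vanish. So \<open>a\<close>
  times the power \<open>q\<close> of \<open>taut\<close> is zero over \<open>X\<close>, where that
  power belongs to the basis.\<close>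

lemma top_free:
 assumes a: "ZS U a" and 0: "cohS X' (pull fst a \<smile> cpow h (Suc q)) 0"
 shows "cohS U a 0" proof -
 obtain \<gamma> where \<gamma>: "eqS X' (pull fst a \<smile> cpow h (Suc q)) (delta \<gamma>)" by (rule coh_eq_delta[OF 0])
 obtain \<alpha> \<beta> where ab: "eqK SA (pull fst a \<smile> cpow h (Suc q)) (delta \<alpha>)" "eqK SB (pull fst a \<smile> cpow h (Suc q)) (delta \<beta>)"
  "cohS X (tr (pull j (\<alpha> + \<beta>))) (pull fst a \<smile> cpow taut q)" by (rule top_primitives[OF a])
 have "Z SA (\<gamma> + \<alpha>)" "Z SB (\<gamma> + \<beta>)" unfolding Z_def delta_add eqK_diff
  by (rule eqK_trans[OF eqK_sym[OF eqK_mono[OF \<gamma> SA_sub]] ab(1)], assumption)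
   (rule eqK_trans[OF eqK_sym[OF eqK_mono[OF \<gamma> SB_sub]] ab(2)])
 from coh_add[OF tr_j_A[OF this(1)] tr_j_B[OF this(2)]]
 have "cohS X (tr (pull j (\<alpha> + \<beta>))) 0" by (simp add: tr_add[symmetric] pull_add[symmetric] ac_simps)
 from coh_trans[OF coh_sym[OF ab(3)] this] have "cohS X (pull fst a \<smile> cpow taut q) 0" .
 hence "cohS X (lh fst taut (Suc q) (\<lambda>i. if i = q then a else 0)) 0" by (simp add: lh_def)
 from freeness[OF _ this, of q] show ?thesis using a by simp
qed

text \<open>For uniqueness, restriction to \<open>X\<close> kills every coefficient but the top one,
  which is left to \<open>top_free\<close>. For existence, the class is changed by combinations of
  lower powers of \<open>h\<close> until it vanishes on \<open>A\<close> and on \<open>B\<close>;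
  what then remains is measured by a transfer and removed by the top power.\<close>

lemma LH_h: "LH (Sing U) (Sing X') fst h (Suc (Suc q))" unfolding LH_def proof (intro conjI allI impI)
 fix a i assume a: "\<forall>i<Suc (Suc q). ZS U (a i)" and 0: "cohS X' (lh fst h (Suc (Suc q)) a) 0"
  and i: "i < Suc (Suc q)"
 have hX: "eqS X h taut" proof -
  have "eqS X (pull r taut) taut" proof (rule pull_ident)
   fix z assume "z \<in> topspace X"
   hence "v \<bullet> e = 0" if "v \<in> snd z" for v using that perp by (auto simp: topspace_bundle)
   thus "r z = z" by (cases z) auto
  qed
  from eqK_trans[OF eqK_mono[OF h_A X_sub] this] show ?thesis .
 qed
 have s: "lh fst h (Suc (Suc q)) a = lh fst h (Suc q) a + pull fst (a (Suc q)) \<smile> cpow h (Suc q)" by (simp add: lh_def)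
 have mX: "maps fst (Sing X) (Sing U)" "maps fst (Sing X') (Sing U)" by (rule maps_bundle_fst)+
 have ZX: "ZS X h" by (rule Z_mono[OF Z_h SA_sub[OF X_sub]])
 have "cohS X (lh fst h (Suc (Suc q)) a) (lh fst taut (Suc (Suc q)) a)"
  by (rule coh_lh_class[OF sset_S mX(1) ZX eqK_coh[OF hX]]) (use a in auto)
 hence "cohS X (lh fst taut (Suc (Suc q)) a) 0" using coh_mono[OF 0 SA_sub[OF X_sub]] coh_sym coh_trans by blast
 moreover have "cohS X (lh fst taut (Suc (Suc q)) a) (lh fst taut (Suc q) a + 0)"
  unfolding lh_def sum.lessThan_Suc[of _ "Suc q"] using coh_smile_right[OF sset_S Z_pull[OF mX(1)] nil, of "a (Suc q)"] a
  by (intro coh_add coh_refl) simp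
 ultimately have "cohS X (lh fst taut (Suc q) a) 0" using coh_sym coh_trans by fastforce
 hence lo: "cohS U (a i) 0" if "i < Suc q" for i using LHX a that unfolding LH_def by auto
 have "cohS X' (lh fst h (Suc q) a) (lh fst h (Suc q) (\<lambda>_. 0))"
  by (rule coh_lh[OF sset_S mX(2) Z_h lo]) simp
 hence "cohS X' (lh fst h (Suc (Suc q)) a) (0 + pull fst (a (Suc q)) \<smile> cpow h (Suc q))"
  unfolding s by (intro coh_add coh_refl) (simp add: lh_def)
 from coh_trans[OF coh_sym[OF this] 0] have "cohS U (a (Suc q)) 0" using a by (intro top_free) auto
 thus "cohS U (a i) 0" using lo i by (cases "i = Suc q") auto
next
 fix c assume c: "ZS X' c"
 let ?L = "lh fst taut (Suc q)" and ?H = "lh fst h (Suc q)"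
 have mX: "maps fst (Sing X) (Sing U)" "maps fst (Sing X') (Sing U)" "maps fst SA (Sing U)" "maps fst SB (Sing U)"
  by (rule maps_bundle_fst maps_Sing fst_A)+
 have ZhA: "Z SA h" and ZhB: "Z SB h" using Z_h SA_sub SB_sub by (blast intro: Z_mono)+
 \<comment> \<open>Multiplication by \<open>taut\<close> moves the coefficients up by one; the top
   one drops out by \<open>nil\<close>.\<close>
 have shift: "cohS X (taut \<smile> d) (?L (\<lambda>i. if i = 0 then 0 else b (i - 1)))"
  if d: "ZS X d" and b: "cohS X d (?L b)" "\<forall>i<Suc q. ZS U (b i)" for d b
 proof -
  have "cohS X (taut \<smile> d) (d \<smile> taut)" by (rule coh_sym[OF taut_central[OF d]])
  also have "cohS X \<dots> (?L b \<smile> taut)" by (rule coh_smile_left[OF sset_S Z_taut b(1)])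
  also have "?L b \<smile> taut = (\<Sum>i<q. pull fst (b i) \<smile> cpow taut (Suc i)) + pull fst (b q) \<smile> cpow taut (Suc q)"
   by (simp add: lh_def smile_sum_left smile_add_left smile_assoc)
  also have "cohS X \<dots> ((\<Sum>i<q. pull fst (b i) \<smile> cpow taut (Suc i)) + 0)"
   using coh_smile_right[OF sset_S Z_pull[OF mX(1)] nil, of "b q"] b by (intro coh_add coh_refl) simp
  also have "(\<Sum>i<q. pull fst (b i) \<smile> cpow taut (Suc i)) + 0 = ?L (\<lambda>i. if i = 0 then 0 else b (i - 1))"
   unfolding lh_def sum.lessThan_Suc_shift by simp
  finally show ?thesis .
 qed
 obtain m where m: "ZS U m" "coh SB c (pull fst m)" using retract_B[OF Z_mono[OF c SB_sub]] .
 define c1 where "c1 = c + pull fst m"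
 have Z1: "ZS X' c1" unfolding c1_def by (intro Z_add c Z_pull[OF mX(2)] m)
 have c1B: "coh SB c1 0" using m(2) by (simp add: c1_def coh_add_0)
 obtain a where a: "\<forall>i<Suc q. ZS U (a i)" "cohS X c1 (?L a)"
  using spanning[OF Z_mono[OF Z1 SA_sub[OF X_sub]]] .
 have c1A: "coh SA c1 (pull r (?L a))"
  by (rule coh_trans[OF retr(3)[OF Z_mono[OF Z1 SA_sub]] coh_pull[OF mr a(2)]])
 \<comment> \<open>\<open>c1\<close> vanishes on \<open>B\<close>, hence on the overlap. By the
   Gysin sequence its restriction to \<open>X\<close> is a multiple of \<open>taut\<close>, so its
   coefficient \<open>a 0\<close> is zero, and a combination of positive powers of \<open>h\<close>,
   each zero on \<open>B\<close>, can cancel \<open>c1\<close> on \<open>A\<close>.\<close>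
 have "cohS E (pull pr (?L a)) 0" proof -
  have "cohS E (pull j c1) (pull pr (?L a))"
   by (rule coh_trans[OF coh_pull[OF mj(1) c1A] eqK_coh[OF r_j]])
  thus ?thesis using coh_pull[OF mj(2) c1B] coh_sym coh_trans by fastforce
 qed
 then obtain d where d: "ZS X d" "cohS X (?L a) (taut \<smile> d)" by (rule gysin_kernel)
 then obtain b where b: "\<forall>i<Suc q. ZS U (b i)" "cohS X d (?L b)" using spanning by blast
 have z: "cohS X (?L (\<lambda>i. a i + (if i = 0 then 0 else b (i - 1)))) 0"
  unfolding lh_add coh_add_0 by (rule coh_trans[OF d(2) shift[OF d(1) b(2,1)]])
 have "\<forall>i<Suc q. ZS U (a i + (if i = 0 then 0 else b (i - 1)))" using a b by (auto intro!: Z_add)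
 from freeness[OF this z, of 0] have a0: "cohS U (a 0) 0" by simp
 define a' where "a' = a(0 := 0)"
 have Za': "\<forall>i<Suc q. ZS U (a' i)" using a by (simp add: a'_def)
 define c2 where "c2 = c1 + ?H a'"
 have Z2: "ZS X' c2" unfolding c2_def by (intro Z_add Z1 Z_lh[OF sset_S mX(2) Z_h]) (use Za' in blast)
 have "coh SA (?H a') (lh fst (pull r taut) (Suc q) a')"
  by (rule coh_lh_class[OF sset_S mX(3) ZhA eqK_coh[OF h_A]]) (use Za' in blast)
 also have "coh SA \<dots> (lh fst (pull r taut) (Suc q) a)"
  by (rule coh_lh[OF sset_S mX(3) Z_pull[OF mr Z_taut]]) (use a0 in \<open>auto simp: a'_def coh_sym\<close>)
 also have "\<dots> = pull r (?L a)" by (simp add: pull_lh comp_def)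
 finally have "coh SA c2 0" unfolding c2_def coh_add_0 using c1A coh_sym coh_trans by blast
 then obtain \<alpha> where \<alpha>: "eqK SA c2 (delta \<alpha>)" by (rule coh_eq_delta)
 have hB: "coh SB h 0" by (rule coh_trans[OF eqK_coh[OF h_B] coh_delta])
 have "coh SB (?H a') (lh fst 0 (Suc q) a')"
  by (rule coh_lh_class[OF sset_S mX(4) ZhB hB]) (use Za' in blast)
 moreover have "lh fst 0 (Suc q) a' = (0 :: ('u \<times> (real^'n) set) cochain)" unfolding lh_def sum.lessThan_Suc_shift by (simp add: a'_def)
 ultimately have "coh SB c2 (0 + 0)" unfolding c2_def by (intro coh_add c1B) simp
 hence "coh SB c2 0" by simp
 then obtain \<beta> where \<beta>: "eqK SB c2 (delta \<beta>)" by (rule coh_eq_delta)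
 \<comment> \<open>A transfer is annihilated by \<open>taut\<close>. By \<open>shift\<close> this
   forces all coefficients of \<open>t\<close> but the top one to vanish, and the top one is the
   transfer that belongs to a multiple of \<open>cpow h (Suc q)\<close>.\<close>
 define t where "t = tr (pull j (\<alpha> + \<beta>))"
 have ZC: "Z SC (\<alpha> + \<beta>)" unfolding Z_def delta_add eqK_diff
  by (rule eqK_trans[OF eqK_sym[OF eqK_mono[OF \<alpha> SC_sub(1)]] eqK_mono[OF \<beta> SC_sub(2)]])
 have Zt: "ZS X t" unfolding t_def by (rule Z_tr[OF Z_pull[OF mj(3) ZC]])
 then obtain b where b: "\<forall>i<Suc q. ZS U (b i)" "cohS X t (?L b)" using spanning by blast
 have z: "cohS X (?L (\<lambda>i. if i = 0 then 0 else b (i - 1))) 0"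
  using coh_trans[OF coh_sym[OF shift[OF Zt b(2,1)]]] tr_annihilated[OF Z_pull[OF mj(3) ZC]] unfolding t_def by blast
 have bz: "cohS U (b i) 0" if "i < q" for i using freeness[OF _ z, of "Suc i"] b that by auto
 have "cohS X (?L b) (?L (\<lambda>i. if i = q then b i else 0))"
  by (rule coh_lh[OF sset_S mX(1) Z_taut]) (use bz in \<open>auto simp: less_Suc_eq\<close>)
 also have "?L (\<lambda>i. if i = q then b i else 0) = pull fst (b q) \<smile> cpow taut q" by (simp add: lh_def)
 finally have tb: "cohS X t (pull fst (b q) \<smile> cpow taut q)" by (rule coh_trans[OF b(2)])
 let ?b = "pull fst (b q) \<smile> cpow h (Suc q)"
 have Zb: "ZS U (b q)" using b by simp
 obtain \<alpha>' \<beta>' where ab: "eqK SA (?b) (delta \<alpha>')"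
  "eqK SB (?b) (delta \<beta>')"
  "cohS X (tr (pull j (\<alpha>' + \<beta>'))) (pull fst (b q) \<smile> cpow taut q)" by (rule top_primitives[OF Zb])
 have c3: "cohS X' (c2 + ?b) 0"
 proof (rule zero_criterion[of _ "\<alpha> + \<alpha>'" "\<beta> + \<beta>'"])
  show "ZS X' (c2 + ?b)"
   by (intro Z_add Z_smile Z2 Z_pull[OF mX(2) Zb] Z_cpow Z_h sset_S)
  show "eqK SA (c2 + ?b) (delta (\<alpha> + \<alpha>'))"
   "eqK SB (c2 + ?b) (delta (\<beta> + \<beta>'))"
   unfolding delta_add by (intro eqK_add \<alpha> \<beta> ab)+
  have "tr (pull j (\<alpha> + \<alpha>' + (\<beta> + \<beta>'))) = t + tr (pull j (\<alpha>' + \<beta>'))"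
   by (simp add: t_def pull_add tr_add ac_simps)
  thus "cohS X (tr (pull j (\<alpha> + \<alpha>' + (\<beta> + \<beta>')))) 0"
   using coh_trans[OF tb coh_sym[OF ab(3)]] by (simp add: coh_add_0)
 qed
 define a2 where "a2 = (\<lambda>i. if i = 0 then m else if i = Suc q then b q else a i)"
 have "cohS X' (pull fst m \<smile> unit) (pull fst m)" by (rule eqK_coh[OF smile_unit[OF sset_S]])
 from coh_add[OF coh_refl coh_add[OF this coh_refl]]
 have "cohS X' (c + lh fst h (Suc (Suc q)) a2) (c + (pull fst m + (?H a' + ?b)))"
  unfolding lh_def sum.lessThan_Suc[of _ "Suc q"] sum.lessThan_Suc_shift[of _ q]
  by (simp add: a2_def a'_def add.assoc del: cpow.simps(2))
 from coh_trans[OF this] c3 have "cohS X' (c + lh fst h (Suc (Suc q)) a2) 0"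
  by (simp add: c2_def c1_def add.assoc del: cpow.simps)
 hence "cohS X' c (lh fst h (Suc (Suc q)) a2)" by (simp only: coh_add_0)
 moreover have "\<forall>i<Suc (Suc q). ZS U (a2 i)" using a m Zb by (auto simp: a2_def)
 ultimately show "\<exists>a. (\<forall>i<Suc (Suc q). ZS U (a i)) \<and> cohS X' c (lh fst h (Suc (Suc q)) a)" by blast
qed

lemma LH_extend: "LH (Sing U) (Sing X') fst taut (Suc (Suc q))"
proof (rule LH_transfer[where \<Phi> = "\<lambda>z. z" and \<Psi> = "\<lambda>z. z", OF _ _ _ _ _ _ Z_h Z_taut _ LH_h])
 have "cohS X' (taut + 0) (taut + delta (vfun y))" by (intro coh_add coh_refl coh_sym[OF coh_delta])
 hence "cohS X' taut h" by (simp add: h_def)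
 thus "cohS X' (pull (\<lambda>z. z) taut) h" by (simp add: pull_pull comp_def)
qed (simp_all add: cont_bundle_fst)

end

lemma LH_line:
 fixes e :: "real^'n" assumes e: "e \<noteq> 0"
 shows "LH (Sing U) (Sing (PB U (\<lambda>_. span {e}))) fst taut 1"
proof (rule LH_transfer[where \<Phi> = "\<lambda>u. (u, span {e})" and \<Psi> = fst and q = "\<lambda>u. u"])
 let ?X = "PB U (\<lambda>_. span {e})"
 show c: "continuous_map U ?X (\<lambda>u. (u, span {e}))"
  using RP_I[OF e] by (simp add: cont_bundle_iff comp_def)
 show "(fst z, span {e}) = z" if z: "z \<in> topspace ?X" for z proof -
  have L: "snd z \<in> topspace RP" "snd z \<subseteq> span {e}" using z by (auto simp: topspace_bundle)
  obtain v where v: "v \<in> snd z" "v \<noteq> 0" using sect[OF L(1)] by blast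
  show ?thesis using RP_eq_span[OF L(1) v] RP_eq_span[OF RP_I[OF e] _ v(2)] v L by (cases z) auto
 qed
 show "ZS U (pull (\<lambda>u. (u, span {e})) taut)" by (rule Z_pull[OF maps_Sing[OF c] Z_taut])
 show "cohS U (pull (\<lambda>u. (u, span {e})) taut) (pull (\<lambda>u. (u, span {e})) taut)" by simp
 have *: "cohS U (pull (\<lambda>u. u) a \<smile> unit) a" for a
  by (rule eqK_coh[OF eqK_trans[OF smile_unit[OF sset_S] pull_ident]]) simp
 have l: "lh (\<lambda>u. u) h 1 a = pull (\<lambda>u. u) (a 0) \<smile> unit" for h :: "'a cochain" and a by (simp add: lh_def)
 show "LH (Sing U) (Sing U) (\<lambda>u. u) (pull (\<lambda>u. (u, span {e})) taut) 1" unfolding LH_def l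
 proof (intro conjI allI impI)
  fix a :: "nat \<Rightarrow> 'a cochain" and i assume "cohS U (pull (\<lambda>u. u) (a 0) \<smile> unit) 0" "i < (1::nat)"
  thus "cohS U (a i) 0" using coh_trans[OF coh_sym[OF *[of "a 0"]]] by simp
 next
  fix c assume "ZS U c"
  thus "\<exists>a. (\<forall>i<1. ZS U (a i)) \<and> cohS U c (pull (\<lambda>u. u) (a 0) \<smile> unit)"
   by (intro exI[of _ "\<lambda>_. c"]) (simp add: coh_sym[OF *])
 qed
qed (simp_all add: cont_bundle_fst Z_taut)

lemma LH_trivial:
 fixes I :: "(real^'n) set" and U :: "'u topology"
 assumes I: "I \<subseteq> Basis" "I \<noteq> {}"
 shows "LH (Sing U) (Sing (PB U (\<lambda>_. span I))) fst taut (card I)"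
 using finite_subset[OF I(1) finite_Basis] I(2,1)
proof (induction I rule: finite_ne_induct)
 case (singleton e)
 hence "e \<noteq> 0" by auto
 from LH_line[OF this] show ?case by simp
next
 case (insert e I)
 have perp: "v \<bullet> e = 0" if "v \<in> span I" for v using that proof (induction rule: span_induct_alt)
  case (step c x y)
  have "x \<bullet> e = 0" using step(1) insert.hyps insert.prems by (subst inner_Basis) auto
  thus ?case using step by (simp add: inner_add_left)
 qed simp
 have dec: "v - (v \<bullet> e) *\<^sub>R e \<in> span I" if v: "v \<in> span (insert e I)" for v proof -
  obtain k where k: "v - k *\<^sub>R e \<in> span I" using v by (auto simp: span_insert)
  have "e \<bullet> e = 1" using insert by (auto simp: inner_Basis)
  hence "k = v \<bullet> e" using perp[OF k] by (simp add: inner_diff_left)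
  thus ?thesis using k by simp
 qed
 have q: "Suc (card I - 1) = card I" "card (insert e I) = Suc (Suc (card I - 1))" using insert by (simp_all add: card_gt_0_iff)
 have "line_extension U (span I) (span (insert e I)) e (card I - 1)"
  by unfold_locales (use insert perp dec taut_nilpotent[of I U] q(1) in \<open>auto simp: span_mono subset_insertI span_base\<close>)
 from line_extension.LH_extend[OF this] show ?case by (simp only: q(2))
qed

subsection \<open>Vector bundles\<close>

abbreviation "inverse_map \<equiv> inv_into UNIV"

text \<open>A subbundle of the trivial bundle, described by continuity of its projections. Local
  triviality is a consequence, obtained in charts by projecting coordinate subspaces to the
  fibres.\<close>

definition vector_bundle :: "'b topology \<Rightarrow> ('b \<Rightarrow> (real^'n) set) \<Rightarrow> nat \<Rightarrow> bool" where
 "vector_bundle B F k \<longleftrightarrow> (\<forall>b\<in>topspace B. subspace (F b) \<and> dim (F b) = k) \<and>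
   (\<forall>u. continuous_map B euclidean (\<lambda>b. proj (F b) u))"

lemma vbD:
 assumes "vector_bundle B F k"
 shows "b \<in> topspace B \<Longrightarrow> subspace (F b)" "b \<in> topspace B \<Longrightarrow> dim (F b) = k"
  "continuous_map B euclidean (\<lambda>b. proj (F b) u)" using assms by (auto simp: vector_bundle_def)

lemma vb_subtopology: "vector_bundle B F k \<Longrightarrow> vector_bundle (subtopology B W) F k"
 by (auto simp: vector_bundle_def continuous_map_from_subtopology)

lemma vb_pullback: "vector_bundle B F k \<Longrightarrow> continuous_map X B g \<Longrightarrow> vector_bundle X (\<lambda>x. F (g x)) k"
 using continuous_map_compose[of X B g euclidean] unfolding vector_bundle_def comp_def
 by (auto dest: continuous_map_funspace)

lemma cont_matrix_family:
 fixes T :: "'b \<Rightarrow> real^'n \<Rightarrow> real^'n"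
 assumes "\<And>u. continuous_map B euclidean (\<lambda>b. T b u)"
 shows "continuous_map B euclideanreal (\<lambda>b. det (matrix (T b)))"
 using assms unfolding continuous_map_atin det_def matrix_def by (auto intro!: tendsto_intros)

text \<open>Cramer's rule writes the inverse through determinants.\<close>

lemma cont_inverse_family:
 fixes T :: "'b \<Rightarrow> real^'n \<Rightarrow> real^'n"
 assumes T: "\<And>u. continuous_map B euclidean (\<lambda>b. T b u)"
  and lin: "\<And>b. b \<in> topspace B \<Longrightarrow> linear (T b)" and inj: "\<And>b. b \<in> topspace B \<Longrightarrow> inj (T b)"
 shows "continuous_map B euclidean (\<lambda>b. inverse_map (T b) u)" proof -
 let ?M = "\<lambda>b k. \<chi> i j. if j = k then u $ i else matrix (T b) $ i $ j"
 have "continuous_map B euclidean (\<lambda>b. \<chi> k. det (?M b k) / det (matrix (T b)))"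
  unfolding continuous_map_atin limitin_canonical_iff
 proof (intro ballI vec_tendstoI, unfold vec_lambda_beta, intro tendsto_divide)
  fix x :: 'b and k assume x: "x \<in> topspace B"
  have T': "((\<lambda>b. T b v $ i) \<longlongrightarrow> T x v $ i) (atin B x)" for v i
   using T[of v] x unfolding continuous_map_atin limitin_canonical_iff by (auto intro: tendsto_vec_nth)
  show "det (matrix (T x)) \<noteq> 0" using det_nz_iff_inj[OF lin[OF x]] inj[OF x] by simp
  show "((\<lambda>b. det (matrix (T b))) \<longlongrightarrow> det (matrix (T x))) (atin B x)"
   using cont_matrix_family[OF T] x unfolding continuous_map_atin by simp
  show "((\<lambda>b. det (?M b k)) \<longlongrightarrow> det (?M x k)) (atin B x)" unfolding det_def
  proof (intro tendsto_sum tendsto_mult tendsto_const tendsto_prod)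
   fix p i show "((\<lambda>b. ?M b k $ i $ p i) \<longlongrightarrow> ?M x k $ i $ p i) (atin B x)"
    using T' by (auto simp: matrix_def)
  qed
 qed
 thus ?thesis proof (rule continuous_map_eq)
  fix b assume b: "b \<in> topspace B"
  have "matrix (T b) *v inverse_map (T b) u = T b (inverse_map (T b) u)" by (rule matrix_works) (use lin[OF b] in \<open>simp add: linear_matrix_vector_mul_eq\<close>)
  also have "\<dots> = u" using linear_inj_imp_surj[OF lin[OF b] inj[OF b]] by (rule surj_f_inv_f)
  finally show "(\<chi> k. det (?M b k) / det (matrix (T b))) = inverse_map (T b) u"
   using cramer[of "matrix (T b)" "inverse_map (T b) u" u] det_nz_iff_inj[OF lin[OF b]] inj[OF b] by simp
 qed
qed

text \<open>Where one coordinate subspace projects isomorphically to all fibres, the bundle is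
  trivial. The trivialisation is extended to automorphisms of the ambient space, so that it acts on
  lines and \<open>eta_natural\<close> applies.\<close>

lemma LH_chart:
 assumes F: "vector_bundle B F k" and I: "I \<subseteq> Basis" "I \<noteq> {}" "card I = k"
  and inj: "\<And>b. b \<in> topspace B \<Longrightarrow> inj_on (proj (F b)) (span I)"
 shows "LH (Sing B) (Sing (PB B F)) fst taut k" proof -
 let ?p = "proj (span I)"
 \<comment> \<open>\<open>T b\<close> sends \<open>span I\<close> to \<open>F b\<close> and the
   complement of \<open>span I\<close> to the complement of \<open>F b\<close>, each by orthogonal
   projection.\<close>
 define T where "T = (\<lambda>b x. proj (F b) (?p x) + ((x - ?p x) - proj (F b) (x - ?p x)))"
 note S = vbD(1)[OF F]
 have lin: "linear (T b)" if b: "b \<in> topspace B" for b proof -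
  have 1: "linear (\<lambda>x. x - ?p x)" by (intro linear_compose_sub linear_ident linear_proj subspace_span)
  have "linear (\<lambda>x. proj (F b) (?p x))" "linear (\<lambda>x. proj (F b) (x - ?p x))"
   using linear_compose[OF linear_proj[OF subspace_span] linear_proj[OF S[OF b]], of I]
    linear_compose[OF 1 linear_proj[OF S[OF b]]] by (simp_all add: comp_def)
  thus ?thesis unfolding T_def by (intro linear_compose_add linear_compose_sub 1)
 qed
 have im: "proj (F b) ` span I = F b" if b: "b \<in> topspace B" for b proof (rule subspace_dim_equal)
  show "subspace (proj (F b) ` span I)" by (rule linear_subspace_image[OF linear_proj[OF S[OF b]] subspace_span])
  have "dim (proj (F b) ` span I) = dim (span I)"
   by (rule dim_image_eq[OF linear_proj[OF S[OF b]]]) (simp add: inj[OF b] span_span)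
  also have "\<dots> = k" using I independent_mono[OF independent_Basis I(1)] by (simp add: dim_eq_card_independent)
  finally show "dim (F b) \<le> dim (proj (F b) ` span I)" using vbD(2)[OF F b] by simp
 qed (use S[OF b] proj_mem in auto)
 have Tinj: "inj (T b)" if b: "b \<in> topspace B" for b unfolding linear_injective_0[OF lin[OF b]]
 proof (intro allI impI)
  fix x assume 0: "T b x = 0"
  define p where "p = proj (F b) (?p x)"
  define y where "y = x - ?p x"
  define q where "q = y - proj (F b) y"
  have pq: "p + q = 0" using 0 by (simp add: T_def p_def q_def y_def)
  have "orthogonal q p" unfolding q_def p_def by (intro proj_orthogonal proj_mem S b)
  hence "p \<bullet> p = 0" using pq by (simp add: orthogonal_def add_eq_0_iff)
  hence p0: "p = 0" "q = 0" using pq by auto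
  have "proj (F b) 0 = 0" by (rule linear_0[OF linear_proj[OF S[OF b]]])
  hence "?p x = 0" using inj_onD[OF inj[OF b], of "?p x" 0] p0(1) by (simp add: p_def proj_mem span_0)
  have yF: "y \<in> F b" using p0(2) proj_mem[OF S[OF b], of y] by (simp add: q_def)
  then obtain z where z: "z \<in> span I" "y = proj (F b) z" using im[OF b] by auto
  have "y \<bullet> y = z \<bullet> y" using proj_inner_sym[OF S[OF b], of z y] z(2) proj_ident[OF S[OF b] yF] by simp
  also have "\<dots> = 0" using proj_orthogonal[OF subspace_span z(1), of x]
   by (simp add: y_def orthogonal_def inner_commute)
  finally show "x = 0" using \<open>?p x = 0\<close> by (simp add: y_def)
 qed
 have TI: "T b x = proj (F b) x" if "x \<in> span I" "b \<in> topspace B" for b x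
  using that linear_0[OF linear_proj[OF S]] by (simp add: T_def proj_ident)
 have Tim: "T b ` span I = F b" if b: "b \<in> topspace B" for b
  using im[OF b] TI[OF _ b] by (metis image_cong)
 have surj: "surj (T b)" if b: "b \<in> topspace B" for b
  by (rule linear_inj_imp_surj[OF lin[OF b] Tinj[OF b]])
 have Tinv: "inverse_map (T b) ` F b = span I" if b: "b \<in> topspace B" for b
  using Tim[OF b] inj_imp_inv_eq[OF Tinj[OF b]] image_inv_f_f[OF Tinj[OF b]] by metis
 have linv: "linear (inverse_map (T b))" if b: "b \<in> topspace B" for b
  by (rule inj_linear_imp_inv_linear[OF lin[OF b] Tinj[OF b]])
 have cT: "continuous_map B euclidean (\<lambda>b. T b u)" for u unfolding T_def
  by (intro continuous_map_add continuous_map_diff continuous_map_canonical_const vbD(3)[OF F])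
 have cT': "continuous_map B euclidean (\<lambda>b. inverse_map (T b) u)" for u
  by (rule cont_inverse_family[OF cT lin Tinj])
 have comp: "continuous_map (PB B G) euclidean (\<lambda>z. f (fst z))"
  if "continuous_map B euclidean f" for f :: "'a \<Rightarrow> real^'b" and G
  by (rule cm_comp[OF cont_bundle_fst that])
 define \<Phi> where "\<Phi> = (\<lambda>z. (fst z, T (fst z) ` snd z))"
 define \<Psi> where "\<Psi> = (\<lambda>z. (fst z, inverse_map (T (fst z)) ` snd z))"
 let ?P = "PB B (\<lambda>_. span I)" and ?Q = "PB B F"
 have B1: "fst z \<in> topspace B" if "z \<in> topspace ?P" for z using that by (auto simp: topspace_bundle)
 have B2: "fst z \<in> topspace B" if "z \<in> topspace ?Q" for z using that by (auto simp: topspace_bundle)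
 have nz: "T b u \<noteq> 0" if "b \<in> topspace B" "u \<noteq> 0" for b u
  using that linear_injective_0[OF lin] Tinj by blast
 have nz': "inverse_map (T b) u \<noteq> 0" if "b \<in> topspace B" "u \<noteq> 0" for b u
  using that surj_f_inv_f[OF surj] linear_0[OF lin] by metis
 have c1: "continuous_map ?P RP (\<lambda>z. T (fst z) ` snd z)"
  by (rule cont_line_image[OF cont_bundle_snd comp[OF cT]]) (use B1 lin nz in auto)
 have c2: "continuous_map ?Q RP (\<lambda>z. inverse_map (T (fst z)) ` snd z)"
  by (rule cont_line_image[OF cont_bundle_snd comp[OF cT']]) (use B2 linv nz' in auto)
 have \<Phi>: "continuous_map ?P ?Q \<Phi>" unfolding cont_bundle_iff
  using c1 Tim by (auto simp: \<Phi>_def comp_def cont_bundle_fst topspace_bundle)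
 have \<Psi>: "continuous_map ?Q ?P \<Psi>" unfolding cont_bundle_iff
  using c2 Tinv by (auto simp: \<Psi>_def comp_def cont_bundle_fst topspace_bundle)
 show ?thesis
 proof (rule LH_transfer[OF \<Phi> \<Psi> _ cont_bundle_fst cont_bundle_fst _ Z_taut Z_taut])
  show "\<Phi> (\<Psi> z) = z" if "z \<in> topspace ?Q" for z
   using image_f_inv_f[OF surj[OF B2[OF that]]] by (simp add: \<Phi>_def \<Psi>_def)
  show "cohS ?P (pull \<Phi> taut) taut" unfolding pull_pull
  proof (rule coh_sym, rule eta_natural[OF cont_bundle_snd _ _ comp[OF cT]])
   show "continuous_map ?P RP (snd \<circ> \<Phi>)" using c1 by (simp add: comp_def \<Phi>_def)
  qed (use B1 lin nz in \<open>auto simp: \<Phi>_def\<close>)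
  show "LH (Sing B) (Sing ?P) fst taut k" using LH_trivial[OF I(1,2)] I(3) by simp
 qed (simp add: \<Phi>_def)
qed

section \<open>Gluing the Leray-Hirsch property over open sets\<close>

abbreviation LH_over :: "'b topology \<Rightarrow> ('b \<Rightarrow> (real^'n) set) \<Rightarrow> nat \<Rightarrow> 'b set \<Rightarrow> bool" where
 "LH_over B F k W \<equiv> LH (Sing (subtopology B W)) (Sing (PB (subtopology B W) F)) fst taut k"

lemma bundle_subtopology:
 "PB (subtopology B W) F = subtopology (PB B F) {z. fst z \<in> W}" proof -
 have "(W \<times> UNIV) \<inter> {(b, L). L \<subseteq> F b} = {(b, L). L \<subseteq> F b} \<inter> {z. fst z \<in> W}" by auto
 thus ?thesis unfolding projective_bundle_def using subtopology_Times[of B RP W UNIV]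
  by (metis subtopology_UNIV subtopology_subtopology)
qed

lemma LH_iff_cone_bundle: "LH (Sing B) (Sing (PB B F)) fst taut k \<longleftrightarrow>
  LHcone (Sing B) (Sing (PB B F)) fst taut k"
 by (rule LH_iff_cone[OF sset_S sset_S maps_bundle_fst Z_taut])

lemma LH_union:
 assumes W: "openin B W1" "openin B W2" and L: "LH_over B F k W1" "LH_over B F k W2" "LH_over B F k (W1 \<inter> W2)"
 shows "LH_over B F k (W1 \<union> W2)" proof -
 let ?B = "subtopology B (W1 \<union> W2)"
 let ?P = "PB ?B F"
 let ?V = "\<lambda>W. {z :: _ \<times> (real^'b) set. fst z \<in> W}"
 have b: "Sing (subtopology ?B W) = Sing (subtopology B W)" if "W \<subseteq> W1 \<union> W2" for W
  using that by (simp add: subtopology_subtopology Int_absorb1)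
 have p: "Sing (subtopology ?P (?V W)) = Sing (PB (subtopology B W) F)" if "W \<subseteq> W1 \<union> W2" for W
  using that by (simp add: bundle_subtopology[symmetric] subtopology_subtopology Int_absorb1)
 have sb: "small ?B {W1, W2} = (\<lambda>p f. Sing (subtopology B W1) p f \<or> Sing (subtopology B W2) p f)"
  by (intro ext) (simp add: small_two b)
 have sp: "small ?P {?V W1, ?V W2} = (\<lambda>p f. Sing (PB (subtopology B W1) F) p f \<or> Sing (PB (subtopology B W2) F) p f)"
  by (intro ext) (simp add: small_two p)
 have ib: "(\<lambda>p f. Sing (subtopology B W1) p f \<and> Sing (subtopology B W2) p f) = Sing (subtopology B (W1 \<inter> W2))"
  by (intro ext) (auto simp: Sing_def singular_simplex_subtopology)
 have ip: "(\<lambda>p f. Sing (PB (subtopology B W1) F) p f \<and> Sing (PB (subtopology B W2) F) p f) =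
   Sing (PB (subtopology B (W1 \<inter> W2)) F)"
  by (intro ext) (auto simp: Sing_def bundle_subtopology singular_simplex_subtopology)
 have cone: "LHcone (small ?B {W1, W2}) (small ?P {?V W1, ?V W2}) fst taut k" unfolding sb sp
  by (rule LHcone_union_small; (unfold ib ip)?)
   (use L[unfolded LH_iff_cone_bundle] in \<open>simp_all add: maps_bundle_fst Z_taut\<close>)
 have q: "maps fst (small ?P {?V W1, ?V W2}) (small ?B {W1, W2})"
  unfolding sb sp maps_def using maps_bundle_fst[of "subtopology B W1" F, unfolded maps_def]
   maps_bundle_fst[of "subtopology B W2" F, unfolded maps_def] by blast
 have oB: "openin ?B W1" "openin ?B W2" using W by (auto simp: openin_open_subtopology openin_Un)
 have oP: "openin ?P (topspace ?P \<inter> fst -` W)" if "openin ?B W" for W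
  using openin_continuous_map_preimage[OF cont_bundle_fst that] by (simp add: Int_def vimage_def)
 have "subtopology ?P (topspace ?P \<inter> fst -` W) = subtopology ?P (?V W)" for W
  by (simp add: subtopology_restrict vimage_def)
 hence V: "small ?P {topspace ?P \<inter> fst -` W1, topspace ?P \<inter> fst -` W2} = small ?P {?V W1, ?V W2}"
  by (intro ext) (simp add: small_two)
 have "LHcone (Sing ?B) (Sing ?P) fst taut k"
 proof (rule LHcone_small[where \<C> = "{W1, W2}" and \<D> = "{topspace ?P \<inter> fst -` W1, topspace ?P \<inter> fst -` W2}", OF maps_bundle_fst _ Z_taut])
  show "topspace ?P \<subseteq> \<Union>{topspace ?P \<inter> fst -` W1, topspace ?P \<inter> fst -` W2}"
   by (auto simp: topspace_bundle)
  show "openin ?P V" if "V \<in> {topspace ?P \<inter> fst -` W1, topspace ?P \<inter> fst -` W2}" for V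
   using that oP[OF oB(1)] oP[OF oB(2)] by blast
  show "openin ?B V" if "V \<in> {W1, W2}" for V using that oB by blast
  show "topspace ?B \<subseteq> \<Union>{W1, W2}" by auto
 qed (unfold V, rule q, rule cone)
 thus ?thesis by (simp only: LH_iff_cone_bundle)
qed

text \<open>The property is demanded on every open subset, for then it passes to unions of two open
  sets. There are finitely many coordinate subspaces of dimension \<open>k\<close>, hence finitely
  many charts, over any base.\<close>

theorem LH_vector_bundle:
 fixes F :: "'b \<Rightarrow> (real^'n) set"
 assumes F: "vector_bundle B F k" and k: "0 < k"
 shows "LH (Sing B) (Sing (PB B F)) fst taut k" proof -
 define hered where "hered = (\<lambda>W. \<forall>V. openin B V \<longrightarrow> V \<subseteq> W \<longrightarrow> LH_over B F k V)"
 define \<I> where "\<I> = {I. I \<subseteq> (Basis :: (real^'n) set) \<and> card I = k}"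
 \<comment> \<open>Invertibility of \<open>T I b\<close> is an open condition, and it makes the
   projection from \<open>span I\<close> to \<open>F b\<close> injective.\<close>
 define T where "T = (\<lambda>I b x. proj (F b) (proj (span I) x) + (x - proj (span I) x))"
 define U where "U = (\<lambda>I. {b \<in> topspace B. det (matrix (T I b)) \<noteq> 0})"
 note S = vbD(1)[OF F]
 have lin: "linear (T I b)" if b: "b \<in> topspace B" for b I unfolding T_def
  using linear_compose[OF linear_proj[OF subspace_span] linear_proj[OF S[OF b]], of I]
  by (intro linear_compose_add linear_compose_sub linear_ident linear_proj subspace_span) (simp add: comp_def)
 have oU: "openin B (U I)" for I unfolding U_def
  by (rule open_nonzero, rule cont_matrix_family, unfold T_def)
   (intro continuous_map_add continuous_map_canonical_const vbD(3)[OF F])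
 have fin: "finite \<I>" unfolding \<I>_def by (rule finite_subset[of _ "Pow Basis"]) auto
 have empty: "LH_over B F k {}" proof -
  have "\<not> Sing (subtopology B {}) p f" "\<not> Sing (PB (subtopology B {}) F) p f'" for p f f'
   unfolding Sing_def by (rule singular_simplex_empty, simp add: topspace_bundle)+
  thus ?thesis unfolding LH_def coh_def eqK_def Z_def by blast
 qed
 have U: "hered (U I)" if I: "I \<in> \<I>" for I unfolding hered_def proof (intro allI impI)
  fix V assume V: "openin B V" "V \<subseteq> U I"
  show "LH_over B F k V" proof (rule LH_chart[OF vb_subtopology[OF F]])
   show "I \<subseteq> Basis" "card I = k" "I \<noteq> {}" using I k by (auto simp: \<I>_def)
   fix b assume "b \<in> topspace (subtopology B V)"
   hence b: "b \<in> topspace B" "det (matrix (T I b)) \<noteq> 0" using V by (auto simp: U_def)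
   hence "inj (T I b)" using det_nz_iff_inj[OF lin[OF b(1)]] by simp
   hence i: "inj_on (T I b) (span I)" by (rule inj_on_subset) simp
   show "inj_on (proj (F b)) (span I)"
    by (rule inj_on_cong[THEN iffD1, OF _ i]) (simp add: T_def proj_ident)
  qed
 qed
 have un: "hered (W1 \<union> W2)" if "openin B W1" "openin B W2" "hered W1" "hered W2" for W1 W2
  unfolding hered_def proof (intro allI impI)
  fix V assume V: "openin B V" "V \<subseteq> W1 \<union> W2"
  have "LH_over B F k ((V \<inter> W1) \<union> (V \<inter> W2))" proof (rule LH_union)
   show o: "openin B (V \<inter> W1)" "openin B (V \<inter> W2)" using V that by (auto intro: openin_Int)
   hence "openin B (V \<inter> W1 \<inter> (V \<inter> W2))" by (rule openin_Int)
   moreover have "V \<inter> W1 \<inter> (V \<inter> W2) \<subseteq> W1" by blast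
   ultimately show "LH_over B F k (V \<inter> W1 \<inter> (V \<inter> W2))" using that(3) unfolding hered_def by blast
   show "LH_over B F k (V \<inter> W1)" "LH_over B F k (V \<inter> W2)"
    using that(3,4) o unfolding hered_def by blast+
  qed
  moreover have "(V \<inter> W1) \<union> (V \<inter> W2) = V" using V by auto
  ultimately show "LH_over B F k V" by simp
 qed
 have "hered (\<Union>I\<in>J. U I)" if "J \<subseteq> \<I>" for J using finite_subset[OF that fin] that
 proof (induction J rule: finite_induct)
  case empty
  thus ?case using \<open>LH_over B F k {}\<close> by (simp add: hered_def)
 next
  case (insert I J)
  have "hered (U I \<union> (\<Union>I\<in>J. U I))" by (rule un[OF oU]) (use oU insert U in auto)
  thus ?case by simp
 qed
 from this[of \<I>] have h: "hered (\<Union>I\<in>\<I>. U I)" by simp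
 have "topspace B \<subseteq> (\<Union>I\<in>\<I>. U I)" proof
  fix b assume b: "b \<in> topspace B"
  let ?f = "proj (F b)"
  note lf = linear_proj[OF S[OF b]]
  \<comment> \<open>The projections of the basis vectors span the fibre; a basis selected from them
    names the coordinate subspace of a chart around \<open>b\<close>.\<close>
  obtain C where C: "C \<subseteq> ?f ` Basis" "independent C" "?f ` Basis \<subseteq> span C" by (rule maximal_independent_subset)
  then obtain I where I: "I \<subseteq> Basis" "inj_on ?f I" "C = ?f ` I" unfolding subset_image_inj by blast
  have "?f ` span Basis \<subseteq> span C" using linear_span_image[OF lf, of Basis] span_minimal[OF C(3)] by auto
  moreover have "?f ` UNIV = F b"
   using proj_mem[OF S[OF b]] proj_ident[OF S[OF b]] by (metis image_subset_iff rangeI subsetI subset_antisym)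
  ultimately have "F b \<subseteq> span C" by simp
  moreover have "span C \<subseteq> F b" using C(1) proj_mem[OF S[OF b]] by (intro span_minimal S b) auto
  ultimately have "span C = F b" by simp
  hence "card C = k" using vbD(2)[OF F b] dim_span[of C] C(2) by (simp add: dim_eq_card_independent)
  hence cI: "card I = k" using I by (simp add: card_image)
  have inj: "inj_on ?f (span I)" using linear_inj_on_span_independent_image[OF lf] C(2) I by simp
  let ?p = "proj (span I)"
  have im: "?f ` span I = F b" using linear_span_image[OF lf, of I] I(3) \<open>span C = F b\<close> by simp
  have "inj (T I b)" unfolding linear_injective_0[OF lin[OF b]] proof (intro allI impI)
   fix x assume 0: "T I b x = 0"
   define y where "y = x - ?p x"
   have y: "y = - ?f (?p x)" using 0 by (simp add: T_def y_def add_eq_0_iff)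
   hence yF: "y \<in> F b" using subspace_neg[OF S[OF b] proj_mem[OF S[OF b]]] by simp
   then obtain z where z: "z \<in> span I" "y = ?f z" using im by auto
   have "y \<bullet> y = z \<bullet> y" using proj_inner_sym[OF S[OF b], of z y] z(2) proj_ident[OF S[OF b] yF] by simp
   also have "\<dots> = 0" using proj_orthogonal[OF subspace_span z(1), of x]
    by (simp add: y_def orthogonal_def inner_commute)
   finally have y0: "y = 0" by simp
   have "?p x = 0" using inj_onD[OF inj, of "?p x" 0] y y0 linear_0[OF lf] by (simp add: proj_mem span_0)
   thus "x = 0" using y0 by (simp add: y_def)
  qed
  hence "b \<in> U I" using b det_nz_iff_inj[OF lin[OF b]] by (simp add: U_def)
  thus "b \<in> (\<Union>I\<in>\<I>. U I)" using I cI by (auto simp: \<I>_def)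
 qed
 hence "LH_over B F k (topspace B)" using h openin_topspace unfolding hered_def by blast
 thus ?thesis by simp
qed

subsection \<open>Stiefel--Whitney classes\<close>

definition whitney_sum :: "nat \<Rightarrow> (nat \<Rightarrow> 'b cochain) \<Rightarrow> ('b \<times> (real^'n) set) cochain" where
 "whitney_sum k w = (\<Sum>i\<le>k. pull fst (w i) \<smile> cpow taut (k - i))"

text \<open>The defining relation on the level of cocycles. The \<open>w i\<close> may have
  components in all degrees; \<open>sw_homog\<close> extracts the homogeneous ones when the given
  classes are reached.\<close>

definition sw :: "'b topology \<Rightarrow> ('b \<Rightarrow> (real^'n) set) \<Rightarrow> nat \<Rightarrow> (nat \<Rightarrow> 'b cochain) \<Rightarrow> bool" where
 "sw B F k w \<longleftrightarrow> cohS B (w 0) unit \<and> (\<forall>i. ZS B (w i)) \<and> (\<forall>i>k. w i = 0) \<and>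
   cohS (PB B F) (whitney_sum k w) 0"

lemma whitney_sum_lh:
 "whitney_sum k w = pull fst (w 0) \<smile> cpow taut k + lh fst taut k (\<lambda>j. w (k - j))" proof -
 let ?g = "\<lambda>j. pull fst (w (k - j)) \<smile> cpow taut j"
 have "(\<Sum>i<k. pull fst (w (Suc i)) \<smile> cpow taut (k - Suc i)) = (\<Sum>i<k. ?g (k - Suc i))"
  by (rule sum.cong) simp_all
 also have "\<dots> = lh fst taut k (\<lambda>j. w (k - j))" unfolding lh_def by (rule sum.nat_diff_reindex)
 finally show ?thesis unfolding whitney_sum_def by (simp add: sum.atMost_shift)
qed

lemma LH_independent:
 assumes "LH M K q h k" "\<And>i. Z M (a i)" "coh K (lh q h k a) 0" "i < k"
 shows "coh M (a i) 0" using assms unfolding LH_def by simp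

lemma coh_top:
 assumes "cohS B a b"
 shows "cohS (PB B F) (pull fst a \<smile> cpow taut k) (pull fst b \<smile> cpow taut k)"
 by (rule coh_smile_left[OF sset_S Z_cpow[OF sset_S Z_taut] coh_pull[OF maps_bundle_fst assms]])

lemma coh_unit_top:
 assumes "cohS B a unit"
 shows "cohS (PB B F) (pull fst a \<smile> cpow taut k) (cpow taut k)"
 by (rule coh_trans[OF coh_top[OF assms, unfolded pull_unit] eqK_coh[OF unit_smile[OF sset_S]]])

lemma sw_exists:
 assumes F: "vector_bundle B F k" and k: "0 < k"
 obtains w where "sw B F k w" proof -
 let ?P = "Sing (PB B F)"
 obtain a where a: "\<forall>i<k. ZS B (a i)" "coh ?P (cpow taut k) (lh fst taut k a)"
  using LH_vector_bundle[OF F k] Z_cpow[OF sset_S Z_taut] unfolding LH_def by blast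
 define w where "w = (\<lambda>i. if i = 0 then unit else if i \<le> k then a (k - i) else 0)"
 have e: "lh fst taut k (\<lambda>j. w (k - j)) = lh fst taut k a"
  unfolding lh_def by (rule sum.cong) (auto simp: w_def)
 have "coh ?P (whitney_sum k w) (cpow taut k + lh fst taut k a)"
  unfolding whitney_sum_lh e by (intro coh_add coh_unit_top coh_refl) (simp add: w_def)
 moreover have "coh ?P (cpow taut k + lh fst taut k a) 0" using a(2) by (simp only: coh_add_0)
 ultimately have "coh ?P (whitney_sum k w) 0" by (rule coh_trans)
 hence "sw B F k w" unfolding sw_def using a(1) k by (simp add: w_def)
 thus thesis by (rule that)
qed

lemma sw_unique:
 assumes F: "vector_bundle B F k" and k: "0 < k" and v: "sw B F k v" and w: "sw B F k w"
 shows "cohS B (v i) (w i)" proof -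
 let ?P = "Sing (PB B F)"
 have sum: "coh ?P (cpow taut k) (lh fst taut k (\<lambda>j. v (k - j)))" if v: "sw B F k v" for v proof -
  have "coh ?P (cpow taut k + lh fst taut k (\<lambda>j. v (k - j))) (whitney_sum k v)"
   unfolding whitney_sum_lh by (intro coh_add coh_refl coh_sym[OF coh_unit_top]) (use v in \<open>simp add: sw_def\<close>)
  moreover have "coh ?P (whitney_sum k v) 0" using v by (simp add: sw_def)
  ultimately have "coh ?P (cpow taut k + lh fst taut k (\<lambda>j. v (k - j))) 0" by (rule coh_trans)
  thus ?thesis by (simp only: coh_add_0)
 qed
 have "coh ?P (lh fst taut k (\<lambda>j. v (k - j))) (lh fst taut k (\<lambda>j. w (k - j)))"
  by (rule coh_trans[OF coh_sym[OF sum[OF v]] sum[OF w]])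
 hence 0: "coh ?P (lh fst taut k (\<lambda>j. v (k - j) + w (k - j))) 0" by (simp only: lh_add coh_add_0)
 have "ZS B (v (k - j) + w (k - j))" for j using v w by (auto simp: sw_def intro: Z_add)
 from LH_independent[OF LH_vector_bundle[OF F k] this 0]
 have *: "cohS B (v (k - j) + w (k - j)) 0" if "j < k" for j using that .
 consider "i = 0" | "i > k" | "0 < i" "i \<le> k" by linarith
 thus ?thesis proof cases
  case 1
  have "cohS B (v 0) unit" "cohS B (w 0) unit" using v w by (simp_all add: sw_def)
  from coh_trans[OF this(1) coh_sym[OF this(2)]] 1 show ?thesis by simp
 next
  case 2
  thus ?thesis using v w by (simp add: sw_def)
 next
  case 3
  thus ?thesis using *[of "k - i"] by (simp add: coh_add_0)
 qed
qed

lemma sw_pull: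
 fixes F :: "'b \<Rightarrow> (real^'n) set"
 assumes g: "continuous_map X B g" and w: "sw B F k w"
 shows "sw X (\<lambda>x. F (g x)) k (\<lambda>i. pull g (w i))" proof -
 let ?P = "PB X (\<lambda>x. F (g x))"
 define g' where "g' = (\<lambda>z. (g (fst z), snd z :: (real^'n) set))"
 have c: "continuous_map ?P (PB B F) g'"
  using continuous_map_compose[OF cont_bundle_fst g]
  unfolding cont_bundle_iff g'_def
  by (auto simp: comp_def cont_bundle_snd topspace_bundle)
 have "pull g' (whitney_sum k w) = whitney_sum k (\<lambda>i. pull g (w i))"
  by (simp add: whitney_sum_def pull_sum pull_smile pull_cpow pull_pull g'_def comp_def)
 moreover have "cohS ?P (pull g' (whitney_sum k w)) (pull g' 0)"
  by (rule coh_pull[OF maps_Sing[OF c]]) (use w in \<open>simp add: sw_def\<close>)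
 moreover have "cohS X (pull g (w 0)) (pull g unit)"
  by (rule coh_pull[OF maps_Sing[OF g]]) (use w in \<open>simp add: sw_def\<close>)
 ultimately show ?thesis using w Z_pull[OF maps_Sing[OF g]] by (simp add: sw_def)
qed

text \<open>The product of \<open>v\<close> with the total class \<open>1 + x\<close> of a
  line.\<close>

definition whitney_line :: "'b cochain \<Rightarrow> (nat \<Rightarrow> 'b cochain) \<Rightarrow> nat \<Rightarrow> 'b cochain" where
 "whitney_line x v i = v i + (if i = 0 then 0 else x \<smile> v (i - 1))"

text \<open>Whitney's formula for adding a line. The Whitney polynomial \<open>A\<close> of
  \<open>F1\<close> vanishes where lines project injectively to \<open>F1\<close>, and
  \<open>C\<close> where they project injectively to \<open>L\<close>. By \<open>dec\<close> these
  open sets cover the projective bundle, so the product of \<open>A\<close> and \<open>C\<close> is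
  zero.\<close>

lemma sw_whitney_line:
 fixes F1 :: "'b \<Rightarrow> (real^'n) set"
 assumes F1: "vector_bundle B F1 k" and L: "continuous_map B RP L"
  and dec: "\<And>b u. b \<in> topspace B \<Longrightarrow> u \<in> F b \<Longrightarrow> u = proj (F1 b) u + proj (L b) u"
  and v: "sw B F1 k v"
 shows "sw B F (Suc k) (whitney_line (pull L eta) v)" proof -
 let ?P = "PB B F"
 define x where "x = pull L eta"
 have Zx: "ZS B x" unfolding x_def by (rule Z_pull[OF maps_Sing[OF L] Z_eta])
 have cx: "concentrated 1 x" unfolding x_def by (rule conc_pull[OF conc_eta])
 have LR: "b \<in> topspace B \<Longrightarrow> L b \<in> topspace RP" for b using L by (auto dest: continuous_map_funspace)
 have Zv: "ZS B (v i)" for i using v by (simp add: sw_def)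
 have Lb: "subspace (L b)" if "b \<in> topspace B" for b using LR[OF that] by simp
 have B: "fst z \<in> topspace B" "snd z \<in> topspace RP" "snd z \<subseteq> F (fst z)" if "z \<in> topspace ?P" for z
  using that by (auto simp: topspace_bundle)
 have cL: "continuous_map B euclidean (\<lambda>b. proj (L b) u)" for u
  by (rule cm_comp[OF L cont_proj_line[of u]])
 have comp: "continuous_map ?P euclidean (\<lambda>z. f (fst z))" if "continuous_map B euclidean f" for f :: "'b \<Rightarrow> real^'n"
  by (rule cm_comp[OF cont_bundle_fst that])
 have c1: "continuous_map ?P euclidean (\<lambda>z. proj (F1 (fst z)) (proj (snd z) u))" for u
  by (rule cont_linear_family[of _ "\<lambda>z. proj (F1 (fst z))" "\<lambda>z. proj (snd z) u"])
   (use B vbD(1)[OF F1] comp[OF vbD(3)[OF F1]] in \<open>auto intro: linear_proj cont_proj_snd\<close>)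
 have c2: "continuous_map ?P euclidean (\<lambda>z. proj (L (fst z)) (proj (snd z) u))" for u
  by (rule cont_linear_family[of _ "\<lambda>z. proj (L (fst z))" "\<lambda>z. proj (snd z) u"])
   (use B Lb comp[OF cL] in \<open>auto intro: linear_proj cont_proj_snd\<close>)
 let ?W1 = "\<Union>u. {z \<in> topspace ?P. proj (F1 (fst z)) (proj (snd z) u) \<noteq> 0}"
 let ?W2 = "\<Union>u. {z \<in> topspace ?P. proj (L (fst z)) (proj (snd z) u) \<noteq> 0}"
 have oW: "openin ?P ?W1" "openin ?P ?W2"
  by (intro openin_Union; use open_nonzero[OF c1] open_nonzero[OF c2] in blast)+
 have nz: "T w \<noteq> 0" if z: "snd z \<in> topspace RP" and T: "linear T" "T (proj (snd z) u) \<noteq> 0"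
  and w: "w \<in> snd z" "w \<noteq> 0" for T :: "real^'n \<Rightarrow> real^'n" and z :: "'b \<times> (real^'n) set" and u w
 proof
  assume 0: "T w = 0"
  have "proj (snd z) u \<in> span {w}" using RP_eq_span[OF z w] proj_mem[OF RP_subspace[OF z]] by simp
  then obtain c where "proj (snd z) u = c *\<^sub>R w" by (auto simp: span_singleton)
  thus False using T 0 by (simp add: linear_scale)
 qed
 define A :: "('b \<times> (real^'n) set) cochain" where "A = whitney_sum k v"
 define C :: "('b \<times> (real^'n) set) cochain" where "C = taut + pull fst x"
 have ZA: "ZS ?P A" unfolding A_def whitney_sum_def
  by (intro Z_sum Z_smile sset_S Z_cpow Z_taut Z_pull[OF maps_bundle_fst] Zv)
 have ZC: "ZS ?P C" unfolding C_def by (intro Z_add Z_taut Z_pull[OF maps_bundle_fst] Zx)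
 have A0: "cohS (subtopology ?P ?W1) A 0" proof -
  define S where "S = subtopology ?P ?W1"
  define r where "r = (\<lambda>z. (fst z, proj (F1 (fst z)) ` snd z))"
  have X: "z \<in> topspace ?P" "\<exists>u. proj (F1 (fst z)) (proj (snd z) u) \<noteq> 0" if "z \<in> topspace S" for z using that by (auto simp: S_def)
  have lin: "linear (proj (F1 (fst z)))" if "z \<in> topspace S" for z
   using B(1)[OF X(1)[OF that]] vbD(1)[OF F1] by (intro linear_proj) auto
  have n: "proj (F1 (fst z)) u \<noteq> 0" if z: "z \<in> topspace S" and u: "u \<in> snd z" "u \<noteq> 0" for z u
   using nz[OF B(2)[OF X(1)[OF z]] lin[OF z] _ u] X(2)[OF z] by blast
  have cX: "continuous_map S euclidean (\<lambda>z. proj (F1 (fst z)) u)" for u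
   unfolding S_def by (rule continuous_map_from_subtopology[OF comp[OF vbD(3)[OF F1]]])
  have cs: "continuous_map S RP snd"
   unfolding S_def by (rule continuous_map_from_subtopology[OF cont_bundle_snd])
  have c2': "continuous_map S RP (snd \<circ> r)"
   unfolding r_def comp_def snd_conv by (rule cont_line_image[OF cs cX lin n])
  have "continuous_map S B (fst \<circ> r)"
   unfolding r_def comp_def fst_conv S_def by (rule continuous_map_from_subtopology[OF cont_bundle_fst])
  hence cr: "continuous_map S (PB B F1) r" unfolding cont_bundle_iff
  proof (intro conjI ballI)
   show "snd (r z) \<subseteq> F1 (fst (r z))" if z: "z \<in> topspace S" for z
    using proj_mem[OF vbD(1)[OF F1 B(1)[OF X(1)[OF z]]]] by (auto simp: r_def)
  qed (assumption, rule c2')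
  have t: "cohS S taut (pull r taut)" unfolding pull_pull
   by (rule eta_natural[OF cs c2' lin cX]) (use n in \<open>auto simp: r_def\<close>)
  have "cohS S A (pull r A)" unfolding A_def whitney_sum_def pull_sum pull_smile pull_cpow
  proof (intro coh_sum coh_smile sset_S)
   fix i
   have m: "maps fst (Sing S) (Sing B)"
    unfolding S_def by (rule maps_Sing[OF continuous_map_from_subtopology[OF cont_bundle_fst]])
   have Zt: "ZS S taut" by (rule Z_pull[OF maps_Sing[OF cs] Z_eta])
   show "ZS S (pull fst (v i))" by (rule Z_pull[OF m Zv])
   show "ZS S (cpow taut (k - i))" by (rule Z_cpow[OF sset_S Zt])
   show "cohS S (cpow taut (k - i)) (cpow (pull r taut) (k - i))"
    by (rule coh_cpow[OF sset_S Zt t])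
   show "cohS S (pull fst (v i)) (pull r (pull fst (v i)))" by (simp add: pull_pull comp_def r_def)
  qed
  moreover have "cohS (PB B F1) (A :: ('b \<times> (real^'n) set) cochain) 0"
   using v by (simp add: sw_def A_def)
  from coh_pull[OF maps_Sing[OF cr] this] have "cohS S (pull r A) 0" by simp
  ultimately have "cohS S A 0" by (rule coh_trans)
  thus ?thesis by (simp only: S_def)
 qed
 have C0: "cohS (subtopology ?P ?W2) C 0" proof -
  define S where "S = subtopology ?P ?W2"
  have X: "z \<in> topspace ?P" "\<exists>u. proj (L (fst z)) (proj (snd z) u) \<noteq> 0" if "z \<in> topspace S" for z using that by (auto simp: S_def)
  have lin: "linear (proj (L (fst z)))" if "z \<in> topspace S" for z
   using B(1)[OF X(1)[OF that]] Lb by (intro linear_proj) auto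
  have n: "proj (L (fst z)) u \<noteq> 0" if z: "z \<in> topspace S" and u: "u \<in> snd z" "u \<noteq> 0" for z u
   using nz[OF B(2)[OF X(1)[OF z]] lin[OF z] _ u] X(2)[OF z] by blast
  have mem: "proj (L (fst z)) u \<in> L (fst z)" if z: "z \<in> topspace S" for z u
   by (rule proj_mem[OF Lb[OF B(1)[OF X(1)[OF z]]]])
  have cs: "continuous_map S RP snd"
   unfolding S_def by (rule continuous_map_from_subtopology[OF cont_bundle_snd])
  have "continuous_map S RP (L \<circ> fst)"
   unfolding S_def by (rule continuous_map_from_subtopology[OF continuous_map_compose[OF cont_bundle_fst L]])
  hence "cohS S taut (pull (L \<circ> fst) eta)"
   by (rule eta_natural[OF cs _ lin continuous_map_from_subtopology[OF comp[OF cL], of ?W2, folded S_def]])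
    (use n mem in auto)
  thus ?thesis unfolding C_def coh_add_0 x_def pull_pull S_def .
 qed
 have "cohS (subtopology ?P (?W1 \<union> ?W2)) (A \<smile> C) 0"
  by (rule cover_smile[OF oW ZA ZC A0 C0])
 moreover have "topspace ?P \<subseteq> ?W1 \<union> ?W2" proof
  fix z assume z: "z \<in> topspace ?P"
  let ?u = "sect (snd z)"
  have u: "?u \<in> snd z" "?u \<noteq> 0" using sect[OF B(2)[OF z]] by auto
  have "proj (snd z) ?u = ?u" by (rule proj_ident[OF RP_subspace[OF B(2)[OF z]] u(1)])
  moreover have "?u = proj (F1 (fst z)) ?u + proj (L (fst z)) ?u"
   using dec[OF B(1)[OF z]] u(1) B(3)[OF z] by blast
  ultimately have "proj (F1 (fst z)) (proj (snd z) ?u) \<noteq> 0 \<or> proj (L (fst z)) (proj (snd z) ?u) \<noteq> 0"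
   using u(2) by auto
  thus "z \<in> ?W1 \<union> ?W2" using z by blast
 qed
 hence "subtopology ?P (?W1 \<union> ?W2) = ?P" by (rule subtopology_superset)
 ultimately have AC: "cohS ?P (A \<smile> C) 0" by simp
 have "cohS ?P (whitney_sum (Suc k) (whitney_line x v)) (A \<smile> C)" proof -
  let ?t = "\<lambda>i. pull fst (v i) \<smile> cpow taut (k - i)"
  have vk: "v (Suc k) = 0" using v by (simp add: sw_def)
  have s1: "(\<Sum>i\<le>Suc k. pull fst (v i) \<smile> cpow taut (Suc k - i)) = (\<Sum>i\<le>k. ?t i \<smile> taut)"
  proof -
   have "(\<Sum>i\<le>k. pull fst (v i) \<smile> cpow taut (Suc k - i)) = (\<Sum>i\<le>k. ?t i \<smile> taut)"
    by (rule sum.cong) (simp_all add: Suc_diff_le smile_assoc)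
   thus ?thesis by (simp add: vk)
  qed
  have s2: "(\<Sum>i\<le>Suc k. pull fst (if i = 0 then 0 else x \<smile> v (i - 1)) \<smile> cpow taut (Suc k - i)) =
    (\<Sum>i\<le>k. pull fst x \<smile> ?t i)"
   unfolding sum.atMost_Suc_shift by (simp add: pull_smile smile_assoc)
  have "whitney_sum (Suc k) (whitney_line x v) = A \<smile> taut + pull fst x \<smile> A"
   unfolding whitney_sum_def whitney_line_def pull_add smile_add_left sum.distrib s1 s2 A_def
   by (simp only: smile_sum_left smile_sum_right)
  moreover have "cohS ?P (pull fst x \<smile> A) (A \<smile> pull fst x)"
   by (rule coh_sym, rule deg1_central[OF sset_S conc_pull[OF cx] Z_pull[OF maps_bundle_fst Zx] ZA])
  ultimately show ?thesis unfolding C_def smile_add_right by (simp add: coh_add)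
 qed
 from coh_trans[OF this AC] have "cohS ?P (whitney_sum (Suc k) (whitney_line x v)) 0" .
 moreover have "\<forall>i>Suc k. whitney_line x v i = 0" using v by (simp add: sw_def whitney_line_def)
 moreover have "\<forall>i. ZS B (whitney_line x v i)"
  unfolding whitney_line_def by (simp add: Z_add Zv Z_smile Zx)
 ultimately show ?thesis using v unfolding sw_def x_def[symmetric] by (simp add: whitney_line_def)
qed

lemma sw_zero: "sw B (\<lambda>_. {0}) 0 (\<lambda>i. if i = 0 then unit else 0)" proof -
 have "topspace (PB B (\<lambda>_. {0 :: real^'n})) = {}"
  using sect by (fastforce simp: topspace_bundle)
 hence "\<not> Sing (PB B (\<lambda>_. {0 :: real^'n})) p f" for p f
  unfolding Sing_def by (rule singular_simplex_empty)
 thus ?thesis by (auto simp: sw_def coh_def eqK_def)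
qed

lemma sw_trivial: "sw B (\<lambda>_. UNIV :: (real^'n) set) (CARD('n)) (\<lambda>i. if i = 0 then unit else 0)"
proof -
 let ?w = "\<lambda>i :: nat. if i = 0 then unit else 0 :: 'b cochain"
 have e: "whitney_sum (CARD('n)) ?w = pull fst unit \<smile> (cpow taut (CARD('n)) :: ('b \<times> (real^'n) set) cochain)"
  unfolding whitney_sum_lh lh_def by (simp del: pull_unit)
 have c1: "cohS (PB B (\<lambda>_. UNIV :: (real^'n) set)) (pull fst unit \<smile> cpow taut (CARD('n))) (cpow taut (CARD('n)))"
  by (rule coh_unit_top[OF coh_refl])
 have c2: "cohS (PB B (\<lambda>_. UNIV :: (real^'n) set)) (cpow taut (CARD('n))) 0"
  using taut_nilpotent[of "Basis :: (real^'n) set" B] by simp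
 have "cohS (PB B (\<lambda>_. UNIV :: (real^'n) set)) (whitney_sum (CARD('n)) ?w) 0"
  unfolding e by (rule coh_trans[OF c1 c2])
 thus ?thesis unfolding sw_def by simp
qed

subsection \<open>The canonical bundle over the oriented Grassmannian\<close>

text \<open>A matrix viewed as the linear map that takes the standard basis to its rows; frames are
  the injective ones.\<close>

abbreviation vmap :: "real^'n^'k \<Rightarrow> real^'k \<Rightarrow> real^'n" where "vmap M c \<equiv> c v* M"

lemma linear_vmap: "linear (vmap M)" using matrix_vector_mul_linear[of "transpose M"] by simp

lemma vmap_axis: "vmap M (axis i 1) = M $ i"
 by (simp add: vec_eq_iff vector_matrix_mult_def axis_def if_distrib[of "\<lambda>x. x * _"] cong: if_cong)

lemma row_nth: "row i M = M $ i" by (simp add: row_def vec_eq_iff)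

lemma vmap_Basis: "vmap M ` Basis = rows M" proof -
 have B: "(Basis :: (real^'b) set) = range (\<lambda>i. axis i 1)" by (auto simp: Basis_vec_def)
 show ?thesis unfolding B rows_def image_image by (auto simp: row_nth vmap_axis)
qed

lemma span_rows: "span (rows M) = range (vmap M)"
 using linear_span_image[OF linear_vmap, of M Basis] by (simp add: vmap_Basis)

lemma frames_iff: fixes M :: "real^'n^'k" shows "M \<in> frames \<longleftrightarrow> inj (vmap M)" proof
 assume M: "M \<in> frames"
 have i: "inj_on (vmap M) Basis" proof (rule inj_onI)
  fix x y :: "real^'k" assume "x \<in> Basis" "y \<in> Basis" "vmap M x = vmap M y"
  moreover then obtain i j where "x = axis i 1" "y = axis j 1" by (auto simp: Basis_vec_def)
  moreover have "inj (\<lambda>i. M $ i)" using M by (simp add: frames_def row_nth)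
  ultimately show "x = y" by (simp add: vmap_axis inj_eq)
 qed
 have "inj_on (vmap M) (span Basis)"
  using linear_inj_on_span_independent_image[OF linear_vmap _ i] M by (simp add: vmap_Basis frames_def)
 thus "inj (vmap M)" by simp
next
 assume i: "inj (vmap M)"
 have "independent (rows M)" unfolding vmap_Basis[symmetric]
  by (rule linear_independent_injective_image[OF linear_vmap independent_Basis]) (use i in simp)
 moreover have "inj (\<lambda>j. row j M)" proof (rule injI)
  fix j k assume "row j M = row k M"
  hence "vmap M (axis j 1) = vmap M (axis k 1)" by (simp only: vmap_axis row_nth)
  hence "axis j 1 = (axis k 1 :: real^'k)" using i by (rule injD[rotated])
  thus "j = k" by (simp add: axis_eq_axis)
 qed
 ultimately show "M \<in> frames" by (simp add: frames_def)
qed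

lemma vmap_mult: "vmap (A ** M) c = vmap M (vmap A c)" by (simp add: vector_matrix_mul_assoc)

lemma inj_vmap_iff: "inj (vmap A) \<longleftrightarrow> det A \<noteq> 0" for A :: "real^'k^'k" proof -
 have "matrix (vmap A) = transpose A" using matrix_of_matrix_vector_mul[of "transpose A"] by simp
 thus ?thesis using det_nz_iff_inj[OF linear_vmap, of A] by (simp add: det_transpose)
qed

lemma frames_mult: "M \<in> frames \<Longrightarrow> det A \<noteq> 0 \<Longrightarrow> A ** M \<in> frames"
 unfolding frames_iff using inj_compose[of "vmap M" "vmap A"] by (simp add: comp_def vmap_mult inj_vmap_iff)

lemma span_rows_mult: fixes M :: "real^'n^'k" shows "span (rows (A ** M)) \<subseteq> span (rows M)"
 unfolding span_rows by (auto simp: vmap_mult)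

lemma frames_same_span:
 fixes M N :: "real^'n^'k"
 assumes N: "N \<in> frames" and sub: "span (rows N) \<subseteq> span (rows M)"
 obtains A where "det A \<noteq> 0" "N = A ** M" proof -
 have "\<exists>c. N $ i = vmap M c" for i proof -
  have "N $ i \<in> range (vmap N)" by (rule range_eqI[of _ _ "axis i 1"]) (rule vmap_axis[symmetric])
  hence "N $ i \<in> range (vmap M)" using sub unfolding span_rows by (rule subsetD[rotated])
  thus ?thesis by (simp only: image_iff) blast
 qed
 hence "\<forall>i. \<exists>c. N $ i = vmap M c" by (rule allI)
 then obtain a where a: "\<And>i. N $ i = vmap M (a i)" unfolding choice_iff by fast
 define A where "A = (\<chi> i. a i)"
 have NA: "N = A ** M"
  by (simp add: vec_eq_iff a A_def matrix_matrix_mult_def vector_matrix_mult_def mult.commute)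
 have "inj (vmap A)" proof (rule injI)
  fix x y assume "vmap A x = vmap A y"
  hence "vmap N x = vmap N y" by (simp add: NA vmap_mult)
  thus "x = y" by (rule injD[OF N[unfolded frames_iff]])
 qed
 hence "det A \<noteq> 0" by (rule inj_vmap_iff[THEN iffD1])
 thus thesis using NA by (rule that)
qed

lemma oriented_subspace_self: "M \<in> oriented_subspace M"
 unfolding oriented_subspace_def by (auto intro!: exI[of _ "mat 1"])

lemma oriented_subspace_eq: "N \<in> oriented_subspace M \<Longrightarrow> oriented_subspace N = oriented_subspace M"
proof -
 assume "N \<in> oriented_subspace M"
 then obtain A :: "real^'b^'b" where A: "N = A ** M" "det A > 0" by (auto simp: oriented_subspace_def)
 hence "invertible A" by (simp add: invertible_det_nz)
 then obtain A' where A': "A' ** A = mat 1" by (auto simp: invertible_def)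
 have "det A' * det A = 1" using A' by (metis det_mul det_I)
 hence d: "det A' > 0" using A(2) by (metis zero_less_mult_pos2 zero_less_one)
 have M: "M = A' ** N" using A' A(1) by (simp add: matrix_mul_assoc)
 show ?thesis proof (intro equalityI subsetI)
  fix Q assume "Q \<in> oriented_subspace N"
  then obtain C :: "real^'b^'b" where "Q = C ** N" "det C > 0" by (auto simp: oriented_subspace_def)
  thus "Q \<in> oriented_subspace M" unfolding oriented_subspace_def
   using A by (auto intro!: exI[of _ "C ** A"] simp: det_mul matrix_mul_assoc)
 next
  fix Q assume "Q \<in> oriented_subspace M"
  then obtain C :: "real^'b^'b" where "Q = C ** M" "det C > 0" by (auto simp: oriented_subspace_def)
  thus "Q \<in> oriented_subspace N" unfolding oriented_subspace_def
   using M d by (auto intro!: exI[of _ "C ** A'"] simp: det_mul matrix_mul_assoc)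
 qed
qed

lemma topspace_G: "topspace Gr = oriented_subspace ` frames"
 by (auto simp: oriented_Grassmannian_def topspace_quotient_topology)

lemma cont_oriented_subspace: "continuous_map (top_of_set frames) Gr oriented_subspace"
 unfolding oriented_Grassmannian_def by (rule quotient_imp_continuous_map[OF quotient_map_quotient_topology])

lemma cont_G_I:
 "continuous_map (top_of_set frames) X (\<lambda>M. g (oriented_subspace M)) \<Longrightarrow> continuous_map Gr X g"
 unfolding oriented_Grassmannian_def
 by (rule continuous_compose_quotient_map[OF quotient_map_quotient_topology]) (simp add: comp_def)

lemma canonical_fibre_eq: "CF (oriented_subspace M) = span (rows M)" proof -
 have "span (rows N) \<subseteq> span (rows M)" if "N \<in> oriented_subspace M" for N
  using that span_rows_mult by (auto simp: oriented_subspace_def)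
 thus ?thesis unfolding canonical_fibre_def using oriented_subspace_self by blast
qed

lemma gram_inner: fixes M :: "real^'n^'k" shows "vmap M c \<bullet> v = c \<bullet> (M *v v)"
 by (rule dot_lmul_matrix)

text \<open>The projection onto the span of a frame, expressed by the inverse of its Gram operator;
  in this form it visibly depends continuously on the frame.\<close>

lemma proj_span_rows:
 assumes M: "M \<in> frames"
 shows "inj (\<lambda>c. M *v vmap M c)" "proj (span (rows M)) u = vmap M (inverse_map (\<lambda>c. M *v vmap M c) (M *v u))"
proof -
 let ?T = "\<lambda>c. M *v vmap M c"
 have lin: "linear ?T" using linear_compose[OF linear_vmap matrix_vector_mul_linear, of M M] by (simp add: comp_def)
 show inj: "inj ?T" unfolding linear_injective_0[OF lin] proof (intro allI impI)
  fix c assume "?T c = 0"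
  hence "vmap M c = vmap M 0" using gram_inner[of c M "vmap M c"] by simp
  thus "c = 0" using M unfolding frames_iff by (rule injD[rotated])
 qed
 let ?c = "inverse_map ?T (M *v u)"
 have c: "?T ?c = M *v u" by (rule surj_f_inv_f[OF linear_inj_imp_surj[OF lin inj]])
 show "proj (span (rows M)) u = vmap M ?c" proof (rule proj_unique[OF subspace_span])
  show "vmap M ?c \<in> span (rows M)" by (simp add: span_rows)
  fix w assume "w \<in> span (rows M)"
  then obtain d where "w = vmap M d" by (auto simp: span_rows)
  thus "orthogonal (u - vmap M ?c) w" using gram_inner[of d M "u - vmap M ?c"] c
   by (simp add: orthogonal_def inner_commute matrix_vector_mult_diff_distrib)
 qed
qed

lemma vb_canonical: "vector_bundle Gr (CF :: (real^'n^'k) set \<Rightarrow> _) (CARD('k))"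
 unfolding vector_bundle_def proof (intro conjI ballI allI)
 fix V :: "(real^'n^'k) set" assume "V \<in> topspace Gr"
 then obtain M where M: "M \<in> frames" "V = oriented_subspace M" by (auto simp: topspace_G)
 show "subspace (CF V)" by (simp add: M canonical_fibre_eq)
 have "dim (CF V) = card (rows M)"
  unfolding M canonical_fibre_eq using M(1) by (simp add: frames_def dim_eq_card_independent)
 also have "\<dots> = CARD('k)" proof -
  have "rows M = range (\<lambda>i. row i M)" by (auto simp: rows_def)
  thus ?thesis using M(1) by (simp add: frames_def card_image)
 qed
 finally show "dim (CF V) = CARD('k)" .
next
 fix u :: "real^'n"
 show "continuous_map Gr euclidean (\<lambda>V :: (real^'n^'k) set. proj (CF V) u)"
 proof (rule cont_G_I, unfold canonical_fibre_eq)
  let ?X = "top_of_set frames :: (real^'n^'k) topology"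
  let ?T = "\<lambda>M :: real^'n^'k. \<lambda>c. M *v vmap M c"
  have co: "continuous_map ?X euclidean (\<lambda>M. M *v f M)" if "continuous_on frames f" for f :: "real^'n^'k \<Rightarrow> real^'n"
   unfolding continuous_map_in_subtopology matrix_vector_mult_def by (simp add: continuous_intros that)
  have tr: "continuous_on frames (\<lambda>M :: real^'n^'k. vmap M c)" for c
   unfolding vector_matrix_mult_def by (simp add: continuous_intros)
  have T: "continuous_map ?X euclidean (\<lambda>M. ?T M c)" for c by (rule co[OF tr])
  have lin: "linear (?T M)" for M
   using linear_compose[OF linear_vmap matrix_vector_mul_linear, of M M] by (simp add: comp_def)
  have inv: "continuous_map ?X euclidean (\<lambda>M. inverse_map (?T M) c)" for c
   by (rule cont_inverse_family[OF T lin]) (simp add: proj_span_rows)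
  have linv: "linear (inverse_map (?T M))" if "M \<in> topspace ?X" for M
   by (rule inj_linear_imp_inv_linear[OF lin proj_span_rows(1)]) (use that in simp)
  have "continuous_map ?X euclidean (\<lambda>M. inverse_map (?T M) (M *v u))"
   by (rule cont_linear_family[of _ "\<lambda>M. inverse_map (?T M)", OF linv inv co]) (simp_all)
  from cont_linear_family[of ?X "\<lambda>M. vmap M", OF linear_vmap _ this]
  have "continuous_map ?X euclidean (\<lambda>M. vmap M (inverse_map (?T M) (M *v u)))" using tr by simp
  thus "continuous_map ?X euclidean (\<lambda>M. proj (span (rows M)) u)"
   by (rule continuous_map_eq) (simp add: proj_span_rows)
 qed
qed

subsection \<open>Orthogonal complements of tautological lines\<close>

text \<open>The complement of the tautological line, as a bundle over the projective bundle.
  Iterating projective bundles of residuals produces flags of orthogonal lines.\<close>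

definition residual :: "('b \<Rightarrow> (real^'n) set) \<Rightarrow> 'b \<times> (real^'n) set \<Rightarrow> (real^'n) set" where
 "residual F z = F (fst z) \<inter> orthogonal_comp (snd z)"

lemma bundle_pointD:
 assumes "z \<in> topspace (PB B F)"
 shows "fst z \<in> topspace B" "snd z \<in> topspace RP" "snd z \<subseteq> F (fst z)"
 using assms by (auto simp: topspace_bundle)

lemma proj_residual:
 assumes F: "vector_bundle B F k" and z: "z \<in> topspace (PB B F)"
 shows "proj (residual F z) u = proj (F (fst z)) u - proj (snd z) u" proof (rule proj_unique)
 note b = bundle_pointD[OF z] and S = vbD(1)[OF F bundle_pointD(1)[OF z]]
 note L = RP_subspace[OF b(2)]
 show "subspace (residual F z)" unfolding residual_def by (intro subspace_inter S subspace_orthogonal_comp)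
 show "proj (F (fst z)) u - proj (snd z) u \<in> residual F z" unfolding residual_def orthogonal_comp_def
 proof (intro IntI CollectI ballI)
  show "proj (F (fst z)) u - proj (snd z) u \<in> F (fst z)"
   using b(3) proj_mem[OF L] by (intro subspace_diff S proj_mem) auto
  fix w assume w: "w \<in> snd z"
  thus "orthogonal w (proj (F (fst z)) u - proj (snd z) u)"
   using proj_inner[OF L w, of u] proj_inner[OF S, of w u] b(3)
   by (auto simp: orthogonal_def inner_commute inner_diff_right)
 qed
 fix w assume w: "w \<in> residual F z"
 hence "orthogonal (proj (snd z) u) w" "w \<in> F (fst z)"
  using proj_mem[OF L, of u] by (auto simp: residual_def orthogonal_comp_def)
 with proj_orthogonal[OF S this(2), of u]
 show "orthogonal (u - (proj (F (fst z)) u - proj (snd z) u)) w"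
  by (simp add: orthogonal_def inner_diff_left)
qed

lemma vb_residual:
 assumes F: "vector_bundle B F (Suc k)"
 shows "vector_bundle (PB B F) (residual F) k" unfolding vector_bundle_def
proof (intro conjI ballI allI)
 fix z assume z: "z \<in> topspace (PB B F)"
 note b = bundle_pointD[OF z] and S = vbD(1)[OF F bundle_pointD(1)[OF z]]
 show "subspace (residual F z)" unfolding residual_def by (intro subspace_inter S subspace_orthogonal_comp)
 have "residual F z = {y \<in> F (fst z). \<forall>x\<in>snd z. orthogonal x y}"
  by (auto simp: residual_def orthogonal_comp_def)
 hence "dim (residual F z) + dim (snd z) = Suc k"
  using dim_subspace_orthogonal_to_vectors[OF RP_subspace[OF b(2)] S b(3)] vbD(2)[OF F b(1)] by simp
 moreover have "dim (snd z) = 1" using sect[OF b(2)] by (metis dim_span dim_singleton)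
 ultimately show "dim (residual F z) = k" by simp
next
 fix u
 have "continuous_map (PB B F) euclidean (\<lambda>z. proj (F (fst z)) u - proj (snd z) u)"
  using continuous_map_compose[OF cont_bundle_fst vbD(3)[OF F, of u]]
  by (intro continuous_map_diff cont_proj_snd) (simp add: comp_def)
 thus "continuous_map (PB B F) euclidean (\<lambda>z. proj (residual F z) u)"
  by (rule continuous_map_eq) (simp add: proj_residual[OF F])
qed

text \<open>Over its projective bundle, the bundle splits into the tautological line and the
  residual.\<close>

lemma sw_residual:
 assumes F: "vector_bundle B F (Suc k)" and v: "sw (PB B F) (residual F) k v" and w: "sw B F (Suc k) w"
 shows "cohS (PB B F) (pull fst (w i)) (whitney_line taut v i)" proof -
 let ?P = "PB B F"
 have F': "vector_bundle ?P (\<lambda>z. F (fst z)) (Suc k)" by (rule vb_pullback[OF F cont_bundle_fst])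
 have "sw ?P (\<lambda>z. F (fst z)) (Suc k) (whitney_line taut v)"
 proof (rule sw_whitney_line[OF vb_residual[OF F] cont_bundle_snd _ v])
  fix z u assume z: "z \<in> topspace ?P" and u: "u \<in> F (fst z)"
  have "proj (F (fst z)) u = u" by (rule proj_ident[OF vbD(1)[OF F bundle_pointD(1)[OF z]] u])
  thus "u = proj (residual F z) u + proj (snd z) u" by (simp add: proj_residual[OF F z])
 qed
 from sw_unique[OF F' _ sw_pull[OF cont_bundle_fst w] this] show ?thesis by simp
qed

lemma cont_line_bundle:
 assumes F: "vector_bundle B F 1"
 shows "continuous_map B RP F" proof (rule cont_RP_I[OF _ vbD(3)[OF F]])
 fix b assume b: "b \<in> topspace B"
 obtain C where C: "C \<subseteq> F b" "independent C" "F b \<subseteq> span C" "card C = dim (F b)" by (rule basis_exists)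
 hence "card C = 1" using vbD(2)[OF F b] by simp
 then obtain v where v: "C = {v}" by (rule card_1_singletonE)
 have "span C = F b" using C(1,3) span_minimal[OF C(1) vbD(1)[OF F b]] by auto
 moreover have "v \<noteq> 0" using C(2) v dependent_zero by blast
 ultimately show "F b \<in> topspace RP" using RP_I v by metis
qed

subsection \<open>Orientations of orthogonal frames\<close>

text \<open>A reflection of the coordinates; multiplying frames by it exchanges the two orientations
  of a subspace.\<close>

definition flip :: "real^3^3" where "flip = vector [vector [-1, 0, 0], vector [0, 1, 0], vector [0, 0, 1]]"

lemma det_flip: "det flip = -1" by (simp add: flip_def det_3)

lemma flip_flip: "flip ** flip = mat 1"
 by (simp add: flip_def vec_eq_iff forall_3 matrix_matrix_mult_def sum_3 mat_def)

definition rev_orient :: "(real^'n^3) set \<Rightarrow> (real^'n^3) set" where "rev_orient V = (**) flip ` V"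

definition orient :: "(real^'n^3) set \<Rightarrow> real^'n^3 \<Rightarrow> bit" where
 "orient V M = (if M \<in> V then 0 else 1)"

lemma oriented_subspace_mem:
 fixes N :: "real^'n^'k"
 assumes N: "N \<in> frames"
 shows "C ** N \<in> oriented_subspace N \<longleftrightarrow> det C > 0" proof
 assume "C ** N \<in> oriented_subspace N"
 then obtain A where A: "C ** N = A ** N" "det A > 0" by (auto simp: oriented_subspace_def)
 have "C $ i = A $ i" for i proof -
  have e: "vmap N (D $ i) = (D ** N) $ i" for D :: "real^'k^'k"
   by (simp add: vec_eq_iff matrix_matrix_mult_def vector_matrix_mult_def)
  have "vmap N (C $ i) = vmap N (A $ i)" by (simp only: e A(1))
  thus ?thesis by (rule injD[OF N[unfolded frames_iff]])
 qed
 hence "C = A" by (simp add: vec_eq_iff)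
 thus "det C > 0" using A(2) by simp
qed (auto simp: oriented_subspace_def)

lemma rev_orient_eq: "rev_orient (oriented_subspace N) = oriented_subspace (flip ** N)"
proof (intro equalityI subsetI)
 fix Q assume "Q \<in> rev_orient (oriented_subspace N)"
 then obtain A :: "real^3^3" where A: "Q = flip ** (A ** N)" "det A > 0" by (auto simp: rev_orient_def oriented_subspace_def)
 have "Q = (flip ** A ** flip) ** (flip ** N)"
  unfolding A(1) matrix_mul_assoc[symmetric] using flip_flip by (simp add: matrix_mul_assoc[of flip flip N])
 moreover have "det (flip ** A ** flip) > 0" using A(2) by (simp add: det_mul det_flip)
 ultimately show "Q \<in> oriented_subspace (flip ** N)" unfolding oriented_subspace_def by blast
next
 fix Q assume "Q \<in> oriented_subspace (flip ** N)"
 then obtain A :: "real^3^3" where A: "Q = A ** (flip ** N)" "det A > 0" by (auto simp: oriented_subspace_def)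
 have "Q = flip ** ((flip ** A ** flip) ** N)" unfolding A(1) by (simp add: matrix_mul_assoc flip_flip)
 moreover have "det (flip ** A ** flip) > 0" using A(2) by (simp add: det_mul det_flip)
 ultimately show "Q \<in> rev_orient (oriented_subspace N)" unfolding oriented_subspace_def rev_orient_def by blast
qed

lemma orient_mult:
 assumes V: "V \<in> topspace Gr" and M: "M \<in> frames" "span (rows M) \<subseteq> CF V" and A: "det A \<noteq> 0"
 shows "orient V (A ** M) = orient V M + (if det A < 0 then 1 else 0)"
  "orient (rev_orient V) M = orient V M + 1" proof -
 obtain N where N: "N \<in> frames" "V = oriented_subspace N" using V by (auto simp: topspace_G)
 obtain C :: "real^3^3" where C: "det C \<noteq> 0" "M = C ** N"
  by (rule frames_same_span[OF M(1) M(2)[unfolded N(2) canonical_fibre_eq]])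
 have fN: "flip ** N \<in> frames" by (rule frames_mult[OF N(1)]) (simp add: det_flip)
 have "M = (C ** flip) ** (flip ** N)"
  unfolding C(2) by (simp add: matrix_mul_assoc[symmetric]) (simp add: matrix_mul_assoc[of flip flip] flip_flip)
 hence "M \<in> rev_orient V \<longleftrightarrow> det C < 0"
  using oriented_subspace_mem[OF fN, of "C ** flip"] by (simp add: N rev_orient_eq det_mul det_flip)
 moreover have "M \<in> V \<longleftrightarrow> det C > 0" by (simp add: N(2) C(2) oriented_subspace_mem[OF N(1)])
 moreover have "A ** M \<in> V \<longleftrightarrow> det A * det C > 0"
  using oriented_subspace_mem[OF N(1), of "A ** C"] by (simp add: N(2) C(2) matrix_mul_assoc det_mul)
 ultimately show "orient V (A ** M) = orient V M + (if det A < 0 then 1 else 0)"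
  "orient (rev_orient V) M = orient V M + 1" using A C(1) by (auto simp: orient_def zero_less_mult_iff)
qed

lemma rev_orient_G: "V \<in> topspace Gr \<Longrightarrow> rev_orient V \<in> topspace Gr \<and>
  CF (rev_orient V) = CF V \<and> rev_orient (rev_orient V) = V" proof -
 assume "V \<in> topspace Gr"
 then obtain N where N: "N \<in> frames" "V = oriented_subspace N" by (auto simp: topspace_G)
 have f: "flip ** N \<in> frames" by (rule frames_mult[OF N(1)]) (simp add: det_flip)
 have ff: "flip ** (flip ** N) = N" by (simp add: matrix_mul_assoc flip_flip)
 have "span (rows (flip ** N)) = span (rows N)"
  using span_rows_mult[of flip N] span_rows_mult[of flip "flip ** N"] unfolding ff by blast
 thus ?thesis using f by (simp add: N(2) rev_orient_eq topspace_G canonical_fibre_eq ff)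
qed

lemma cont_rev_orient: "continuous_map Gr Gr (rev_orient :: (real^'n^3) set \<Rightarrow> _)"
proof (rule cont_G_I, unfold rev_orient_eq)
 have "continuous_map (top_of_set frames) (top_of_set frames) (\<lambda>M :: real^'n^3. flip ** M)"
  unfolding continuous_map_in_subtopology proof
  show "continuous_map (top_of_set frames) euclidean (\<lambda>M :: real^'n^3. flip ** M)"
   unfolding matrix_matrix_mult_def by (simp add: continuous_intros)
  show "(\<lambda>M :: real^'n^3. flip ** M) \<in> topspace (top_of_set frames) \<rightarrow> frames"
   using frames_mult[of _ flip] by (auto simp: det_flip)
 qed
 from continuous_map_compose[OF this cont_oriented_subspace]
 show "continuous_map (top_of_set frames) Gr (\<lambda>M :: real^'n^3. oriented_subspace (flip ** M))"
  by (simp add: comp_def)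
qed

definition orth3 :: "real^'n \<Rightarrow> real^'n \<Rightarrow> real^'n \<Rightarrow> bool" where
 "orth3 u v w \<longleftrightarrow> u \<noteq> 0 \<and> v \<noteq> 0 \<and> w \<noteq> 0 \<and> u \<bullet> v = 0 \<and> u \<bullet> w = 0 \<and> v \<bullet> w = 0"

lemma vmap_3: "vmap (vector [u, v, w] :: real^'n^3) c = c $ 1 *\<^sub>R u + c $ 2 *\<^sub>R v + c $ 3 *\<^sub>R w"
 by (simp add: vec_eq_iff vector_matrix_mult_def sum_3)

lemma orth3_inner:
 assumes "orth3 u v w"
 shows "(a *\<^sub>R u + b *\<^sub>R v + c *\<^sub>R w) \<bullet> u = a * (u \<bullet> u)" "(a *\<^sub>R u + b *\<^sub>R v + c *\<^sub>R w) \<bullet> v = b * (v \<bullet> v)"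
  "(a *\<^sub>R u + b *\<^sub>R v + c *\<^sub>R w) \<bullet> w = c * (w \<bullet> w)"
 using assms by (simp_all add: orth3_def inner_add_left inner_commute[of v u] inner_commute[of w u] inner_commute[of w v])

lemma frame_orth3:
 assumes "orth3 u v w" shows "vector [u, v, w] \<in> (frames :: (real^'n^3) set)"
 unfolding frames_iff linear_injective_0[OF linear_vmap] proof (intro allI impI)
 fix c :: "real^3" assume "vmap (vector [u, v, w] :: real^'n^3) c = 0"
 hence "c $ 1 *\<^sub>R u + c $ 2 *\<^sub>R v + c $ 3 *\<^sub>R w = 0" by (simp only: vmap_3)
 hence "c $ 1 = 0" "c $ 2 = 0" "c $ 3 = 0"
  using orth3_inner[OF assms, of "c $ 1" "c $ 2" "c $ 3"] assms by (auto simp: orth3_def)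
 thus "c = 0" by (simp add: vec_eq_iff forall_3)
qed

lemma span_orth3: "span (rows (vector [u, v, w] :: real^'n^3)) = {a *\<^sub>R u + b *\<^sub>R v + c *\<^sub>R w | a b c. True}"
proof -
 have "range (vmap (vector [u, v, w] :: real^'n^3)) = {a *\<^sub>R u + b *\<^sub>R v + c *\<^sub>R w | a b c. True}"
 proof (intro equalityI subsetI)
  fix x assume "x \<in> {a *\<^sub>R u + b *\<^sub>R v + c *\<^sub>R w | a b c. True}"
  then obtain a b c where "x = a *\<^sub>R u + b *\<^sub>R v + c *\<^sub>R w" by blast
  hence "x = vmap (vector [u, v, w] :: real^'n^3) (vector [a, b, c])" by (simp only: vmap_3 vector_3)
  thus "x \<in> range (vmap (vector [u, v, w] :: real^'n^3))" by blast
 qed (use vmap_3 in blast)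
 thus ?thesis by (simp only: span_rows)
qed

lemma gram_det_pos:
 assumes "orth3 u v w" shows "det ((vector [u, v, w] :: real^'n^3) ** transpose (vector [u, v, w])) > 0"
proof -
 have e: "(M ** transpose M) $ i $ j = M $ i \<bullet> M $ j" for M :: "real^'n^3" and i j
  by (simp add: matrix_matrix_mult_def transpose_def inner_vec_def)
 show ?thesis using assms unfolding det_3 e by (simp add: orth3_def inner_commute)
qed

text \<open>The sign of the determinant of \<open>N ** transpose M\<close> is the same for all
  frames \<open>N\<close> of one oriented subspace, so orientations near that of \<open>M\<close>
  form an open set.\<close>

lemma open_orientation: "openin Gr {V \<in> topspace Gr. \<forall>N\<in>V. det (N ** transpose M) > 0}"
 for M :: "real^'n^'k" proof -
 have e: "(\<forall>N\<in>oriented_subspace Q. det (N ** transpose M) > 0) \<longleftrightarrow> det (Q ** transpose M) > 0" for Q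
 proof
  assume "det (Q ** transpose M) > 0"
  thus "\<forall>N\<in>oriented_subspace Q. det (N ** transpose M) > 0"
   by (auto simp: oriented_subspace_def matrix_mul_assoc[symmetric] det_mul)
 qed (use oriented_subspace_self in blast)
 have "continuous_map (top_of_set frames) euclideanreal (\<lambda>Q :: real^'n^'k. det (Q ** transpose M))"
  unfolding det_def matrix_matrix_mult_def by (simp add: continuous_intros)
 from openin_continuous_map_preimage[OF this, of "{0<..}"]
 have "openin (top_of_set frames) {Q \<in> frames. det (Q ** transpose M) > 0}" by simp
 moreover have "{Q \<in> topspace (top_of_set frames). oriented_subspace Q \<in>
   {V \<in> topspace Gr. \<forall>N\<in>V. det (N ** transpose M) > 0}} = {Q \<in> frames. det (Q ** transpose M) > 0}"
  by (auto simp: e topspace_G)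
 ultimately show ?thesis
  unfolding oriented_Grassmannian_def openin_quotient_topology by (auto simp: topspace_quotient_topology)
qed

lemma continuous_on_vector_3:
 assumes "continuous_on D l1" "continuous_on D l2" "continuous_on D l3"
 shows "continuous_on D (\<lambda>x. vector [l1 x, l2 x, l3 x] :: real^'n^3)" proof -
 have e: "(\<lambda>x. vector [l1 x, l2 x, l3 x] :: real^'n^3) = (\<lambda>x. \<chi> i. if i = 1 then l1 x else if i = 2 then l2 x else l3 x)"
  by (intro ext) (simp add: vec_eq_iff forall_3)
 have "continuous_on D (\<lambda>x. if i = 1 then l1 x else if i = 2 then l2 x else l3 x)" for i :: 3
  using assms by (cases "i = 1"; cases "i = 2") simp_all
 thus ?thesis unfolding e by (rule continuous_on_vec_lambda)
qed

text \<open>Near a point \<open>x0\<close>, the oriented subspace is compared with its frame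
  \<open>N0\<close> and the moving frame with \<open>M x0\<close>, both through signs of
  determinants. These signs persist nearby, so \<open>orient\<close> is locally constant.\<close>

lemma orient_const:
 fixes l1 l2 l3 :: "(nat \<Rightarrow> real) \<Rightarrow> real^'n"
 assumes V: "continuous_map (top_of_set D) Gr V" and D: "connected D"
  and l: "continuous_on D l1" "continuous_on D l2" "continuous_on D l3"
  and o: "\<And>x. x \<in> D \<Longrightarrow> orth3 (l1 x) (l2 x) (l3 x)"
  and F: "\<And>x. x \<in> D \<Longrightarrow> span (rows (vector [l1 x, l2 x, l3 x] :: real^'n^3)) \<subseteq> CF (V x)"
  and xy: "x \<in> D" "y \<in> D"
 shows "orient (V x) (vector [l1 x, l2 x, l3 x]) = orient (V y) (vector [l1 y, l2 y, l3 y])" proof -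
 define M :: "_ \<Rightarrow> real^'n^3" where "M = (\<lambda>x. vector [l1 x, l2 x, l3 x])"
 have VG: "V x \<in> topspace Gr" if "x \<in> D" for x using continuous_map_funspace[OF V] that by auto
 have Mf: "M x \<in> frames" if "x \<in> D" for x unfolding M_def by (rule frame_orth3[OF o[OF that]])
 have FM: "span (rows (M x)) \<subseteq> CF (V x)" if "x \<in> D" for x unfolding M_def by (rule F[OF that])
 have d: "M x \<in> V x \<or> flip ** M x \<in> V x" if "x \<in> D" for x
  using orient_mult(1)[OF VG[OF that] Mf[OF that] FM[OF that], of flip] by (auto simp: orient_def det_flip split: if_splits)
 have cM: "continuous_on D M" unfolding M_def by (rule continuous_on_vector_3[OF l])
 have "(\<lambda>x. orient (V x) (M x)) constant_on D" proof (rule locally_constant_imp_constant[OF D])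
  fix x0 assume x0: "x0 \<in> D"
  define N0 where "N0 = (if M x0 \<in> V x0 then M x0 else flip ** M x0)"
  have N0: "N0 \<in> V x0" using d[OF x0] by (auto simp: N0_def)
  have g: "det (M x0 ** transpose (M x0)) > 0" unfolding M_def by (rule gram_det_pos[OF o[OF x0]])
  let ?O = "{V \<in> topspace Gr. \<forall>N\<in>V. det (N ** transpose N0) > 0}"
  have n1: "\<forall>N\<in>V x0. det (N ** transpose N0) > 0" proof
   fix N assume N: "N \<in> V x0"
   have "oriented_subspace N0 = V x0"
    using VG[OF x0] N0 oriented_subspace_eq[of N0] by (auto simp: topspace_G)
   then obtain A :: "real^3^3" where A: "N = A ** N0" "det A > 0" using N by (auto simp: oriented_subspace_def)
   have "det (N0 ** transpose N0) > 0"
    using g by (auto simp: N0_def matrix_transpose_mul matrix_mul_assoc det_mul det_transpose det_flip)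
     (simp add: matrix_mul_assoc[symmetric] det_mul det_flip)
   thus "det (N ** transpose N0) > 0" using A by (simp add: matrix_mul_assoc[symmetric] det_mul)
  qed
  have o1: "openin (top_of_set D) {x \<in> D. V x \<in> ?O}"
   using openin_continuous_map_preimage[OF V open_orientation[of N0]] by simp
  have o2: "openin (top_of_set D) {x \<in> D. det (M x ** transpose (M x0)) > 0}" proof -
   have "continuous_on D (\<lambda>x. det (M x ** transpose (M x0)))"
    unfolding det_def matrix_matrix_mult_def by (simp add: continuous_intros cM)
   hence "continuous_map (top_of_set D) euclideanreal (\<lambda>x. det (M x ** transpose (M x0)))" by simp
   from openin_continuous_map_preimage[OF this, of "{0<..}"] show ?thesis by simp
  qed
  have "orient (V x) (M x) = orient (V x0) (M x0)"
   if x: "x \<in> D" "V x \<in> ?O" "det (M x ** transpose (M x0)) > 0" for x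
  proof (cases "M x0 \<in> V x0")
   case True
   have "flip ** M x \<notin> V x" proof
    assume "flip ** M x \<in> V x"
    hence "det ((flip ** M x) ** transpose N0) > 0" using x(2) by blast
    thus False using x(3) True by (simp add: N0_def matrix_mul_assoc[symmetric] det_mul det_flip)
   qed
   thus ?thesis using d[OF x(1)] True by (simp add: orient_def)
  next
   case False
   have "M x \<notin> V x" proof
    assume "M x \<in> V x"
    hence "det (M x ** transpose N0) > 0" using x(2) by blast
    thus False using x(3) False by (simp add: N0_def matrix_transpose_mul matrix_mul_assoc det_mul det_transpose det_flip)
   qed
   thus ?thesis using False by (simp add: orient_def)
  qed
  note eq = this
  let ?T = "{x \<in> D. V x \<in> ?O} \<inter> {x \<in> D. det (M x ** transpose (M x0)) > 0}"
  have "openin (top_of_set D) ?T" by (rule openin_Int[OF o1 o2])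
  moreover have "x0 \<in> ?T" using x0 VG[OF x0] g n1 by simp
  moreover have "\<forall>x\<in>?T. orient (V x) (M x) = orient (V x0) (M x0)" proof
   fix x assume "x \<in> ?T"
   hence "x \<in> D" "V x \<in> ?O" "det (M x ** transpose (M x0)) > 0" by blast+
   thus "orient (V x) (M x) = orient (V x0) (M x0)" by (rule eq)
  qed
  ultimately show "\<exists>T. openin (top_of_set D) T \<and> x0 \<in> T \<and> (\<forall>x\<in>T. orient (V x) (M x) = orient (V x0) (M x0))"
   by blast
 qed
 thus ?thesis using xy unfolding constant_on_def M_def by metis
qed

text \<open>The two frames differ by a diagonal matrix, and the sign of its determinant is the
  product of the three relative signs.\<close>

lemma orient_change:
 fixes u v w :: "real^'n"
 assumes V: "V \<in> topspace Gr" and o: "orth3 u v w"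
  and F: "span (rows (vector [u, v, w] :: real^'n^3)) \<subseteq> CF V"
  and s: "u' \<in> span {u}" "v' \<in> span {v}" "w' \<in> span {w}" and nz: "u' \<noteq> 0" "v' \<noteq> 0" "w' \<noteq> 0"
 shows "orient V (vector [u', v', w']) = orient V (vector [u, v, w]) + (sgn2 u u' + sgn2 v v' + sgn2 w w')"
proof -
 obtain a b c where abc: "u' = a *\<^sub>R u" "v' = b *\<^sub>R v" "w' = c *\<^sub>R w" using s by (auto simp: span_singleton)
 define A :: "real^3^3" where "A = vector [vector [a, 0, 0], vector [0, b, 0], vector [0, 0, c]]"
 have n: "a \<noteq> 0" "b \<noteq> 0" "c \<noteq> 0" using nz abc by auto
 have dA: "det A = a * b * c" by (simp add: A_def det_3)
 have p: "0 < u \<bullet> u" "0 < v \<bullet> v" "0 < w \<bullet> w" using o by (auto simp: orth3_def)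
 have "(vector [u', v', w'] :: real^'n^3) = A ** vector [u, v, w]"
  by (simp add: vec_eq_iff forall_3 matrix_matrix_mult_def sum_3 A_def abc)
 hence "orient V (vector [u', v', w']) = orient V (vector [u, v, w]) + (if a * b * c < 0 then 1 else 0)"
  using orient_mult(1)[OF V frame_orth3[OF o] F, of A] n dA by simp
 moreover have "(if a * b * c < 0 then 1 else 0) = sgn2 u u' + sgn2 v v' + sgn2 w w'" proof -
  have "k * (x \<bullet> x) < 0 \<longleftrightarrow> k < 0" if "0 < x \<bullet> x" for k and x :: "real^'n"
   using that by (metis less_asym mult_less_0_iff)
  hence "sgn2 u u' = (if a < 0 then 1 else 0)" "sgn2 v v' = (if b < 0 then 1 else 0)" "sgn2 w w' = (if c < 0 then 1 else 0)"
   using p by (simp_all only: sgn2_def abc inner_scaleR_right)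
  thus ?thesis using n by (auto simp: mult_less_0_iff zero_less_mult_iff)
 qed
 ultimately show ?thesis by simp
qed

subsection \<open>The double cover of the flag manifold\<close>

text \<open>Flags are built as iterated projective bundles, over a point and over the Grassmannian,
  so that Leray-Hirsch applies at every stage.\<close>

type_synonym 'n fl2 = "(unit \<times> (real^'n) set) \<times> (real^'n) set"
type_synonym 'n fl3 = "('n::finite) fl2 \<times> (real^'n) set"
type_synonym 'n of2 = "((real^'n^3) set \<times> (real^'n) set) \<times> (real^'n) set"

abbreviation "R1 \<equiv> residual (\<lambda>_ :: unit. UNIV :: (real^'n) set)"
abbreviation "R2 \<equiv> residual R1"
abbreviation Fl1 :: "(unit \<times> (real^'n) set) topology" where
 "Fl1 \<equiv> PB (discrete_topology {()}) (\<lambda>_. UNIV)"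
abbreviation "Fl2 \<equiv> PB Fl1 R1"
abbreviation "Fl3 \<equiv> PB Fl2 R2"
abbreviation "S1 \<equiv> residual (CF :: (real^'n^3) set \<Rightarrow> (real^'n) set)"
abbreviation "S2 \<equiv> residual S1"
abbreviation OF1 :: "((real^'n^3) set \<times> (real^'n) set) topology" where
 "OF1 \<equiv> PB Gr CF"
abbreviation "OF2 \<equiv> PB OF1 S1"

text \<open>Two orthogonal lines in a 3-space determine the third line in it. Conversely three
  orthogonal lines span a 3-space, which has two orientations; hence a double cover.\<close>

definition forget_orient :: "('n::finite) of2 \<Rightarrow> 'n fl3" where
 "forget_orient z = ((((), snd (fst z)), snd z), S2 z)"

lemma S2_line: "continuous_map OF2 RP (S2 :: ('n::finite) of2 \<Rightarrow> (real^'n) set)"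
proof (rule cont_line_bundle)
 have "vector_bundle Gr (CF :: (real^'n^3) set \<Rightarrow> (real^'n) set) (Suc (Suc 1))"
  using vb_canonical[where 'k = 3] by (simp add: numeral_3_eq_3)
 thus "vector_bundle OF2 (S2 :: _ \<Rightarrow> (real^'n) set) 1" by (intro vb_residual)
qed

lemma cont_forget: "continuous_map OF2 Fl3 forget_orient" proof -
 have 2: "continuous_map OF2 RP (\<lambda>z. snd (fst z))"
  by (rule cm_comp[OF cont_bundle_fst cont_bundle_snd])
 show ?thesis unfolding cont_bundle_iff using 2 S2_line
  by (auto simp: forget_orient_def comp_def cont_bundle_snd) (auto simp: residual_def topspace_bundle)
qed

lemma orth3_lines:
 assumes "L1 \<in> topspace RP" "L2 \<in> topspace RP" "L3 \<in> topspace RP"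
  and "L2 \<subseteq> orthogonal_comp L1" "L3 \<subseteq> orthogonal_comp L1" "L3 \<subseteq> orthogonal_comp L2"
  and "u \<in> L1" "v \<in> L2" "w \<in> L3" "u \<noteq> 0" "v \<noteq> 0" "w \<noteq> 0"
 shows "orth3 u v w" using assms unfolding orth3_def orthogonal_comp_def orthogonal_def by blast

lemma Fl3_D:
 assumes "y \<in> topspace Fl3"
 shows "snd (fst (fst y)) \<in> topspace RP" "snd (fst y) \<in> topspace RP" "snd y \<in> topspace RP"
  "snd (fst y) \<subseteq> orthogonal_comp (snd (fst (fst y)))" "snd y \<subseteq> orthogonal_comp (snd (fst (fst y)))" "snd y \<subseteq> orthogonal_comp (snd (fst y))"
 using assms by (auto simp: topspace_bundle residual_def)

lemma OF2_D:
 assumes "z \<in> topspace OF2"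
 shows "fst (fst z) \<in> topspace Gr" "snd (fst z) \<subseteq> CF (fst (fst z))" "snd z \<subseteq> CF (fst (fst z))"
  "S2 z \<subseteq> CF (fst (fst z))"
 using assms by (auto simp: topspace_bundle residual_def)

lemma cont_Fl3_lines:
 "continuous_map Fl3 RP (\<lambda>y. snd (fst (fst y)))" "continuous_map Fl3 RP (\<lambda>y. snd (fst y))"
 "continuous_map Fl3 RP snd"
 using continuous_map_compose[OF continuous_map_compose[OF cont_bundle_fst cont_bundle_fst] cont_bundle_snd]
  continuous_map_compose[OF cont_bundle_fst cont_bundle_snd] cont_bundle_snd
 by (simp_all add: comp_def)

lemma Fl3_lifts:
 fixes f :: "_ \<Rightarrow> ('n::finite) fl3"
 assumes f: "singular_simplex p Fl3 f"
 obtains l1 l2 l3 where "is_lift p (\<lambda>x. snd (fst (fst (f x)))) l1" "is_lift p (\<lambda>x. snd (fst (f x))) l2" "is_lift p (\<lambda>x. snd (f x)) l3"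
  "\<And>x. x \<in> \<Delta> p \<Longrightarrow> orth3 (l1 x) (l2 x) (l3 x)" proof -
 note s = singular_simplex_simplex_map[OF f]
 obtain l1 where 1: "is_lift p (\<lambda>x. snd (fst (fst (f x)))) l1" using lift_exists[OF s[OF cont_Fl3_lines(1)]] unfolding is_lift_map .
 obtain l2 where 2: "is_lift p (\<lambda>x. snd (fst (f x))) l2" using lift_exists[OF s[OF cont_Fl3_lines(2)]] unfolding is_lift_map .
 obtain l3 where 3: "is_lift p (\<lambda>x. snd (f x)) l3" using lift_exists[OF s[OF cont_Fl3_lines(3)]] unfolding is_lift_map .
 show thesis proof (rule that[OF 1 2 3])
  fix x assume x: "x \<in> \<Delta> p"
  hence "f x \<in> topspace Fl3" using simplexD[OF f] by blast
  from orth3_lines[OF Fl3_D[OF this]] is_lift_mem[OF 1 x] is_lift_mem[OF 2 x] is_lift_mem[OF 3 x]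
  show "orth3 (l1 x) (l2 x) (l3 x)" by blast
 qed
qed

lemma lift_orient:
 fixes g :: "_ \<Rightarrow> ('n::finite) of2"
 assumes g: "singular_simplex p OF2 g" and fg: "\<And>x. x \<in> \<Delta> p \<Longrightarrow> f x = forget_orient (g x)"
  and l: "is_lift p (\<lambda>x. snd (fst (fst (f x)))) l1" "is_lift p (\<lambda>x. snd (fst (f x))) l2" "is_lift p (\<lambda>x. snd (f x)) l3"
  and o: "\<And>x. x \<in> \<Delta> p \<Longrightarrow> orth3 (l1 x) (l2 x) (l3 x)"
  and xy: "x \<in> \<Delta> p" "y \<in> \<Delta> p"
 shows "orient (fst (fst (g x))) (vector [l1 x, l2 x, l3 x]) = orient (fst (fst (g y))) (vector [l1 y, l2 y, l3 y])"
  "span (rows (vector [l1 x, l2 x, l3 x] :: real^'n^3)) \<subseteq> CF (fst (fst (g x)))"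
proof -
 have F: "span (rows (vector [l1 x, l2 x, l3 x] :: real^'n^3)) \<subseteq> CF (fst (fst (g x)))"
  if x: "x \<in> \<Delta> p" for x proof -
  have gx: "g x \<in> topspace OF2" using simplexD[OF g x] .
  have S: "subspace (CF (fst (fst (g x))))"
   by (rule vbD(1)[OF vb_canonical OF2_D(1)[OF gx]])
  have "l1 x \<in> CF (fst (fst (g x)))" "l2 x \<in> CF (fst (fst (g x)))" "l3 x \<in> CF (fst (fst (g x)))"
   using is_lift_mem[OF l(1) x] is_lift_mem[OF l(2) x] is_lift_mem[OF l(3) x] OF2_D[OF gx] fg[OF x]
   by (auto simp: forget_orient_def)
  thus ?thesis unfolding span_orth3 using S by (auto intro: subspace_add subspace_scale)
 qed
 thus "span (rows (vector [l1 x, l2 x, l3 x] :: real^'n^3)) \<subseteq> CF (fst (fst (g x)))" using xy by blast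
 have "continuous_map (top_of_set (\<Delta> p)) OF2 g" by (rule simplex_cont[OF g])
 from continuous_map_compose[OF continuous_map_compose[OF this cont_bundle_fst] cont_bundle_fst]
 have c: "continuous_map (top_of_set (\<Delta> p)) Gr (\<lambda>x. fst (fst (g x)))" by (simp add: comp_def)
 show "orient (fst (fst (g x))) (vector [l1 x, l2 x, l3 x]) = orient (fst (fst (g y))) (vector [l1 y, l2 y, l3 y])"
  by (rule orient_const[OF c connected_simplex _ _ _ o F xy]) (use l in \<open>auto simp: is_lift_def\<close>)
qed

definition flag_class :: "(('n::finite) fl3) cochain" where
 "flag_class = pull (\<lambda>y. snd (fst (fst y))) eta + pull (\<lambda>y. snd (fst y)) eta + pull snd eta"

definition flag_flip :: "('n::finite) of2 \<Rightarrow> 'n of2" where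
 "flag_flip z = ((rev_orient (fst (fst z)), snd (fst z)), snd z)"

definition flag_orient :: "('n::finite) of2 \<Rightarrow> bit" where
 "flag_orient z = orient (fst (fst z)) (vector [sect (snd (fst z)), sect (snd z), sect (S2 z)])"

lemma flag_flip_D:
 assumes z: "z \<in> topspace OF2"
 shows "flag_flip z \<in> topspace OF2" "S2 (flag_flip z) = S2 z" "forget_orient (flag_flip z) = forget_orient z"
  "flag_flip (flag_flip z) = z" using z rev_orient_G[OF OF2_D(1)[OF z]]
 by (auto simp: flag_flip_def topspace_bundle residual_def forget_orient_def)

lemma S2_orth3:
 assumes z: "z \<in> topspace OF2" and v: "v1 \<in> snd (fst z)" "v2 \<in> snd z" "v3 \<in> S2 z" "v1 \<noteq> 0" "v2 \<noteq> 0" "v3 \<noteq> 0"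
 shows "orth3 v1 v2 v3" "span (rows (vector [v1, v2, v3] :: real^'n^3)) \<subseteq> CF (fst (fst z))"
proof -
 have y: "forget_orient z \<in> topspace Fl3"
  using continuous_map_funspace[OF cont_forget] z by auto
 show "orth3 v1 v2 v3" by (rule orth3_lines[OF Fl3_D[OF y]]) (use v in \<open>simp_all add: forget_orient_def\<close>)
 have S: "subspace (CF (fst (fst z)))" by (rule vbD(1)[OF vb_canonical OF2_D(1)[OF z]])
 have "v1 \<in> CF (fst (fst z))" "v2 \<in> CF (fst (fst z))" "v3 \<in> CF (fst (fst z))"
  using v OF2_D[OF z] by auto
 thus "span (rows (vector [v1, v2, v3] :: real^'n^3)) \<subseteq> CF (fst (fst z))"
  unfolding span_orth3 using S by (auto intro: subspace_add subspace_scale)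
qed

lemma flag_sect:
 assumes "z \<in> topspace OF2"
 shows "sect (snd (fst z)) \<in> snd (fst z)" "sect (snd (fst z)) \<noteq> 0" "sect (snd z) \<in> snd z" "sect (snd z) \<noteq> 0"
  "sect (S2 z) \<in> S2 z" "sect (S2 z) \<noteq> 0" proof -
 have "snd (fst z) \<in> topspace RP" "snd z \<in> topspace RP" "S2 z \<in> topspace RP"
  using assms continuous_map_funspace[OF S2_line] by (auto simp: topspace_bundle)
 thus "sect (snd (fst z)) \<in> snd (fst z)" "sect (snd (fst z)) \<noteq> 0" "sect (snd z) \<in> snd z" "sect (snd z) \<noteq> 0"
  "sect (S2 z) \<in> S2 z" "sect (S2 z) \<noteq> 0" by (simp_all add: sect)
qed

lemma is_lift_span: "is_lift p f l \<Longrightarrow> x \<in> \<Delta> p \<Longrightarrow> f x = span {l x}"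
 by (simp add: is_lift_def)

text \<open>Over a simplex the three lines lift to vectors that form a frame; its oriented span
  gives one lift of the simplex, the reversed one the other. A sheet is labelled by comparing its
  orientation with the frame of chosen vectors. Along an edge this label changes by the three
  comparisons that define \<open>eta\<close>, hence by \<open>flag_class\<close> exactly.\<close>

lemma flag_double_cover:
 "double_cover OF2 (Fl3 :: (('n::finite) fl3) topology)
   forget_orient flag_flip flag_orient flag_class" proof
 show "continuous_map OF2 Fl3 (forget_orient :: _ \<Rightarrow> 'n fl3)"
  by (rule cont_forget)
 show "concentrated 1 flag_class"
  by (simp add: concentrated_def flag_class_def pull_def conc_eta[unfolded concentrated_def, rule_format])
next
 show "continuous_map OF2 OF2 (flag_flip :: 'n of2 \<Rightarrow> _)"
 proof -
  have 1: "continuous_map OF2 (RP :: (real^'n) set topology) (\<lambda>z. snd (fst z))"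
   by (rule cm_comp[OF cont_bundle_fst cont_bundle_snd])
  have 2: "continuous_map OF2 Gr (\<lambda>z :: 'n of2. rev_orient (fst (fst z)))"
   by (rule cm_comp[OF cm_comp[OF cont_bundle_fst cont_bundle_fst] cont_rev_orient])
  have 3: "snd (fst z) \<subseteq> CF (rev_orient (fst (fst z)))" "snd z \<subseteq> S1 (rev_orient (fst (fst z)), snd (fst z))"
   if "z \<in> topspace OF2" for z :: "'n of2"
   using that rev_orient_G[OF OF2_D(1)[OF that]] by (auto simp: topspace_bundle residual_def)
  show ?thesis unfolding cont_bundle_iff comp_def flag_flip_def fst_conv snd_conv
   using 1 2 3 cont_bundle_snd by blast
 qed
next
 fix z :: "'n of2" assume z: "z \<in> topspace OF2"
 show "forget_orient (flag_flip z) = forget_orient z" "flag_flip (flag_flip z) = z" using flag_flip_D[OF z] by simp_all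
 show "flag_orient (flag_flip z) = flag_orient z + 1"
  using orient_mult(2)[OF OF2_D(1)[OF z] frame_orth3[OF S2_orth3(1)[OF z]] S2_orth3(2)[OF z], of _ _ _ "mat 1"] flag_sect[OF z] flag_flip_D(2)[OF z]
  by (simp add: flag_orient_def flag_flip_def)
next
 fix p and f :: "(nat \<Rightarrow> real) \<Rightarrow> 'n fl3"
 assume f: "singular_simplex p Fl3 f"
 let ?D = "\<Delta> p"
 obtain l1 l2 l3 where l: "is_lift p (\<lambda>x. snd (fst (fst (f x)))) l1" "is_lift p (\<lambda>x. snd (fst (f x))) l2" "is_lift p (\<lambda>x. snd (f x)) l3"
  and o: "\<And>x. x \<in> ?D \<Longrightarrow> orth3 (l1 x) (l2 x) (l3 x)" by (rule Fl3_lifts[OF f]) blast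
 define M :: "_ \<Rightarrow> real^'n^3" where "M = (\<lambda>x. vector [l1 x, l2 x, l3 x])"
 define g where "g = (\<lambda>x. ((oriented_subspace (M x), snd (fst (fst (f x)))), snd (fst (f x))))"
 have Mf: "M x \<in> frames" if "x \<in> ?D" for x unfolding M_def by (rule frame_orth3[OF o[OF that]])
 have fx: "f x \<in> topspace Fl3" if "x \<in> ?D" for x by (rule simplexD[OF f that])
 have fib: "CF (oriented_subspace (M x)) = {a *\<^sub>R l1 x + b *\<^sub>R l2 x + c *\<^sub>R l3 x | a b c. True}" for x
  unfolding canonical_fibre_eq M_def span_orth3 ..
 have L: "snd (fst (fst (f x))) = {a *\<^sub>R l1 x | a. True}" "snd (fst (f x)) = {b *\<^sub>R l2 x | b. True}" "snd (f x) = {c *\<^sub>R l3 x | c. True}"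
  if "x \<in> ?D" for x using that l by (auto simp: is_lift_def span_singleton)
 have perp: "a *\<^sub>R l1 x + b *\<^sub>R l2 x + c *\<^sub>R l3 x \<in> orthogonal_comp (snd (fst (fst (f x)))) \<longleftrightarrow> a = 0"
  "a *\<^sub>R l1 x + b *\<^sub>R l2 x + c *\<^sub>R l3 x \<in> orthogonal_comp (snd (fst (f x))) \<longleftrightarrow> b = 0"
  if x: "x \<in> ?D" for x a b c proof -
  have nz: "l1 x \<bullet> l1 x \<noteq> 0" "l2 x \<bullet> l2 x \<noteq> 0" using o[OF x] by (auto simp: orth3_def)
  let ?y = "a *\<^sub>R l1 x + b *\<^sub>R l2 x + c *\<^sub>R l3 x"
  have "?y \<in> orthogonal_comp (snd (fst (fst (f x)))) \<longleftrightarrow> ?y \<bullet> l1 x = 0"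
   unfolding L(1)[OF x] orthogonal_comp_def orthogonal_def by (auto simp: inner_commute dest: spec[of _ 1])
  thus "?y \<in> orthogonal_comp (snd (fst (fst (f x)))) \<longleftrightarrow> a = 0" using orth3_inner(1)[OF o[OF x]] nz by simp
  have "?y \<in> orthogonal_comp (snd (fst (f x))) \<longleftrightarrow> ?y \<bullet> l2 x = 0"
   unfolding L(2)[OF x] orthogonal_comp_def orthogonal_def by (auto simp: inner_commute dest: spec[of _ 1])
  thus "?y \<in> orthogonal_comp (snd (fst (f x))) \<longleftrightarrow> b = 0" using orth3_inner(2)[OF o[OF x]] nz by simp
 qed
 have S1x: "S1 (fst (g x)) = {b *\<^sub>R l2 x + c *\<^sub>R l3 x | b c. True}" if x: "x \<in> ?D" for x
 proof -
  have "S1 (fst (g x)) = {a *\<^sub>R l1 x + b *\<^sub>R l2 x + c *\<^sub>R l3 x | a b c. a = 0}"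
   unfolding g_def residual_def fst_conv snd_conv fib using perp(1)[OF x] by blast
  thus ?thesis by simp
 qed
 have S2x: "S2 (g x) = snd (f x)" if x: "x \<in> ?D" for x proof -
  have sg: "snd (g x) = snd (fst (f x))" by (simp add: g_def)
  have p: "b *\<^sub>R l2 x + c *\<^sub>R l3 x \<in> orthogonal_comp (snd (g x)) \<longleftrightarrow> b = 0" for b c
   using perp(2)[OF x, of 0 b c] by (simp add: sg)
  have "S2 (g x) = {b *\<^sub>R l2 x + c *\<^sub>R l3 x | b c. True} \<inter> orthogonal_comp (snd (g x))"
   by (simp only: residual_def[of S1 "g x"] S1x[OF x])
  also have "\<dots> = {b *\<^sub>R l2 x + c *\<^sub>R l3 x | b c. b = 0}" using p by blast
  finally show ?thesis by (simp add: L(3)[OF x])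
 qed
 have cf: "continuous_map (top_of_set ?D) Fl3 f" by (rule simplex_cont[OF f])
 have cV: "continuous_map (top_of_set ?D) Gr (\<lambda>x. oriented_subspace (M x))"
 proof -
  have "continuous_map (top_of_set ?D) (top_of_set frames) M" unfolding continuous_map_in_subtopology M_def
   using continuous_on_vector_3[of ?D l1 l2 l3] l Mf by (auto simp: is_lift_def M_def)
  from continuous_map_compose[OF this cont_oriented_subspace] show ?thesis by (simp add: comp_def)
 qed
 have c12: "continuous_map (top_of_set ?D) RP (\<lambda>x. snd (fst (fst (f x))))" "continuous_map (top_of_set ?D) RP (\<lambda>x. snd (fst (f x)))"
  using continuous_map_compose[OF cf cont_Fl3_lines(1)] continuous_map_compose[OF cf cont_Fl3_lines(2)] by (simp_all add: comp_def)
 have "continuous_map (top_of_set ?D) OF2 g" unfolding cont_bundle_iff comp_def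
 proof (intro conjI ballI)
  fix x assume "x \<in> topspace (top_of_set ?D)"
  hence x: "x \<in> ?D" by simp
  show "snd (fst (g x)) \<subseteq> CF (fst (fst (g x)))"
   unfolding g_def fst_conv snd_conv fib L(1)[OF x] by (auto intro: exI[of _ 0]) (metis add.right_neutral scaleR_zero_left)
  show "snd (g x) \<subseteq> S1 (fst (g x))"
   unfolding S1x[OF x] by (auto simp: g_def L(2)[OF x]) (metis add.right_neutral scaleR_zero_left)
 qed (use cV c12 in \<open>simp_all add: g_def\<close>)
 hence "singular_simplex p OF2 (restrict g ?D)" by (rule simplex_restrictI)
 moreover have "smap p forget_orient (restrict g ?D) = f"
 proof (rule simplex_ext[OF singular_simplex_simplex_map[OF calculation cont_forget] f])
  fix x assume x: "x \<in> ?D"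
  have "forget_orient (g x) = f x" unfolding forget_orient_def S2x[OF x] by (simp add: g_def prod_eq_iff)
  thus "smap p forget_orient (restrict g ?D) x = f x" using x by (simp add: simplex_map_def)
 qed
 ultimately show "\<exists>g. singular_simplex p OF2 g \<and> smap p forget_orient g = f" by blast
next
 fix p and g g' :: "(nat \<Rightarrow> real) \<Rightarrow> 'n of2"
 assume g: "singular_simplex p OF2 g" and g': "singular_simplex p OF2 g'"
  and eq: "smap p forget_orient g = smap p forget_orient g'"
 let ?D = "\<Delta> p"
 define f where "f = smap p forget_orient g"
 have f: "singular_simplex p Fl3 f" unfolding f_def by (rule singular_simplex_simplex_map[OF g cont_forget])
 have fg: "f x = forget_orient (g x)" if "x \<in> ?D" for x using that by (simp add: f_def simplex_map_def)
 have fg': "f x = forget_orient (g' x)" if "x \<in> ?D" for x using fun_cong[OF eq, of x] that by (simp add: f_def simplex_map_def)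
 obtain l1 l2 l3 where l: "is_lift p (\<lambda>x. snd (fst (fst (f x)))) l1" "is_lift p (\<lambda>x. snd (fst (f x))) l2" "is_lift p (\<lambda>x. snd (f x)) l3"
  and o: "\<And>x. x \<in> ?D \<Longrightarrow> orth3 (l1 x) (l2 x) (l3 x)" by (rule Fl3_lifts[OF f]) blast
 have lo: "orient (fst (fst (g x))) (vector [l1 x, l2 x, l3 x]) = orient (fst (fst (g y))) (vector [l1 y, l2 y, l3 y])"
  "span (rows (vector [l1 x, l2 x, l3 x] :: real^'n^3)) \<subseteq> CF (fst (fst (g x)))"
  if "x \<in> ?D" "y \<in> ?D" for x y using that by - (rule lift_orient[OF g fg l o]; assumption)+
 have lo': "orient (fst (fst (g' x))) (vector [l1 x, l2 x, l3 x]) = orient (fst (fst (g' y))) (vector [l1 y, l2 y, l3 y])"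
  "span (rows (vector [l1 x, l2 x, l3 x] :: real^'n^3)) \<subseteq> CF (fst (fst (g' x)))"
  if "x \<in> ?D" "y \<in> ?D" for x y using that by - (rule lift_orient[OF g' fg' l o]; assumption)+
 define M :: "_ \<Rightarrow> real^'n^3" where "M = (\<lambda>x. vector [l1 x, l2 x, l3 x])"
 have Mf: "M x \<in> frames" if "x \<in> ?D" for x unfolding M_def by (rule frame_orth3[OF o[OF that]])
 \<comment> \<open>The lifted frame spans the subspace, so only the orientation is left open, and
   \<open>orient\<close> tells which of the two it is.\<close>
 have V: "fst (fst (g x)) = (if orient (fst (fst (g x))) (M x) = 0 then oriented_subspace (M x) else rev_orient (oriented_subspace (M x)))"
  if x: "x \<in> ?D" and G: "fst (fst (g x)) \<in> topspace Gr" and s: "span (rows (M x)) \<subseteq> CF (fst (fst (g x)))"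
  for x and g :: "(nat \<Rightarrow> real) \<Rightarrow> 'n of2"
 proof -
  let ?V = "fst (fst (g x))"
  obtain N where N: "?V = oriented_subspace N" using G by (auto simp: topspace_G)
  show ?thesis proof (cases "M x \<in> ?V")
   case True
   hence "oriented_subspace (M x) = ?V" using oriented_subspace_eq N by metis
   thus ?thesis using True by (simp add: orient_def)
  next
   case False
   hence "flip ** M x \<in> ?V"
    using orient_mult(1)[OF G Mf[OF x] s, of flip] by (auto simp: orient_def det_flip split: if_splits)
   hence "oriented_subspace (flip ** M x) = ?V" using oriented_subspace_eq N by metis
   thus ?thesis using False by (simp add: orient_def rev_orient_eq)
  qed
 qed
 have x0: "vtx 0 \<in> ?D" by simp
 have GD: "fst (fst (g x)) \<in> topspace Gr" "fst (fst (g' x)) \<in> topspace Gr" if "x \<in> ?D" for x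
  using OF2_D(1)[OF simplexD[OF g that]] OF2_D(1)[OF simplexD[OF g' that]] by auto
 define a a' where "a = orient (fst (fst (g (vtx 0)))) (M (vtx 0))" and "a' = orient (fst (fst (g' (vtx 0)))) (M (vtx 0))"
 have s: "orient (fst (fst (g x))) (M x) = a" "orient (fst (fst (g' x))) (M x) = a'" if "x \<in> ?D" for x
  unfolding M_def a_def a'_def by (rule lo(1)[OF that x0], rule lo'(1)[OF that x0])
 have Vg: "fst (fst (g x)) = (if a = 0 then oriented_subspace (M x) else rev_orient (oriented_subspace (M x)))"
  "fst (fst (g' x)) = (if a' = 0 then oriented_subspace (M x) else rev_orient (oriented_subspace (M x)))" if x: "x \<in> ?D" for x
  using V[of x g, OF x GD(1)[OF x]] V[of x g', OF x GD(2)[OF x]] lo(2)[OF x x] lo'(2)[OF x x] s[OF x] unfolding M_def by simp_all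
 have MG: "oriented_subspace (M x) \<in> topspace Gr" if "x \<in> ?D" for x using Mf[OF that] by (simp add: topspace_G)
 have rest: "snd (fst (g' x)) = snd (fst (g x))" "snd (g' x) = snd (g x)" if "x \<in> ?D" for x
  using fg[OF that] fg'[OF that] by (simp_all add: forget_orient_def)
 show "g' = g \<or> g' = smap p flag_flip g" proof (cases "a = a'")
  case True
  have "g' = g" proof (rule simplex_ext[OF g' g])
   fix x assume x: "x \<in> ?D"
   have "fst (fst (g' x)) = fst (fst (g x))" unfolding Vg[OF x] True ..
   thus "g' x = g x" using rest[OF x] by (simp add: prod_eq_iff)
  qed
  thus ?thesis ..
 next
  case False
  have sg: "smap p flag_flip g x = flag_flip (g x)" if "x \<in> ?D" for x using that by (simp add: simplex_map_def)
  have e: "g' x = flag_flip (g x)" if x: "x \<in> ?D" for x proof -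
   have "fst (fst (g' x)) = rev_orient (fst (fst (g x)))"
    unfolding Vg[OF x] using False rev_orient_G[OF MG[OF x]] by (cases a; cases a') simp_all
   thus ?thesis using rest[OF x] by (simp add: prod_eq_iff flag_flip_def)
  qed
  have "g' = smap p flag_flip g" proof
   fix x show "g' x = smap p flag_flip g x" proof (cases "x \<in> ?D")
    case True
    thus ?thesis by (simp only: e sg)
   next
    case False
    thus ?thesis using g' by (simp add: simplex_map_def singular_simplex_def extensional_def)
   qed
  qed
  thus ?thesis ..
 qed
next
 fix g :: "(nat \<Rightarrow> real) \<Rightarrow> 'n of2"
 assume g: "singular_simplex 1 OF2 g"
 let ?D = "\<Delta> 1"
 define f where "f = smap 1 forget_orient g"
 have f: "singular_simplex 1 Fl3 f" unfolding f_def by (rule singular_simplex_simplex_map[OF g cont_forget])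
 have fg: "f x = forget_orient (g x)" if "x \<in> ?D" for x using that by (simp add: f_def simplex_map_def)
 obtain l1 l2 l3 where l: "is_lift 1 (\<lambda>x. snd (fst (fst (f x)))) l1" "is_lift 1 (\<lambda>x. snd (fst (f x))) l2" "is_lift 1 (\<lambda>x. snd (f x)) l3"
  and o: "\<And>x. x \<in> ?D \<Longrightarrow> orth3 (l1 x) (l2 x) (l3 x)" by (rule Fl3_lifts[OF f]) blast
 have lo: "orient (fst (fst (g x))) (vector [l1 x, l2 x, l3 x]) = orient (fst (fst (g y))) (vector [l1 y, l2 y, l3 y])"
  "span (rows (vector [l1 x, l2 x, l3 x] :: real^'n^3)) \<subseteq> CF (fst (fst (g x)))"
  if "x \<in> ?D" "y \<in> ?D" for x y using that by - (rule lift_orient[OF g fg l o]; assumption)+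
 let ?M = "\<lambda>x. vector [l1 x, l2 x, l3 x] :: real^'n^3"
 let ?t = "\<lambda>x. sgn2 (l1 x) (sect (snd (fst (g x)))) + sgn2 (l2 x) (sect (snd (g x))) + sgn2 (l3 x) (sect (S2 (g x)))"
 \<comment> \<open>Passing from the lifted frame to the frame of chosen vectors costs one relative
   sign for each line.\<close>
 have th: "flag_orient (g x) = orient (fst (fst (g x))) (?M x) + ?t x" if x: "x \<in> ?D" for x proof -
  have z: "g x \<in> topspace OF2" by (rule simplexD[OF g x])
  have sp: "snd (fst (g x)) = span {l1 x}" "snd (g x) = span {l2 x}" "S2 (g x) = span {l3 x}"
   using is_lift_span[OF l(1) x] is_lift_span[OF l(2) x] is_lift_span[OF l(3) x] unfolding fg[OF x]
   by (simp_all add: forget_orient_def)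
  show ?thesis unfolding flag_orient_def by (rule orient_change[OF OF2_D(1)[OF z] o[OF x] lo(2)[OF x x]])
    (use flag_sect[OF z] sp in auto)
 qed
 have v: "vtx 0 \<in> ?D" "vtx 1 \<in> ?D" by simp_all
 have e: "eta 1 (smap 1 k f) = sgn2 (h (vtx 0)) (sect (k (f (vtx 0)))) + sgn2 (h (vtx 1)) (sect (k (f (vtx 1))))"
  if "is_lift 1 (\<lambda>x. k (f x)) h" for k :: "_ \<Rightarrow> (real^'n) set" and h
  using eta_eq[OF is_lift_map[of 1 k f h, THEN iffD2, OF that]] v by (simp add: simplex_map_def)
 have "flag_class 1 f = ?t (vtx 0) + ?t (vtx 1)"
  unfolding flag_class_def pull_def plus_fun_apply e[OF l(1)] e[OF l(2)] e[OF l(3)] fg[OF v(1)] fg[OF v(2)]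
  by (simp add: forget_orient_def bit_ac)
 also have "\<dots> = flag_orient (g (vtx 1)) + flag_orient (g (vtx 0))"
  unfolding th[OF v(1)] th[OF v(2)] lo(1)[OF v(1) v(2)] by (simp add: bit_ac)
 finally show "flag_class 1 (smap 1 forget_orient g) = flag_orient (g (vtx 1)) + flag_orient (g (vtx 0))"
  unfolding f_def .
qed

subsection \<open>Evaluating polynomials at classes of degree one\<close>

text \<open>Ring homomorphisms to cohomology, given by representing cocycles; the laws hold up to
  coboundaries.\<close>

definition cohom :: "'b sset \<Rightarrow> ('a::comm_ring_1 \<Rightarrow> 'b cochain) \<Rightarrow> bool" where
 "cohom K \<phi> \<longleftrightarrow> (\<forall>p. Z K (\<phi> p)) \<and> (\<forall>p q. coh K (\<phi> (p + q)) (\<phi> p + \<phi> q)) \<and>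
   (\<forall>p q. coh K (\<phi> (p * q)) (\<phi> p \<smile> \<phi> q)) \<and> coh K (\<phi> 1) unit"

lemma cohomD:
 assumes "cohom K \<phi>"
 shows "Z K (\<phi> p)" "coh K (\<phi> (p + q)) (\<phi> p + \<phi> q)" "coh K (\<phi> (p * q)) (\<phi> p \<smile> \<phi> q)" "coh K (\<phi> 1) unit"
 using assms by (auto simp: cohom_def)

lemma cohom_0: assumes "cohom K \<phi>" shows "coh K (\<phi> 0) 0" using cohomD(2)[OF assms, of 0 0] by simp

lemma cohom_sum: assumes \<phi>: "cohom K \<phi>" shows "coh K (\<phi> (\<Sum>i\<in>A. f i)) (\<Sum>i\<in>A. \<phi> (f i))"
proof (induction A rule: infinite_finite_induct)
 case (insert x F)
 have "coh K (\<phi> (f x + sum f F)) (\<phi> (f x) + (\<Sum>i\<in>F. \<phi> (f i)))"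
  by (rule coh_trans[OF cohomD(2)[OF \<phi>] coh_add[OF coh_refl insert.IH]])
 thus "coh K (\<phi> (\<Sum>i\<in>insert x F. f i)) (\<Sum>i\<in>insert x F. \<phi> (f i))" using insert.hyps by simp
next
 case empty
 show "coh K (\<phi> (\<Sum>i\<in>{}. f i)) (\<Sum>i\<in>{}. \<phi> (f i))" using cohom_0[OF \<phi>] by simp
next
 case (infinite A)
 thus "coh K (\<phi> (\<Sum>i\<in>A. f i)) (\<Sum>i\<in>A. \<phi> (f i))" using cohom_0[OF \<phi>] by simp
qed

lemma cohom_power: assumes K: "sset K" and \<phi>: "cohom K \<phi>" shows "coh K (\<phi> (p ^ i)) (cpow (\<phi> p) i)"
proof (induction i)
 case 0
 show "coh K (\<phi> (p ^ 0)) (cpow (\<phi> p) 0)" using cohomD(4)[OF \<phi>] by simp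
next
 case (Suc i)
 have "coh K (\<phi> (p ^ i * p)) (cpow (\<phi> p) i \<smile> \<phi> p)"
  by (rule coh_trans[OF cohomD(3)[OF \<phi>] coh_smile_left[OF K cohomD(1)[OF \<phi>] Suc]])
 thus "coh K (\<phi> (p ^ Suc i)) (cpow (\<phi> p) (Suc i))" by (simp add: mult.commute)
qed

definition bit_hom :: "bit \<Rightarrow> 'b cochain" where "bit_hom b = (if b = 0 then 0 else unit)"

lemma cohom_bit_hom: assumes K: "sset K" shows "cohom K bit_hom" proof -
 have u: "coh K unit (unit \<smile> unit)" by (rule eqK_coh[OF eqK_sym[OF unit_smile[OF K]]])
 have "coh K (bit_hom (p * q)) (bit_hom p \<smile> bit_hom q)" for p q
  using u by (cases p; cases q) (simp_all add: bit_hom_def)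
 moreover have "coh K (bit_hom (p + q)) (bit_hom p + bit_hom q)" for p q
  by (cases p; cases q) (simp_all add: bit_hom_def)
 ultimately show ?thesis by (simp add: cohom_def bit_hom_def)
qed

text \<open>Evaluation by Horner's scheme, with the variable multiplied from the right.
  Multiplicativity is where \<open>deg1_central\<close> enters.\<close>

definition ev1 :: "('a::comm_ring_1 \<Rightarrow> 'b cochain) \<Rightarrow> 'b cochain \<Rightarrow> 'a poly \<Rightarrow> 'b cochain" where
 "ev1 \<phi> h p = fold_coeffs (\<lambda>a c. \<phi> a + c \<smile> h) p 0"

lemma ev1_0 [simp]: "ev1 \<phi> h 0 = 0" by (simp add: ev1_def)

lemma ev1_pCons': "a \<noteq> 0 \<or> p \<noteq> 0 \<Longrightarrow> ev1 \<phi> h (pCons a p) = \<phi> a + ev1 \<phi> h p \<smile> h"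
 by (auto simp: ev1_def)

lemma pull_ev1: "pull g (ev1 \<phi> h p) = ev1 (\<lambda>a. pull g (\<phi> a)) (pull g h) p"
proof (induction p rule: pCons_induct)
 case 0
 show "pull g (ev1 \<phi> h 0) = ev1 (\<lambda>a. pull g (\<phi> a)) (pull g h) 0" by simp
next
 case (pCons a p)
 thus "pull g (ev1 \<phi> h (pCons a p)) = ev1 (\<lambda>a. pull g (\<phi> a)) (pull g h) (pCons a p)"
  by (simp only: ev1_pCons' pull_add pull_smile)
qed

context
 fixes K :: "'b sset" and \<phi> :: "'a::comm_ring_1 \<Rightarrow> 'b cochain" and h :: "'b cochain"
 assumes K: "sset K" and \<phi>: "cohom K \<phi>" and h: "concentrated 1 h" "Z K h"
begin

lemma ev1_pCons: "coh K (ev1 \<phi> h (pCons a p)) (\<phi> a + ev1 \<phi> h p \<smile> h)"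
proof (cases "a = 0 \<and> p = 0")
 case True
 thus ?thesis using coh_sym[OF cohom_0[OF \<phi>]] by simp
next
 case False
 hence "ev1 \<phi> h (pCons a p) = \<phi> a + ev1 \<phi> h p \<smile> h" by (intro ev1_pCons') blast
 thus ?thesis by simp
qed

lemma Z_ev1: "Z K (ev1 \<phi> h p)" proof (induction p rule: pCons_induct)
 case (pCons a p)
 show "Z K (ev1 \<phi> h (pCons a p))"
  unfolding ev1_pCons'[OF pCons.hyps(1)] by (intro Z_add Z_smile K h cohomD(1)[OF \<phi>] pCons.IH)
next
 case 0
 show "Z K (ev1 \<phi> h 0)" by simp
qed

lemma ev1_add: "coh K (ev1 \<phi> h (p + q)) (ev1 \<phi> h p + ev1 \<phi> h q)"
proof (induction p q rule: poly_induct2)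
 case (pCons a p b q)
 let ?e = "ev1 \<phi> h"
 have "coh K (?e (pCons (a + b) (p + q))) (\<phi> (a + b) + ?e (p + q) \<smile> h)" by (rule ev1_pCons)
 also have "coh K \<dots> ((\<phi> a + \<phi> b) + (?e p + ?e q) \<smile> h)"
  by (rule coh_add[OF cohomD(2)[OF \<phi>] coh_smile_left[OF K h(2) pCons]])
 also have "(\<phi> a + \<phi> b) + (?e p + ?e q) \<smile> h = (\<phi> a + ?e p \<smile> h) + (\<phi> b + ?e q \<smile> h)"
  by (simp only: smile_add_left ac_simps)
 also have "coh K \<dots> (?e (pCons a p) + ?e (pCons b q))"
  by (rule coh_add[OF coh_sym[OF ev1_pCons] coh_sym[OF ev1_pCons]])
 finally show "coh K (?e (pCons a p + pCons b q)) (?e (pCons a p) + ?e (pCons b q))" by simp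
qed simp

lemma ev1_smult: "coh K (ev1 \<phi> h (Polynomial.smult a p)) (\<phi> a \<smile> ev1 \<phi> h p)"
proof (induction p rule: pCons_induct)
 case (pCons b p)
 let ?e = "ev1 \<phi> h"
 have "coh K (?e (pCons (a * b) (Polynomial.smult a p))) (\<phi> (a * b) + ?e (Polynomial.smult a p) \<smile> h)" by (rule ev1_pCons)
 also have "coh K \<dots> (\<phi> a \<smile> \<phi> b + (\<phi> a \<smile> ?e p) \<smile> h)"
  by (rule coh_add[OF cohomD(3)[OF \<phi>] coh_smile_left[OF K h(2) pCons.IH]])
 also have "\<phi> a \<smile> \<phi> b + (\<phi> a \<smile> ?e p) \<smile> h = \<phi> a \<smile> (\<phi> b + ?e p \<smile> h)"
  by (simp only: smile_add_right smile_assoc)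
 also have "coh K \<dots> (\<phi> a \<smile> ?e (pCons b p))"
  by (rule coh_smile_right[OF K cohomD(1)[OF \<phi>] coh_sym[OF ev1_pCons]])
 finally show "coh K (?e (Polynomial.smult a (pCons b p))) (\<phi> a \<smile> ?e (pCons b p))" by simp
next
 case 0
 show "coh K (ev1 \<phi> h (Polynomial.smult a 0)) (\<phi> a \<smile> ev1 \<phi> h 0)" by simp
qed

lemma ev1_mult: "coh K (ev1 \<phi> h (p * q)) (ev1 \<phi> h p \<smile> ev1 \<phi> h q)"
proof (induction p rule: pCons_induct)
 case (pCons a p)
 let ?e = "ev1 \<phi> h"
 have "coh K (?e (Polynomial.smult a q + pCons 0 (p * q))) (?e (Polynomial.smult a q) + ?e (pCons 0 (p * q)))" by (rule ev1_add)
 also have "coh K \<dots> (\<phi> a \<smile> ?e q + (\<phi> 0 + ?e (p * q) \<smile> h))" by (rule coh_add[OF ev1_smult ev1_pCons])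
 also have "coh K \<dots> (\<phi> a \<smile> ?e q + (0 + (?e p \<smile> ?e q) \<smile> h))"
  by (intro coh_add coh_refl cohom_0[OF \<phi>] coh_smile_left[OF K h(2) pCons.IH])
 also have "\<phi> a \<smile> ?e q + (0 + (?e p \<smile> ?e q) \<smile> h) = \<phi> a \<smile> ?e q + ?e p \<smile> (?e q \<smile> h)"
  by (simp only: smile_assoc add_0_left)
 also have "coh K \<dots> (\<phi> a \<smile> ?e q + ?e p \<smile> (h \<smile> ?e q))"
  by (rule coh_add[OF coh_refl coh_smile_right[OF K Z_ev1 deg1_central[OF K h Z_ev1]]])
 also have "\<phi> a \<smile> ?e q + ?e p \<smile> (h \<smile> ?e q) = (\<phi> a + ?e p \<smile> h) \<smile> ?e q"
  by (simp only: smile_add_left smile_assoc)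
 also have "coh K \<dots> (?e (pCons a p) \<smile> ?e q)"
  by (rule coh_smile_left[OF K Z_ev1 coh_sym[OF ev1_pCons]])
 finally show "coh K (?e (pCons a p * q)) (?e (pCons a p) \<smile> ?e q)" by simp
next
 case 0
 show "coh K (ev1 \<phi> h (0 * q)) (ev1 \<phi> h 0 \<smile> ev1 \<phi> h q)" by simp
qed

lemma ev1_const: "coh K (ev1 \<phi> h [:a:]) (\<phi> a)" using ev1_pCons[of a 0] by simp

lemma cohom_ev1: "cohom K (ev1 \<phi> h)" unfolding cohom_def
 using Z_ev1 ev1_add ev1_mult coh_trans[OF ev1_const cohomD(4)[OF \<phi>]] by (simp add: one_pCons)

lemma ev1_var: "coh K (ev1 \<phi> h [:0, 1:]) h" proof -
 have "coh K (ev1 \<phi> h [:0, 1:]) (\<phi> 0 + ev1 \<phi> h [:1:] \<smile> h)" by (rule ev1_pCons)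
 also have "coh K \<dots> (0 + unit \<smile> h)"
  by (intro coh_add cohom_0[OF \<phi>] coh_smile_left[OF K h(2)] coh_trans[OF ev1_const cohomD(4)[OF \<phi>]])
 also have "0 + unit \<smile> h = unit \<smile> h" by simp
 also have "coh K \<dots> h" by (rule eqK_coh[OF unit_smile[OF K]])
 finally show ?thesis .
qed

end

section \<open>Polynomials in two classes\<close>

type_synonym poly2 = "bit poly poly"

definition evp :: "'b cochain \<Rightarrow> 'b cochain \<Rightarrow> poly2 \<Rightarrow> 'b cochain" where
 "evp h k = ev1 (ev1 bit_hom h) k"

text \<open>\<open>X2\<close> is the variable of the coefficient polynomials and \<open>Y2\<close>
  the outer variable.\<close>

definition X2 :: poly2 where "X2 = [:[:0, 1:]:]"
definition Y2 :: poly2 where "Y2 = [:0, 1:]"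

lemma pull_evp: "pull g (evp h k p) = evp (pull g h) (pull g k) p" proof -
 have "pull g (bit_hom b) = bit_hom b" for b by (auto simp: bit_hom_def pull_def fun_eq_iff unit_def)
 thus ?thesis unfolding evp_def by (simp only: pull_ev1)
qed

context
 fixes K :: "'b sset" and h k :: "'b cochain"
 assumes K: "sset K" and h: "concentrated 1 h" "Z K h" and k: "concentrated 1 k" "Z K k"
begin

lemma cohom_evp: "cohom K (evp h k)" unfolding evp_def by (intro cohom_ev1 cohom_bit_hom K h k)

lemma evp_X2: "coh K (evp h k X2) h" unfolding evp_def X2_def
 by (rule coh_trans, rule ev1_const[OF K cohom_ev1[OF K cohom_bit_hom[OF K] h] k], rule ev1_var[OF K cohom_bit_hom[OF K] h])

lemma evp_Y2: "coh K (evp h k Y2) k" unfolding evp_def Y2_def by (intro ev1_var cohom_ev1 cohom_bit_hom K h k)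

lemma evp_X2_power: "coh K (evp h k (X2 ^ i)) (cpow h i)"
 by (rule coh_trans[OF cohom_power[OF K cohom_evp] coh_cpow[OF K cohomD(1)[OF cohom_evp] evp_X2]])

lemma evp_Y2_power: "coh K (evp h k (Y2 ^ i)) (cpow k i)"
 by (rule coh_trans[OF cohom_power[OF K cohom_evp] coh_cpow[OF K cohomD(1)[OF cohom_evp] evp_Y2]])

lemma evp_mono: "coh K (evp h k (X2 ^ i * Y2 ^ j)) (cpow h i \<smile> cpow k j)"
 by (rule coh_trans[OF cohomD(3)[OF cohom_evp] coh_smile[OF K cohomD(1)[OF cohom_evp] cohomD(1)[OF cohom_evp] evp_X2_power evp_Y2_power]])

end

subsection \<open>The kernel of the pullback to the double cover\<close>

lemma concentrated_add: "concentrated n a \<Longrightarrow> concentrated n b \<Longrightarrow> concentrated n (a + b)"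
 by (simp add: concentrated_def)

text \<open>Division by the linear polynomial \<open>z + taut\<close>: a class from the base that is
  a multiple of it is, already on the base, a multiple of the Whitney polynomial evaluated at
  \<open>z\<close>. The quotient \<open>e\<close> is the top coefficient of
  \<open>d\<close>.\<close>

lemma linear_multiple:
 fixes F :: "'b \<Rightarrow> (real^'n) set"
 assumes F: "vector_bundle B F (Suc N)" and u: "sw B F (Suc N) u"
  and z: "concentrated 1 z" "ZS B z" and c: "ZS B c" and d: "ZS (PB B F) d"
  and cd: "cohS (PB B F) (pull fst c) ((pull fst z + taut) \<smile> d)"
 obtains e where "ZS B e" "cohS B c (e \<smile> (\<Sum>j\<le>Suc N. u (Suc N - j) \<smile> cpow z j))"
proof -
 let ?P = "Sing (PB B F)" and ?B = "Sing B"
 let ?n = "Suc N"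
 note LH = LH_vector_bundle[OF F zero_less_Suc]
 have Zu: "Z ?B (u i)" for i using u by (simp add: sw_def)
 have Zt: "Z ?P (cpow taut i)" for i by (rule Z_cpow[OF sset_S Z_taut])
 have Zf: "Z ?B a \<Longrightarrow> Z ?P (pull fst a)" for a by (rule Z_pull[OF maps_bundle_fst])
 obtain \<delta>' where "\<forall>i<?n. Z ?B (\<delta>' i)" "coh ?P d (lh fst taut ?n \<delta>')" using LH d unfolding LH_def by blast
 define \<delta> where "\<delta> = (\<lambda>i. if i < ?n then \<delta>' i else 0)"
 have Z\<delta>: "Z ?B (\<delta> i)" for i using \<open>\<forall>i<?n. Z ?B (\<delta>' i)\<close> by (simp add: \<delta>_def)
 have "lh fst taut ?n \<delta> = (lh fst taut ?n \<delta>' :: ('b \<times> (real^'n) set) cochain)" unfolding lh_def by (rule sum.cong) (simp_all add: \<delta>_def)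
 hence d\<delta>: "coh ?P d (lh fst taut ?n \<delta>)" using \<open>coh ?P d (lh fst taut ?n \<delta>')\<close> by (simp only:)
 have hN: "coh ?P (cpow taut ?n) (lh fst taut ?n (\<lambda>j. u (?n - j)))" proof -
  have "coh ?P (cpow taut ?n + lh fst taut ?n (\<lambda>j. u (?n - j))) (whitney_sum ?n u)"
   unfolding whitney_sum_lh by (intro coh_add coh_refl coh_sym[OF coh_unit_top]) (use u in \<open>simp add: sw_def\<close>)
  moreover have "coh ?P (whitney_sum ?n u) 0" using u by (simp add: sw_def)
  ultimately have "coh ?P (cpow taut ?n + lh fst taut ?n (\<lambda>j. u (?n - j))) 0" by (rule coh_trans)
  thus ?thesis by (simp only: coh_add_0)
 qed
 \<comment> \<open>The coefficients of the sum of both sides of \<open>cd\<close>, after the power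
   \<open>?n\<close> of \<open>taut\<close> has been reduced by the Whitney relation.\<close>
 define a where "a = (\<lambda>j. (if j = 0 then c else \<delta> (j - 1)) + (\<delta> j \<smile> z + \<delta> N \<smile> u (?n - j)))"
 have Za: "Z ?B (a j)" for j unfolding a_def by (auto intro!: Z_add Z_smile c Z\<delta> z Zu)
 have "coh ?P (lh fst taut ?n a) 0" proof -
  let ?l = "lh fst taut ?n :: _ \<Rightarrow> ('b \<times> (real^'n) set) cochain"
  let ?S = "\<Sum>i<N. pull fst (\<delta> i) \<smile> cpow taut (Suc i)"
  let ?u = "?l (\<lambda>j. \<delta> N \<smile> u (?n - j))"
  let ?z = "?l (\<lambda>j. \<delta> j \<smile> z)"
  have 1: "coh ?P (d \<smile> taut) (?S + ?u)"
  proof -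
   have "coh ?P (d \<smile> taut) (?l \<delta> \<smile> taut)" by (rule coh_smile_left[OF sset_S Z_taut d\<delta>])
   also have "?l \<delta> \<smile> taut = ?S + pull fst (\<delta> N) \<smile> cpow taut ?n"
    by (simp add: lh_def smile_add_left smile_sum_left smile_assoc)
   also have "coh ?P \<dots> (?S + pull fst (\<delta> N) \<smile> ?l (\<lambda>j. u (?n - j)))"
    by (rule coh_add[OF coh_refl coh_smile_right[OF sset_S Zf[OF Z\<delta>] hN]])
   also have "pull fst (\<delta> N) \<smile> ?l (\<lambda>j. u (?n - j)) = ?u"
    by (simp only: lh_def smile_sum_right pull_smile smile_assoc)
   finally show ?thesis .
  qed
  have 2: "coh ?P (d \<smile> pull fst z) (?z)" proof -
   have "coh ?P (d \<smile> pull fst z) (?l \<delta> \<smile> pull fst z)" by (rule coh_smile_left[OF sset_S Zf[OF z(2)] d\<delta>])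
   also have "?l \<delta> \<smile> pull fst z = (\<Sum>i<?n. pull fst (\<delta> i) \<smile> (cpow taut i \<smile> pull fst z))"
    by (simp only: lh_def smile_sum_left smile_assoc)
   also have "coh ?P \<dots> (\<Sum>i<?n. pull fst (\<delta> i) \<smile> (pull fst z \<smile> cpow taut i))"
    by (intro coh_sum coh_smile_right[OF sset_S Zf[OF Z\<delta>]]
      deg1_central[OF sset_S conc_pull[OF z(1)] Zf[OF z(2)] Zt])
   also have "\<dots> = ?z" by (simp only: lh_def pull_smile smile_assoc)
   finally show ?thesis .
  qed
  have Zw: "Z ?P (pull fst z + taut)" by (intro Z_add Zf z Z_taut)
  have cw: "concentrated 1 (pull fst z + taut :: ('b \<times> (real^'n) set) cochain)"
   by (rule concentrated_add[OF conc_pull[OF z(1)] conc_taut])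
  have "coh ?P (pull fst c) (d \<smile> (pull fst z + taut))"
   by (rule coh_trans[OF cd coh_sym[OF deg1_central[OF sset_S cw Zw d]]])
  also have "d \<smile> (pull fst z + taut) = d \<smile> taut + d \<smile> pull fst z" by (simp only: smile_add_right add.commute)
  also have "coh ?P \<dots> ((?S + ?u) + ?z)"
   by (rule coh_add[OF 1 2])
  finally have 3: "coh ?P (pull fst c) ((?S + ?u) + ?z)" .
  have e: "?l a = (pull fst c \<smile> unit + ?S) + (?z + ?u)"
  proof -
   have "?l a = ?l (\<lambda>j. if j = 0 then c else \<delta> (j - 1)) + (?z + ?u)"
    unfolding a_def by (simp only: lh_add)
   moreover have "?l (\<lambda>j. if j = 0 then c else \<delta> (j - 1)) = pull fst c \<smile> unit + ?S"
    unfolding lh_def sum.lessThan_Suc_shift by simp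
   ultimately show ?thesis by simp
  qed
  have "coh ?P (?l a) ((pull fst c + ?S) + (?z + ?u))"
   unfolding e by (intro coh_add coh_refl eqK_coh[OF smile_unit[OF sset_S]])
  also have "\<dots> = pull fst c + ((?S + ?u) + ?z)"
   by (simp only: ac_simps)
  also have "coh ?P \<dots> 0" using 3 by (simp only: coh_add_0)
  finally show ?thesis .
 qed
 from LH_independent[OF LH Za this] have a0: "coh ?B (a j) 0" if "j < ?n" for j using that .
 \<comment> \<open>Horner's scheme: the vanishing of each next coefficient rewrites
   \<open>\<delta> J\<close>, which raises the power of \<open>z\<close> and collects one more term
   of the Whitney polynomial.\<close>
 have "coh ?B c (\<delta> J \<smile> cpow z (Suc J) + \<delta> N \<smile> (\<Sum>j\<le>J. u (?n - j) \<smile> cpow z j))" if "J < ?n" for J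
  using that proof (induction J)
  case 0
  have "coh ?B (c + (\<delta> 0 \<smile> z + \<delta> N \<smile> u ?n)) 0" using a0[of 0] by (simp add: a_def)
  hence "coh ?B c (\<delta> 0 \<smile> z + \<delta> N \<smile> u ?n)" by (simp only: coh_add_0)
  also have "coh ?B \<dots> (\<delta> 0 \<smile> (unit \<smile> z) + \<delta> N \<smile> (u ?n \<smile> unit))"
   by (intro coh_add coh_smile_right[OF sset_S Z\<delta>] eqK_coh eqK_sym[OF unit_smile[OF sset_S]] eqK_sym[OF smile_unit[OF sset_S]])
  finally show "coh ?B c (\<delta> 0 \<smile> cpow z (Suc 0) + \<delta> N \<smile> (\<Sum>j\<le>0. u (?n - j) \<smile> cpow z j))" by simp
 next
  case (Suc J)
  let ?s = "\<lambda>J. \<Sum>j\<le>J. u (?n - j) \<smile> cpow z j"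
  have "coh ?B (\<delta> J + (\<delta> (Suc J) \<smile> z + \<delta> N \<smile> u (?n - Suc J))) 0" using a0[OF Suc.prems] by (simp add: a_def)
  hence s: "coh ?B (\<delta> J) (\<delta> (Suc J) \<smile> z + \<delta> N \<smile> u (?n - Suc J))" by (simp only: coh_add_0)
  have Zz: "Z ?B (cpow z i)" for i by (rule Z_cpow[OF sset_S z(2)])
  have "coh ?B c (\<delta> J \<smile> cpow z (Suc J) + \<delta> N \<smile> ?s J)" by (rule Suc.IH[OF Suc_lessD[OF Suc.prems]])
  also have "coh ?B \<dots> ((\<delta> (Suc J) \<smile> z + \<delta> N \<smile> u (?n - Suc J)) \<smile> cpow z (Suc J) + \<delta> N \<smile> ?s J)"
   by (rule coh_add[OF coh_smile_left[OF sset_S Zz s] coh_refl])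
  also have "\<dots> = \<delta> (Suc J) \<smile> (z \<smile> cpow z (Suc J)) + \<delta> N \<smile> ?s (Suc J)"
   by (simp only: smile_add_left smile_add_right smile_assoc sum.atMost_Suc ac_simps)
  also have "coh ?B \<dots> (\<delta> (Suc J) \<smile> cpow z (Suc (Suc J)) + \<delta> N \<smile> ?s (Suc J))"
  proof (rule coh_add[OF coh_smile_right[OF sset_S Z\<delta>] coh_refl])
   show "coh ?B (z \<smile> cpow z (Suc J)) (cpow z (Suc (Suc J)))"
    using coh_sym[OF deg1_central[OF sset_S z Zz[of "Suc J"]]] by (simp only: cpow.simps)
  qed
  finally show "coh ?B c (\<delta> (Suc J) \<smile> cpow z (Suc (Suc J)) + \<delta> N \<smile> ?s (Suc J))" .
 qed
 from this[of N] have "coh ?B c (\<delta> N \<smile> cpow z ?n + \<delta> N \<smile> (\<Sum>j\<le>N. u (?n - j) \<smile> cpow z j))" by simp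
 also have "coh ?B \<dots> (\<delta> N \<smile> (u 0 \<smile> cpow z ?n) + \<delta> N \<smile> (\<Sum>j\<le>N. u (?n - j) \<smile> cpow z j))"
 proof (intro coh_add coh_refl coh_smile_right[OF sset_S Z\<delta>])
  have "coh ?B (u 0 \<smile> cpow z ?n) (unit \<smile> cpow z ?n)"
   by (rule coh_smile_left[OF sset_S Z_cpow[OF sset_S z(2)]]) (use u in \<open>simp add: sw_def\<close>)
  from coh_trans[OF this eqK_coh[OF unit_smile[OF sset_S]]]
  show "coh ?B (cpow z ?n) (u 0 \<smile> cpow z ?n)" by (rule coh_sym)
 qed
 also have "\<dots> = \<delta> N \<smile> (\<Sum>j\<le>?n. u (?n - j) \<smile> cpow z j)"
  by (simp add: smile_add_right add.commute)
 finally show thesis by (rule that[OF Z\<delta>])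
qed

subsection \<open>Relations in the cohomology of the flag manifolds\<close>

definition hpoly :: "nat \<Rightarrow> poly2" where "hpoly m = (\<Sum>i\<le>m. X2 ^ i * Y2 ^ (m - i))"
text \<open>For \<open>m = Suc n\<close> this is the Whitney polynomial of \<open>R2\<close> with
  \<open>X2 + Y2\<close> in place of \<open>taut\<close>.\<close>

definition gpoly :: "nat \<Rightarrow> poly2" where "gpoly m = (\<Sum>j\<le>m. hpoly (m - j) * (X2 + Y2) ^ j)"
definition apoly :: poly2 where "apoly = X2 ^ 2 + X2 * Y2 + Y2 ^ 2"

lemma poly2_double: "p + p = (0 :: poly2)" proof -
 have "p + p = (1 + 1) * p" by (simp only: distrib_right mult_1_left)
 moreover have "(1 + 1 :: poly2) = 0" by (simp add: one_pCons)
 ultimately show ?thesis by simp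
qed

lemma hpoly_Suc: "hpoly (Suc m) = X2 ^ Suc m + Y2 * hpoly m" proof -
 have "(\<Sum>i\<le>m. X2 ^ i * Y2 ^ (Suc m - i)) = Y2 * hpoly m"
  unfolding hpoly_def sum_distrib_left by (rule sum.cong) (simp_all add: Suc_diff_le algebra_simps)
 thus ?thesis by (simp add: hpoly_def)
qed

lemma LH_injective:
 assumes F: "vector_bundle B F (Suc k)" and c: "ZS B c" and 0: "cohS (PB B F) (pull fst c) 0"
 shows "cohS B c 0" proof -
 let ?a = "\<lambda>i. if i = 0 then c else 0"
 have "lh fst taut (Suc k) ?a = (pull fst c \<smile> unit :: ('a \<times> (real^'b) set) cochain)"
  unfolding lh_def sum.lessThan_Suc_shift by simp
 moreover have "cohS (PB B F) (pull fst c \<smile> unit) 0"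
  by (rule coh_trans[OF eqK_coh[OF smile_unit[OF sset_S]] 0])
 ultimately have "cohS (PB B F) (lh fst taut (Suc k) ?a) 0" by (simp only:)
 from LH_independent[OF LH_vector_bundle[OF F] _ this, of 0] c show ?thesis by simp
qed

lemma LH_top_injective:
 assumes F: "vector_bundle B F (Suc k)" and c: "ZS B c" and 0: "cohS (PB B F) (pull fst c \<smile> cpow taut k) 0"
 shows "cohS B c 0" proof -
 let ?a = "\<lambda>i. if i = k then c else 0"
 have "lh fst taut (Suc k) ?a = (pull fst c \<smile> cpow taut k :: ('a \<times> (real^'b) set) cochain)"
  unfolding lh_def by simp
 with 0 have "cohS (PB B F) (lh fst taut (Suc k) ?a) 0" by (simp only:)
 from LH_independent[OF LH_vector_bundle[OF F] _ this, of k] c show ?thesis by simp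
qed

text \<open>Division of \<open>w\<close> by \<open>1 + x\<close>, degree by degree.\<close>

lemma whitney_line_solve:
 assumes x: "concentrated 1 x" "ZS B x" and v: "\<And>i. ZS B (v i)"
  and w: "\<And>i. cohS B (w i) (whitney_line x v i)"
 shows "cohS B (v 0) (w 0)" "cohS B (v (Suc i)) (w (Suc i) + v i \<smile> x)" proof -
 show "cohS B (v 0) (w 0)" using coh_sym[OF w[of 0]] by (simp add: whitney_line_def)
 have "cohS B (w (Suc i)) (v (Suc i) + x \<smile> v i)" using w[of "Suc i"] by (simp add: whitney_line_def)
 also have "cohS B \<dots> (v (Suc i) + v i \<smile> x)"
  by (rule coh_add[OF coh_refl coh_sym[OF deg1_central[OF sset_S x v]]])
 finally have "cohS B (w (Suc i) + (v (Suc i) + v i \<smile> x)) 0" by (simp only: coh_add_0)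
 hence "cohS B (v (Suc i) + (w (Suc i) + v i \<smile> x)) 0" by (simp only: ac_simps)
 thus "cohS B (v (Suc i)) (w (Suc i) + v i \<smile> x)" by (simp only: coh_add_0)
qed

abbreviation fl_x :: "('n::finite) fl2 cochain" where "fl_x \<equiv> pull fst taut"
abbreviation fl_y :: "('n::finite) fl2 cochain" where "fl_y \<equiv> taut"
abbreviation fl_ev :: "poly2 \<Rightarrow> ('n::finite) fl2 cochain" where "fl_ev \<equiv> evp fl_x fl_y"

lemma fl_classes: "concentrated 1 fl_x" "ZS Fl2 fl_x" "concentrated 1 fl_y" "ZS Fl2 fl_y"
 by (rule conc_pull[OF conc_taut] Z_pull[OF maps_bundle_fst Z_taut] conc_taut Z_taut)+

lemmas fl_cohom = cohom_evp[OF sset_S fl_classes]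
lemmas fl_hom = cohomD[OF fl_cohom]

lemma fl_gpoly:
 assumes u: "\<And>i. cohS (Fl2 :: ('n::finite) fl2 topology) (u i) (fl_ev (hpoly i))" "\<And>i. ZS (Fl2 :: 'n fl2 topology) (u i)"
 shows "cohS (Fl2 :: 'n fl2 topology) (\<Sum>j\<le>m. u (m - j) \<smile> cpow (fl_x + fl_y) j) (fl_ev (gpoly m))"
proof -
 let ?F2 = "Fl2 :: 'n fl2 topology"
 have Zz: "ZS ?F2 (fl_x + fl_y)" by (intro Z_add fl_classes)
 have "cohS ?F2 (fl_ev (X2 + Y2)) (fl_ev X2 + fl_ev Y2)" by (rule fl_hom(2))
 also have "cohS ?F2 \<dots> (fl_x + fl_y)"
  by (intro coh_add evp_X2[OF sset_S fl_classes] evp_Y2[OF sset_S fl_classes])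
 finally have z: "cohS ?F2 (fl_x + fl_y) (fl_ev (X2 + Y2))" by (rule coh_sym)
 have zj: "cohS ?F2 (cpow (fl_x + fl_y) j) (fl_ev ((X2 + Y2) ^ j))" for j
  by (rule coh_trans[OF coh_cpow[OF sset_S Zz z] coh_sym[OF cohom_power[OF sset_S fl_cohom]]])
 have "cohS ?F2 (\<Sum>j\<le>m. u (m - j) \<smile> cpow (fl_x + fl_y) j) (\<Sum>j\<le>m. fl_ev (hpoly (m - j) * (X2 + Y2) ^ j))"
  by (intro coh_sum coh_trans[OF coh_smile[OF sset_S u(2) Z_cpow[OF sset_S Zz] u(1) zj] coh_sym[OF fl_hom(3)]])
 also have "cohS ?F2 \<dots> (fl_ev (gpoly m))" unfolding gpoly_def by (rule coh_sym[OF cohom_sum[OF fl_cohom]])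
 finally show ?thesis .
qed

abbreviation fl_map :: "('n::finite) of2 \<Rightarrow> 'n fl2" where
 "fl_map \<equiv> \<lambda>z. fst (forget_orient z)"

lemma flag_class_eq: "flag_class = pull fst (fl_x + fl_y) + taut"
 by (simp add: flag_class_def pull_add pull_pull comp_def)

lemma cont_fl_map: "continuous_map OF2 Fl2 fl_map"
 by (rule cm_comp[OF cont_forget cont_bundle_fst])

lemma flag_class_cover: "cohS OF2 (pull forget_orient (flag_class :: (('n::finite) fl2 \<times> (real^'n) set) cochain)) 0"
 by (rule coh_trans[OF eqK_coh[OF eqK_sym[OF double_cover.delta_Theta[OF flag_double_cover]]] coh_delta])

abbreviation of_ev :: "poly2 \<Rightarrow> ('n::finite) of2 cochain" where
 "of_ev p \<equiv> pull fl_map (fl_ev p)"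

lemma of_classes:
 "concentrated 1 (pull fl_map fl_x :: ('n::finite) of2 cochain)" "ZS OF2 (pull fl_map fl_x :: 'n of2 cochain)" "concentrated 1 (pull fl_map fl_y :: 'n of2 cochain)" "ZS OF2 (pull fl_map fl_y :: 'n of2 cochain)"
 by (intro conc_pull fl_classes Z_pull[OF maps_Sing[OF cont_fl_map]])+

lemma of_ev_eq: "of_ev = evp (pull fl_map fl_x) (pull fl_map fl_y)" by (intro ext) (simp only: pull_evp)

lemma of_cohom: "cohom (Sing OF2) of_ev" unfolding of_ev_eq by (rule cohom_evp[OF sset_S of_classes])

lemmas of_hom = cohomD[OF of_cohom]

text \<open>The class of a double cover becomes zero on the covering space, so
  \<open>flag_class\<close> gives a linear relation between the three lines.\<close>

lemma third_line_sum: "cohS OF2 (pull fl_map (fl_x + fl_y)) (pull S2 eta :: ('n::finite) of2 cochain)"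
proof -
 have e: "pull forget_orient (flag_class :: (('n fl2) \<times> (real^'n) set) cochain) = pull fl_map (fl_x + fl_y) + pull S2 eta"
  unfolding flag_class_eq pull_add pull_pull comp_def by (simp add: forget_orient_def)
 show ?thesis using flag_class_cover[where 'n = 'n] unfolding e coh_add_0 .
qed

lemma third_line: "cohS OF2 (pull S2 eta :: ('n::finite) of2 cochain) (of_ev (X2 + Y2))"
proof (rule coh_sym, rule coh_trans[OF _ third_line_sum])
 show "cohS OF2 (of_ev (X2 + Y2) :: 'n of2 cochain) (pull fl_map (fl_x + fl_y))" unfolding pull_add
  by (rule coh_trans[OF of_hom(2)]) (intro coh_add coh_pull[OF maps_Sing[OF cont_fl_map]]
    evp_X2[OF sset_S fl_classes] evp_Y2[OF sset_S fl_classes])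
qed

lemma cohom_multiple_0:
 assumes \<psi>: "cohom (Sing K) \<psi>" and "cohS K (\<psi> p) 0" shows "cohS K (\<psi> (A * p)) 0"
 using coh_trans[OF cohomD(3)[OF \<psi>] coh_smile_right[OF sset_S cohomD(1)[OF \<psi>] assms(2)]] by simp

lemma cohom_add_0:
 assumes \<psi>: "cohom K \<psi>" and "coh K (\<psi> p) 0" "coh K (\<psi> q) 0" shows "coh K (\<psi> (p + q)) 0"
 using coh_trans[OF cohomD(2)[OF \<psi>] coh_add[OF assms(2,3)]] by simp

context
 fixes n :: nat
 assumes n: "CARD('n::finite) = Suc (Suc (Suc n))"
begin

lemma bundle_R:
 "vector_bundle (discrete_topology {()}) (\<lambda>_. UNIV :: (real^'n) set) (Suc (Suc (Suc n)))"
 "vector_bundle Fl1 (R1 :: _ \<Rightarrow> (real^'n) set) (Suc (Suc n))"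
 "vector_bundle Fl2 (R2 :: _ \<Rightarrow> (real^'n) set) (Suc n)" proof -
 show 1: "vector_bundle (discrete_topology {()}) (\<lambda>_. UNIV :: (real^'n) set) (Suc (Suc (Suc n)))"
  using n by (simp add: vector_bundle_def proj_ident dim_UNIV)
 show 2: "vector_bundle Fl1 (R1 :: _ \<Rightarrow> (real^'n) set) (Suc (Suc n))" by (rule vb_residual[OF 1])
 show "vector_bundle Fl2 (R2 :: _ \<Rightarrow> (real^'n) set) (Suc n)" by (rule vb_residual[OF 2])
qed

text \<open>The monomial is the product of the top basis powers of two projective bundles. Removing
  one after the other would make the unit of a point zero.\<close>

lemma fl_top: "\<not> cohS (Fl2 :: ('n::finite) fl2 topology) (fl_ev (X2 ^ Suc (Suc n) * Y2 ^ Suc n)) 0"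
proof
 assume "cohS (Fl2 :: 'n fl2 topology) (fl_ev (X2 ^ Suc (Suc n) * Y2 ^ Suc n)) 0"
 from coh_trans[OF coh_sym[OF evp_mono[OF sset_S fl_classes]] this]
 have "cohS (Fl2 :: 'n fl2 topology) (pull fst (cpow taut (Suc (Suc n))) \<smile> cpow taut (Suc n)) 0"
  by (simp only: pull_cpow)
 from LH_top_injective[OF bundle_R(2) Z_cpow[OF sset_S Z_taut] this]
 have 1: "cohS (Fl1 :: (unit \<times> (real^'n) set) topology) (cpow taut (Suc (Suc n))) 0" .
 have "cohS (Fl1 :: (unit \<times> (real^'n) set) topology) (pull fst unit \<smile> cpow taut (Suc (Suc n))) 0"
  by (rule coh_trans[OF coh_unit_top[OF coh_refl] 1])
 from LH_top_injective[OF bundle_R(1) Z_unit this]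
 have "cohS (discrete_topology {()}) unit 0" .
 moreover have "Sing (discrete_topology {()}) 0 (restrict (\<lambda>_. ()) (\<Delta> 0))"
  unfolding Sing_def by (rule simplex_restrictI) simp
 ultimately show False using unit_not_coh_0 by blast
qed

lemma eta_nilpotent: "cohS (RP :: (real^'n) set topology) (cpow eta (Suc (Suc (Suc n)))) 0"
proof -
 have c: "continuous_map (RP :: (real^'n) set topology) Fl1 (\<lambda>L. ((), L))"
  unfolding cont_bundle_iff by (simp add: comp_def)
 have "cohS (Fl1 :: (unit \<times> (real^'n) set) topology) (cpow taut (Suc (Suc (Suc n)))) 0"
  using taut_nilpotent[of "Basis :: (real^'n) set" "discrete_topology {()}"] n by simp
 from coh_pull[OF maps_Sing[OF c] this]
 have "cohS (RP :: (real^'n) set topology) (cpow (pull (\<lambda>L. L) eta) (Suc (Suc (Suc n)))) 0"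
  by (simp only: pull_cpow pull_pull comp_def snd_conv pull_0)
 with coh_cpow[OF sset_S Z_eta eqK_coh[OF eqK_sym[OF pull_ident[OF refl]]]] show ?thesis by (rule coh_trans)
qed

lemma line_nilpotent: "continuous_map B RP (L :: _ \<Rightarrow> (real^'n) set) \<Longrightarrow> cohS B (cpow (pull L eta) (Suc (Suc (Suc n)))) 0"
 using coh_pull[OF maps_Sing eta_nilpotent] by (simp only: pull_cpow pull_0)

text \<open>Splitting off the first line from the trivial bundle gives the powers of x as classes of
  \<open>R1\<close>; splitting off the second gives \<open>hpoly\<close> for \<open>R2\<close>. The
  Whitney relation of \<open>R1\<close> at y is the vanishing of
  \<open>hpoly (Suc (Suc n))\<close>.\<close>

lemma fl_relations:
 obtains u where "sw Fl2 (R2 :: _ \<Rightarrow> (real^'n) set) (Suc n) u" "\<And>i. cohS Fl2 (u i) (fl_ev (hpoly i))"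
  "cohS (Fl2 :: 'n fl2 topology) (fl_ev (hpoly (Suc (Suc n)))) 0" proof -
 let ?F1 = "Fl1 :: (unit \<times> (real^'n) set) topology" and ?F2 = "Fl2 :: 'n fl2 topology"
 obtain v where v: "sw ?F1 R1 (Suc (Suc n)) v" by (rule sw_exists[OF bundle_R(2)]) simp
 obtain u where u: "sw ?F2 R2 (Suc n) u" by (rule sw_exists[OF bundle_R(3)]) simp
 have Zv: "ZS ?F1 (v i)" and Zu: "ZS ?F2 (u i)" for i using u v by (simp_all add: sw_def)
 note v1 = whitney_line_solve[OF conc_taut Z_taut Zv
   sw_residual[OF bundle_R(1) v sw_trivial[of "discrete_topology {()}", where 'n = 'n, unfolded n]]]
 have vi: "cohS ?F1 (v i) (cpow taut i)" for i proof (induction i)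
  case 0
  show "cohS ?F1 (v 0) (cpow taut 0)" using v1(1) by simp
 next
  case (Suc i)
  have "cohS ?F1 (v (Suc i)) (v i \<smile> taut)" using v1(2)[of i] by simp
  from coh_trans[OF this coh_smile_left[OF sset_S Z_taut Suc]]
  show "cohS ?F1 (v (Suc i)) (cpow taut (Suc i))" by simp
 qed
 have pvi: "cohS ?F2 (pull fst (v i)) (fl_ev (X2 ^ i))" for i proof -
  have "cohS ?F2 (pull fst (v i)) (cpow fl_x i)"
   using coh_pull[OF maps_bundle_fst vi] by (simp only: pull_cpow)
  thus ?thesis using coh_sym[OF evp_X2_power[OF sset_S fl_classes]] by (rule coh_trans)
 qed
 note u1 = whitney_line_solve[OF conc_taut Z_taut Zu sw_residual[OF bundle_R(2) u v]]
 have ui: "cohS ?F2 (u i) (fl_ev (hpoly i))" for i proof (induction i)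
  case 0
  show "cohS ?F2 (u 0) (fl_ev (hpoly 0))" using coh_trans[OF u1(1) pvi] by (simp add: hpoly_def)
 next
  case (Suc i)
  have "cohS ?F2 (u (Suc i)) (pull fst (v (Suc i)) + u i \<smile> fl_y)" by (rule u1(2))
  also have "cohS ?F2 \<dots> (fl_ev (X2 ^ Suc i) + fl_ev (hpoly i) \<smile> fl_ev Y2)"
   by (intro coh_add pvi coh_smile[OF sset_S Zu Z_taut Suc] coh_sym[OF evp_Y2[OF sset_S fl_classes]])
  also have "cohS ?F2 \<dots> (fl_ev (X2 ^ Suc i) + fl_ev (hpoly i * Y2))"
   by (rule coh_add[OF coh_refl coh_sym[OF fl_hom(3)]])
  also have "cohS ?F2 \<dots> (fl_ev (X2 ^ Suc i + hpoly i * Y2))" by (rule coh_sym[OF fl_hom(2)])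
  also have "X2 ^ Suc i + hpoly i * Y2 = hpoly (Suc i)" by (simp only: hpoly_Suc mult.commute)
  finally show "cohS ?F2 (u (Suc i)) (fl_ev (hpoly (Suc i)))" .
 qed
 have "cohS ?F2 (fl_ev (hpoly (Suc (Suc n)))) (\<Sum>i\<le>Suc (Suc n). fl_ev (X2 ^ i * Y2 ^ (Suc (Suc n) - i)))"
  unfolding hpoly_def by (rule cohom_sum[OF fl_cohom])
 also have "cohS ?F2 \<dots> (whitney_sum (Suc (Suc n)) v)" unfolding whitney_sum_def
 proof (rule coh_sum)
  fix i
  have "cohS ?F2 (fl_ev (X2 ^ i * Y2 ^ (Suc (Suc n) - i))) (fl_ev (X2 ^ i) \<smile> fl_ev (Y2 ^ (Suc (Suc n) - i)))"
   by (rule fl_hom(3))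
  also have "cohS ?F2 \<dots> (pull fst (v i) \<smile> cpow taut (Suc (Suc n) - i))"
   by (rule coh_smile[OF sset_S fl_hom(1) fl_hom(1) coh_sym[OF pvi] evp_Y2_power[OF sset_S fl_classes]])
  finally show "cohS ?F2 (fl_ev (X2 ^ i * Y2 ^ (Suc (Suc n) - i))) (pull fst (v i) \<smile> cpow taut (Suc (Suc n) - i))" .
 qed
 also have "cohS ?F2 (whitney_sum (Suc (Suc n)) v) 0" using v by (simp add: sw_def)
 finally have "cohS ?F2 (fl_ev (hpoly (Suc (Suc n)))) 0" .
 thus thesis by (rule that[OF u ui])
qed

text \<open>The Gysin sequence of the double cover gives a multiple of \<open>flag_class\<close>,
  and \<open>linear_multiple\<close> eliminates the third line from it.\<close>

lemma of_kernel:
 assumes c: "ZS (Fl2 :: ('n::finite) fl2 topology) c" and 0: "cohS OF2 (pull fl_map c :: 'n of2 cochain) 0"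
 obtains e where "ZS Fl2 e" "cohS Fl2 c (e \<smile> fl_ev (gpoly (Suc n)))" proof -
 let ?F2 = "Fl2 :: 'n fl2 topology"
 obtain u where u: "sw ?F2 R2 (Suc n) u" "\<And>i. cohS ?F2 (u i) (fl_ev (hpoly i))" by (rule fl_relations) blast
 have "cohS OF2 (pull forget_orient (pull fst c)) 0" using 0 by (simp only: pull_pull comp_def)
 then obtain d where d: "ZS Fl3 d" "cohS Fl3 (pull fst c) (flag_class \<smile> d)"
  by (rule double_cover.gysin_kernel[OF flag_double_cover])
 obtain e where e: "ZS ?F2 e" "cohS ?F2 c (e \<smile> (\<Sum>j\<le>Suc n. u (Suc n - j) \<smile> cpow (fl_x + fl_y) j))"
  by (rule linear_multiple[OF bundle_R(3) u(1) concentrated_add[OF fl_classes(1,3)] Z_add[OF fl_classes(2,4)] c d(1) d(2)[unfolded flag_class_eq]])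
 have "ZS ?F2 (u i)" for i using u(1) by (simp add: sw_def)
 from coh_trans[OF e(2) coh_smile_right[OF sset_S e(1) fl_gpoly[OF u(2) this]]]
 show thesis by (rule that[OF e(1)])
qed

text \<open>The second relation is the Whitney relation of \<open>R2\<close>, pulled back along the
  third line, whose class is x + y. The powers vanish because each of the three lines is pulled back
  from projective space.\<close>

lemma of_relations:
 "cohS OF2 (of_ev (hpoly (Suc (Suc n))) :: ('n::finite) of2 cochain) 0" "cohS OF2 (of_ev (gpoly (Suc n)) :: 'n of2 cochain) 0"
 "cohS OF2 (of_ev (X2 ^ Suc (Suc (Suc n))) :: 'n of2 cochain) 0" "cohS OF2 (of_ev (Y2 ^ Suc (Suc (Suc n))) :: 'n of2 cochain) 0"
 "cohS OF2 (of_ev ((X2 + Y2) ^ Suc (Suc (Suc n))) :: 'n of2 cochain) 0" proof -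
 let ?F2 = "Fl2 :: 'n fl2 topology"
 note m = maps_Sing[OF cont_fl_map]
 obtain u where u: "sw ?F2 R2 (Suc n) u" "\<And>i. cohS ?F2 (u i) (fl_ev (hpoly i))"
  "cohS ?F2 (fl_ev (hpoly (Suc (Suc n)))) 0" by (rule fl_relations) blast
 show "cohS OF2 (of_ev (hpoly (Suc (Suc n))) :: 'n of2 cochain) 0" using coh_pull[OF m u(3)] by simp
 have Zu: "ZS ?F2 (u i)" for i using u(1) by (simp add: sw_def)
 have Zz: "ZS ?F2 (fl_x + fl_y)" by (intro Z_add fl_classes)
 have "cohS OF2 (of_ev (gpoly (Suc n))) (pull fl_map (\<Sum>j\<le>Suc n. u (Suc n - j) \<smile> cpow (fl_x + fl_y) j))"
  by (rule coh_sym[OF coh_pull[OF m fl_gpoly[OF u(2) Zu]]])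
 also have "pull fl_map (\<Sum>j\<le>Suc n. u (Suc n - j) \<smile> cpow (fl_x + fl_y) j) =
   (\<Sum>j\<le>Suc n. pull fl_map (u (Suc n - j)) \<smile> cpow (pull fl_map (fl_x + fl_y)) j)"
  by (simp only: pull_sum pull_smile pull_cpow)
 also have "cohS OF2 \<dots> (\<Sum>j\<le>Suc n. pull fl_map (u (Suc n - j)) \<smile> cpow (pull S2 eta) j)"
  by (intro coh_sum coh_smile_right[OF sset_S Z_pull[OF m Zu]] coh_cpow[OF sset_S Z_pull[OF m Zz] third_line_sum])
 also have "\<dots> = pull forget_orient (whitney_sum (Suc n) u)" proof -
  have w: "(whitney_sum (Suc n) u :: ('n fl2 \<times> (real^'n) set) cochain) = (\<Sum>j\<le>Suc n. pull fst (u (Suc n - j)) \<smile> cpow taut (Suc n - (Suc n - j)))"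
   unfolding whitney_sum_def
   using sum.nat_diff_reindex[of "\<lambda>i. pull fst (u i) \<smile> cpow taut (Suc n - i)" "Suc (Suc n)", symmetric]
   by (simp only: lessThan_Suc_atMost diff_Suc_Suc)
  show ?thesis
   unfolding w pull_sum pull_smile pull_cpow pull_pull comp_def by (rule sum.cong) (simp_all add: forget_orient_def)
 qed
 also have "cohS OF2 (pull forget_orient (whitney_sum (Suc n) u)) (pull forget_orient 0)"
  by (rule coh_pull[OF maps_Sing[OF cont_forget]]) (use u(1) in \<open>simp add: sw_def\<close>)
 finally show "cohS OF2 (of_ev (gpoly (Suc n)) :: 'n of2 cochain) 0" by simp
 have l: "pull fl_map fl_x = pull (\<lambda>z. snd (fst z)) eta" "pull fl_map fl_y = pull snd eta"
  by (simp_all add: pull_pull comp_def forget_orient_def)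
 have c1: "continuous_map OF2 (RP :: (real^'n) set topology) (\<lambda>z. snd (fst z))"
  by (rule cm_comp[OF cont_bundle_fst cont_bundle_snd])
 show "cohS OF2 (of_ev (X2 ^ Suc (Suc (Suc n))) :: 'n of2 cochain) 0"
  unfolding fun_cong[OF of_ev_eq]
  by (rule coh_trans[OF evp_X2_power[OF sset_S of_classes]], unfold l, rule line_nilpotent[OF c1])
 show "cohS OF2 (of_ev (Y2 ^ Suc (Suc (Suc n))) :: 'n of2 cochain) 0"
  unfolding fun_cong[OF of_ev_eq]
  by (rule coh_trans[OF evp_Y2_power[OF sset_S of_classes]], unfold l, rule line_nilpotent[OF cont_bundle_snd])
 have "cohS OF2 (of_ev ((X2 + Y2) ^ Suc (Suc (Suc n))) :: 'n of2 cochain) (cpow (of_ev (X2 + Y2)) (Suc (Suc (Suc n))))"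
  by (rule cohom_power[OF sset_S of_cohom])
 also have "cohS OF2 \<dots> (cpow (pull S2 eta) (Suc (Suc (Suc n))))"
  by (rule coh_cpow[OF sset_S of_hom(1) coh_sym[OF third_line]])
 also have "cohS OF2 \<dots> 0" by (rule line_nilpotent[OF S2_line])
 finally show "cohS OF2 (of_ev ((X2 + Y2) ^ Suc (Suc (Suc n))) :: 'n of2 cochain) 0" .
qed

definition fl_ideal :: "poly2 set" where
 "fl_ideal = {A * X2 ^ Suc (Suc (Suc n)) + B * hpoly (Suc (Suc n)) | A B. True}"

lemma fl_ideal_0: "p \<in> fl_ideal \<Longrightarrow> cohS (Fl2 :: ('n::finite) fl2 topology) (fl_ev p) 0"
proof -
 let ?F2 = "Fl2 :: 'n fl2 topology"
 have "cohS ?F2 (fl_ev (hpoly (Suc (Suc n)))) 0" by (rule fl_relations)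
 moreover have "cohS ?F2 (fl_ev (X2 ^ Suc (Suc (Suc n)))) 0"
 proof (rule coh_trans[OF evp_X2_power[OF sset_S fl_classes]])
  have c: "continuous_map ?F2 (RP :: (real^'n) set topology) (\<lambda>z. snd (fst z))"
   by (rule cm_comp[OF cont_bundle_fst cont_bundle_snd])
  show "cohS ?F2 (cpow fl_x (Suc (Suc (Suc n)))) 0"
   using line_nilpotent[OF c] by (simp only: pull_pull comp_def)
 qed
 moreover assume "p \<in> fl_ideal"
 ultimately show ?thesis
  unfolding fl_ideal_def by (auto intro!: cohom_add_0[OF fl_cohom] cohom_multiple_0[OF fl_cohom])
qed

text \<open>A certificate by duality: if \<open>p\<close> died upstairs, it would be a multiple of
  \<open>gpoly (Suc n)\<close>, hence killed by \<open>u\<close>; but \<open>p * u\<close> is the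
  nonzero top class.\<close>

theorem nonzero_criterion:
 assumes g: "u * gpoly (Suc n) \<in> fl_ideal" and top: "p * u + X2 ^ Suc (Suc n) * Y2 ^ Suc n \<in> fl_ideal"
 shows "\<not> cohS OF2 (of_ev p :: ('n::finite) of2 cochain) 0" proof
 let ?F2 = "Sing (Fl2 :: 'n fl2 topology)"
 let ?t = "X2 ^ Suc (Suc n) * Y2 ^ Suc n"
 assume "cohS OF2 (of_ev p :: 'n of2 cochain) 0"
 then obtain e where e: "Z ?F2 e" "coh ?F2 (fl_ev p) (e \<smile> fl_ev (gpoly (Suc n)))" by (rule of_kernel[OF fl_hom(1)])
 have "coh ?F2 (fl_ev (p * u)) (fl_ev p \<smile> fl_ev u)" by (rule fl_hom(3))
 also have "coh ?F2 \<dots> ((e \<smile> fl_ev (gpoly (Suc n))) \<smile> fl_ev u)" by (rule coh_smile_left[OF sset_S fl_hom(1) e(2)])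
 also have "\<dots> = e \<smile> (fl_ev (gpoly (Suc n)) \<smile> fl_ev u)" by (rule smile_assoc)
 also have "coh ?F2 \<dots> (e \<smile> fl_ev (gpoly (Suc n) * u))"
  by (rule coh_smile_right[OF sset_S e(1) coh_sym[OF fl_hom(3)]])
 also have "coh ?F2 \<dots> (e \<smile> 0)"
  by (rule coh_smile_right[OF sset_S e(1)]) (use fl_ideal_0[OF g] in \<open>simp add: mult.commute\<close>)
 finally have pu: "coh ?F2 (fl_ev (p * u)) 0" by simp
 have "coh ?F2 (fl_ev (p * u + ?t)) (fl_ev (p * u) + fl_ev ?t)" by (rule fl_hom(2))
 from coh_trans[OF coh_sym[OF this] fl_ideal_0[OF top]]
 have "coh ?F2 (fl_ev (p * u)) (fl_ev ?t)" by (simp only: coh_add_0)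
 from coh_trans[OF coh_sym[OF this] pu] fl_top show False by blast
qed

text \<open>The powers of \<open>Y2\<close> and of \<open>X2 + Y2\<close> are listed as generators
  as well, because the certificates of \<open>upper_poly_2\<close> are expressed with them.\<close>

theorem zero_criterion:
 assumes "p = A * X2 ^ Suc (Suc (Suc n)) + B * hpoly (Suc (Suc n)) + C * gpoly (Suc n)
   + D * Y2 ^ Suc (Suc (Suc n)) + E * (X2 + Y2) ^ Suc (Suc (Suc n))"
 shows "cohS OF2 (of_ev p :: ('n::finite) of2 cochain) 0"
 unfolding assms by (intro cohom_add_0[OF of_cohom] cohom_multiple_0[OF of_cohom] of_relations)

end

text \<open>Upstairs the canonical bundle is a sum of three lines, so \<open>w 2\<close> becomes the
  second elementary symmetric polynomial in x, y and x + y.\<close>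

lemma canonical_w2:
 assumes w: "sw (Gr :: (real^'n^3) set topology) CF 3 w"
 shows "cohS OF2 (pull fst (pull fst (w 2))) (pull (\<lambda>z. fst (forget_orient z)) (fl_ev apoly :: 'n fl2 cochain))"
proof -
 let ?O1 = "OF1 :: ((real^'n^3) set \<times> (real^'n) set) topology" and ?O2 = "OF2 :: 'n of2 topology"
 have F0: "vector_bundle (Gr :: (real^'n^3) set topology) CF (Suc (Suc (Suc 0)))"
  using vb_canonical[where 'k = 3 and 'n = 'n] by (simp add: numeral_3_eq_3)
 note F1 = vb_residual[OF F0] and F2 = vb_residual[OF vb_residual[OF F0]]
 obtain s where s: "sw ?O1 S1 (Suc (Suc 0)) s" by (rule sw_exists[OF F1]) simp
 obtain r where r: "sw ?O2 S2 (Suc 0) r" by (rule sw_exists[OF F2]) simp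
 let ?x = "pull fst taut :: 'n of2 cochain"
 let ?y = "taut :: 'n of2 cochain"
 let ?z = "pull S2 eta :: 'n of2 cochain"
 let ?E = "\<lambda>p. pull (\<lambda>z. fst (forget_orient z)) (fl_ev p :: 'n fl2 cochain)"
 note E = of_hom
 have xy: "pull (\<lambda>z. fst (forget_orient z)) fl_x = ?x" "pull (\<lambda>z. fst (forget_orient z)) fl_y = ?y"
  by (simp_all add: pull_pull comp_def forget_orient_def)
 have Ex: "cohS ?O2 ?x (?E X2)" and Ey: "cohS ?O2 ?y (?E Y2)" unfolding fun_cong[OF of_ev_eq] xy
  by (rule coh_sym[OF evp_X2[OF sset_S of_classes[where 'n = 'n, unfolded xy]]], rule coh_sym[OF evp_Y2[OF sset_S of_classes[where 'n = 'n, unfolded xy]]])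
 have Zr: "ZS ?O2 (r i)" and Zs: "ZS ?O1 (s i)" for i using r s by (simp_all add: sw_def)
 have Zz: "ZS ?O2 ?z" by (rule Z_pull[OF maps_Sing[OF S2_line] Z_eta])
 have r1: "cohS ?O2 (r 1) (?E (X2 + Y2))" proof -
  have p0: "proj {0} v = 0" for v :: "real^'n" using proj_mem[OF subspace_single_0, of v] by simp
  have "sw ?O2 S2 (Suc 0) (whitney_line ?z (\<lambda>i. if i = 0 then unit else 0))"
  proof (rule sw_whitney_line[OF _ S2_line _ sw_zero])
   show "vector_bundle ?O2 (\<lambda>_. {0}) 0" by (simp add: vector_bundle_def p0)
   show "u = proj {0} u + proj (S2 b) u" if "b \<in> topspace ?O2" "u \<in> S2 b" for b u
    using proj_ident[OF vbD(1)[OF F2 that(1)] that(2)] by (simp add: p0)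
  qed
  from sw_unique[OF F2 _ r this, of 1]
  have "cohS ?O2 (r 1) (?z \<smile> unit)" by (simp add: whitney_line_def)
  from coh_trans[OF coh_trans[OF this eqK_coh[OF smile_unit[OF sset_S]]] third_line] show ?thesis .
 qed
 have s1: "cohS ?O2 (pull fst (s 1)) (?E ((X2 + Y2) + Y2))" proof -
  have "cohS ?O2 (pull fst (s 1)) (r 1 + ?y \<smile> r 0)"
   using sw_residual[OF F1 r s, of 1] by (simp add: whitney_line_def)
  also have "cohS ?O2 \<dots> (?E (X2 + Y2) + ?y \<smile> unit)"
   by (intro coh_add r1 coh_smile_right[OF sset_S Z_taut]) (use r in \<open>simp add: sw_def\<close>)
  also have "cohS ?O2 \<dots> (?E (X2 + Y2) + ?E Y2)"
   by (intro coh_add coh_refl coh_trans[OF eqK_coh[OF smile_unit[OF sset_S]] Ey])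
  also have "cohS ?O2 \<dots> (?E ((X2 + Y2) + Y2))" by (rule coh_sym[OF E(2)])
  finally show ?thesis .
 qed
 have s2: "cohS ?O2 (pull fst (s 2)) (?E (Y2 * (X2 + Y2)))" proof -
  have "cohS ?O2 (pull fst (s 2)) (?y \<smile> r 1)"
   using sw_residual[OF F1 r s, of 2] r by (simp add: whitney_line_def sw_def)
  also have "cohS ?O2 \<dots> (?E Y2 \<smile> ?E (X2 + Y2))" by (rule coh_smile[OF sset_S Z_taut Zr Ey r1])
  also have "cohS ?O2 \<dots> (?E (Y2 * (X2 + Y2)))" by (rule coh_sym[OF E(3)])
  finally show ?thesis .
 qed
 have "cohS ?O1 (pull fst (w 2)) (s 2 + taut \<smile> s 1)"
  using sw_residual[OF F0 s, of w 2] w by (simp add: whitney_line_def numeral_3_eq_3)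
 from coh_pull[OF maps_bundle_fst this]
 have "cohS ?O2 (pull fst (pull fst (w 2))) (pull fst (s 2) + ?x \<smile> pull fst (s 1))" by (simp only: pull_add pull_smile)
 also have "cohS ?O2 \<dots> (?E (Y2 * (X2 + Y2)) + ?E X2 \<smile> ?E ((X2 + Y2) + Y2))"
  by (intro coh_add s2 coh_smile[OF sset_S _ _ Ex s1] Z_pull[OF maps_bundle_fst] Z_taut Zs)
 also have "cohS ?O2 \<dots> (?E (Y2 * (X2 + Y2)) + ?E (X2 * ((X2 + Y2) + Y2)))"
  by (rule coh_add[OF coh_refl coh_sym[OF E(3)]])
 also have "cohS ?O2 \<dots> (?E (Y2 * (X2 + Y2) + X2 * ((X2 + Y2) + Y2)))" by (rule coh_sym[OF E(2)])
 also have "Y2 * (X2 + Y2) + X2 * ((X2 + Y2) + Y2) = apoly"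
  by (simp add: apoly_def power2_eq_square add.assoc poly2_double distrib_left mult.commute[of Y2 X2] add.commute add.left_commute)
 finally show ?thesis .
qed

theorem canonical_power_iff:
 assumes w: "sw (Gr :: (real^'n^3) set topology) CF 3 w"
 shows "cohS (Gr :: (real^'n^3) set topology) (cpow (w 2) m) 0 \<longleftrightarrow>
  cohS OF2 (pull (\<lambda>z. fst (forget_orient z)) (fl_ev (apoly ^ m) :: 'n fl2 cochain)) 0"
proof -
 let ?G = "Gr :: (real^'n^3) set topology"
 let ?p = "pull fst (pull fst (cpow (w 2) m)) :: 'n of2 cochain"
 have F0: "vector_bundle ?G CF (Suc (Suc (Suc 0)))"
  using vb_canonical[where 'k = 3 and 'n = 'n] by (simp add: numeral_3_eq_3)
 have Zw: "ZS ?G (w i)" for i using w by (simp add: sw_def)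
 have Zm: "ZS ?G (cpow (w 2) m)" by (rule Z_cpow[OF sset_S Zw])
 have "cohS OF2 ?p (pull (\<lambda>z. fst (forget_orient z)) (fl_ev (apoly ^ m)))" unfolding pull_cpow
  by (rule coh_trans[OF coh_cpow[OF sset_S _ canonical_w2[OF w]] coh_sym[OF cohom_power[OF sset_S of_cohom]]])
   (intro Z_pull[OF maps_bundle_fst] Zw)
 note e = this
 have "cohS ?G (cpow (w 2) m) 0 \<longleftrightarrow> cohS OF2 ?p 0" proof
  assume "cohS OF2 ?p 0"
  from LH_injective[OF vb_residual[OF F0] Z_pull[OF maps_bundle_fst Zm] this]
  show "cohS ?G (cpow (w 2) m) 0" by (rule LH_injective[OF F0 Zm])
 next
  assume "cohS ?G (cpow (w 2) m) 0"
  from coh_pull[OF maps_bundle_fst coh_pull[OF maps_bundle_fst this]] show "cohS OF2 ?p 0" by simp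
 qed
 thus ?thesis using coh_trans[OF e] coh_trans[OF coh_sym[OF e]] by blast
qed

subsection \<open>Polynomial identities in characteristic two\<close>

lemma poly2_two: "(2 :: poly2) = 0" using poly2_double[of 1] by simp

lemma frobenius: "(p + q :: poly2) ^ (2 ^ k) = p ^ (2 ^ k) + q ^ (2 ^ k)" proof (induction k)
 case (Suc k)
 have "(u + v) ^ 2 = u ^ 2 + v ^ 2" for u v :: poly2 by (simp add: power2_sum poly2_two)
 thus ?case using Suc by (simp add: power_mult mult.commute[of 2])
qed simp

lemma Z_h: "(X2 + Y2) * hpoly m = X2 ^ Suc m + Y2 ^ Suc m" proof (induction m)
 case 0
 thus ?case by (simp add: hpoly_def)
next
 case (Suc m)
 have "(X2 + Y2) * hpoly (Suc m) = (X2 + Y2) * X2 ^ Suc m + Y2 * ((X2 + Y2) * hpoly m)"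
  by (simp add: hpoly_Suc algebra_simps)
 also have "\<dots> = X2 ^ Suc (Suc m) + Y2 ^ Suc (Suc m) + 2 * (Y2 * X2 ^ Suc m)"
  unfolding Suc by (simp add: algebra_simps)
 finally show ?case by (simp add: poly2_two)
qed

lemma gpoly_Suc: "gpoly (Suc m) = hpoly (Suc m) + (X2 + Y2) * gpoly m" proof -
 have "(\<Sum>j\<le>m. hpoly (Suc m - Suc j) * (X2 + Y2) ^ Suc j) = (X2 + Y2) * gpoly m"
  unfolding gpoly_def sum_distrib_left by (rule sum.cong) (simp_all add: algebra_simps)
 thus ?thesis unfolding gpoly_def[of "Suc m"] sum.atMost_Suc_shift by simp
qed

text \<open>The quotient formula for complete symmetric polynomials in three variables:
  \<open>X2 * Y2 * (X2 + Y2)\<close> is the Vandermonde product of \<open>X2\<close>,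
  \<open>Y2\<close>, \<open>X2 + Y2\<close> in characteristic two.\<close>

lemma b_g: "X2 * Y2 * (X2 + Y2) * gpoly m = X2 ^ (m + 3) + Y2 ^ (m + 3) + (X2 + Y2) ^ (m + 3)"
proof (induction m)
 case 0
 have "X2 ^ 3 + Y2 ^ 3 + (X2 + Y2) ^ 3 = X2 * Y2 * (X2 + Y2) + 2 * (X2 ^ 3 + Y2 ^ 3 + X2 * Y2 * (X2 + Y2))"
  by (simp add: algebra_simps power3_eq_cube)
 thus ?case by (simp add: gpoly_def hpoly_def poly2_two)
next
 case (Suc m)
 have "X2 * Y2 * (X2 + Y2) * gpoly (Suc m) =
   X2 * Y2 * ((X2 + Y2) * hpoly (Suc m)) + (X2 + Y2) * (X2 * Y2 * (X2 + Y2) * gpoly m)"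
  by (simp add: gpoly_Suc algebra_simps)
 also have "\<dots> = X2 * Y2 * (X2 ^ (m + 2) + Y2 ^ (m + 2)) + (X2 + Y2) * (X2 ^ (m + 3) + Y2 ^ (m + 3) + (X2 + Y2) ^ (m + 3))"
  by (simp only: Suc.IH Z_h) simp
 also have "\<dots> = X2 ^ (Suc m + 3) + Y2 ^ (Suc m + 3) + (X2 + Y2) ^ (Suc m + 3)" proof -
  have "X2 * Y2 * (u + v) + (X2 + Y2) * (X2 * u + Y2 * v + w) =
    X2 * (X2 * u) + Y2 * (Y2 * v) + (X2 + Y2) * w + 2 * (X2 * Y2 * (u + v))" for u v w :: poly2
   by (simp add: algebra_simps)
  from this[of "X2 ^ (m + 2)" "Y2 ^ (m + 2)" "(X2 + Y2) ^ (m + 3)"]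
  show ?thesis by (simp add: poly2_two power_Suc[symmetric] eval_nat_numeral del: power_Suc)
 qed
 finally show ?case .
qed

lemma XYZ_nonzero: "X2 \<noteq> 0" "Y2 \<noteq> 0" "X2 + Y2 \<noteq> 0" by (auto simp: X2_def Y2_def)

lemma power_X2: "X2 ^ n = [:[:0, 1:] ^ n:]" by (induction n) (simp_all add: X2_def one_pCons mult.commute)

text \<open>Setting both variables equal shows that \<open>A + B\<close> is divisible by
  \<open>X2 + Y2\<close>; by \<open>Z_h\<close> the rest is divisible anyway. So dividing the
  monomial ideal by \<open>X2 + Y2\<close> leads to the ideal of the flag manifold.\<close>

lemma ideal_division:
 assumes v: "(X2 + Y2) * v = A * X2 ^ Suc n + B * Y2 ^ Suc n"
 obtains C where "v = C * X2 ^ Suc n + B * hpoly n" proof -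
 let ?x = "[:0, 1:] :: bit poly"
 have Z: "X2 + Y2 = [:- ?x, 1:]" by (simp add: X2_def Y2_def)
 have "(X2 + Y2) * v = (A + B) * X2 ^ Suc n + B * ((X2 + Y2) * hpoly n) + 2 * (- B * X2 ^ Suc n)"
  unfolding v Z_h by (simp add: algebra_simps)
 hence e: "(X2 + Y2) * v = (A + B) * X2 ^ Suc n + B * ((X2 + Y2) * hpoly n)" by (simp add: poly2_two)
 hence "(X2 + Y2) * (v - B * hpoly n) = (A + B) * X2 ^ Suc n" by (simp add: algebra_simps)
 hence "poly ((A + B) * X2 ^ Suc n) ?x = poly ((X2 + Y2) * (v - B * hpoly n)) ?x" by simp
 also have "\<dots> = 0" by (simp add: Z)
 finally have "poly (A + B) ?x * ?x ^ Suc n = 0" by (simp only: power_X2 poly_mult poly_pCons poly_0) simp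
 hence "poly (A + B) ?x = 0" by (rule mult_eq_0_iff[THEN iffD1, THEN disjE]) (assumption, simp only: power_eq_0_iff, simp)
 then obtain C where C: "A + B = (X2 + Y2) * C" unfolding Z poly_eq_0_iff_dvd by (rule dvdE)
 have "(X2 + Y2) * v = (X2 + Y2) * (C * X2 ^ Suc n + B * hpoly n)" unfolding e C by (simp add: algebra_simps)
 hence "v = C * X2 ^ Suc n + B * hpoly n" using XYZ_nonzero(3) by (simp only: mult_cancel_left) simp
 thus thesis by (rule that)
qed

text \<open>Congruence modulo a monomial ideal, where reductions can be seen term by term.
  Membership in the flag ideal is tested there after multiplication by
  \<open>X2 + Y2\<close>.\<close>

definition pcong :: "nat \<Rightarrow> poly2 \<Rightarrow> poly2 \<Rightarrow> bool" where
 "pcong n p q \<longleftrightarrow> (\<exists>A B. p = q + (A * X2 ^ n + B * Y2 ^ n))"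

lemma pcongI: "p = q + (A * X2 ^ n + B * Y2 ^ n) \<Longrightarrow> pcong n p q" unfolding pcong_def by blast

lemma pcong_trans: assumes "pcong n p q" "pcong n q r" shows "pcong n p r" proof -
 obtain A B C D where "p = q + (A * X2 ^ n + B * Y2 ^ n)" "q = r + (C * X2 ^ n + D * Y2 ^ n)"
  using assms by (auto simp: pcong_def)
 hence "p = r + ((A + C) * X2 ^ n + (B + D) * Y2 ^ n)" by (simp add: algebra_simps)
 thus ?thesis by (rule pcongI)
qed

lemma pcong_mult: assumes "pcong n p q" shows "pcong n (c * p) (c * q)" proof -
 obtain A B where "p = q + (A * X2 ^ n + B * Y2 ^ n)" using assms by (auto simp: pcong_def)
 hence "c * p = c * q + ((c * A) * X2 ^ n + (c * B) * Y2 ^ n)" by (simp add: algebra_simps)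
 thus ?thesis by (rule pcongI)
qed

lemma pcong_shift: assumes "pcong n p q" shows "pcong (n + d) ((X2 * Y2) ^ d * p) ((X2 * Y2) ^ d * q)" proof -
 obtain A B where "p = q + (A * X2 ^ n + B * Y2 ^ n)" using assms by (auto simp: pcong_def)
 hence "(X2 * Y2) ^ d * p = (X2 * Y2) ^ d * q + ((A * Y2 ^ d) * X2 ^ (n + d) + (B * X2 ^ d) * Y2 ^ (n + d))"
  by (simp add: algebra_simps power_add power_mult_distrib)
 thus ?thesis by (rule pcongI)
qed

lemma pcong_mono: assumes "pcong n p q" "m \<le> n" shows "pcong m p q" proof -
 obtain A B where "p = q + (A * X2 ^ n + B * Y2 ^ n)" using assms by (auto simp: pcong_def)
 hence "p = q + ((A * X2 ^ (n - m)) * X2 ^ m + (B * Y2 ^ (n - m)) * Y2 ^ m)"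
  using assms(2) by (simp add: mult.assoc power_add[symmetric])
 thus ?thesis by (rule pcongI)
qed

lemma pcong_power: assumes "pcong n p q" shows "pcong (n * 2 ^ k) (p ^ 2 ^ k) (q ^ 2 ^ k)" proof -
 obtain A B where "p = q + (A * X2 ^ n + B * Y2 ^ n)" using assms by (auto simp: pcong_def)
 hence "p ^ 2 ^ k = q ^ 2 ^ k + (A ^ 2 ^ k * X2 ^ (n * 2 ^ k) + B ^ 2 ^ k * Y2 ^ (n * 2 ^ k))"
  by (simp only: frobenius power_mult_distrib power_mult)
 thus ?thesis by (rule pcongI)
qed

text \<open>From \<open>k\<close> to \<open>k + 1\<close> the congruence is squared and multiplied
  by \<open>apoly\<close>. Of the three terms of \<open>apoly\<close> only \<open>X2 * Y2\<close>
  survives, as the squares lift an exponent to \<open>2 ^ Suc k\<close>.\<close>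

lemma apoly_power: "pcong (2 ^ k) (apoly ^ (2 ^ k - 1)) ((X2 * Y2) ^ (2 ^ k - 1))" proof (induction k)
 case 0
 show ?case by (rule pcongI[of _ _ 0 _ 0]) simp
next
 case (Suc k)
 let ?Q = "2 ^ k :: nat"
 have Q: "2 ^ Suc k - 1 = (?Q - 1) * 2 + 1" proof -
  have "?Q \<ge> 1" by simp
  thus ?thesis unfolding power_Suc by linarith
 qed
 have 1: "pcong (2 ^ Suc k) ((apoly ^ (?Q - 1)) ^ 2) (((X2 * Y2) ^ (?Q - 1)) ^ 2)"
  using pcong_power[OF Suc, of 1] by (simp add: mult.commute)
 have p1: "pcong (2 ^ Suc k) (apoly * (apoly ^ (?Q - 1)) ^ 2) (apoly * ((X2 * Y2) ^ (?Q - 1)) ^ 2)"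
  by (rule pcong_mult[OF 1])
 have e1: "apoly * (apoly ^ (?Q - 1)) ^ 2 = apoly ^ (2 ^ Suc k - 1)"
  unfolding Q by (simp add: power_add power_mult)
 have p2: "pcong (2 ^ Suc k) (apoly * ((X2 * Y2) ^ (?Q - 1)) ^ 2) ((X2 * Y2) ^ (2 ^ Suc k - 1))" proof -
  have e: "2 ^ Suc k = (?Q - 1) * 2 + 2" using Q by simp
  have "apoly * ((X2 * Y2) ^ (?Q - 1)) ^ 2 = (X2 * Y2) ^ ((?Q - 1) * 2 + 1) +
    (Y2 ^ ((?Q - 1) * 2) * X2 ^ ((?Q - 1) * 2 + 2) + X2 ^ ((?Q - 1) * 2) * Y2 ^ ((?Q - 1) * 2 + 2))"
   by (simp only: apoly_def power_add power_mult power_mult_distrib power_one_right) (simp add: algebra_simps power2_eq_square)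
  hence "pcong ((?Q - 1) * 2 + 2) (apoly * ((X2 * Y2) ^ (?Q - 1)) ^ 2) ((X2 * Y2) ^ ((?Q - 1) * 2 + 1))"
   by (rule pcongI)
  thus ?thesis by (simp only: e[symmetric] Q[symmetric])
 qed
 show ?case using pcong_trans[OF p1 p2] unfolding e1 .
qed

text \<open>A Frobenius power of the preceding congruence: the exponent is
  \<open>2 ^ (k - 2) - 1\<close> times \<open>2 ^ (l + 2)\<close>.\<close>

lemma apoly_power_4:
 assumes "2 \<le> k"
 shows "pcong (2 ^ k * 2 ^ l) (apoly ^ ((2 ^ k - 4) * 2 ^ l)) ((X2 * Y2) ^ ((2 ^ k - 4) * 2 ^ l))" proof -
 obtain j where j: "k = 2 + j" using le_Suc_ex[OF assms] by blast
 have "(2 ^ j - 1) * 2 ^ (2 + l) = (2 ^ k - 4) * (2 ^ l :: nat)" "2 ^ j * 2 ^ (2 + l) = 2 ^ k * (2 ^ l :: nat)"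
  by (simp_all add: j power_add diff_mult_distrib)
 thus ?thesis using pcong_power[OF apoly_power[of j], of "2 + l"] unfolding power_mult[symmetric] by (simp only:)
qed

text \<open>Both ends of the range of \<open>n\<close> are reached from an extreme one: nonvanishing is transported
 upwards by multiplying with powers of \<open>X2 * Y2\<close>, vanishing downwards because the ideal shrinks.\<close>

definition flag_ideal :: "nat \<Rightarrow> poly2 \<Rightarrow> bool" where
 "flag_ideal n p \<longleftrightarrow> (\<exists>A B. p = A * X2 ^ Suc n + B * hpoly n)"

section \<open>Certificates for nonvanishing\<close>

lemma flag_idealI: "pcong (Suc n) ((X2 + Y2) * p) 0 \<Longrightarrow> flag_ideal n p"
 unfolding pcong_def flag_ideal_def using ideal_division[of p _ n] by (metis add_0)

text \<open>Multiplied by \<open>X2 + Y2\<close>, the top monomial becomes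
  \<open>(X2 * Y2) ^ n\<close> modulo \<open>X2 ^ Suc n\<close>.\<close>

lemma flag_ideal_top:
 assumes "pcong (Suc n) ((X2 + Y2) * p) ((X2 * Y2) ^ n)"  "0 < n"
 shows "flag_ideal n (p + X2 ^ n * Y2 ^ (n - 1))" proof (rule flag_idealI)
 obtain A B where AB: "(X2 + Y2) * p = (X2 * Y2) ^ n + (A * X2 ^ Suc n + B * Y2 ^ Suc n)"
  using assms(1) by (auto simp: pcong_def)
 obtain m where m: "n = Suc m" using assms(2) by (cases n) auto
 have "(X2 + Y2) * (p + X2 ^ n * Y2 ^ (n - 1)) = 0 + ((A + Y2 ^ m) * X2 ^ Suc n + B * Y2 ^ Suc n) + 2 * (X2 * Y2) ^ n"
  unfolding distrib_left[of "X2 + Y2"] AB by (simp add: m algebra_simps power_mult_distrib)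
 thus "pcong (Suc n) ((X2 + Y2) * (p + X2 ^ n * Y2 ^ (n - 1))) 0"
  by (intro pcongI[of _ _ "A + Y2 ^ m" _ B]) (simp add: poly2_two)
qed

text \<open>Here \<open>n\<close> is the dimension of the ambient space minus one. In
  \<open>b_g\<close> the third power has exponent \<open>2 ^ k + d\<close>, from which Frobenius
  splits off \<open>2 ^ k\<close>; after multiplication by \<open>(X2 * Y2) ^ d\<close> every term
  is divisible by \<open>X2 ^ Suc n\<close> or \<open>Y2 ^ Suc n\<close>.\<close>

lemma lower_poly_1:
 assumes k: "3 \<le> k" and n: "n = 2 ^ k - 2 + d"
 obtains u where "flag_ideal n (u * gpoly (n - 1))" "flag_ideal n (apoly ^ (2 ^ k - 4) * u + X2 ^ n * Y2 ^ (n - 1))"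
proof -
 define q :: nat where "q = 2 ^ k"
 have "2 ^ 3 \<le> (2 :: nat) ^ k" by (rule power_increasing[OF k]) simp
 hence q: "8 \<le> q" by (simp add: q_def)
 have nq: "n = q - 2 + d" using n by (simp add: q_def)
 define z where "z = X2 + Y2"
 \<comment> \<open>For \<open>d = 0\<close> the product of \<open>X2 * Y2 ^ 2\<close>,
   \<open>z\<close> and \<open>(X2 * Y2) ^ (q - 4)\<close> is \<open>(X2 * Y2) ^ (q - 2)\<close>
   plus a multiple of \<open>Y2 ^ (q - 1)\<close>. The factor \<open>(X2 * Y2) ^ d\<close> carries
   this along as \<open>n\<close> grows.\<close>
 define u where "u = (X2 * Y2) ^ d * (X2 * Y2 ^ 2)"
 have zq: "z ^ q = X2 ^ q + Y2 ^ q" unfolding z_def q_def by (rule frobenius)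
 have "n - 1 + 3 = q + d" using q nq by simp
 hence bg: "X2 * Y2 * z * gpoly (n - 1) = X2 ^ (q + d) + Y2 ^ (q + d) + z ^ (q + d)" using b_g[of "n - 1"] by (simp add: z_def)
 have qd: "q + d = Suc n + 1" using q nq by simp
 have "z * (u * gpoly (n - 1)) = (X2 * Y2) ^ d * Y2 * (X2 * Y2 * z * gpoly (n - 1))"
  by (simp add: u_def power2_eq_square algebra_simps)
 also have "\<dots> = (X2 * Y2) ^ d * Y2 * (X2 ^ (q + d) + Y2 ^ (q + d) + (X2 ^ q + Y2 ^ q) * z ^ d)"
  unfolding bg by (simp only: power_add zq)
 also have "\<dots> = 0 + ((Y2 * ((X2 * Y2) ^ d * X2 + Y2 ^ d * X2 * z ^ d)) * X2 ^ Suc n + (Y2 * ((X2 * Y2) ^ d * Y2 + X2 ^ d * Y2 * z ^ d)) * Y2 ^ Suc n)"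
 proof -
  have e: "(X2 * Y2) ^ d * X2 ^ q = Y2 ^ d * (X2 * X2 ^ Suc n)" "(X2 * Y2) ^ d * Y2 ^ q = X2 ^ d * (Y2 * Y2 ^ Suc n)"
   "X2 ^ (q + d) = X2 * X2 ^ Suc n" "Y2 ^ (q + d) = Y2 * Y2 ^ Suc n" proof -
   have "(X2 * Y2) ^ d * X2 ^ q = Y2 ^ d * X2 ^ (q + d)" "(X2 * Y2) ^ d * Y2 ^ q = X2 ^ d * Y2 ^ (q + d)"
    by (simp_all add: power_add power_mult_distrib)
   thus "(X2 * Y2) ^ d * X2 ^ q = Y2 ^ d * (X2 * X2 ^ Suc n)" "(X2 * Y2) ^ d * Y2 ^ q = X2 ^ d * (Y2 * Y2 ^ Suc n)"
    "X2 ^ (q + d) = X2 * X2 ^ Suc n" "Y2 ^ (q + d) = Y2 * Y2 ^ Suc n" unfolding qd by simp_all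
  qed
  have "(X2 * Y2) ^ d * Y2 * (X2 ^ (q + d) + Y2 ^ (q + d) + (X2 ^ q + Y2 ^ q) * z ^ d) =
    Y2 * ((X2 * Y2) ^ d * (X2 ^ (q + d) + Y2 ^ (q + d)) + ((X2 * Y2) ^ d * X2 ^ q + (X2 * Y2) ^ d * Y2 ^ q) * z ^ d)"
   by (simp only: algebra_simps)
  thus ?thesis unfolding e by (simp only: algebra_simps add_0_left)
 qed
 finally have g: "flag_ideal n (u * gpoly (n - 1))" unfolding z_def by (intro flag_idealI pcongI)
 have A: "pcong q (apoly ^ (q - 4)) ((X2 * Y2) ^ (q - 4))" using apoly_power_4[of k 0] k by (simp add: q_def)
 have "pcong (q - 1) (X2 * Y2 ^ 2 * z * apoly ^ (q - 4)) ((X2 * Y2) ^ (q - 2))"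
 proof (rule pcong_trans[OF pcong_mult[OF pcong_mono[OF A]]])
  obtain j where j: "q = 4 + j" using q le_Suc_ex[of 4 q] by auto
  have e: "q - 4 = j" "q - 2 = Suc (Suc j)" "q - 3 = Suc j" "q - 1 = Suc (Suc (Suc j))" by (simp_all add: j)
  have "X2 * Y2 ^ 2 * z * (X2 * Y2) ^ (q - 4) = (X2 * Y2) ^ (q - 2) + (0 * X2 ^ (q - 1) + X2 ^ (q - 3) * Y2 ^ (q - 1))"
   unfolding e z_def by (simp add: algebra_simps power_mult_distrib power2_eq_square)
  thus "pcong (q - 1) (X2 * Y2 ^ 2 * z * (X2 * Y2) ^ (q - 4)) ((X2 * Y2) ^ (q - 2))" by (rule pcongI)
 qed simp
 from pcong_shift[OF this, of d]
 have "pcong (q - 1 + d) ((X2 * Y2) ^ d * (X2 * Y2 ^ 2 * z * apoly ^ (q - 4))) ((X2 * Y2) ^ d * (X2 * Y2) ^ (q - 2))" .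
 moreover have "q - 1 + d = Suc n" using q by (simp add: nq)
 moreover have "(X2 * Y2) ^ d * (X2 * Y2) ^ (q - 2) = (X2 * Y2) ^ n" by (simp only: nq power_add mult.commute)
 moreover have "(X2 * Y2) ^ d * (X2 * Y2 ^ 2 * z * apoly ^ (q - 4)) = z * (apoly ^ (q - 4) * u)"
  by (simp only: u_def ac_simps)
 ultimately have "pcong (Suc n) (z * (apoly ^ (q - 4) * u)) ((X2 * Y2) ^ n)" by (simp only:)
 from flag_ideal_top[OF this[unfolded z_def]] nq q
 have "flag_ideal n (apoly ^ (q - 4) * u + X2 ^ n * Y2 ^ (n - 1))" by simp
 with g show thesis unfolding q_def by (rule that)
qed

lemma power_mod_Y2: "\<exists>H. (X2 + Y2) ^ e = X2 ^ e + Y2 * H" proof (induction e)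
 case (Suc e)
 then obtain H where "(X2 + Y2) ^ e = X2 ^ e + Y2 * H" by blast
 hence "(X2 + Y2) ^ Suc e = X2 ^ Suc e + Y2 * (X2 ^ e + (X2 + Y2) * H)" by (simp add: algebra_simps)
 thus ?case by blast
qed (auto intro: exI[of _ 0])

lemma apoly_mod_Y2: "\<exists>C. apoly ^ j = X2 ^ (2 * j) + Y2 * C" proof (induction j)
 case (Suc j)
 then obtain C where C: "apoly ^ j = X2 ^ (2 * j) + Y2 * C" by blast
 have "apoly ^ Suc j = X2 ^ (2 * Suc j) + Y2 * ((X2 + Y2) * X2 ^ (2 * j) + apoly * C)"
  unfolding power_Suc[of apoly] C by (simp add: apoly_def algebra_simps power2_eq_square)
 thus ?case by blast
qed (auto intro: exI[of _ 0])

text \<open>The same scheme further from the power of two \<open>q\<close>: the missing part of the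
  exponent is supplied by \<open>z ^ r\<close> with \<open>r = 2 * 2 ^ s\<close>, which is itself a
  Frobenius power.\<close>

lemma lower_poly_2:
 assumes k: "s + 3 \<le> k" and d: "d < 2 ^ s" and s: "1 \<le> s" and n: "n = 2 ^ k - 2 * 2 ^ s + d"
 obtains u where "flag_ideal n (u * gpoly (n - 1))" "flag_ideal n (apoly ^ (2 ^ k - 3 * 2 ^ s - 1) * u + X2 ^ n * Y2 ^ (n - 1))"
proof -
 define q p r :: nat where "q = 2 ^ k" and "p = 2 ^ s" and "r = 2 * p"
 have "2 ^ (s + 3) \<le> (2 :: nat) ^ k" by (rule power_increasing[OF k]) simp
 hence q: "8 * p \<le> q" by (simp add: q_def p_def power_add)
 have "2 ^ 1 \<le> (2 :: nat) ^ s" by (rule power_increasing[OF s]) simp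
 hence p: "2 \<le> p" by (simp add: p_def)
 have nq: "n = q - r + d" and dp: "d < p" using n d by (simp_all add: q_def p_def r_def)
 define z where "z = X2 + Y2"
 \<comment> \<open>The factor \<open>z ^ r\<close> raises the exponent \<open>n + 2\<close> of
   \<open>z\<close> in \<open>b_g\<close> to \<open>q + d + 2\<close>. The degree of
   \<open>u\<close> is the one complementary to the power of \<open>apoly\<close>.\<close>
 define u where "u = (X2 * Y2) ^ d * (X2 * z ^ r)"
 have zq: "z ^ q = X2 ^ q + Y2 ^ q" unfolding z_def q_def by (rule frobenius)
 have zr: "z ^ r = X2 ^ r + Y2 ^ r" using frobenius[of X2 Y2 "Suc s"] by (simp add: z_def r_def p_def)
 obtain e where e: "r = d + 2 + e" "q = Suc n + 1 + e" proof (rule that[of "r - 2 - d"])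
  show "r = d + 2 + (r - 2 - d)" using dp p by (simp add: r_def)
  show "q = Suc n + 1 + (r - 2 - d)" using dp p q by (simp add: r_def nq)
 qed
 \<comment> \<open>The leading term of \<open>z ^ e\<close> produces a term that cancels against one
   from \<open>z ^ q\<close>. What remains is divisible by \<open>Y2\<close>.\<close>
 obtain H where H: "z ^ e = X2 ^ e + Y2 * H" using power_mod_Y2 unfolding z_def by blast
 have "n - 1 + 3 = n + 2" using q p by (simp add: nq r_def)
 hence bg: "X2 * Y2 * z * gpoly (n - 1) = X2 * X2 ^ Suc n + Y2 * Y2 ^ Suc n + z ^ (n + 2)" using b_g[of "n - 1"] by (simp add: z_def)
 let ?c = "(X2 * Y2) ^ d"
 \<comment> \<open>\<open>u\<close> contains \<open>X2\<close> but possibly no \<open>Y2\<close>;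
   multiplying by \<open>Y2\<close> gives access to \<open>b_g\<close>, and this factor is cancelled
   at the end.\<close>
 have "Y2 * (z * (u * gpoly (n - 1))) = ?c * z ^ r * (X2 * Y2 * z * gpoly (n - 1))"
  by (simp only: u_def ac_simps)
 also have "\<dots> = ?c * (z ^ r * (X2 * X2 ^ Suc n + Y2 * Y2 ^ Suc n) + z ^ q * z ^ (d + 2))" proof -
  have "z ^ r * z ^ (n + 2) = z ^ q * z ^ (d + 2)" unfolding power_add[symmetric] using e by (simp add: algebra_simps)
  thus ?thesis unfolding bg by (simp only: distrib_left mult.assoc)
 qed
 also have "\<dots> = ?c * (z ^ (d + 2) * (X2 ^ e + Y2 * H) * (X2 * X2 ^ Suc n) + z ^ r * (Y2 * Y2 ^ Suc n)
   + (X2 ^ e * (X2 * X2 ^ Suc n) + Y2 ^ e * (Y2 * Y2 ^ Suc n)) * z ^ (d + 2))" proof -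
  have "z ^ r = z ^ (d + 2) * z ^ e" unfolding e(1) by (rule power_add)
  hence 1: "z ^ r * (X2 * X2 ^ Suc n) = z ^ (d + 2) * (X2 ^ e + Y2 * H) * (X2 * X2 ^ Suc n)" by (simp only: H)
  have "w ^ q = w ^ e * (w * w ^ Suc n)" for w :: poly2 unfolding e(2) by (simp add: power_add mult.commute)
  hence 2: "z ^ q = X2 ^ e * (X2 * X2 ^ Suc n) + Y2 ^ e * (Y2 * Y2 ^ Suc n)" unfolding zq by metis
  show ?thesis unfolding 2 distrib_left[of "z ^ r"] 1 ..
 qed
 also have "\<dots> = Y2 * ((?c * z ^ (d + 2) * H * X2) * X2 ^ Suc n + (?c * (z ^ r + Y2 ^ e * z ^ (d + 2))) * Y2 ^ Suc n)
   + 2 * (?c * z ^ (d + 2) * X2 ^ e * (X2 * X2 ^ Suc n))"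
  by (simp only: distrib_left distrib_right mult_2 ac_simps)
 finally have "z * (u * gpoly (n - 1)) = 0 + ((?c * z ^ (d + 2) * H * X2) * X2 ^ Suc n + (?c * (z ^ r + Y2 ^ e * z ^ (d + 2))) * Y2 ^ Suc n)"
  using XYZ_nonzero(2) unfolding poly2_two by (simp only: mult_cancel_left mult_zero_left add_0_left add_0_right) simp
 hence g: "flag_ideal n (u * gpoly (n - 1))" unfolding z_def by (intro flag_idealI pcongI)
 \<comment> \<open>The exponent \<open>q - 3 * p - 1\<close> is split as
   \<open>(p - 1) + (q - 4 * p)\<close>. The second part is a power of \<open>X2 * Y2\<close> by
   \<open>A\<close>, the first is only needed modulo \<open>Y2\<close>.\<close>
 let ?w = "X2 * z ^ (r + 1) * apoly ^ (p - 1)"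
 have A: "pcong q (apoly ^ (q - 4 * p)) ((X2 * Y2) ^ (q - 4 * p))" proof -
  have 1: "2 ^ (k - s) * 2 ^ s = q" unfolding power_add[symmetric] q_def using k by simp
  have 2: "(2 ^ (k - s) - 4) * 2 ^ s = q - 4 * p" unfolding diff_mult_distrib 1 p_def ..
  show ?thesis using apoly_power_4[of "k - s" s] k unfolding 1 2 by simp
 qed
 have "pcong (r + 1) ?w ((X2 * Y2) ^ r)" proof -
  obtain C where C: "apoly ^ (p - 1) = X2 ^ (2 * (p - 1)) + Y2 * C" using apoly_mod_Y2 by blast
  have "X2 * (X2 * X2 ^ (2 * (p - 1))) = X2 ^ r" proof -
   have "r = Suc (Suc (2 * (p - 1)))" using p by (simp add: r_def)
   thus ?thesis by simp
  qed
  hence "?w = X2 ^ r * Y2 ^ r + ((z * apoly ^ (p - 1)) * X2 ^ (r + 1) + (X2 * X2 * C + X2 * apoly ^ (p - 1)) * Y2 ^ (r + 1))"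
  proof -
   assume x: "X2 * (X2 * X2 ^ (2 * (p - 1))) = X2 ^ r"
   have "?w = (z * apoly ^ (p - 1)) * X2 ^ (r + 1) + Y2 ^ r * (X2 * X2 * apoly ^ (p - 1)) + X2 * apoly ^ (p - 1) * Y2 ^ (r + 1)"
    unfolding power_add zr power_one_right by (simp add: z_def algebra_simps)
   also have "X2 * X2 * apoly ^ (p - 1) = X2 ^ r + X2 * X2 * (Y2 * C)"
    unfolding C distrib_left x[symmetric] by (simp only: mult.assoc)
   finally show ?thesis by (simp add: algebra_simps)
  qed
  thus ?thesis unfolding power_mult_distrib by (rule pcongI)
 qed
 from pcong_shift[OF this, of "q - 4 * p"]
 have 1: "pcong (q - r + 1) ((X2 * Y2) ^ (q - 4 * p) * ?w) ((X2 * Y2) ^ (q - r))"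
 proof -
  have e: "r + 1 + (q - 4 * p) = q - r + 1" "q - 4 * p + r = q - r" using q by (simp_all add: r_def)
  show ?thesis using pcong_shift[OF \<open>pcong (r + 1) _ _\<close>, of "q - 4 * p"] unfolding power_add[symmetric] e .
 qed
 have 2: "pcong (q - r + 1) (?w * apoly ^ (q - 4 * p)) (?w * (X2 * Y2) ^ (q - 4 * p))"
  by (rule pcong_mult[OF pcong_mono[OF A]]) (use p q in \<open>simp add: r_def\<close>)
 have 3: "pcong (q - r + 1) (?w * apoly ^ (q - 4 * p)) ((X2 * Y2) ^ (q - r))"
  by (rule pcong_trans[OF 2]) (use 1 in \<open>simp only: mult.commute\<close>)
 have "?c * (?w * apoly ^ (q - 4 * p)) = z * (apoly ^ (q - 3 * p - 1) * u)"
 proof -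
  have "q - 3 * p - 1 = (p - 1) + (q - 4 * p)" using p q by simp
  thus ?thesis by (simp add: u_def power_add mult_ac)
 qed
 moreover have "q - r + 1 + d = Suc n" by (simp add: nq)
 moreover have "?c * (X2 * Y2) ^ (q - r) = (X2 * Y2) ^ n" by (simp only: nq power_add mult.commute)
 ultimately have "pcong (Suc n) (z * (apoly ^ (q - 3 * p - 1) * u)) ((X2 * Y2) ^ n)"
  using pcong_shift[OF 3, of d] by (simp only:)
 from flag_ideal_top[OF this[unfolded z_def]] nq q p
 have "flag_ideal n (apoly ^ (q - 3 * p - 1) * u + X2 ^ n * Y2 ^ (n - 1))" by (simp add: r_def)
 with g show thesis unfolding q_def p_def by (rule that)
qed

section \<open>Certificates for vanishing\<close>

lemma b_cancel: "X2 * Y2 * (X2 + Y2) * p = X2 * Y2 * (X2 + Y2) * q \<Longrightarrow> p = q"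
 using XYZ_nonzero by simp

text \<open>With \<open>r = 2 ^ k\<close>, the power is \<open>apoly ^ r\<close> times
  \<open>apoly ^ (r - 3)\<close>. The second factor lies in the ideal of \<open>X2 ^ (r - 1)\<close>
  and \<open>hpoly (r - 2)\<close>, and by \<open>1\<close> and \<open>2\<close> multiplying these
  by \<open>apoly ^ r\<close> gives combinations of \<open>gpoly\<close>. This settles the extreme
  case \<open>m + 3 = 3 * r\<close>.\<close>

lemma upper_poly_1:
 assumes k: "2 \<le> k" and m: "m + 3 \<le> 3 * 2 ^ k"
 shows "\<exists>A B C. apoly ^ (2 * 2 ^ k - 3) = A * X2 ^ (m + 3) + B * hpoly (m + 2) + C * gpoly (m + 1)"
proof -
 define r :: nat where "r = 2 ^ k"
 have "2 ^ 2 \<le> (2 :: nat) ^ k" by (rule power_increasing[OF k]) simp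
 then obtain j where j: "r = 4 + j" unfolding r_def[symmetric] using le_Suc_ex[of 4 r] by auto
 define z where "z = X2 + Y2"
 define X Y where "X = X2 ^ r" and "Y = Y2 ^ r"
 define A where "A = apoly ^ r"
 have AX: "A = X * X + X * Y + Y * Y" unfolding A_def apoly_def r_def frobenius
  by (simp add: X_def Y_def r_def power_mult_distrib power2_eq_square)
 have zr: "z ^ r = X + Y" unfolding z_def X_def Y_def r_def by (rule frobenius)
 let ?M = "\<lambda>i. X * X * X * X2 ^ i + Y * Y * Y * Y2 ^ i + (X + Y) * (X + Y) * (X + Y) * z ^ i"
 have pw: "w ^ (3 * r + i) = w ^ r * w ^ r * w ^ r * w ^ i" for w :: poly2 and i
  by (simp add: power_add power_mult power3_eq_cube mult.commute[of 3])
 have N: "X2 * Y2 * z * gpoly (3 * r - 3 + i) = ?M i" for i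
 proof -
  have "3 * r - 3 + i + 3 = 3 * r + i" using j by simp
  hence "X2 * Y2 * z * gpoly (3 * r - 3 + i) = X2 ^ (3 * r + i) + Y2 ^ (3 * r + i) + z ^ (3 * r + i)"
   using b_g[of "3 * r - 3 + i"] by (simp add: z_def)
  thus ?thesis unfolding pw zr X_def[symmetric] Y_def[symmetric] .
 qed
 have h: "X2 * Y2 * z * (A * hpoly (r - 2)) = A * (Y2 * X + X2 * Y)" proof -
  have "z * hpoly (r - 2) = X2 ^ Suc (r - 2) + Y2 ^ Suc (r - 2)" unfolding z_def by (rule Z_h)
  moreover have "X2 * X2 ^ Suc (r - 2) = X" "Y2 * Y2 ^ Suc (r - 2) = Y" proof -
   have "Suc (Suc (r - 2)) = r" by (simp add: j)
   thus "X2 * X2 ^ Suc (r - 2) = X" "Y2 * Y2 ^ Suc (r - 2) = Y" unfolding X_def Y_def power_Suc[symmetric] by simp_all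
  qed
  moreover have "X2 * Y2 * z * (A * hpoly (r - 2)) = A * X2 * Y2 * (z * hpoly (r - 2))" by (simp only: ac_simps)
  ultimately show ?thesis by (simp add: algebra_simps)
 qed
 \<comment> \<open>After multiplication by \<open>X2 * Y2 * z\<close> both sides are explicit in
   \<open>X\<close> and \<open>Y\<close>; they differ by twice the displayed polynomial.\<close>
 have 1: "A * hpoly (r - 2) = gpoly (3 * r - 3 + 1)" proof (rule b_cancel)
  have "A * (Y2 * X + X2 * Y) + 2 * (X2 * X * X * X + Y2 * Y * Y * Y + X2 * X * X * Y + X2 * X * Y * Y + Y2 * X * X * Y + Y2 * X * Y * Y)
   = ?M 1"
   by (simp add: AX z_def algebra_simps)
  thus "X2 * Y2 * (X2 + Y2) * (A * hpoly (r - 2)) = X2 * Y2 * (X2 + Y2) * gpoly (3 * r - 3 + 1)"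
   unfolding z_def[symmetric] h N poly2_two by simp
 qed
 have 2: "A * X2 ^ (r - 1) = gpoly (3 * r - 3 + 2) + X2 * gpoly (3 * r - 3 + 1)" proof (rule b_cancel)
  have "X2 * X2 ^ (r - 1) = X" unfolding X_def power_Suc[symmetric] by (simp add: j)
  hence e1: "X2 * Y2 * z * (A * X2 ^ (r - 1)) = Y2 * z * A * X" by (simp add: algebra_simps)
  have e2: "X2 * Y2 * z * (gpoly (3 * r - 3 + 2) + X2 * gpoly (3 * r - 3 + 1)) =
    (?M 2)
    + X2 * (?M 1)"
   unfolding distrib_left[of "X2 * Y2 * z"] N mult.left_commute[of _ X2] ..
  have e3: "(?M 2)
    + X2 * (?M 1) = Y2 * z * A * X
    + 2 * (X * X * X * X2 ^ 2 + Y * Y * Y * Y2 * z + (X + Y) * (X + Y) * (X + Y) * X2 * z + Y2 * z * X * Y * (X + Y))"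
   by (simp add: AX z_def algebra_simps power2_eq_square)
  show "X2 * Y2 * (X2 + Y2) * (A * X2 ^ (r - 1)) = X2 * Y2 * (X2 + Y2) * (gpoly (3 * r - 3 + 2) + X2 * gpoly (3 * r - 3 + 1))"
   unfolding z_def[symmetric] e1 e2 e3 poly2_two mult_zero_left add_0_right ..
 qed
 have sr: "Suc (r - 2) = r - 1" by (simp add: j)
 \<comment> \<open>In characteristic two \<open>z * apoly\<close> is \<open>X2 ^ 3 + Y2 ^ 3\<close>,
   and \<open>apoly ^ (r - 4)\<close> may be replaced by \<open>(X2 * Y2) ^ (r - 4)\<close>.\<close>
 have "pcong (r - 1) (z * apoly ^ (r - 3)) 0" proof -
  have "pcong r (apoly ^ j) ((X2 * Y2) ^ j)" using apoly_power_4[OF k, of 0] by (simp add: r_def[symmetric] j)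
  hence "pcong (r - 1) ((z * apoly) * apoly ^ j) ((z * apoly) * (X2 * Y2) ^ j)" by (intro pcong_mult) (erule pcong_mono, simp)
  moreover have "(z * apoly) * (X2 * Y2) ^ j = 0 + (Y2 ^ j * X2 ^ (r - 1) + X2 ^ j * Y2 ^ (r - 1))" proof -
   have "z * apoly = X2 ^ 3 + Y2 ^ 3 + 2 * (X2 ^ 2 * Y2 + X2 * Y2 ^ 2)"
    by (simp add: z_def apoly_def algebra_simps power2_eq_square power3_eq_cube)
   thus ?thesis by (simp add: poly2_two j power_mult_distrib power_add algebra_simps power3_eq_cube)
  qed
  moreover have "(z * apoly) * apoly ^ j = z * apoly ^ (r - 3)" by (simp add: j)
  ultimately show ?thesis using pcong_trans pcongI by metis
 qed
 then obtain \<alpha> \<beta> where ab: "z * apoly ^ (r - 3) = \<alpha> * X2 ^ Suc (r - 2) + \<beta> * Y2 ^ Suc (r - 2)"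
  unfolding pcong_def sr add_0_left by blast
 obtain C where C: "apoly ^ (r - 3) = C * X2 ^ Suc (r - 2) + \<beta> * hpoly (r - 2)" by (rule ideal_division[OF ab[unfolded z_def]])
 have "apoly ^ (2 * r - 3) = A * apoly ^ (r - 3)" unfolding A_def power_add[symmetric] by (simp add: j)
 also have "\<dots> = C * (A * X2 ^ (r - 1)) + \<beta> * (A * hpoly (r - 2))" unfolding C sr by (simp only: algebra_simps)
 also have "\<dots> = 0 * X2 ^ (3 * r - 3 + 3) + C * hpoly (3 * r - 3 + 2) + (C * (z + X2) + \<beta>) * gpoly (3 * r - 3 + 1)"
  unfolding 1 2 using gpoly_Suc[of "3 * r - 3 + 1"] by (simp add: z_def algebra_simps)
 finally have base: "\<exists>A B C. apoly ^ (2 * r - 3) = A * X2 ^ (3 * r - 3 + 3) + B * hpoly (3 * r - 3 + 2) + C * gpoly (3 * r - 3 + 1)" by blast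
 \<comment> \<open>By \<open>hpoly_Suc\<close> and \<open>gpoly_Suc\<close> the generators for
   \<open>Suc m\<close> lie in the ideal of those for \<open>m\<close>.\<close>
 have step: "\<exists>A B C. p = A * X2 ^ (m + 3) + B * hpoly (m + 2) + C * gpoly (m + 1)"
  if ex: "\<exists>A B C. p = A * X2 ^ (Suc m + 3) + B * hpoly (Suc m + 2) + C * gpoly (Suc m + 1)" for p m
 proof -
  obtain A B C where "p = A * X2 ^ (Suc m + 3) + B * hpoly (Suc m + 2) + C * gpoly (Suc m + 1)" using ex by blast
  hence "p = (A * X2 + B) * X2 ^ (m + 3) + (B * Y2 + C) * hpoly (m + 2) + (C * z) * gpoly (m + 1)"
   using hpoly_Suc[of "m + 2"] gpoly_Suc[of "m + 1"] by (simp add: z_def algebra_simps eval_nat_numeral)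
  thus ?thesis by blast
 qed
 have "m \<le> 3 * r - 3" using m by (simp add: r_def)
 thus ?thesis unfolding r_def[symmetric] by (induction m rule: inc_induct) (rule base, rule step)
qed

text \<open>It suffices to treat \<open>s = 0\<close> and \<open>m = 2 ^ k - 1\<close>, then to
  apply Frobenius and lower the exponents. In that case \<open>(X2 + Y2) ^ (2 ^ k - 1)\<close> is
  \<open>hpoly (2 ^ k - 1)\<close>, with all its coefficients equal to one.\<close>

lemma upper_poly_2:
 assumes k: "3 \<le> k" and m: "m \<le> (2 ^ k - 1) * 2 ^ s"
 shows "\<exists>A B C. apoly ^ ((2 ^ k - 3) * 2 ^ s) = A * X2 ^ m + B * Y2 ^ m + C * (X2 + Y2) ^ m" proof -
 define Q :: nat where "Q = 2 ^ k"
 have "2 ^ 3 \<le> (2 :: nat) ^ k" by (rule power_increasing[OF k]) simp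
 then obtain j where j: "Q = 5 + j" unfolding Q_def[symmetric] using le_Suc_ex[of 5 Q] by auto
 have h: "hpoly (Q - 1) = (X2 + Y2) ^ (Q - 1)" proof -
  have "(X2 + Y2) * hpoly (Q - 1) = (X2 + Y2) * (X2 + Y2) ^ (Q - 1)"
   unfolding Z_h power_Suc[symmetric] by (simp add: j frobenius[of X2 Y2 k, folded Q_def, unfolded j, simplified] del: power_Suc)
  thus ?thesis using XYZ_nonzero(3) by simp
 qed
 have "pcong Q (apoly ^ (Q - 4)) ((X2 * Y2) ^ (Q - 4))" using apoly_power_4[of k 0] k by (simp add: Q_def)
 from pcong_mult[OF pcong_mono[OF this], of "Q - 1" apoly]
 obtain A B where AB: "apoly * apoly ^ (Q - 4) = apoly * (X2 * Y2) ^ (Q - 4) + (A * X2 ^ (Q - 1) + B * Y2 ^ (Q - 1))"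
  by (auto simp: pcong_def)
 \<comment> \<open>With \<open>j = Q - 5\<close>, three middle terms of the left-hand side are those
   of \<open>apoly * (X2 * Y2) ^ (Q - 4)\<close>; the others contain \<open>X2 ^ (Q - 1)\<close> or
   \<open>Y2 ^ (Q - 1)\<close>.\<close>
 have e: "Y2 ^ j * hpoly (Q - 1) = Y2 ^ j * X2 ^ (Q - 1) + apoly * (X2 * Y2) ^ (Q - 4) + hpoly j * Y2 ^ (Q - 1)"
 proof -
  have "hpoly (Q - 1) = hpoly (Suc (Suc (Suc (Suc j))))" by (rule arg_cong[of _ _ hpoly]) (simp add: j)
  moreover have "Q - 1 = Suc (Suc (Suc (Suc j)))" "Q - 4 = Suc j" by (simp_all add: j)
  ultimately show ?thesis unfolding hpoly_Suc by (simp only: apoly_def) (simp add: algebra_simps power2_eq_square power_mult_distrib)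
 qed
 have "apoly ^ (Q - 3) = apoly * apoly ^ (Q - 4)" by (simp add: j)
 also have "\<dots> = (A + Y2 ^ j) * X2 ^ (Q - 1) + (B + hpoly j) * Y2 ^ (Q - 1) + Y2 ^ j * (X2 + Y2) ^ (Q - 1)
   + 2 * (apoly * (X2 * Y2) ^ (Q - 4)) - 2 * (Y2 ^ j * hpoly (Q - 1))"
  unfolding AB h[symmetric] using e by (simp add: algebra_simps)
 finally have "apoly ^ (Q - 3) = (A + Y2 ^ j) * X2 ^ (Q - 1) + (B + hpoly j) * Y2 ^ (Q - 1) + Y2 ^ j * (X2 + Y2) ^ (Q - 1)"
  by (simp add: poly2_two)
 hence "apoly ^ ((Q - 3) * 2 ^ s) = (A + Y2 ^ j) ^ 2 ^ s * X2 ^ ((Q - 1) * 2 ^ s) + (B + hpoly j) ^ 2 ^ s * Y2 ^ ((Q - 1) * 2 ^ s)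
   + (Y2 ^ j) ^ 2 ^ s * (X2 + Y2) ^ ((Q - 1) * 2 ^ s)"
  unfolding power_mult by (simp only: frobenius[of _ _ s] power_mult_distrib)
 moreover obtain i where "(Q - 1) * 2 ^ s = i + m" using m le_Suc_ex[OF m] unfolding Q_def by (metis add.commute)
 ultimately have "apoly ^ ((Q - 3) * 2 ^ s) = ((A + Y2 ^ j) ^ 2 ^ s * X2 ^ i) * X2 ^ m + ((B + hpoly j) ^ 2 ^ s * Y2 ^ i) * Y2 ^ m
   + ((Y2 ^ j) ^ 2 ^ s * (X2 + Y2) ^ i) * (X2 + Y2) ^ m" by (simp only: power_add mult.assoc)
 thus ?thesis unfolding Q_def by blast
qed

subsection \<open>Passing to the cohomology ring\<close>

text \<open>The representative that is zero off the simplices of \<open>X\<close>, as the given ring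
  demands. It turns \<open>eqS\<close> into equality.\<close>

definition cut :: "'a topology \<Rightarrow> 'a cochain \<Rightarrow> 'a cochain" where
 "cut X c p f = (if Sing X p f then c p f else 0)"

definition bounded_degree :: "'a cochain \<Rightarrow> bool" where
 "bounded_degree c \<longleftrightarrow> (\<exists>N. \<forall>p>N. \<forall>f. c p f = 0)"

lemma eqK_cut: "eqS X (cut X c) c" by (simp add: eqK_def cut_def)

lemma cut_eq_iff: "cut X c = cut X d \<longleftrightarrow> eqS X c d"
 by (auto simp: eqK_def cut_def fun_eq_iff)

lemma cut_0 [simp]: "cut X 0 = 0" by (simp add: cut_def fun_eq_iff)

lemma cut_cut [simp]: "cut X (cut X c) = cut X c" by (simp add: cut_def fun_eq_iff)

lemma cut_add: "cut X (c + d) = cut X c + cut X d" by (simp add: cut_def fun_eq_iff)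

lemma cochains_iff: "c \<in> cochains X \<longleftrightarrow> cut X c = c \<and> bounded_degree c" proof -
 have "(\<forall>p f. c p f \<noteq> 0 \<longrightarrow> singular_simplex p X f) \<longleftrightarrow> cut X c = c"
  unfolding cut_def Sing_def fun_eq_iff by metis
 moreover have "finite {p. \<exists>f. c p f \<noteq> 0} \<longleftrightarrow> bounded_degree c"
  unfolding finite_nat_set_iff_bounded_le bounded_degree_def mem_Collect_eq not_less[symmetric] by blast
 ultimately show ?thesis by (auto simp: cochains_def)
qed

lemma coboundary_cut: "coboundary X c = cut X (delta c)"
 by (intro ext) (auto simp: coboundary_def cut_def delta_def Sing_def)

lemma cup_cut: "cup X c d = cut X (c \<smile> d)"
 by (intro ext) (simp add: cup_def cut_def smile_def Sing_def)

lemma carrier_iff: "c \<in> carrier (ZR X) \<longleftrightarrow> cut X c = c \<and> bounded_degree c \<and> ZS X c"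
proof -
 have "coboundary X c = (\<lambda>p f. 0) \<longleftrightarrow> ZS X c"
  unfolding coboundary_cut lambda_zero Z_def cut_eq_iff[symmetric] by simp
 thus ?thesis by (auto simp: cocycle_ring_def cochains_iff)
qed

lemma cocycle_ring_simps [simp]:
 "mult (ZR X) c d = cut X (c \<smile> d)" "one (ZR X) = cut X unit"
 "zero (ZR X) = 0" "add (ZR X) c d = c + d"
 by (auto simp: cocycle_ring_def cup_cut cut_def unit_def Sing_def fun_eq_iff)

lemma bounded_degree_0 [simp]: "bounded_degree 0" by (simp add: bounded_degree_def)

lemma bounded_degree_concentrated: "concentrated n c \<Longrightarrow> bounded_degree c"
 unfolding bounded_degree_def concentrated_def by (auto intro!: exI[of _ n])

lemma bounded_degree_add: "bounded_degree c \<Longrightarrow> bounded_degree d \<Longrightarrow> bounded_degree (c + d)"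
 unfolding bounded_degree_def by (elim exE, rule_tac x = "max N Na" in exI) simp

lemma bounded_degree_cut: "bounded_degree c \<Longrightarrow> bounded_degree (cut X c)"
 by (auto simp: bounded_degree_def cut_def)

lemma bounded_degree_pull: "bounded_degree c \<Longrightarrow> bounded_degree (pull g c)"
 by (auto simp: bounded_degree_def pull_def)

lemma bounded_degree_delta: "bounded_degree c \<Longrightarrow> bounded_degree (delta c)"
 unfolding bounded_degree_def by (elim exE, rule_tac x = "Suc N" in exI) (auto simp: delta_def)

lemma bounded_degree_smile: assumes "bounded_degree c" "bounded_degree d" shows "bounded_degree (c \<smile> d)"
proof -
 obtain M where M: "\<forall>p>M. \<forall>f. c p f = 0" using assms(1) unfolding bounded_degree_def by blast
 obtain N where N: "\<forall>p>N. \<forall>f. d p f = 0" using assms(2) unfolding bounded_degree_def by blast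
 have "(c \<smile> d) n f = 0" if n: "n > M + N" for n f unfolding smile_def
 proof (rule sum.neutral, rule ballI)
  fix p assume "p \<in> {..n}"
  have "p > M \<or> n - p > N" using n by linarith
  thus "c p (front_face p f) * d (n - p) (back_face p (n - p) f) = 0" using M N by auto
 qed
 thus ?thesis unfolding bounded_degree_def by blast
qed

lemma carrier_cut: "bounded_degree c \<Longrightarrow> ZS X c \<Longrightarrow> cut X c \<in> carrier (ZR X)"
 unfolding carrier_iff using Z_eqK[OF sset_S eqK_sym[OF eqK_cut]] by (simp add: bounded_degree_cut)

lemma carrierD:
 assumes "c \<in> carrier (ZR X)" shows "cut X c = c" "bounded_degree c" "ZS X c"
 using assms by (simp_all add: carrier_iff)

lemma ring_cocycle_ring: "ring (ZR X)" proof (rule ringI)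
 have add: "c + d \<in> carrier (ZR X)" if "c \<in> carrier (ZR X)" "d \<in> carrier (ZR X)" for c d
  using that by (simp add: carrier_iff cut_add bounded_degree_add Z_add)
 show "abelian_group (ZR X)" proof (rule abelian_groupI; (simp add: add ac_simps)?)
  show "0 \<in> carrier (ZR X)" by (simp add: carrier_iff)
  show "\<exists>y\<in>carrier (ZR X). x + y = 0" if "x \<in> carrier (ZR X)" for x
   using that by (intro bexI[of _ x]) simp_all
 qed
 have assoc: "cut X (cut X (a \<smile> b) \<smile> c) = cut X (a \<smile> cut X (b \<smile> c))" for a b c
  unfolding cut_eq_iff by (rule eqK_trans[OF eqK_smile[OF sset_S eqK_cut eqK_refl]], unfold smile_assoc)
   (rule eqK_sym[OF eqK_smile[OF sset_S eqK_refl eqK_cut]])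
 show "monoid (ZR X)" proof (rule monoidI; (simp add: assoc)?)
  show "cut X (x \<smile> y) \<in> carrier (ZR X)" if "x \<in> carrier (ZR X)" "y \<in> carrier (ZR X)" for x y
   using that by (intro carrier_cut bounded_degree_smile Z_smile sset_S) (auto dest: carrierD)
  show "cut X unit \<in> carrier (ZR X)"
   by (rule carrier_cut[OF bounded_degree_concentrated[OF conc_unit] Z_unit])
  fix x assume x: "x \<in> carrier (ZR X)"
  have "cut X (cut X unit \<smile> x) = cut X x"
   unfolding cut_eq_iff by (rule eqK_trans[OF eqK_smile[OF sset_S eqK_cut eqK_refl] unit_smile[OF sset_S]])
  thus "cut X (cut X unit \<smile> x) = x" by (simp add: carrierD(1)[OF x])
  have "cut X (x \<smile> cut X unit) = cut X x"
   unfolding cut_eq_iff by (rule eqK_trans[OF eqK_smile[OF sset_S eqK_refl eqK_cut] smile_unit[OF sset_S]])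
  thus "cut X (x \<smile> cut X unit) = x" by (simp add: carrierD(1)[OF x])
 qed
qed (simp_all add: smile_add_left smile_add_right cut_add)

text \<open>A primitive of a cocycle without components above degree \<open>N\<close> can itself be
  cut off above \<open>N\<close>: in degree \<open>Suc N\<close> its coboundary is unchanged and is
  a component of the cocycle, and beyond that both sides are zero.\<close>

lemma coboundaries_iff: "c \<in> coboundaries X \<longleftrightarrow> cut X c = c \<and> bounded_degree c \<and> cohS X c 0"
proof
 assume "c \<in> coboundaries X"
 then obtain e where e: "c = cut X (delta e)" "bounded_degree e" by (auto simp: coboundaries_def coboundary_cut cochains_iff)
 have "cohS X c 0" unfolding e(1) by (rule coh_trans[OF eqK_coh[OF eqK_cut] coh_delta])
 thus "cut X c = c \<and> bounded_degree c \<and> cohS X c 0"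
  using e(2) by (simp add: e(1) bounded_degree_cut bounded_degree_delta)
next
 assume c: "cut X c = c \<and> bounded_degree c \<and> cohS X c 0"
 then obtain N where N: "\<And>p f. p > N \<Longrightarrow> c p f = 0" by (auto simp: bounded_degree_def)
 obtain e where e: "eqS X c (delta e)" using c by (blast elim: coh_eq_delta)
 define e' where "e' = cut X (\<lambda>p f. if p \<le> N then e p f else 0)"
 have "eqS X c (delta e')" proof (rule eqKI)
  fix p f assume f: "Sing X p f"
  have "delta e' p f = (if p \<le> Suc N then delta e p f else 0)" proof (cases p)
   case (Suc q)
   have "Sing X q (singular_face p k f)" if "k \<le> p" for k
    using sset_face[OF sset_S f, of k] that Suc by simp
   thus ?thesis by (auto simp: delta_def e'_def cut_def Suc simp del: sum.atMost_Suc intro!: sum.cong)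
  qed (simp add: delta_def)
  thus "c p f = delta e' p f" using eqKD[OF e f] N[of p f] by auto
 qed
 hence "c = coboundary X e'" unfolding coboundary_cut using c by (metis cut_eq_iff)
 moreover have "bounded_degree (\<lambda>p f. if p \<le> N then e p f else 0)" unfolding bounded_degree_def by (intro exI[of _ N]) simp
 hence "e' \<in> cochains X" by (simp add: cochains_iff e'_def bounded_degree_cut)
 ultimately show "c \<in> coboundaries X" unfolding coboundaries_def by blast
qed

lemma ideal_coboundaries: "ideal (coboundaries X) (ZR X)" proof (rule idealI[OF ring_cocycle_ring])
 interpret ring "ZR X" by (rule ring_cocycle_ring)
 have Zc: "ZS X c" if "cohS X c 0" for c by (rule coh_Z[OF sset_S coh_sym[OF that] Z_0])
 have sub: "coboundaries X \<subseteq> carrier (ZR X)" by (auto simp: coboundaries_iff carrier_iff Zc)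
 show "subgroup (coboundaries X) (add_monoid (ZR X))" proof (rule add.subgroupI)
  show "coboundaries X \<subseteq> carrier (ZR X)" by (rule sub)
  show "coboundaries X \<noteq> {}" using coboundaries_iff[of 0 X] by auto
  fix a assume a: "a \<in> coboundaries X"
  hence "a \<in> carrier (ZR X)" using sub by blast
  hence "a \<oplus>\<^bsub>ZR X\<^esub> a = \<zero>\<^bsub>ZR X\<^esub>" by simp
  hence "\<ominus>\<^bsub>ZR X\<^esub> a = a" using minus_equality \<open>a \<in> carrier (ZR X)\<close> by blast
  thus "\<ominus>\<^bsub>ZR X\<^esub> a \<in> coboundaries X" using a by simp
  fix b assume "b \<in> coboundaries X"
  thus "a \<oplus>\<^bsub>ZR X\<^esub> b \<in> coboundaries X"
   using a coh_add[of "Sing X" a 0 b 0] by (simp add: coboundaries_iff cut_add bounded_degree_add)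
 qed
 fix a x assume a: "a \<in> coboundaries X" and x: "x \<in> carrier (ZR X)"
 have a0: "cohS X a 0" and Zx: "ZS X x" using a x by (simp_all add: coboundaries_iff carrier_iff)
 have "cohS X (x \<smile> a) (x \<smile> 0)" "cohS X (a \<smile> x) (0 \<smile> x)"
  by (rule coh_smile_right[OF sset_S Zx a0], rule coh_smile_left[OF sset_S Zx a0])
 hence "cohS X (cut X (x \<smile> a)) 0" "cohS X (cut X (a \<smile> x)) 0"
  using coh_trans[OF eqK_coh[OF eqK_cut]] by simp_all
 thus "x \<otimes>\<^bsub>ZR X\<^esub> a \<in> coboundaries X" "a \<otimes>\<^bsub>ZR X\<^esub> x \<in> coboundaries X"
  using a x by (simp_all add: coboundaries_iff carrier_iff bounded_degree_cut bounded_degree_smile)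
qed

definition cls :: "'a topology \<Rightarrow> 'a cochain \<Rightarrow> 'a cochain set" where
 "cls X c = coboundaries X +>\<^bsub>ZR X\<^esub> cut X c"

definition good :: "'a topology \<Rightarrow> 'a cochain \<Rightarrow> bool" where
 "good X c \<longleftrightarrow> bounded_degree c \<and> ZS X c"

lemma good_conc: "concentrated n c \<Longrightarrow> ZS X c \<Longrightarrow> good X c"
 by (simp add: good_def bounded_degree_concentrated)

lemma good_smile: "good X c \<Longrightarrow> good X d \<Longrightarrow> good X (c \<smile> d)"
 by (simp add: good_def bounded_degree_smile Z_smile)

lemma good_cpow: "good X c \<Longrightarrow> good X (cpow c i)" proof (induction i)
 case 0
 show "good X (cpow c 0)" using good_conc[OF conc_unit Z_unit] by simp
next
 case (Suc i)
 thus "good X (cpow c (Suc i))" by (simp add: good_smile)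
qed

lemma good_pull: "continuous_map X Y g \<Longrightarrow> good Y c \<Longrightarrow> good X (pull g c)"
 by (simp add: good_def bounded_degree_pull Z_pull[OF maps_Sing])

lemma good_add: "good X c \<Longrightarrow> good X d \<Longrightarrow> good X (c + d)"
 by (simp add: good_def bounded_degree_add Z_add)

lemma good_sum: "(\<And>i. good X (c i)) \<Longrightarrow> good X (\<Sum>i\<le>(k :: nat). c i)"
proof (induction k)
 case 0
 thus "good X (\<Sum>i\<le>0. c i)" by simp
next
 case (Suc k)
 thus "good X (\<Sum>i\<le>Suc k. c i)" by (simp only: sum.atMost_Suc good_add)
qed

lemma cls_eq_iff:
 assumes "good X c" "good X d"
 shows "cls X c = cls X d \<longleftrightarrow> cohS X c d" proof -
 interpret ring "ZR X" by (rule ring_cocycle_ring)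
 have c: "cut X c \<in> carrier (ZR X)" "cut X d \<in> carrier (ZR X)"
  using assms by (simp_all add: good_def carrier_cut)
 have "cut X d \<oplus>\<^bsub>ZR X\<^esub> cut X d = \<zero>\<^bsub>ZR X\<^esub>" by simp
 hence "\<ominus>\<^bsub>ZR X\<^esub> cut X d = cut X d" using minus_equality c(2) by blast
 hence m: "cut X c \<ominus>\<^bsub>ZR X\<^esub> cut X d = cut X (c + d)" by (simp add: a_minus_def cut_add)
 have "cls X c = cls X d \<longleftrightarrow> cut X (c + d) \<in> coboundaries X"
  unfolding cls_def quotient_eq_iff_same_a_r_cos[OF ideal_coboundaries c, symmetric] m ..
 also have "\<dots> \<longleftrightarrow> cohS X (cut X (c + d)) 0"
  using assms by (simp add: coboundaries_iff good_def bounded_degree_add bounded_degree_cut)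
 also have "\<dots> \<longleftrightarrow> cohS X (c + d) 0"
  using coh_trans[OF eqK_coh[OF eqK_cut]] coh_trans[OF coh_sym[OF eqK_coh[OF eqK_cut]]] by blast
 finally show ?thesis by (simp only: coh_add_0)
qed

lemma ring_cohomology: "ring (HR X)"
 unfolding cohomology_ring_def by (rule ideal.quotient_is_ring[OF ideal_coboundaries])

lemma cls_ring:
 assumes "good X c" "good X d"
 shows "cls X c \<in> carrier (HR X)"
  "cls X c \<otimes>\<^bsub>HR X\<^esub> cls X d = cls X (c \<smile> d)"
  "cls X c \<oplus>\<^bsub>HR X\<^esub> cls X d = cls X (c + d)" proof -
 have c: "cut X c \<in> carrier (ZR X)" "cut X d \<in> carrier (ZR X)"
  using assms by (simp_all add: good_def carrier_cut)
 note h = ideal.rcos_ring_hom[OF ideal_coboundaries, of X, folded cohomology_ring_def]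
 show "cls X c \<in> carrier (HR X)" unfolding cls_def by (rule ring_hom_closed[OF h c(1)])
 have "cls X c \<otimes>\<^bsub>HR X\<^esub> cls X d = coboundaries X +>\<^bsub>ZR X\<^esub> cut X (cut X c \<smile> cut X d)"
  unfolding cls_def using ring_hom_mult[OF h c] by simp
 also have "cut X (cut X c \<smile> cut X d) = cut X (c \<smile> d)"
  unfolding cut_eq_iff by (rule eqK_smile[OF sset_S eqK_cut eqK_cut])
 finally show "cls X c \<otimes>\<^bsub>HR X\<^esub> cls X d = cls X (c \<smile> d)" by (simp only: cls_def)
 show "cls X c \<oplus>\<^bsub>HR X\<^esub> cls X d = cls X (c + d)"
  unfolding cls_def using ring_hom_add[OF h c] by (simp add: cut_add)
qed

lemma one_cohomology: "\<one>\<^bsub>HR X\<^esub> = cls X unit"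
 using ring_hom_one[OF ideal.rcos_ring_hom[OF ideal_coboundaries], of X] by (simp add: cohomology_ring_def cls_def)

lemma zero_cohomology: "\<zero>\<^bsub>HR X\<^esub> = cls X 0" proof -
 interpret ring "ZR X" by (rule ring_cocycle_ring)
 have "coboundaries X \<subseteq> carrier (ZR X)" by (rule additive_subgroup.a_subset[OF ideal.axioms(1)[OF ideal_coboundaries]])
 from a_coset_add_zero[OF this] show ?thesis by (simp add: cohomology_ring_def FactRing_def cls_def)
qed

lemma cls_eq_0_iff: "good X c \<Longrightarrow> cls X c = \<zero>\<^bsub>HR X\<^esub> \<longleftrightarrow> cohS X c 0"
 unfolding zero_cohomology by (rule cls_eq_iff) (simp_all add: good_def)

lemma cls_power: "good X c \<Longrightarrow> cls X c [^]\<^bsub>HR X\<^esub> (m :: nat) = cls X (cpow c m)"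
proof (induction m)
 case 0
 interpret ring "HR X" by (rule ring_cohomology)
 show "cls X c [^]\<^bsub>HR X\<^esub> (0 :: nat) = cls X (cpow c 0)" by (simp add: one_cohomology)
next
 case (Suc m)
 interpret ring "HR X" by (rule ring_cohomology)
 show "cls X c [^]\<^bsub>HR X\<^esub> Suc m = cls X (cpow c (Suc m))"
  using Suc cls_ring(2)[OF good_cpow[OF Suc.prems] Suc.prems] by simp
qed

lemma cohomology_memD:
 assumes "u \<in> cohomology i X"
 obtains c where "u = cls X c" "concentrated i c" "ZS X c" proof -
 obtain c where c: "u = coboundaries X +>\<^bsub>ZR X\<^esub> c" "c \<in> carrier (ZR X)" "\<forall>q f. q \<noteq> i \<longrightarrow> c q f = 0"
  using assms by (auto simp: cohomology_def)
 thus thesis by (intro that[of c]) (auto simp: cls_def carrier_iff concentrated_def)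
qed

lemma cohomology_memI: "concentrated i c \<Longrightarrow> ZS X c \<Longrightarrow> cls X c \<in> cohomology i X"
 unfolding cohomology_def cls_def
 using carrier_cut[OF bounded_degree_concentrated] by (auto simp: cut_def concentrated_def intro!: exI[of _ "cut X c"])

text \<open>The pullback is defined as a union over all representatives; they all give the same
  coset.\<close>

lemma pullback_cls:
 assumes g: "continuous_map X Y g" and c: "good Y c"
 shows "cohomology_pullback X g (cls Y c) = cls X (pull g c)" proof -
 have p: "coboundaries X +>\<^bsub>ZR X\<^esub> cochain_pullback X g d = cls X (pull g d)" for d
  unfolding cls_def by (rule arg_cong[of _ _ "\<lambda>d. coboundaries X +>\<^bsub>ZR X\<^esub> d"])
   (simp add: cochain_pullback_def cut_def pull_def Sing_def fun_eq_iff)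
 have "cls X (pull g d) = cls X (pull g c)" if d: "d \<in> cls Y c" for d proof -
  obtain e where e: "e \<in> coboundaries Y" "d = e + cut Y c" using d unfolding cls_def a_r_coset_def' by auto
  have c0: "cohS Y e 0" "bounded_degree e" using e(1) by (simp_all add: coboundaries_iff)
  have ec: "cohS Y d (0 + c)" unfolding e(2) by (rule coh_add[OF c0(1) eqK_coh[OF eqK_cut]])
  have "ZS Y d" by (rule coh_Z[OF sset_S coh_sym[OF ec]]) (use c in \<open>simp add: good_def\<close>)
  moreover have "bounded_degree d" unfolding e(2)
   by (rule bounded_degree_add[OF c0(2) bounded_degree_cut]) (use c in \<open>simp add: good_def\<close>)
  ultimately have "good Y d" by (simp add: good_def)
  thus ?thesis
   using cls_eq_iff[OF good_pull[OF g] good_pull[OF g c]] coh_pull[OF maps_Sing[OF g] ec] by simp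
 qed
 moreover have "cut Y c \<in> cls Y c" proof -
  have "0 \<in> coboundaries Y" by (simp add: coboundaries_iff)
  thus ?thesis unfolding cls_def a_r_coset_def' by force
 qed
 ultimately show ?thesis unfolding cohomology_pullback_def p by blast
qed

lemma finsum_cls:
 assumes "\<And>i. good X (c i)"
 shows "(\<Oplus>\<^bsub>HR X\<^esub>i\<in>{..k :: nat}. cls X (c i)) = cls X (\<Sum>i\<le>k. c i)"
proof (induction k)
 interpret ring "HR X" by (rule ring_cohomology)
 have cl: "cls X (c i) \<in> carrier (HR X)" for i using cls_ring(1)[OF assms assms] .
 case 0
 show "(\<Oplus>\<^bsub>HR X\<^esub>i\<in>{..0 :: nat}. cls X (c i)) = cls X (\<Sum>i\<le>0. c i)" using cl by simp
next
 interpret ring "HR X" by (rule ring_cohomology)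
 have cl: "cls X (c i) \<in> carrier (HR X)" for i using cls_ring(1)[OF assms assms] .
 case (Suc k)
 have g: "good X (\<Sum>i\<le>k. c i)" by (rule good_sum[OF assms])
 have "(\<Oplus>\<^bsub>HR X\<^esub>i\<in>{..Suc k}. cls X (c i)) = cls X (c (Suc k)) \<oplus>\<^bsub>HR X\<^esub> cls X (\<Sum>i\<le>k. c i)"
  using cl Suc by (simp add: finsum_Suc)
 also have "\<dots> = cls X (\<Sum>i\<le>Suc k. c i)" using cls_ring(3)[OF assms g] by (simp add: add.commute)
 finally show "(\<Oplus>\<^bsub>HR X\<^esub>i\<in>{..Suc k}. cls X (c i)) = cls X (\<Sum>i\<le>Suc k. c i)" .
qed

section \<open>Homogeneous representatives and the classes as defined\<close>

lemma homog_smile_right: "concentrated j b \<Longrightarrow> homog (i + j) (a \<smile> b) = homog i a \<smile> b"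
proof (intro ext)
 fix p f assume b: "concentrated j b"
 show "homog (i + j) (a \<smile> b) p f = (homog i a \<smile> b) p f" proof (cases "p = i + j")
  case True
  thus ?thesis unfolding homog_def smile_def
   by (simp, intro sum.cong refl) (use b in \<open>auto simp: concentrated_def\<close>)
 next
  case False
  have "concentrated (i + j) (homog i a \<smile> b)" by (rule conc_smile[OF conc_homog b])
  thus ?thesis using False by (simp add: homog_def concentrated_def)
 qed
qed

lemma homog_sum: "homog i (\<Sum>j\<in>A. c j) = (\<Sum>j\<in>A. homog i (c j))" proof -
 have "homog i (c + d) = homog i c + homog i d" for c d :: "'a cochain" by (intro ext) (simp add: homog_def)
 thus ?thesis using sum_comp_morphism[of "homog i" c A] by (simp add: comp_def)
qed

lemma homog_pull: "homog i (pull g c) = pull g (homog i c)" by (simp add: homog_def pull_def fun_eq_iff)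

text \<open>The part of degree \<open>k\<close> of the Whitney sum involves exactly the parts of
  degree \<open>i\<close> of the \<open>w i\<close>.\<close>

lemma sw_homog: assumes w: "sw B F k w" shows "sw B F k (\<lambda>i. homog i (w i))" proof -
 have "homog k (whitney_sum k w :: ('a \<times> (real^'b) set) cochain) = whitney_sum k (\<lambda>i. homog i (w i))"
  unfolding whitney_sum_def homog_sum proof (rule sum.cong)
  fix i assume "i \<in> {..k}"
  hence k: "k = i + (k - i)" by simp
  have "homog (i + (k - i)) (pull fst (w i) \<smile> cpow (taut :: ('a \<times> (real^'b) set) cochain) (k - i)) = homog i (pull fst (w i)) \<smile> cpow taut (k - i)"
   by (rule homog_smile_right[OF conc_cpow[OF conc_taut]])
  thus "homog k (pull fst (w i) \<smile> cpow (taut :: ('a \<times> (real^'b) set) cochain) (k - i)) = pull fst (homog i (w i)) \<smile> cpow taut (k - i)"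
   unfolding homog_pull k[symmetric] .
 qed simp
 moreover have "cohS (PB B F) (homog k (whitney_sum k w)) (homog k 0)"
  by (rule coh_homog) (use w in \<open>simp add: sw_def\<close>)
 moreover have "cohS B (homog 0 (w 0)) (homog 0 unit)"
  by (rule coh_homog) (use w in \<open>simp add: sw_def\<close>)
 ultimately show ?thesis using w by (simp add: sw_def Z_homog homog_concentrated[OF conc_unit])
qed

text \<open>Projective space is the projective bundle over a point, so Leray-Hirsch leaves
  \<open>eta\<close> as the only nonzero class of degree one.\<close>

lemma projective_generator_eq:
 assumes n: "CARD('n::finite) = Suc (Suc (Suc n))"
 shows "(projective_generator :: (real^'n) set cochain set) = cls RP eta"
 unfolding projective_generator_def proof (rule the_equality)
 let ?F = "Fl1 :: (unit \<times> (real^'n) set) topology" and ?P = "RP :: (real^'n) set topology"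
 let ?pt = "discrete_topology {()}"
 let ?N = "Suc (Suc (Suc n))"
 have c1: "continuous_map ?P ?F (\<lambda>L. ((), L))"
  unfolding cont_bundle_iff by (simp add: comp_def)
 have LH: "LH (Sing ?pt) (Sing ?F) fst taut ?N" by (rule LH_vector_bundle[OF bundle_R(1)[OF n] zero_less_Suc])
 have bk: "cohS ?P c (pull (\<lambda>L. ((), L)) (pull snd c))" for c
  unfolding pull_pull comp_def snd_conv by (rule eqK_coh[OF eqK_sym[OF pull_ident[OF refl]]])
 have g: "good ?P eta" by (rule good_conc[OF conc_eta Z_eta])
 show "cls ?P eta \<in> cohomology 1 RP \<and> cls ?P eta \<noteq> \<zero>\<^bsub>HR RP\<^esub>"
 proof
  show "cls ?P eta \<in> cohomology 1 RP" by (rule cohomology_memI[OF conc_eta Z_eta])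
  show "cls ?P eta \<noteq> \<zero>\<^bsub>HR RP\<^esub>" proof
   assume "cls ?P eta = \<zero>\<^bsub>HR RP\<^esub>"
   hence "cohS ?P eta 0" unfolding cls_eq_0_iff[OF g] .
   from coh_pull[OF maps_Sing[OF cont_bundle_snd] this]
   have t: "cohS ?F taut 0" by simp
   let ?a = "\<lambda>i :: nat. if i = 1 then unit else 0 :: unit cochain"
   have "lh fst taut ?N ?a = (\<Sum>i<?N. if i = 1 then cpow taut 0 \<smile> cpow taut 1 else 0 :: (unit \<times> (real^'n) set) cochain)"
    unfolding lh_def by (rule sum.cong) simp_all
   also have "\<dots> = cpow taut 0 \<smile> cpow taut 1" by (subst sum.delta) simp_all
   finally have e: "lh fst taut ?N ?a = unit \<smile> (unit \<smile> taut :: (unit \<times> (real^'n) set) cochain)" by simp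
   have "cohS ?F (unit \<smile> (unit \<smile> taut)) 0"
    by (rule coh_trans[OF eqK_coh[OF unit_smile[OF sset_S]] coh_trans[OF eqK_coh[OF unit_smile[OF sset_S]] t]])
   hence "cohS ?F (lh fst taut ?N ?a) 0" by (simp only: e)
   from LH_independent[OF LH _ this, of 1] have "cohS ?pt unit 0" by simp
   moreover have "Sing ?pt 0 (restrict (\<lambda>_. ()) (\<Delta> 0))"
    unfolding Sing_def by (rule simplex_restrictI) simp
   ultimately show False using unit_not_coh_0 by blast
  qed
 qed
 fix a assume a: "a \<in> cohomology 1 ?P \<and> a \<noteq> \<zero>\<^bsub>HR ?P\<^esub>"
 then obtain c where c: "a = cls ?P c" "concentrated 1 c" "ZS ?P c" by (blast elim: cohomology_memD)
 have gc: "good ?P c" by (rule good_conc[OF c(2,3)])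
 have nc: "\<not> cohS ?P c 0" using a unfolding c(1) using cls_eq_0_iff[OF gc] by blast
 have "ZS ?F (pull snd c)" by (rule Z_pull[OF maps_Sing[OF cont_bundle_snd] c(3)])
 then obtain d where d: "\<forall>i<?N. ZS ?pt (d i)" "cohS ?F (pull snd c) (lh fst taut ?N d)"
  using LH unfolding LH_def by blast
 have hd: "homog 1 (pull snd c) = pull snd c" by (rule homog_concentrated[OF conc_pull[OF c(2)]])
 \<comment> \<open>Powers of \<open>taut\<close> from the second on have no component in degree
   one.\<close>
 have hl: "homog 1 (lh fst taut ?N d) = pull fst (homog 1 (d 0)) \<smile> unit + pull fst (homog 0 (d 1)) \<smile> cpow (taut :: (unit \<times> (real^'n) set) cochain) 1"
 proof -
  let ?t = "\<lambda>i. homog 1 (pull fst (d i) \<smile> cpow (taut :: (unit \<times> (real^'n) set) cochain) i)"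
  have z2: "?t (Suc (Suc i)) = 0" for i proof -
   have z: "cpow taut (Suc (Suc i)) p f = 0" if "p \<noteq> Suc (Suc i)" for p and f :: "_ \<Rightarrow> unit \<times> (real^'n) set"
    using conc_cpow[OF conc_taut, of "Suc (Suc i)"] that unfolding concentrated_def by blast
   have "(pull fst (d (Suc (Suc i))) \<smile> cpow taut (Suc (Suc i))) 1 f = 0" for f :: "_ \<Rightarrow> unit \<times> (real^'n) set"
    unfolding smile_def by (rule sum.neutral) (use z in simp)
   thus ?thesis by (simp add: homog_def fun_eq_iff)
  qed
  have z0: "?t 0 = pull fst (homog 1 (d 0)) \<smile> unit"
   using homog_smile_right[OF conc_unit, of 1 "pull fst (d 0) :: (unit \<times> (real^'n) set) cochain"]
   by (simp only: homog_pull cpow.simps(1) add_0_right)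
  have z1: "?t 1 = pull fst (homog 0 (d 1)) \<smile> cpow taut 1"
   using homog_smile_right[OF conc_cpow[OF conc_taut, of 1], of 0 "pull fst (d 1) :: (unit \<times> (real^'n) set) cochain"]
   by (simp only: homog_pull add_0)
  show ?thesis unfolding lh_def homog_sum unfolding sum.lessThan_Suc_shift
   by (simp only: z2[unfolded One_nat_def] sum.neutral_const add_0_right z0[unfolded One_nat_def] z1[unfolded One_nat_def] One_nat_def)
 qed
 \<comment> \<open>On a point a cocycle is cohomologous to zero or to \<open>unit\<close>, and
   neither has a component in degree one.\<close>
 have p0: "cohS ?pt (homog 1 (d 0)) 0" proof -
  have "ZS ?pt (d 0)" using d(1) by simp
  then consider "cohS ?pt (d 0) 0" | "cohS ?pt (d 0) unit" using point_cohomology[of ?pt "()"] by auto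
  thus ?thesis proof cases
   case 1
   thus ?thesis using coh_homog[of _ "d 0" 0 1] by simp
  next
   case 2
   have "homog 1 unit = (0 :: unit cochain)" by (simp add: homog_def unit_def fun_eq_iff)
   thus ?thesis using coh_homog[OF 2, of 1] by simp
  qed
 qed
 let ?h = "pull fst (homog 0 (d 1)) \<smile> cpow taut 1"
 have "cohS ?F (pull snd c) (pull fst (homog 1 (d 0)) \<smile> unit + ?h)"
  using coh_homog[OF d(2), of 1] unfolding hd hl .
 also have "cohS ?F \<dots> (0 + ?h)"
  using coh_smile_left[OF sset_S Z_unit coh_pull[OF maps_bundle_fst p0]] by (intro coh_add coh_refl) simp
 finally have m: "cohS ?F (pull snd c) (?h)" by simp
 have Z1: "ZS ?pt (homog 0 (d 1))" using d(1) by (intro Z_homog) simp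
 have Zt: "ZS ?F (cpow taut 1)" by (rule Z_cpow[OF sset_S Z_taut])
 consider "cohS ?pt (homog 0 (d 1)) 0" | "cohS ?pt (homog 0 (d 1)) unit"
  using point_cohomology[of ?pt "()", OF _ Z1] by auto
 hence "cohS ?F (pull snd c) taut" proof cases
  case 1
  from coh_smile_left[OF sset_S Zt coh_pull[OF maps_bundle_fst 1]]
  have "cohS ?F (?h) 0" by simp
  from coh_trans[OF m this] have "cohS ?F (pull snd c) 0" .
  from coh_pull[OF maps_Sing[OF c1] this] have "cohS ?P (pull (\<lambda>L. ((), L)) (pull snd c)) 0" by simp
  from coh_trans[OF bk this] nc show ?thesis by blast
 next
  case 2
  have "cohS ?F (?h) (cpow taut 1)"
   by (rule coh_unit_top[OF 2])
  also have "cohS ?F \<dots> taut" using eqK_coh[OF unit_smile[OF sset_S]] by simp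
  finally show ?thesis by (rule coh_trans[OF m])
 qed
 from coh_trans[OF coh_trans[OF bk coh_pull[OF maps_Sing[OF c1] this]] coh_sym[OF bk]]
 have "cohS ?P c eta" .
 thus "a = cls ?P eta" unfolding c(1) using cls_eq_iff[OF gc g] by blast
qed

text \<open>The description in the definition is translated clause by clause into \<open>sw\<close>
  for homogeneous cocycles, which \<open>sw_exists\<close> and \<open>sw_unique\<close>
  control.\<close>

lemma stiefel_whitney_eq:
 fixes F :: "'b \<Rightarrow> (real^'n) set"
 assumes n: "CARD('n) = Suc (Suc (Suc n))" and F: "vector_bundle B F k" and k: "0 < k"
  and w: "sw B F k w" and h: "\<And>i. concentrated i (w i)"
 shows "stiefel_whitney B F k i = cls B (w i)" proof -
 let ?P = "PB B F"
 have t: "tautological_class B F = cls ?P taut"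
  unfolding tautological_class_def projective_generator_eq[OF n]
  by (rule pullback_cls[OF cont_bundle_snd good_conc[OF conc_eta Z_eta]])
 have gt: "good ?P (cpow taut i)" for i by (rule good_cpow[OF good_conc[OF conc_taut Z_taut]])
 have sum: "(\<Oplus>\<^bsub>HR ?P\<^esub>i\<in>{..k}. cohomology_pullback ?P fst (cls B (v i)) \<otimes>\<^bsub>HR ?P\<^esub>
   (tautological_class B F [^]\<^bsub>HR ?P\<^esub> (k - i))) = \<zero>\<^bsub>HR ?P\<^esub> \<longleftrightarrow> cohS ?P (whitney_sum k v) 0"
  if v: "\<And>i. good B (v i)" for v proof -
  have g: "good ?P (pull fst (v i))" for i by (rule good_pull[OF cont_bundle_fst v])
  have e: "cohomology_pullback ?P fst (cls B (v i)) \<otimes>\<^bsub>HR ?P\<^esub> (tautological_class B F [^]\<^bsub>HR ?P\<^esub> (k - i)) =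
    cls ?P (pull fst (v i) \<smile> cpow taut (k - i))" for i
   unfolding t pullback_cls[OF cont_bundle_fst v] cls_power[OF good_conc[OF conc_taut Z_taut]]
   by (rule cls_ring(2)[OF g gt])
  have gs: "good ?P (pull fst (v i) \<smile> cpow taut (k - i))" for i by (rule good_smile[OF g gt])
  show ?thesis unfolding e finsum_cls[OF gs] whitney_sum_def cls_eq_0_iff[OF good_sum[OF gs]] ..
 qed
 have gw: "good B (w i)" for i by (rule good_conc[OF h]) (use w in \<open>simp add: sw_def\<close>)
 have u: "good B unit" by (rule good_conc[OF conc_unit Z_unit])
 have "stiefel_whitney B F k = (\<lambda>i. cls B (w i))" unfolding stiefel_whitney_def Let_def
 proof (rule the_equality)
  show "cls B (w 0) = \<one>\<^bsub>HR B\<^esub> \<and> (\<forall>i. cls B (w i) \<in> cohomology i B) \<and> (\<forall>i>k. cls B (w i) = \<zero>\<^bsub>HR B\<^esub>) \<and>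
    (\<Oplus>\<^bsub>HR ?P\<^esub>i\<in>{..k}. cohomology_pullback ?P fst (cls B (w i)) \<otimes>\<^bsub>HR ?P\<^esub>
     (tautological_class B F [^]\<^bsub>HR ?P\<^esub> (k - i))) = \<zero>\<^bsub>HR ?P\<^esub>"
   unfolding sum[OF gw] one_cohomology cls_eq_iff[OF gw u] using w h
   by (simp add: sw_def cohomology_memI zero_cohomology)
  fix v assume v: "v 0 = \<one>\<^bsub>HR B\<^esub> \<and> (\<forall>i. v i \<in> cohomology i B) \<and> (\<forall>i>k. v i = \<zero>\<^bsub>HR B\<^esub>) \<and>
    (\<Oplus>\<^bsub>HR ?P\<^esub>i\<in>{..k}. cohomology_pullback ?P fst (v i) \<otimes>\<^bsub>HR ?P\<^esub>
     (tautological_class B F [^]\<^bsub>HR ?P\<^esub> (k - i))) = \<zero>\<^bsub>HR ?P\<^esub>"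
  have "\<exists>c. v i = cls B c \<and> concentrated i c \<and> ZS B c \<and> (i > k \<longrightarrow> c = 0)" for i
  proof (cases "i > k")
   case True
   thus ?thesis using v by (intro exI[of _ 0]) (simp add: zero_cohomology concentrated_def)
  next
   case False
   have "v i \<in> cohomology i B" using v by blast
   then obtain c where "v i = cls B c" "concentrated i c" "ZS B c" by (rule cohomology_memD)
   thus ?thesis using False by blast
  qed
  then obtain c where c: "\<And>i. v i = cls B (c i)" "\<And>i. concentrated i (c i)" "\<And>i. ZS B (c i)" "\<And>i. i > k \<Longrightarrow> c i = 0"
   by metis
  have gc: "good B (c i)" for i by (rule good_conc[OF c(2,3)])
  have "sw B F k c" unfolding sw_def proof (intro conjI allI impI c(3,4))
   show "cohS B (c 0) unit" using v unfolding c(1) one_cohomology cls_eq_iff[OF gc u] by blast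
   show "cohS ?P (whitney_sum k c) 0" using v unfolding c(1) sum[OF gc] by blast
  qed
  hence "cohS B (c i) (w i)" for i by (rule sw_unique[OF F k _ w])
  thus "v = (\<lambda>i. cls B (w i))" by (intro ext) (simp only: c(1) cls_eq_iff[OF gc gw])
 qed
 thus ?thesis by simp
qed

section \<open>Heights\<close>

lemma height_eq:
 assumes c: "good X c" and m: "\<not> cohS X (cpow c m) 0" "cohS X (cpow c (Suc m)) 0"
 shows "height (HR X) (cls X c) = enat m" proof -
 have Zc: "ZS X c" using c by (simp add: good_def)
 have "cohS X (cpow c j) 0" if "m < j" for j proof -
  obtain i where j: "j = Suc m + i" using le_Suc_ex[of "Suc m" j] \<open>m < j\<close> by auto
  have "cohS X (cpow c j) (cpow c (Suc m) \<smile> cpow c i)" unfolding j by (rule eqK_coh[OF cpow_add[OF sset_S]])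
  also have "cohS X \<dots> (0 \<smile> cpow c i)" by (rule coh_smile_left[OF sset_S Z_cpow[OF sset_S Zc] m(2)])
  finally show ?thesis by simp
 qed
 hence le: "j \<le> m" if "\<not> cohS X (cpow c j) 0" for j using that by (meson not_le)
 have "height (HR X) (cls X c) = Sup {enat j | j. \<not> cohS X (cpow c j) 0}"
  unfolding height_def cls_power[OF c] cls_eq_0_iff[OF good_cpow[OF c]] ..
 also have "\<dots> = enat m" by (rule antisym[OF Sup_least Sup_upper]) (use m(1) le in auto)
 finally show ?thesis .
qed

theorem height_criterion:
 assumes n: "CARD('n::finite) = m + 3"
  and u: "flag_ideal (m + 2) (u * gpoly (m + 1))" "flag_ideal (m + 2) (apoly ^ M * u + X2 ^ (m + 2) * Y2 ^ (m + 1))"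
  and p: "apoly ^ Suc M = A * X2 ^ (m + 3) + B * hpoly (m + 2) + C * gpoly (m + 1) + D * Y2 ^ (m + 3) + E * (X2 + Y2) ^ (m + 3)"
 shows "height (HR Gr) (canonical_stiefel_whitney 2 :: (real^'n^3) set cochain set) = enat M"
proof -
 have n': "CARD('n) = Suc (Suc (Suc m))" using n by simp
 let ?G = "Gr :: (real^'n^3) set topology"
 have F: "vector_bundle ?G CF 3" using vb_canonical[where 'n = 'n and 'k = 3] by simp
 obtain w' where "sw ?G CF 3 w'" by (rule sw_exists[OF F]) simp
 hence w: "sw ?G CF 3 (\<lambda>i. homog i (w' i))" by (rule sw_homog)
 have e: "(canonical_stiefel_whitney 2 :: (real^'n^3) set cochain set) = cls ?G (homog 2 (w' 2))"
  unfolding canonical_stiefel_whitney_def using stiefel_whitney_eq[OF n' F _ w conc_homog, of 2] by simp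
 have g: "good ?G (homog 2 (w' 2))" by (rule good_conc[OF conc_homog]) (use w in \<open>simp add: sw_def\<close>)
 have I: "p \<in> fl_ideal m \<longleftrightarrow> flag_ideal (m + 2) p" for p
  unfolding fl_ideal_def[OF n'] flag_ideal_def by (simp add: eval_nat_numeral)
 show ?thesis unfolding e proof (rule height_eq[OF g])
  show "\<not> cohS ?G (cpow (homog 2 (w' 2)) M) 0" unfolding canonical_power_iff[OF w]
   by (rule nonzero_criterion[OF n']) (use u in \<open>simp_all add: I\<close>)
  show "cohS ?G (cpow (homog 2 (w' 2)) (Suc M)) 0" unfolding canonical_power_iff[OF w]
   by (rule zero_criterion[OF n', of _ A B C D E]) (use p in \<open>simp add: eval_nat_numeral\<close>)
 qed
qed

theorem theorem1p2:
 fixes n t :: nat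
  and w2 :: "(real^'n^3) set cochain set"
 assumes n: "n = CARD('n)" "n \<ge> 7"
  and t: "t \<ge> 3" "2 ^ t - 1 \<le> n" "n < 2 ^ (t + 1) - 1"
  and w2: "w2 = canonical_stiefel_whitney 2"
 shows "(2 ^ t - 1 \<le> n \<and> n \<le> 2 ^ t + 2 ^ (t - 1) \<longrightarrow>
      height (cohomology_ring oriented_Grassmannian) w2 = enat (2 ^ t - 4)) \<and>
     (\<forall>s. 1 \<le> s \<and> s \<le> t - 2 \<and>
      2 ^ (t + 1) - 2 ^ (s + 1) + 1 \<le> n \<and> n \<le> 2 ^ (t + 1) - 2 ^ s \<longrightarrow>
      height (cohomology_ring oriented_Grassmannian) w2 = enat (2 ^ (t + 1) - 3 * 2 ^ s - 1))" proof -
 obtain m where m: "n = m + 3" by (rule that[of "n - 3"]) (use n(2) in simp)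
 have c: "CARD('n) = m + 3" using n(1) m by simp
 have "2 ^ 3 \<le> (2 :: nat) ^ t" by (rule power_increasing[OF t(1)]) simp
 hence t8: "8 \<le> (2 :: nat) ^ t" by simp
 have "height (cohomology_ring oriented_Grassmannian) w2 = enat (2 ^ t - 4)" if up: "n \<le> 2 ^ t + 2 ^ (t - 1)"
 proof -
  have tt: "2 ^ t = 2 * (2 :: nat) ^ (t - 1)" using t(1) by (simp add: power_Suc[symmetric] del: power_Suc)
  \<comment> \<open>The polynomial lemmas count the ambient dimension minus one,
    \<open>m + 2\<close>. So the lower end \<open>2 ^ t - 1\<close> of the range appears as
    \<open>2 ^ t - 2\<close>, and \<open>d\<close> is the distance of \<open>n\<close> from
    it.\<close>
  have "m + 2 = 2 ^ t - 2 + (n - (2 ^ t - 1))" using t(2) m t8 by simp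
  then obtain u where u: "flag_ideal (m + 2) (u * gpoly (m + 2 - 1))" "flag_ideal (m + 2) (apoly ^ (2 ^ t - 4) * u + X2 ^ (m + 2) * Y2 ^ (m + 2 - 1))"
   by (rule lower_poly_1[OF t(1)])
  have mt: "m + 3 \<le> 3 * 2 ^ (t - 1)" using up m tt by simp
  have t2: "2 \<le> t - 1" using t(1) by simp
  then obtain A B C where "apoly ^ (2 * 2 ^ (t - 1) - 3) = A * X2 ^ (m + 3) + B * hpoly (m + 2) + C * gpoly (m + 1)"
   using upper_poly_1[OF t2 mt] by blast
  moreover have "2 * 2 ^ (t - 1) - 3 = Suc (2 ^ t - 4)" using tt t8 by simp
  ultimately have "apoly ^ Suc (2 ^ t - 4) = A * X2 ^ (m + 3) + B * hpoly (m + 2) + C * gpoly (m + 1) + 0 * Y2 ^ (m + 3) + 0 * (X2 + Y2) ^ (m + 3)"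
   by simp
  from height_criterion[OF c _ _ this] u show ?thesis unfolding w2 by simp
 qed
 moreover have "height (cohomology_ring oriented_Grassmannian) w2 = enat (2 ^ (t + 1) - 3 * 2 ^ s - 1)"
  if s: "1 \<le> s" "s \<le> t - 2" and lo: "2 ^ (t + 1) - 2 ^ (s + 1) + 1 \<le> n" and up: "n \<le> 2 ^ (t + 1) - 2 ^ s" for s
 proof -
  \<comment> \<open>In this range the governing power of two is the next one, with exponent
    \<open>t + 1\<close>.\<close>
  have st: "s + 3 \<le> t + 1" using s t(1) by simp
  have "2 ^ (s + 3) \<le> (2 :: nat) ^ (t + 1)" by (rule power_increasing[OF st]) simp
  hence q: "8 * 2 ^ s \<le> (2 :: nat) ^ (t + 1)" by (simp add: power_add)
  have s2: "(2 :: nat) ^ (s + 1) = 2 * 2 ^ s" by simp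
  have p0: "1 \<le> (2 :: nat) ^ s" by simp
  \<comment> \<open>The distance from the lower end of a range of \<open>2 ^ s\<close> values, hence
    less than \<open>2 ^ s\<close>.\<close>
  define d where "d = n - (2 ^ (t + 1) - 2 * 2 ^ s + 1)"
  have "d < 2 ^ s" "m + 2 = 2 ^ (t + 1) - 2 * 2 ^ s + d" using lo up q p0 m unfolding s2 d_def by linarith+
  then obtain u where u: "flag_ideal (m + 2) (u * gpoly (m + 2 - 1))"
    "flag_ideal (m + 2) (apoly ^ (2 ^ (t + 1) - 3 * 2 ^ s - 1) * u + X2 ^ (m + 2) * Y2 ^ (m + 2 - 1))"
   by (rule lower_poly_2[OF st _ s(1)])
  have s3: "3 \<le> t + 1 - s" using st by simp
  have e: "2 ^ (t + 1 - s) * 2 ^ s = (2 :: nat) ^ (t + 1)" unfolding power_add[symmetric] using st by simp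
  have "(2 ^ (t + 1 - s) - 1) * 2 ^ s = (2 :: nat) ^ (t + 1) - 2 ^ s" "(2 ^ (t + 1 - s) - 3) * 2 ^ s = (2 :: nat) ^ (t + 1) - 3 * 2 ^ s"
   unfolding diff_mult_distrib e by simp_all
  moreover have "(2 :: nat) ^ (t + 1) - 3 * 2 ^ s = Suc (2 ^ (t + 1) - 3 * 2 ^ s - 1)" using q p0 by linarith
  ultimately obtain A B C where "apoly ^ Suc (2 ^ (t + 1) - 3 * 2 ^ s - 1) = A * X2 ^ (m + 3) + B * Y2 ^ (m + 3) + C * (X2 + Y2) ^ (m + 3)"
   using upper_poly_2[OF s3, of "m + 3" s] up m by auto
  hence "apoly ^ Suc (2 ^ (t + 1) - 3 * 2 ^ s - 1) = A * X2 ^ (m + 3) + 0 * hpoly (m + 2) + 0 * gpoly (m + 1) + B * Y2 ^ (m + 3) + C * (X2 + Y2) ^ (m + 3)"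
   by simp
  from height_criterion[OF c _ _ this] u show ?thesis unfolding w2 by simp
 qed
 ultimately show ?thesis by blast
qed

end
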